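(* Let $R$ be a regular local ring of characteristic $2$, and let $P$ be a differential $R$-module admitting a finite free flag. Then there is an isomorphism of $R$-modules $$H(T_R(P))\ \cong\ R_F\otimes_R H(P);$$ equivalently (the Frobenius of $R$ being flat), $H(T_R(P))\cong H(F_R^*P)$.
   Context: A differential $R$-module is an $R$-module $P$ with an $R$-linear endomorphism $d_P$ such that $d_P^2=0$ (no grading); $H(P)=\ker d_P/\operatorname{im} d_P$. A (finite) free flag on $P$ is a finite filtration $0=P^0\subset P^1\subset\cdots\subset P^r=P$ by direct summands (as $R$-modules) whose subquotients are free of finite rank and such that $d_P(P^i)\subseteq P^{i-1}$ for all $i$. The Tate construction on $P$ is the differential $R$-module $T_R(P)=(P\otimes_R P,\ \partial+(1+\tau))$, where $\partial=d_P\otimes 1+1\otimes d_P$ and $\tau(x\otimes y)=y\otimes x$; this squares to zero because $2=0$ in $R$. $R_F$ denotes $R$ as an $R$-bimodule with the regular left action and right action twisted by Frobenius, $x\cdot r=xr^2$. $F_R^*P=R_F\otimes_R P$ is the Frobenius pullback, with differential $1\otimes d_P$ and with $R$-module structure coming from the left action on $R_F$. Regular local rings are Noetherian. *)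

theory Defs
  imports "HOL-Algebra.Module" "HOL-Algebra.Ring_Divisibility" "HOL-Library.Extended_Nat"
begin

section \<open>Regular local rings\<close>

definition has_characteristic :: "('a, 'k) ring_scheme \<Rightarrow> nat \<Rightarrow> bool" where
  "has_characteristic R p \<longleftrightarrow> (\<forall>n::nat. [n] \<cdot>\<^bsub>R\<^esub> \<one>\<^bsub>R\<^esub> = \<zero>\<^bsub>R\<^esub> \<longleftrightarrow> p dvd n)"

definition local_ring :: "('a, 'k) ring_scheme \<Rightarrow> bool" where
  "local_ring R \<longleftrightarrow> cring R \<and> (\<exists>!\<mm>. maximalideal \<mm> R)"

definition krull_dim :: "('a, 'k) ring_scheme \<Rightarrow> enat" where
  "krull_dim R = Sup {enat n | n. \<exists>p :: nat \<Rightarrow> 'a set.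
     (\<forall>i\<le>n. primeideal (p i) R) \<and> (\<forall>i<n. p i \<subset> p (Suc i))}"

text \<open>Regular: the maximal ideal is generated by as many elements as the Krull dimension.\<close>

definition regular_local_ring :: "('a, 'k) ring_scheme \<Rightarrow> bool" where
  "regular_local_ring R \<longleftrightarrow> local_ring R \<and> noetherian_ring R \<and>
     (\<exists>S \<subseteq> carrier R. finite S \<and> enat (card S) = krull_dim R \<and> maximalideal (Idl\<^bsub>R\<^esub> S) R)"


section \<open>Modules\<close>

text \<open>
  The record type of modules extends that of rings, so every module below carries the fields
  \<^const>\<open>monoid.mult\<close> and \<^const>\<open>monoid.one\<close>; they have no meaning for a module and are left
  \<^const>\<open>undefined\<close>.
\<close>

definition module_hom ::
    "('a, 'k) ring_scheme \<Rightarrow> ('a, 'b, 'x) module_scheme \<Rightarrow> ('a, 'c, 'y) module_scheme \<Rightarrow> ('b \<Rightarrow> 'c) set"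
  where
  "module_hom R M N = {h. h \<in> carrier M \<rightarrow> carrier N \<and>
     (\<forall>x\<in>carrier M. \<forall>y\<in>carrier M. h (x \<oplus>\<^bsub>M\<^esub> y) = h x \<oplus>\<^bsub>N\<^esub> h y) \<and>
     (\<forall>a\<in>carrier R. \<forall>x\<in>carrier M. h (a \<odot>\<^bsub>M\<^esub> x) = a \<odot>\<^bsub>N\<^esub> h x)}"

definition isomorphic_modules ::
    "('a, 'k) ring_scheme \<Rightarrow> ('a, 'b, 'x) module_scheme \<Rightarrow> ('a, 'c, 'y) module_scheme \<Rightarrow> bool"
  where
  "isomorphic_modules R M N \<longleftrightarrow> (\<exists>h \<in> module_hom R M N. bij_betw h (carrier M) (carrier N))"

definition quotient_module :: "('a, 'b, 'x) module_scheme \<Rightarrow> 'b set \<Rightarrow> ('a, 'b set) module" where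
  "quotient_module M L =
     \<lparr>carrier = a_rcosets\<^bsub>M\<^esub> L, monoid.mult = undefined, one = undefined,
      zero = L, add = set_add M, smult = (\<lambda>a X. \<Union>x\<in>X. L +>\<^bsub>M\<^esub> (a \<odot>\<^bsub>M\<^esub> x))\<rparr>"

definition finite_free :: "('a, 'k) ring_scheme \<Rightarrow> ('a, 'b, 'x) module_scheme \<Rightarrow> bool" where
  "finite_free R M \<longleftrightarrow> (\<exists>B \<subseteq> carrier M. finite B \<and>
     (\<forall>x\<in>carrier M. \<exists>!c. c \<in> B \<rightarrow>\<^sub>E carrier R \<and> x = (\<Oplus>\<^bsub>M\<^esub>b\<in>B. c b \<odot>\<^bsub>M\<^esub> b)))"

definition direct_summand ::
    "('a, 'k) ring_scheme \<Rightarrow> ('a, 'b, 'x) module_scheme \<Rightarrow> 'b set \<Rightarrow> bool" where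
  "direct_summand R M N \<longleftrightarrow> submodule N R M \<and>
     (\<exists>N'. submodule N' R M \<and> N \<inter> N' = {\<zero>\<^bsub>M\<^esub>} \<and> N <+>\<^bsub>M\<^esub> N' = carrier M)"

definition submodule_generated ::
    "('a, 'k) ring_scheme \<Rightarrow> ('a, 'b, 'x) module_scheme \<Rightarrow> 'b set \<Rightarrow> 'b set" where
  "submodule_generated R M A = \<Inter>{H. submodule H R M \<and> A \<subseteq> H}"


section \<open>Tensor products\<close>

text \<open>The free module on a set \<open>X\<close>: finitely supported functions on \<open>X\<close>, extended by zero.\<close>

definition free_module :: "('a, 'k) ring_scheme \<Rightarrow> 'i set \<Rightarrow> ('a, 'i \<Rightarrow> 'a) module" where
  "free_module R X =
     \<lparr>carrier = {f. range f \<subseteq> carrier R \<and> finite {i. f i \<noteq> \<zero>\<^bsub>R\<^esub>} \<and> {i. f i \<noteq> \<zero>\<^bsub>R\<^esub>} \<subseteq> X},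
      monoid.mult = undefined, one = undefined,
      zero = (\<lambda>i. \<zero>\<^bsub>R\<^esub>), add = (\<lambda>f g i. f i \<oplus>\<^bsub>R\<^esub> g i), smult = (\<lambda>a f i. a \<otimes>\<^bsub>R\<^esub> f i)\<rparr>"

definition free_unit :: "('a, 'k) ring_scheme \<Rightarrow> 'i \<Rightarrow> 'i \<Rightarrow> 'a" where
  "free_unit R i = (\<lambda>j. if j = i then \<one>\<^bsub>R\<^esub> else \<zero>\<^bsub>R\<^esub>)"

text \<open>
  The tensor product of an \<open>R\<close>-bimodule \<open>M\<close> with an \<open>R\<close>-module \<open>N\<close>. The left action on \<open>M\<close> is
  \<^const>\<open>smult\<close>, the right action is the extra argument \<open>\<rho>\<close>. Tensors are balanced over the right
  action, and the module structure of the result comes from the left action.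
\<close>

definition tensor_relations ::
    "('a, 'k) ring_scheme \<Rightarrow> ('a, 'b, 'x) module_scheme \<Rightarrow> ('b \<Rightarrow> 'a \<Rightarrow> 'b) \<Rightarrow>
     ('a, 'c, 'y) module_scheme \<Rightarrow> ('b \<times> 'c \<Rightarrow> 'a) set" where
  "tensor_relations R M \<rho> N =
    (let F = free_module R (carrier M \<times> carrier N); e = free_unit R in
       {e (x \<oplus>\<^bsub>M\<^esub> x', y) \<ominus>\<^bsub>F\<^esub> (e (x, y) \<oplus>\<^bsub>F\<^esub> e (x', y)) | x x' y.
          x \<in> carrier M \<and> x' \<in> carrier M \<and> y \<in> carrier N} \<union>
       {e (x, y \<oplus>\<^bsub>N\<^esub> y') \<ominus>\<^bsub>F\<^esub> (e (x, y) \<oplus>\<^bsub>F\<^esub> e (x, y')) | x y y'.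
          x \<in> carrier M \<and> y \<in> carrier N \<and> y' \<in> carrier N} \<union>
       {e (\<rho> x a, y) \<ominus>\<^bsub>F\<^esub> e (x, a \<odot>\<^bsub>N\<^esub> y) | a x y.
          a \<in> carrier R \<and> x \<in> carrier M \<and> y \<in> carrier N} \<union>
       {e (a \<odot>\<^bsub>M\<^esub> x, y) \<ominus>\<^bsub>F\<^esub> (a \<odot>\<^bsub>F\<^esub> e (x, y)) | a x y.
          a \<in> carrier R \<and> x \<in> carrier M \<and> y \<in> carrier N})"

definition tensor_kernel ::
    "('a, 'k) ring_scheme \<Rightarrow> ('a, 'b, 'x) module_scheme \<Rightarrow> ('b \<Rightarrow> 'a \<Rightarrow> 'b) \<Rightarrow>
     ('a, 'c, 'y) module_scheme \<Rightarrow> ('b \<times> 'c \<Rightarrow> 'a) set" where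
  "tensor_kernel R M \<rho> N =
     submodule_generated R (free_module R (carrier M \<times> carrier N)) (tensor_relations R M \<rho> N)"

definition tensor_module ::
    "('a, 'k) ring_scheme \<Rightarrow> ('a, 'b, 'x) module_scheme \<Rightarrow> ('b \<Rightarrow> 'a \<Rightarrow> 'b) \<Rightarrow>
     ('a, 'c, 'y) module_scheme \<Rightarrow> ('a, ('b \<times> 'c \<Rightarrow> 'a) set) module" where
  "tensor_module R M \<rho> N =
     quotient_module (free_module R (carrier M \<times> carrier N)) (tensor_kernel R M \<rho> N)"

definition pure_tensor ::
    "('a, 'k) ring_scheme \<Rightarrow> ('a, 'b, 'x) module_scheme \<Rightarrow> ('b \<Rightarrow> 'a \<Rightarrow> 'b) \<Rightarrow>
     ('a, 'c, 'y) module_scheme \<Rightarrow> 'b \<Rightarrow> 'c \<Rightarrow> ('b \<times> 'c \<Rightarrow> 'a) set" where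
  "pure_tensor R M \<rho> N x y =
     tensor_kernel R M \<rho> N +>\<^bsub>free_module R (carrier M \<times> carrier N)\<^esub> free_unit R (x, y)"

text \<open>
  The map out of a tensor product with \<open>x \<otimes> y \<mapsto> \<beta> x y\<close>, computed on a representative of a coset;
  it is independent of that choice if \<open>\<beta>\<close> is biadditive, balanced and linear for the left action.
\<close>

definition tensor_lift ::
    "('a, 'k) ring_scheme \<Rightarrow> ('a, 'd, 'z) module_scheme \<Rightarrow> ('b \<Rightarrow> 'c \<Rightarrow> 'd) \<Rightarrow>
     ('b \<times> 'c \<Rightarrow> 'a) set \<Rightarrow> 'd" where
  "tensor_lift R L \<beta> X =
     (let f = (SOME f. f \<in> X)
      in \<Oplus>\<^bsub>L\<^esub>p\<in>{p. f p \<noteq> \<zero>\<^bsub>R\<^esub>}. f p \<odot>\<^bsub>L\<^esub> \<beta> (fst p) (snd p))"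

definition tensor_map ::
    "('a, 'k) ring_scheme \<Rightarrow> ('a, 'b, 'x) module_scheme \<Rightarrow> ('b \<Rightarrow> 'a \<Rightarrow> 'b) \<Rightarrow>
     ('a, 'c, 'y) module_scheme \<Rightarrow> ('b \<Rightarrow> 'b) \<Rightarrow> ('c \<Rightarrow> 'c) \<Rightarrow>
     ('b \<times> 'c \<Rightarrow> 'a) set \<Rightarrow> ('b \<times> 'c \<Rightarrow> 'a) set" where
  "tensor_map R M \<rho> N g h =
     tensor_lift R (tensor_module R M \<rho> N) (\<lambda>x y. pure_tensor R M \<rho> N (g x) (h y))"


section \<open>Differential modules\<close>

definition differential_module ::
    "('a, 'k) ring_scheme \<Rightarrow> ('a, 'b, 'x) module_scheme \<Rightarrow> ('b \<Rightarrow> 'b) \<Rightarrow> bool" where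
  "differential_module R P d \<longleftrightarrow> module R P \<and> d \<in> module_hom R P P \<and>
     (\<forall>x\<in>carrier P. d (d x) = \<zero>\<^bsub>P\<^esub>)"

definition homology :: "('a, 'b, 'x) module_scheme \<Rightarrow> ('b \<Rightarrow> 'b) \<Rightarrow> ('a, 'b set) module" where
  "homology P d = quotient_module (P\<lparr>carrier := a_kernel P P d\<rparr>) (d ` carrier P)"

definition admits_finite_free_flag ::
    "('a, 'k) ring_scheme \<Rightarrow> ('a, 'b, 'x) module_scheme \<Rightarrow> ('b \<Rightarrow> 'b) \<Rightarrow> bool" where
  "admits_finite_free_flag R P d \<longleftrightarrow> (\<exists>(r::nat) (F :: nat \<Rightarrow> 'b set).
     F 0 = {\<zero>\<^bsub>P\<^esub>} \<and> F r = carrier P \<and>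
     (\<forall>i\<le>r. direct_summand R P (F i)) \<and>
     (\<forall>i<r. F i \<subseteq> F (Suc i) \<and>
        finite_free R (quotient_module (P\<lparr>carrier := F (Suc i)\<rparr>) (F i)) \<and>
        d ` F (Suc i) \<subseteq> F i))"


section \<open>The Tate construction\<close>

definition tensor_square ::
    "('a, 'k) ring_scheme \<Rightarrow> ('a, 'b, 'x) module_scheme \<Rightarrow> ('a, ('b \<times> 'b \<Rightarrow> 'a) set) module" where
  "tensor_square R P = tensor_module R P (\<lambda>x a. a \<odot>\<^bsub>P\<^esub> x) P"

definition tensor_swap ::
    "('a, 'k) ring_scheme \<Rightarrow> ('a, 'b, 'x) module_scheme \<Rightarrow>
     ('b \<times> 'b \<Rightarrow> 'a) set \<Rightarrow> ('b \<times> 'b \<Rightarrow> 'a) set" where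
  "tensor_swap R P =
     tensor_lift R (tensor_square R P) (\<lambda>x y. pure_tensor R P (\<lambda>x a. a \<odot>\<^bsub>P\<^esub> x) P y x)"

text \<open>The Tate construction is \<^const>\<open>tensor_square\<close> with differential
  \<open>(d \<otimes> 1 + 1 \<otimes> d) + (1 + \<tau>)\<close>.\<close>

definition tate_differential ::
    "('a, 'k) ring_scheme \<Rightarrow> ('a, 'b, 'x) module_scheme \<Rightarrow> ('b \<Rightarrow> 'b) \<Rightarrow>
     ('b \<times> 'b \<Rightarrow> 'a) set \<Rightarrow> ('b \<times> 'b \<Rightarrow> 'a) set" where
  "tate_differential R P d z =
     (tensor_map R P (\<lambda>x a. a \<odot>\<^bsub>P\<^esub> x) P d (\<lambda>y. y) z
        \<oplus>\<^bsub>tensor_square R P\<^esub> tensor_map R P (\<lambda>x a. a \<odot>\<^bsub>P\<^esub> x) P (\<lambda>x. x) d z)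
     \<oplus>\<^bsub>tensor_square R P\<^esub> (z \<oplus>\<^bsub>tensor_square R P\<^esub> tensor_swap R P z)"


section \<open>Frobenius pullback\<close>

definition regular_module :: "('a, 'k) ring_scheme \<Rightarrow> ('a, 'a) module" where
  "regular_module R =
     \<lparr>carrier = carrier R, monoid.mult = undefined, one = undefined,
      zero = zero R, add = add R, smult = monoid.mult R\<rparr>"

definition frobenius_action :: "('a, 'k) ring_scheme \<Rightarrow> 'a \<Rightarrow> 'a \<Rightarrow> 'a" where
  "frobenius_action R x a = x \<otimes>\<^bsub>R\<^esub> a [^]\<^bsub>R\<^esub> (2::nat)"

definition frobenius_pullback ::
    "('a, 'k) ring_scheme \<Rightarrow> ('a, 'b, 'x) module_scheme \<Rightarrow> ('a, ('a \<times> 'b \<Rightarrow> 'a) set) module" where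
  "frobenius_pullback R P = tensor_module R (regular_module R) (frobenius_action R) P"

definition frobenius_pullback_differential ::
    "('a, 'k) ring_scheme \<Rightarrow> ('a, 'b, 'x) module_scheme \<Rightarrow> ('b \<Rightarrow> 'b) \<Rightarrow>
     ('a \<times> 'b \<Rightarrow> 'a) set \<Rightarrow> ('a \<times> 'b \<Rightarrow> 'a) set" where
  "frobenius_pullback_differential R P d =
     tensor_map R (regular_module R) (frobenius_action R) P (\<lambda>x. x) d"

end

theory Submission
  imports Defs
begin

text \<open>
  For \<open>x \<in> P\<close> put \<open>f x = x \<otimes> x + x \<otimes> d x\<close>. In characteristic 2 the Tate differential \<open>D\<close> satisfies
  \<open>D (f x) = d x \<otimes> d x\<close>, and \<open>(y + z) \<otimes> (y + z) = y \<otimes> y + z \<otimes> z + D (y \<otimes> z)\<close> for cycles, so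
  \<open>z \<mapsto> z \<otimes> z\<close> induces a linear map from \<open>R\<^sub>F \<otimes> H(P)\<close> to the homology of the Tate construction. If \<open>P\<close> is
  enlarged by one basis element \<open>e\<close>, the mixed tensors \<open>p \<otimes> e\<close> and \<open>e \<otimes> q\<close> contribute an acyclic piece,
  and the remaining \<open>e \<otimes> e\<close> matches the new generator of \<open>R\<^sub>F \<otimes> P\<close>; hence induction along the flag
  shows that the map is bijective, as soon as the Frobenius map is flat.

  Flatness (Kunz) is proved through colon ideals. By Krull's principal ideal theorem a minimal set of
  generators of the maximal ideal is a regular sequence. Modulo all of it flatness is trivial, and it
  lifts from \<open>R / (I + x)\<close> to \<open>R / I\<close> when \<open>x\<close> is a nonzerodivisor modulo \<open>I\<close>: first to ideals containing a
  power of \<open>x\<close>, then to all ideals by Krull's intersection theorem.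
\<close>

section \<open>Ideals\<close>

text \<open>Squaring cycles is additive only modulo boundaries and \<open>f\<close> is not additive
  at all, so no chain map between the Frobenius pullback and the Tate construction is at hand. The
  comparison is a linear relation instead, spanned by the pairs
  \<open>(z \<otimes> z, 1 \<otimes> z)\<close> for cycles \<open>z\<close>. The term
  \<open>x \<otimes> d x\<close> in \<open>f\<close> is forced: \<open>x \<otimes> x\<close> has
  boundary \<open>d x \<otimes> x + x \<otimes> d x\<close>, and these mixed terms occur again in
  the boundary of \<open>x \<otimes> d x\<close>.

  When \<open>e\<close> is added, the connecting map sends \<open>e \<otimes> e\<close> to
  \<open>d e \<otimes> d e\<close>, just as \<open>1 \<otimes> e\<close> goes to
  \<open>1 \<otimes> d e\<close>. The rest is a five lemma on elements, in which injectivity for the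
  smaller module serves surjectivity for the larger one.

  Flatness is used elementwise: a combination of values of a semilinear map that a functional
  annihilates comes from elements that the matching functional annihilates in the source. Removing
  one generator at a time reduces this to one ideal and one element,
  \<open>(I^[2] : a^2) = (I : a)^[2]\<close>, where \<open>I^[2]\<close> is generated by the squares
  of \<open>I\<close>. Stated only for ideals above a fixed one, this can be lifted along a regular
  sequence.\<close>

definition ideal_adjoin :: "('a, 'k) ring_scheme \<Rightarrow> 'a set \<Rightarrow> 'a \<Rightarrow> 'a set" where
  "ideal_adjoin R I x = {i \<oplus>\<^bsub>R\<^esub> r \<otimes>\<^bsub>R\<^esub> x | i r. i \<in> I \<and> r \<in> carrier R}"

definition ideal_colon :: "('a, 'k) ring_scheme \<Rightarrow> 'a set \<Rightarrow> 'a \<Rightarrow> 'a set" where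
  "ideal_colon R I a = {r \<in> carrier R. a \<otimes>\<^bsub>R\<^esub> r \<in> I}"

context cring
begin

lemma ideal_criterion:
  assumes "I \<subseteq> carrier R" "\<zero> \<in> I"
    and "\<And>a b. a \<in> I \<Longrightarrow> b \<in> I \<Longrightarrow> a \<oplus> b \<in> I"
    and "\<And>r a. r \<in> carrier R \<Longrightarrow> a \<in> I \<Longrightarrow> r \<otimes> a \<in> I"
  shows "ideal I R"
proof (rule idealI)
  show "ring R" by (rule ring_axioms)
  show "subgroup I (add_monoid R)"
  proof (rule add.subgroupI)
    fix a assume a: "a \<in> I"
    then have "\<ominus> a = (\<ominus> \<one>) \<otimes> a" using assms(1) by (auto simp: l_minus)
    then show "\<ominus> a \<in> I" using assms(4)[of "\<ominus> \<one>" a] a by simp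
  qed (use assms in auto)
  show "x \<otimes> a \<in> I" "a \<otimes> x \<in> I" if "a \<in> I" "x \<in> carrier R" for a x
    using that assms(1) assms(4)[OF that(2,1)] m_comm[of a x] by auto
qed

lemma ideal_rules:
  assumes "ideal I R"
  shows "I \<subseteq> carrier R" "\<zero> \<in> I" "\<And>a. a \<in> I \<Longrightarrow> a \<in> carrier R"
    "\<And>a b. a \<in> I \<Longrightarrow> b \<in> I \<Longrightarrow> a \<oplus> b \<in> I" "\<And>a. a \<in> I \<Longrightarrow> \<ominus> a \<in> I"
    "\<And>a b. a \<in> I \<Longrightarrow> b \<in> I \<Longrightarrow> a \<ominus> b \<in> I"
    "\<And>r a. r \<in> carrier R \<Longrightarrow> a \<in> I \<Longrightarrow> r \<otimes> a \<in> I" "\<And>r a. r \<in> carrier R \<Longrightarrow> a \<in> I \<Longrightarrow> a \<otimes> r \<in> I"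
proof -
  interpret ideal I R by fact
  show "I \<subseteq> carrier R" by (rule a_subset)
  show "\<zero> \<in> I" by simp
  show "\<And>a. a \<in> I \<Longrightarrow> a \<in> carrier R" by (rule Icarr)
  show "\<And>a b. a \<in> I \<Longrightarrow> b \<in> I \<Longrightarrow> a \<oplus> b \<in> I" by simp
  show "\<And>a. a \<in> I \<Longrightarrow> \<ominus> a \<in> I" by simp
  show "\<And>a b. a \<in> I \<Longrightarrow> b \<in> I \<Longrightarrow> a \<ominus> b \<in> I" by (simp add: minus_eq)
  show "\<And>r a. r \<in> carrier R \<Longrightarrow> a \<in> I \<Longrightarrow> r \<otimes> a \<in> I" by (rule I_l_closed)
  show "\<And>r a. r \<in> carrier R \<Longrightarrow> a \<in> I \<Longrightarrow> a \<otimes> r \<in> I" by (rule I_r_closed)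
qed

lemma ideal_add_cancel:
  assumes "ideal I R" "a \<in> I" "b \<in> carrier R" "a \<oplus> b \<in> I"
  shows "b \<in> I"
proof -
  have "a \<in> carrier R" using assms ideal_rules(3)[OF assms(1)] by simp
  then have "b = (a \<oplus> b) \<ominus> a" using assms(3) by algebra
  then show ?thesis using ideal_rules(6)[OF assms(1) assms(4,2)] by simp
qed

lemma ideal_minus_cancel:
  assumes "ideal I R" "a \<in> I" "b \<in> carrier R" "b \<ominus> a \<in> I"
  shows "b \<in> I"
proof -
  have "a \<in> carrier R" using assms ideal_rules(3)[OF assms(1)] by simp
  then have "b = (b \<ominus> a) \<oplus> a" using assms(3) by algebra
  then show ?thesis using ideal_rules(4)[OF assms(1) assms(4,2)] by simp
qed

lemma primeideal_rules:
  assumes "primeideal p R"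
  shows "ideal p R" "\<one> \<notin> p"
    "\<And>a b. a \<in> carrier R \<Longrightarrow> b \<in> carrier R \<Longrightarrow> a \<otimes> b \<in> p \<Longrightarrow> a \<in> p \<or> b \<in> p"
proof -
  interpret primeideal p R by fact
  show "ideal p R" by (rule ideal_axioms)
  show "\<one> \<notin> p" using one_imp_carrier I_notcarr by auto
  show "\<And>a b. a \<in> carrier R \<Longrightarrow> b \<in> carrier R \<Longrightarrow> a \<otimes> b \<in> p \<Longrightarrow> a \<in> p \<or> b \<in> p" by (rule I_prime)
qed

lemma primeideal_pow:
  assumes "primeideal p R" "a \<in> carrier R" "a [^] (n::nat) \<in> p"
  shows "a \<in> p"
  using assms(3)
proof (induction n)
  case 0 then show ?case using primeideal_rules(2)[OF assms(1)] by simp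
next
  case (Suc n) then show ?case using primeideal_rules(3)[OF assms(1), of "a [^] n" a] assms(2) by auto
qed

lemma ideal_adjoin_ideal:
  assumes "ideal I R" "x \<in> carrier R"
  shows "ideal (ideal_adjoin R I x) R"
proof (rule ideal_criterion)
  note IR = ideal_rules[OF assms(1)]
  show "ideal_adjoin R I x \<subseteq> carrier R" using assms(2) IR(3) by (auto simp: ideal_adjoin_def)
  have "\<zero> = \<zero> \<oplus> \<zero> \<otimes> x" using assms(2) by simp
  then show "\<zero> \<in> ideal_adjoin R I x" unfolding ideal_adjoin_def using IR(2) by blast
  fix a b assume "a \<in> ideal_adjoin R I x" "b \<in> ideal_adjoin R I x"
  then obtain i r j s where h: "a = i \<oplus> r \<otimes> x" "b = j \<oplus> s \<otimes> x" "i \<in> I" "j \<in> I" "r \<in> carrier R" "s \<in> carrier R"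
    by (auto simp: ideal_adjoin_def)
  then have "a \<oplus> b = (i \<oplus> j) \<oplus> (r \<oplus> s) \<otimes> x" using assms(2) IR(3) by (simp add: l_distr a_ac)
  then show "a \<oplus> b \<in> ideal_adjoin R I x" unfolding ideal_adjoin_def using h IR(4) by blast
next
  note IR = ideal_rules[OF assms(1)]
  fix t a assume t: "t \<in> carrier R" and "a \<in> ideal_adjoin R I x"
  then obtain i r where h: "a = i \<oplus> r \<otimes> x" "i \<in> I" "r \<in> carrier R" by (auto simp: ideal_adjoin_def)
  then have "t \<otimes> a = t \<otimes> i \<oplus> (t \<otimes> r) \<otimes> x" using assms(2) IR(3) t by (simp add: r_distr m_assoc)
  then show "t \<otimes> a \<in> ideal_adjoin R I x" unfolding ideal_adjoin_def using h IR(7) t by blast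
qed

lemma ideal_adjoin_superset:
  assumes "ideal I R" "x \<in> carrier R"
  shows "I \<subseteq> ideal_adjoin R I x" "x \<in> ideal_adjoin R I x"
proof -
  note IR = ideal_rules[OF assms(1)]
  show "I \<subseteq> ideal_adjoin R I x"
  proof
    fix i assume "i \<in> I"
    then have "i = i \<oplus> \<zero> \<otimes> x" using assms(2) IR(3) by simp
    then show "i \<in> ideal_adjoin R I x" unfolding ideal_adjoin_def using \<open>i \<in> I\<close> by blast
  qed
  have "x = \<zero> \<oplus> \<one> \<otimes> x" using assms(2) by simp
  then show "x \<in> ideal_adjoin R I x" unfolding ideal_adjoin_def using IR(2) by blast
qed

lemma ideal_adjoin_minimal:
  assumes "ideal J R" "I \<subseteq> J" "x \<in> J"
  shows "ideal_adjoin R I x \<subseteq> J"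
  using assms ideal_rules[OF assms(1)] by (auto simp: ideal_adjoin_def subset_eq)

lemma ideal_adjoin_mult_mem:
  assumes "ideal I R" "x \<in> carrier R" "r \<in> carrier R"
  shows "r \<otimes> x \<in> ideal_adjoin R I x" "x \<otimes> r \<in> ideal_adjoin R I x"
  using ideal_rules(7,8)[OF ideal_adjoin_ideal] ideal_adjoin_superset(2) assms by auto

lemma ideal_colon_ideal:
  assumes "ideal I R" "a \<in> carrier R"
  shows "ideal (ideal_colon R I a) R"
  using ideal_rules[OF assms(1)] assms(2)
  by (intro ideal_criterion) (auto simp: ideal_colon_def r_distr m_lcomm)

lemma ideal_colon_superset:
  assumes "ideal I R" "a \<in> carrier R"
  shows "I \<subseteq> ideal_colon R I a"
  using ideal_rules[OF assms(1)] assms(2) by (auto simp: ideal_colon_def)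

end

section \<open>Noetherian rings\<close>

locale noetherian_cring = cring R + noetherian_ring R for R (structure)
begin

text \<open>In a Noetherian ring a nonempty chain of ideals contains its own union, which is the
  upper bound that Zorn's lemma asks for.\<close>

lemma exists_maximal_ideal_in:
  assumes "S \<noteq> {}" "\<And>I. I \<in> S \<Longrightarrow> ideal I R"
  shows "\<exists>M\<in>S. \<forall>I\<in>S. M \<subseteq> I \<longrightarrow> I = M"
proof (rule subset_Zorn_nonempty[OF assms(1)])
  fix C assume C: "C \<noteq> {}" "subset.chain S C"
  have "subset.chain {I. ideal I R} C"
    using C(2) assms(2) by (auto simp: subset.chain_def)
  then have "\<Union>C \<in> C" using ideal_chain_is_trivial C(1) by blast
  then show "\<Union>C \<in> S" using C(2) by (auto simp: subset.chain_def)
qed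

lemma ascending_chain_stable:
  fixes f :: "nat \<Rightarrow> 'a set"
  assumes "\<And>n. ideal (f n) R" "\<And>n. f n \<subseteq> f (Suc n)"
  shows "\<exists>n. \<forall>m\<ge>n. f m = f n"
proof -
  obtain n where n: "\<forall>I\<in>range f. f n \<subseteq> I \<longrightarrow> I = f n"
    using exists_maximal_ideal_in[of "range f"] assms(1) by auto
  have "f n \<subseteq> f m" if "n \<le> m" for m using that lift_Suc_mono_le[of f n m] assms(2) by blast
  then show ?thesis using n by blast
qed

text \<open>The colon ideals \<open>I : x^n\<close> ascend and so become stationary. The bound
  \<open>k\<close>, uniform in \<open>w\<close>, is the form in which the Artin-Rees lemma is used
  below.\<close>

lemma colon_pow_stable:
  assumes "ideal I R" "x \<in> carrier R"
  shows "\<exists>k::nat. \<forall>n\<ge>k. \<forall>w\<in>carrier R. x [^] n \<otimes> w \<in> I \<longrightarrow> x [^] k \<otimes> w \<in> I"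
proof -
  have "\<exists>k::nat. \<forall>m\<ge>k. ideal_colon R I (x [^] m) = ideal_colon R I (x [^] k)"
  proof (rule ascending_chain_stable)
    fix n :: nat
    show "ideal (ideal_colon R I (x [^] n)) R" using assms by (intro ideal_colon_ideal) auto
    show "ideal_colon R I (x [^] n) \<subseteq> ideal_colon R I (x [^] Suc n)"
      using assms ideal_rules[OF assms(1)] by (auto simp: ideal_colon_def m_assoc m_lcomm m_comm[of _ x])
  qed
  then show ?thesis by (auto simp: ideal_colon_def)
qed

text \<open>An associated prime of \<open>R / C\<close>: a maximal one among the annihilators of
  nonzero classes is prime, because \<open>C : z\<close> lies in \<open>C : z a\<close> and the two
  agree unless \<open>z a\<close> is in \<open>C\<close>.\<close>

lemma exists_colon_prime:
  assumes "ideal C R" "C \<noteq> carrier R"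
  shows "\<exists>z\<in>carrier R - C. primeideal (ideal_colon R C z) R"
proof -
  note CR = ideal_rules[OF assms(1)]
  obtain z where z: "z \<in> carrier R - C"
    and zmax: "\<And>w. w \<in> carrier R - C \<Longrightarrow> ideal_colon R C z \<subseteq> ideal_colon R C w \<Longrightarrow> ideal_colon R C w = ideal_colon R C z"
  proof -
    have "carrier R - C \<noteq> {}" using assms(2) CR(1) by blast
    then have "\<exists>M\<in>ideal_colon R C ` (carrier R - C). \<forall>I\<in>ideal_colon R C ` (carrier R - C). M \<subseteq> I \<longrightarrow> I = M"
      using assms(1) by (intro exists_maximal_ideal_in) (auto intro: ideal_colon_ideal)
    then show ?thesis using that by blast
  qed
  have "primeideal (ideal_colon R C z) R"
  proof (rule primeidealI)
    show "ideal (ideal_colon R C z) R" using z assms ideal_colon_ideal by blast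
    show "cring R" by (rule is_cring)
    have "\<one> \<notin> ideal_colon R C z" using z by (simp add: ideal_colon_def)
    then show "carrier R \<noteq> ideal_colon R C z" using one_closed by metis
    fix a b assume ab: "a \<in> carrier R" "b \<in> carrier R" "a \<otimes> b \<in> ideal_colon R C z"
    show "a \<in> ideal_colon R C z \<or> b \<in> ideal_colon R C z"
    proof (cases "z \<otimes> a \<in> C")
      case True then show ?thesis using ab by (simp add: ideal_colon_def)
    next
      case False
      have "ideal_colon R C z \<subseteq> ideal_colon R C (z \<otimes> a)"
      proof
        fix r assume "r \<in> ideal_colon R C z"
        then have r: "r \<in> carrier R" "z \<otimes> r \<in> C" by (auto simp: ideal_colon_def)
        have "(z \<otimes> a) \<otimes> r = a \<otimes> (z \<otimes> r)" using r z ab by (simp add: m_ac)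
        then show "r \<in> ideal_colon R C (z \<otimes> a)" using r CR(7)[OF ab(1) r(2)] by (simp add: ideal_colon_def)
      qed
      then have "ideal_colon R C (z \<otimes> a) = ideal_colon R C z" using zmax False z ab by blast
      moreover have "b \<in> ideal_colon R C (z \<otimes> a)" using ab z by (simp add: ideal_colon_def m_assoc)
      ultimately show ?thesis by simp
    qed
  qed
  then show ?thesis using z by blast
qed

end

section \<open>Krull's principal ideal theorem\<close>

text \<open>The saturated ideals are the contractions of the ideals of the localisation at \<open>P\<close>; working with
  them avoids constructing the localised ring.\<close>

definition saturated_wrt :: "('a, 'k) ring_scheme \<Rightarrow> 'a set \<Rightarrow> 'a set \<Rightarrow> bool" where
  "saturated_wrt R P J \<longleftrightarrow> ideal J R \<and>
     (\<forall>s\<in>carrier R - P. \<forall>r\<in>carrier R. s \<otimes>\<^bsub>R\<^esub> r \<in> J \<longrightarrow> r \<in> J)"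

definition saturation_wrt :: "('a, 'k) ring_scheme \<Rightarrow> 'a set \<Rightarrow> 'a set \<Rightarrow> 'a set" where
  "saturation_wrt R P J = {r \<in> carrier R. \<exists>s\<in>carrier R - P. s \<otimes>\<^bsub>R\<^esub> r \<in> J}"

section \<open>Saturation at a prime ideal\<close>

context cring
begin

lemma primeideal_compl_mult:
  assumes "primeideal P R" "s \<in> carrier R - P" "t \<in> carrier R - P"
  shows "s \<otimes> t \<in> carrier R - P"
  using primeideal_rules(3)[OF assms(1), of s t] assms(2,3) by auto

lemma saturation_wrtI:
  assumes "r \<in> carrier R" "s \<in> carrier R - P" "s \<otimes> r \<in> J"
  shows "r \<in> saturation_wrt R P J"
  using assms unfolding saturation_wrt_def by blast

lemma saturation_wrtE:
  assumes "r \<in> saturation_wrt R P J"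
  obtains s where "r \<in> carrier R" "s \<in> carrier R - P" "s \<otimes> r \<in> J"
  using assms unfolding saturation_wrt_def by blast

lemma saturated_wrtD:
  assumes "saturated_wrt R P J" "s \<in> carrier R - P" "r \<in> carrier R" "s \<otimes> r \<in> J"
  shows "r \<in> J"
  using assms unfolding saturated_wrt_def by blast

lemma saturation_wrt_ideal:
  assumes "primeideal P R" "ideal J R"
  shows "ideal (saturation_wrt R P J) R"
proof (rule ideal_criterion)
  note JR = ideal_rules[OF assms(2)]
  show "saturation_wrt R P J \<subseteq> carrier R" by (auto simp: saturation_wrt_def)
  have "\<one> \<in> carrier R - P" using primeideal_rules(2)[OF assms(1)] by simp
  moreover have "\<one> \<otimes> \<zero> \<in> J" using JR(2) by simp
  ultimately show "\<zero> \<in> saturation_wrt R P J" by (intro saturation_wrtI[of _ \<one>]) auto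
  fix a b assume "a \<in> saturation_wrt R P J" "b \<in> saturation_wrt R P J"
  then obtain s t where h: "a \<in> carrier R" "b \<in> carrier R" "s \<in> carrier R - P" "t \<in> carrier R - P"
    "s \<otimes> a \<in> J" "t \<otimes> b \<in> J" by (auto simp: saturation_wrt_def)
  have "(s \<otimes> t) \<otimes> (a \<oplus> b) = t \<otimes> (s \<otimes> a) \<oplus> s \<otimes> (t \<otimes> b)" using h by (simp add: r_distr m_ac)
  also have "\<dots> \<in> J" using h JR by auto
  finally show "a \<oplus> b \<in> saturation_wrt R P J"
    using h primeideal_compl_mult[OF assms(1) h(3,4)] by (intro saturation_wrtI[of _ "s \<otimes> t"]) auto
next
  note JR = ideal_rules[OF assms(2)]
  fix r a assume r: "r \<in> carrier R" and "a \<in> saturation_wrt R P J"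
  then obtain s where h: "a \<in> carrier R" "s \<in> carrier R - P" "s \<otimes> a \<in> J" by (auto simp: saturation_wrt_def)
  have "s \<otimes> (r \<otimes> a) = r \<otimes> (s \<otimes> a)" using h r by (simp add: m_lcomm)
  then show "r \<otimes> a \<in> saturation_wrt R P J" using h r JR(7)[OF r h(3)] by (intro saturation_wrtI[of _ s]) auto
qed

lemma saturation_wrt_saturated:
  assumes "primeideal P R" "ideal J R"
  shows "saturated_wrt R P (saturation_wrt R P J)"
  unfolding saturated_wrt_def
proof (intro conjI ballI impI)
  show "ideal (saturation_wrt R P J) R" by (rule saturation_wrt_ideal[OF assms])
  fix s r assume s: "s \<in> carrier R - P" and r: "r \<in> carrier R" "s \<otimes> r \<in> saturation_wrt R P J"
  then obtain t where t: "t \<in> carrier R - P" "t \<otimes> (s \<otimes> r) \<in> J" by (auto simp: saturation_wrt_def)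
  then have "(t \<otimes> s) \<otimes> r \<in> J" using s r by (simp add: m_assoc)
  then show "r \<in> saturation_wrt R P J"
    using r primeideal_compl_mult[OF assms(1) t(1) s] by (intro saturation_wrtI[of _ "t \<otimes> s"]) auto
qed

lemma saturation_wrt_superset:
  assumes "primeideal P R" "ideal J R"
  shows "J \<subseteq> saturation_wrt R P J"
proof
  fix r assume r: "r \<in> J"
  then have "r \<in> carrier R" "\<one> \<otimes> r \<in> J" using ideal_rules[OF assms(2)] by auto
  then show "r \<in> saturation_wrt R P J"
    using primeideal_rules(2)[OF assms(1)] by (intro saturation_wrtI[of _ \<one>]) auto
qed

lemma saturation_wrt_minimal:
  assumes "saturated_wrt R P K" "J \<subseteq> K"
  shows "saturation_wrt R P J \<subseteq> K"
  using assms by (auto elim!: saturation_wrtE intro: saturated_wrtD)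

end

section \<open>Krull intersections and descending chains at a prime\<close>

context noetherian_cring
begin

text \<open>The Artin-Rees bound for the ideal \<open>J + (x z)\<close> turns \<open>s z\<close> in
  \<open>J + (x^k)\<close> into \<open>s z\<close> in \<open>J + (x z)\<close>, which says that
  \<open>(s - t x) z\<close> lies in \<open>J\<close>. Since \<open>s\<close> is outside
  \<open>P\<close> and \<open>x\<close> inside, \<open>s - t x\<close> is invertible at
  \<open>P\<close>, and saturation removes it.\<close>

lemma krull_intersection:
  assumes P: "primeideal P R" and J: "saturated_wrt R P J" and x: "x \<in> P" and z: "z \<in> carrier R"
    and mem: "\<And>n::nat. \<exists>s\<in>carrier R - P. s \<otimes> z \<in> ideal_adjoin R J (x [^] n)"
  shows "z \<in> J"
proof -
  have Ji: "ideal J R" using J by (simp add: saturated_wrt_def)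
  note JR = ideal_rules[OF Ji] and PR = ideal_rules[OF primeideal_rules(1)[OF P]]
  have xc: "x \<in> carrier R" using PR(3) x by blast
  let ?A = "ideal_adjoin R J (x \<otimes> z)"
  have A: "ideal ?A R" using ideal_adjoin_ideal[OF Ji] xc z by simp
  note AR = ideal_rules[OF A] and JA = ideal_adjoin_superset[OF Ji, of "x \<otimes> z"]
  obtain k :: nat where k: "\<And>n w. n \<ge> k \<Longrightarrow> w \<in> carrier R \<Longrightarrow> x [^] n \<otimes> w \<in> ?A \<Longrightarrow> x [^] k \<otimes> w \<in> ?A"
    using colon_pow_stable[OF A xc] by blast
  obtain s where s: "s \<in> carrier R - P" "s \<otimes> z \<in> ideal_adjoin R J (x [^] k)" using mem by blast
  then obtain j w where jw: "j \<in> J" "w \<in> carrier R" "s \<otimes> z = j \<oplus> w \<otimes> x [^] k" by (auto simp: ideal_adjoin_def)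
  have sc: "s \<in> carrier R" and jc: "j \<in> carrier R" using s jw JR by auto
  \<comment> \<open>One more factor \<open>x\<close> brings \<open>w x^k = s z - j\<close> into
    \<open>J + (x z)\<close>; stability at \<open>k\<close> then takes this factor away
    again.\<close>
  have "x [^] Suc k \<otimes> w = s \<otimes> (x \<otimes> z) \<oplus> (\<ominus> x) \<otimes> j"
  proof -
    have "x [^] Suc k \<otimes> w = x \<otimes> (w \<otimes> x [^] k)" using xc jw by (simp add: m_ac)
    also have "w \<otimes> x [^] k = s \<otimes> z \<ominus> j"
    proof -
      have "w \<otimes> x [^] k \<in> carrier R" using jw xc by simp
      then show ?thesis unfolding jw(3) using jc by algebra
    qed
    also have "x \<otimes> (s \<otimes> z \<ominus> j) = s \<otimes> (x \<otimes> z) \<oplus> (\<ominus> x) \<otimes> j" using xc sc jc z by algebra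
    finally show ?thesis .
  qed
  also have "\<dots> \<in> ?A"
  proof (rule AR(4))
    show "s \<otimes> (x \<otimes> z) \<in> ?A" using AR(7) JA sc xc z by simp
    show "\<ominus> x \<otimes> j \<in> ?A" using AR(7) JA xc z jw(1) by (simp add: subset_eq)
  qed
  finally have "x [^] Suc k \<otimes> w \<in> ?A" .
  then have "x [^] k \<otimes> w \<in> ?A" using k[of "Suc k" w] jw by simp
  then have "w \<otimes> x [^] k \<in> ?A" using jw xc by (simp add: m_comm)
  then have "s \<otimes> z \<in> ?A" unfolding jw(3) using jw(1) AR(4) JA(1) xc z by (simp add: subset_eq)
  then obtain j' t where jt: "j' \<in> J" "t \<in> carrier R" "s \<otimes> z = j' \<oplus> t \<otimes> (x \<otimes> z)" by (auto simp: ideal_adjoin_def)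
  have j'c: "j' \<in> carrier R" using jt JR by auto
  have "(s \<ominus> t \<otimes> x) \<otimes> z = s \<otimes> z \<ominus> t \<otimes> (x \<otimes> z)" using sc jt xc z by algebra
  also have "\<dots> = j'" unfolding jt(3) using j'c jt(2) xc z by algebra
  finally have "(s \<ominus> t \<otimes> x) \<otimes> z \<in> J" using jt by simp
  moreover have "s \<ominus> t \<otimes> x \<in> carrier R - P"
    using ideal_minus_cancel[OF primeideal_rules(1)[OF P], of "t \<otimes> x" s] s(1) sc jt(2) PR(7)[OF jt(2) x] xc by auto
  ultimately show ?thesis using saturated_wrtD[OF J _ z] by blast
qed

text \<open>Localised at \<open>P\<close>, the quotient by \<open>B\<close> has a single prime and
  is therefore Artinian. Noetherian induction on a lower bound \<open>C\<close> of the chain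
  replaces a composition series: if \<open>C\<close> is maximal among the bounds for which some
  chain does not stop, the saturation \<open>?C'\<close> of \<open>C + (z)\<close> is a simple
  extension of \<open>C\<close> at \<open>P\<close>, and chains above \<open>?C'\<close> do
  stop.\<close>

lemma saturated_dcc:
  assumes P: "primeideal P R" and B: "B \<subseteq> P"
    and min: "\<And>q. primeideal q R \<Longrightarrow> B \<subseteq> q \<Longrightarrow> q \<subseteq> P \<Longrightarrow> q = P"
    and f: "\<And>k::nat. saturated_wrt R P (f k)" "\<And>k. B \<subseteq> f k" "\<And>k. f (Suc k) \<subseteq> f k"
  shows "\<exists>n. \<forall>k\<ge>n. f k = f n"
proof -
  define dcc where "dcc C \<longleftrightarrow> (\<forall>f::nat \<Rightarrow> 'a set. (\<forall>k. saturated_wrt R P (f k) \<and> C \<subseteq> f k \<and> f (Suc k) \<subseteq> f k)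
      \<longrightarrow> (\<exists>n. \<forall>k\<ge>n. f k = f n))" for C
  define S where "S = {C. saturated_wrt R P C \<and> B \<subseteq> C \<and> \<not> dcc C}"
  have "S = {}"
  proof (rule ccontr)
    assume "S \<noteq> {}"
    moreover have "ideal I R" if "I \<in> S" for I using that by (simp add: S_def saturated_wrt_def)
    ultimately have "\<exists>M\<in>S. \<forall>I\<in>S. M \<subseteq> I \<longrightarrow> I = M" by (rule exists_maximal_ideal_in)
    then obtain C where CS: "C \<in> S" and Cmax: "\<And>I. I \<in> S \<Longrightarrow> C \<subseteq> I \<Longrightarrow> I = C"
      by blast
    have C: "saturated_wrt R P C" "B \<subseteq> C" "\<not> dcc C" using CS by (simp_all add: S_def)
    have Ci: "ideal C R" using C(1) by (simp add: saturated_wrt_def)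
    note CR = ideal_rules[OF Ci]
    obtain f where f: "\<And>k::nat. saturated_wrt R P (f k)" "\<And>k. C \<subseteq> f k" "\<And>k. f (Suc k) \<subseteq> f k"
      and nf: "\<not> (\<exists>n. \<forall>k\<ge>n. f k = f n)" using C(3) unfolding dcc_def by blast
    have fi: "ideal (f k) R" for k using f(1) by (simp add: saturated_wrt_def)
    have anti: "f l \<subseteq> f k" if "k \<le> l" for k l using that lift_Suc_antimono_le[of f k l] f(3) by blast
    have "C \<noteq> carrier R"
    proof
      assume "C = carrier R"
      then have "f k = carrier R" for k using f(2) ideal_rules(1)[OF fi] by blast
      then show False using nf by simp
    qed
    then obtain z where z: "z \<in> carrier R" "z \<notin> C" and zp: "primeideal (ideal_colon R C z) R"
      using exists_colon_prime[OF Ci] by blast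
    \<comment> \<open>Elements outside \<open>P\<close> act as units on saturated ideals, so none of
      them can annihilate the nonzero class of \<open>z\<close>. By minimality of \<open>P\<close>
      over \<open>B\<close> the annihilator is then all of \<open>P\<close>.\<close>
    have "ideal_colon R C z \<subseteq> P"
    proof
      fix r assume "r \<in> ideal_colon R C z"
      then have r: "r \<in> carrier R" "r \<otimes> z \<in> C" using z by (auto simp: ideal_colon_def m_comm)
      show "r \<in> P"
      proof (rule ccontr)
        assume "r \<notin> P"
        then show False using r z saturated_wrtD[OF C(1), of r z] by blast
      qed
    qed
    then have colP: "ideal_colon R C z = P"
      using min[OF zp] ideal_colon_superset[OF Ci z(1)] C(2) by blast
    let ?C' = "saturation_wrt R P (ideal_adjoin R C z)"
    have adj: "ideal (ideal_adjoin R C z) R" using ideal_adjoin_ideal[OF Ci z(1)] .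
    have C': "saturated_wrt R P ?C'" using saturation_wrt_saturated[OF P adj] .
    have sub: "C \<subseteq> ?C'" "z \<in> ?C'"
      using saturation_wrt_superset[OF P adj] ideal_adjoin_superset[OF Ci z(1)] by auto
    have "?C' \<notin> S" using Cmax[OF _ sub(1)] sub(2) z(2) by blast
    then have dccC': "dcc ?C'" using C' sub(1) C(2) unfolding S_def by blast
    \<comment> \<open>In \<open>s w = c + a z\<close> the coefficient \<open>a\<close> is outside
      \<open>P = (C : z)\<close>, for otherwise \<open>w\<close> would already be in
      \<open>C\<close>. So \<open>a\<close> is a unit at \<open>P\<close> and \<open>z\<close> can
      be recovered from \<open>w\<close>.\<close>
    have simple: "z \<in> I" if I: "saturated_wrt R P I" "C \<subseteq> I" "w \<in> I" "w \<in> ?C'" "w \<notin> C" for I w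
    proof -
      have Ii: "ideal I R" using I(1) by (simp add: saturated_wrt_def)
      obtain s where s: "w \<in> carrier R" "s \<in> carrier R - P" "s \<otimes> w \<in> ideal_adjoin R C z"
        using I(4) by (rule saturation_wrtE)
      then obtain c a where ca: "c \<in> C" "a \<in> carrier R" "s \<otimes> w = c \<oplus> a \<otimes> z" by (auto simp: ideal_adjoin_def)
      have "a \<notin> P"
      proof
        assume "a \<in> P"
        then have "z \<otimes> a \<in> C" unfolding colP[symmetric] ideal_colon_def by simp
        then have "a \<otimes> z \<in> C" using z ca by (simp add: m_comm)
        then have "s \<otimes> w \<in> C" using ca CR(4) by simp
        then show False using I(5) s saturated_wrtD[OF C(1)] by blast
      qed
      moreover have "a \<otimes> z \<in> I"
      proof (rule ideal_add_cancel[OF Ii])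
        show "c \<in> I" using ca I by blast
        show "a \<otimes> z \<in> carrier R" using ca z by simp
        show "c \<oplus> a \<otimes> z \<in> I" using ideal_rules(7)[OF Ii, of s w] s I(3) ca(3) by simp
      qed
      ultimately show "z \<in> I" using ca z saturated_wrtD[OF I(1), of a z] by blast
    qed
    have C'min: "?C' \<subseteq> I" if "saturated_wrt R P I" "C \<subseteq> I" "z \<in> I" for I
      using saturation_wrt_minimal[OF that(1)] ideal_adjoin_minimal[OF _ that(2,3)] that(1)
      by (auto simp: saturated_wrt_def)
    show False
    proof (cases "\<forall>k. z \<in> f k")
      case True
      have "\<forall>k. saturated_wrt R P (f k) \<and> ?C' \<subseteq> f k \<and> f (Suc k) \<subseteq> f k"
        using f C'min[OF f(1) f(2)] True by simp
      then show False using dccC'[unfolded dcc_def, THEN spec, of f] nf by blast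
    next
      case False
      then obtain k1 where k1: "z \<notin> f k1" by blast
      \<comment> \<open>From \<open>k1\<close> on, \<open>simple\<close> shows that
        \<open>f k\<close> meets \<open>?C'\<close> only in \<open>C\<close>. Hence
        \<open>f k\<close> is determined by the ideal \<open>?J k\<close> above it, and the chain
        \<open>?J\<close> lies above \<open>?C'\<close>, where it is stationary.\<close>
      let ?J = "\<lambda>k. saturation_wrt R P (ideal_adjoin R (f k) z)"
      have adjf: "ideal (ideal_adjoin R (f k) z) R" for k using ideal_adjoin_ideal[OF fi z(1)] .
      have Jsat: "saturated_wrt R P (?J k)" for k using saturation_wrt_saturated[OF P adjf] .
      have fJ: "f k \<subseteq> ?J k" "z \<in> ?J k" for k
        using saturation_wrt_superset[OF P adjf] ideal_adjoin_superset[OF fi z(1)] by blast+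
      have "ideal_adjoin R (f (Suc k)) z \<subseteq> ideal_adjoin R (f k) z" for k using f(3) by (auto simp: ideal_adjoin_def)
      then have "?J (Suc k) \<subseteq> ?J k" for k unfolding saturation_wrt_def by blast
      moreover have "?C' \<subseteq> ?J k" for k using C'min[OF Jsat] fJ f(2) by blast
      ultimately have "\<forall>k. saturated_wrt R P (?J k) \<and> ?C' \<subseteq> ?J k \<and> ?J (Suc k) \<subseteq> ?J k"
        using Jsat by blast
      then have "\<exists>n. \<forall>k\<ge>n. ?J k = ?J n" using dccC'[unfolded dcc_def, THEN spec, of ?J] by blast
      then obtain n where n: "\<And>k. k \<ge> n \<Longrightarrow> ?J k = ?J n" by blast
      \<comment> \<open>Past \<open>n\<close> the ideals \<open>?J k\<close> are constant, and past
        \<open>k1\<close> the element \<open>z\<close> is outside \<open>f k\<close>; both are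
        needed at once.\<close>
      define N where "N = max n k1"
      have "f k = f N" if k: "k \<ge> N" for k
      proof
        show "f k \<subseteq> f N" using anti k .
        show "f N \<subseteq> f k"
        proof
          fix w assume w: "w \<in> f N"
          have "k \<ge> n" "N \<ge> n" using k by (simp_all add: N_def)
          then have "?J k = ?J N" using n by metis
          then have "w \<in> ?J k" using fJ w by blast
          then obtain s where s: "w \<in> carrier R" "s \<in> carrier R - P" "s \<otimes> w \<in> ideal_adjoin R (f k) z"
            by (rule saturation_wrtE)
          then obtain i a where ia: "i \<in> f k" "a \<in> carrier R" "s \<otimes> w = i \<oplus> a \<otimes> z" by (auto simp: ideal_adjoin_def)
          have iN: "i \<in> f N" using ia anti[OF k] by blast
          have swN: "i \<oplus> a \<otimes> z \<in> f N" unfolding ia(3)[symmetric] using ideal_rules(7)[OF fi] s w by blast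
          have azN: "a \<otimes> z \<in> f N" using ideal_add_cancel[OF fi iN _ swN] ia z by simp
          have "a \<otimes> z \<in> ?C'" using ideal_rules(7)[OF _ ia(2) sub(2)] C' by (simp add: saturated_wrt_def)
          moreover have "z \<notin> f N" using k1 anti[of k1 N] by (auto simp: N_def)
          ultimately have "a \<otimes> z \<in> C" using simple[OF f(1) f(2) azN] by blast
          then have "a \<otimes> z \<in> f k" using f(2) by blast
          then have "s \<otimes> w \<in> f k" unfolding ia(3) by (rule ideal_rules(4)[OF fi ia(1)])
          then show "w \<in> f k" using saturated_wrtD[OF f(1)] s by blast
        qed
      qed
      then show False using nf by blast
    qed
  qed
  \<comment> \<open>\<open>B\<close> is only a set, while the induction is about saturated ideals;
    the least saturated ideal above \<open>B\<close> takes its place.\<close>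
  let ?C = "saturation_wrt R P (Idl B)"
  have Bc: "B \<subseteq> carrier R" using f(2)[of 0] f(1)[of 0] ideal_rules(1) by (auto simp: saturated_wrt_def)
  have "saturated_wrt R P ?C" "B \<subseteq> ?C"
    using saturation_wrt_saturated[OF P genideal_ideal[OF Bc]] saturation_wrt_superset[OF P genideal_ideal[OF Bc]]
      genideal_self[OF Bc] by auto
  then have "dcc ?C" using \<open>S = {}\<close> unfolding S_def by blast
  have "?C \<subseteq> f k" for k
    using saturation_wrt_minimal[OF f(1)] genideal_minimal[of "f k" B] f(1)[of k] f(2) by (simp add: saturated_wrt_def)
  then have "\<forall>k. saturated_wrt R P (f k) \<and> ?C \<subseteq> f k \<and> f (Suc k) \<subseteq> f k" using f by simp
  then show ?thesis using \<open>dcc ?C\<close>[unfolded dcc_def, THEN spec, of f] by blast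
qed

end

section \<open>Symbolic powers and the height of a principal ideal\<close>

context noetherian_cring
begin

text \<open>If the claim fails, \<open>P\<close> is minimal over \<open>p + (x)\<close>, so the
  ideals \<open>f k\<close> become stationary. Because the \<open>E k\<close> are closed under
  division by \<open>x\<close>, it follows that \<open>E n\<close> lies in \<open>E (n + 1)\<close>
  plus every power of \<open>x\<close>, locally at \<open>P\<close>. Krull's intersection theorem
  then puts \<open>y^n\<close> into \<open>E (n + 1)\<close>, which is impossible for an element
  \<open>y\<close> of \<open>p'\<close> outside \<open>p\<close>.\<close>

theorem principal_ideal_theorem:
  assumes p: "primeideal p R" and p': "primeideal p' R" and P: "primeideal P R"
    and sub: "p \<subset> p'" "p' \<subset> P" and x: "x \<in> P"
  shows "\<exists>q. primeideal q R \<and> p \<subseteq> q \<and> x \<in> q \<and> q \<subset> P"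
proof (rule ccontr)
  assume neg: "\<not> ?thesis"
  have pi: "ideal p R" and pi': "ideal p' R" and Pi: "ideal P R" using p p' P primeideal_rules by auto
  note pR = ideal_rules[OF pi] and PR = ideal_rules[OF Pi] and pR' = ideal_rules[OF pi']
  have xc: "x \<in> carrier R" using PR x by blast
  \<comment> \<open>Otherwise \<open>p'\<close> itself would be the prime whose existence is
    denied.\<close>
  have xp': "x \<notin> p'" using neg p' sub by blast
  obtain y where y: "y \<in> p'" "y \<notin> p" using sub by blast
  have yc: "y \<in> carrier R" using pR' y by blast
  have oneP: "\<one> \<in> carrier R - P" using primeideal_rules(2)[OF P] by simp
  \<comment> \<open>\<open>E k\<close> is contracted from the ring in which \<open>x\<close> and all
    elements outside \<open>P\<close> are inverted. As \<open>x\<close> is not in \<open>p'\<close>,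
    this is a substitute for the symbolic powers of \<open>p'\<close>, made from the powers of the
    single element \<open>y\<close>.\<close>
  define E where "E k = {r \<in> carrier R. \<exists>j::nat. \<exists>s\<in>carrier R - P.
      s \<otimes> (x [^] j \<otimes> r) \<in> ideal_adjoin R p (y [^] k)}" for k :: nat
  have EI: "r \<in> E k" if "r \<in> carrier R" "s \<in> carrier R - P" "s \<otimes> (x [^] j \<otimes> r) \<in> ideal_adjoin R p (y [^] k)"
    for r s k and j :: nat using that unfolding E_def by blast
  have EE: "\<exists>s j. r \<in> carrier R \<and> s \<in> carrier R - P \<and> s \<otimes> (x [^] (j::nat) \<otimes> r) \<in> ideal_adjoin R p (y [^] k)"
    if "r \<in> E k" for r k using that unfolding E_def by blast
  have adji: "ideal (ideal_adjoin R p (y [^] k)) R" for k :: nat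
    using ideal_adjoin_ideal[OF pi] yc by simp
  note aR = ideal_rules[OF adji]
  have Ei: "ideal (E k) R" for k
  proof (rule ideal_criterion)
    show "E k \<subseteq> carrier R" by (auto simp: E_def)
    show "\<zero> \<in> E k" using oneP xc aR(2) by (intro EI[of _ \<one> 0]) auto
    fix a b assume "a \<in> E k" "b \<in> E k"
    then obtain s i t j where h: "a \<in> carrier R" "b \<in> carrier R" "s \<in> carrier R - P" "t \<in> carrier R - P"
      "s \<otimes> (x [^] (i::nat) \<otimes> a) \<in> ideal_adjoin R p (y [^] k)" "t \<otimes> (x [^] (j::nat) \<otimes> b) \<in> ideal_adjoin R p (y [^] k)"
      using EE by metis
    have "(s \<otimes> t) \<otimes> (x [^] (i + j) \<otimes> (a \<oplus> b))
        = (t \<otimes> x [^] j) \<otimes> (s \<otimes> (x [^] i \<otimes> a)) \<oplus> (s \<otimes> x [^] i) \<otimes> (t \<otimes> (x [^] j \<otimes> b))"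
      using h xc by (simp add: nat_pow_mult[symmetric] r_distr m_ac)
    also have "\<dots> \<in> ideal_adjoin R p (y [^] k)" using aR(4,7) h xc by simp
    finally show "a \<oplus> b \<in> E k"
      using h primeideal_compl_mult[OF P h(3,4)] by (intro EI[of _ "s \<otimes> t" "i + j"]) auto
  next
    fix r a assume r: "r \<in> carrier R" and "a \<in> E k"
    then obtain s i where h: "a \<in> carrier R" "s \<in> carrier R - P"
      "s \<otimes> (x [^] (i::nat) \<otimes> a) \<in> ideal_adjoin R p (y [^] k)"
      using EE by metis
    have "s \<otimes> (x [^] i \<otimes> (r \<otimes> a)) = r \<otimes> (s \<otimes> (x [^] i \<otimes> a))" using h r xc by (simp add: m_ac)
    then show "r \<otimes> a \<in> E k" using h r aR(7)[OF r h(3)] by (intro EI[of _ s i]) auto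
  qed
  note ER = ideal_rules[OF Ei]
  have Exsat: "a \<in> E k" if a: "a \<in> carrier R" "a \<otimes> x \<in> E k" for a k
  proof -
    obtain s j where h: "s \<in> carrier R - P" "s \<otimes> (x [^] (j::nat) \<otimes> (a \<otimes> x)) \<in> ideal_adjoin R p (y [^] k)"
      using EE[OF a(2)] by blast
    have "s \<otimes> (x [^] j \<otimes> (a \<otimes> x)) = s \<otimes> (x [^] Suc j \<otimes> a)" using h a xc by (simp add: m_ac)
    then show ?thesis using h a EI[of a s "Suc j" k] by simp
  qed
  have Esat: "saturated_wrt R P (E k)" for k
    unfolding saturated_wrt_def
  proof (intro conjI ballI impI Ei)
    fix s r assume s: "s \<in> carrier R - P" and r: "r \<in> carrier R" "s \<otimes> r \<in> E k"
    then obtain t j where h: "t \<in> carrier R - P" "t \<otimes> (x [^] (j::nat) \<otimes> (s \<otimes> r)) \<in> ideal_adjoin R p (y [^] k)"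
      using EE[OF r(2)] by blast
    have "t \<otimes> (x [^] j \<otimes> (s \<otimes> r)) = (t \<otimes> s) \<otimes> (x [^] j \<otimes> r)" using h r s xc by (simp add: m_ac)
    then show "r \<in> E k" using h r EI[OF r(1) primeideal_compl_mult[OF P h(1) s]] by simp
  qed
  have adjsub: "ideal_adjoin R p (y [^] Suc k) \<subseteq> ideal_adjoin R p (y [^] k)" for k :: nat
  proof (rule ideal_adjoin_minimal[OF adji])
    show "p \<subseteq> ideal_adjoin R p (y [^] k)" using ideal_adjoin_superset(1)[OF pi] yc by simp
    show "y [^] Suc k \<in> ideal_adjoin R p (y [^] k)"
      using aR(8)[OF yc ideal_adjoin_superset(2)[OF pi]] yc by simp
  qed
  have Eanti: "E (Suc k) \<subseteq> E k" for k
  proof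
    fix r assume "r \<in> E (Suc k)"
    then show "r \<in> E k" using EE[of r "Suc k"] EI[of r _ _ k] adjsub by blast
  qed
  have pE: "p \<subseteq> E k" for k
  proof
    fix r assume r: "r \<in> p"
    have "\<one> \<otimes> (x [^] (0::nat) \<otimes> r) \<in> ideal_adjoin R p (y [^] k)"
      using r pR(3)[OF r] ideal_adjoin_superset(1)[OF pi, of "y [^] k"] yc by auto
    then show "r \<in> E k" using EI[OF pR(3)[OF r] oneP] by blast
  qed
  define f where "f k = saturation_wrt R P (ideal_adjoin R (E k) x)" for k
  have fi: "ideal (ideal_adjoin R (E k) x) R" for k using ideal_adjoin_ideal[OF Ei xc] .
  have "\<exists>n. \<forall>k\<ge>n. f k = f n"
  proof (rule saturated_dcc[OF P, of "ideal_adjoin R p x"])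
    show "ideal_adjoin R p x \<subseteq> P" using ideal_adjoin_minimal[OF Pi _ x] sub by blast
    show "q = P" if "primeideal q R" "ideal_adjoin R p x \<subseteq> q" "q \<subseteq> P" for q
      using neg that ideal_adjoin_superset[OF pi xc] by blast
    show "saturated_wrt R P (f k)" for k unfolding f_def by (rule saturation_wrt_saturated[OF P fi])
    have "ideal_adjoin R p x \<subseteq> ideal_adjoin R (E k) x" for k using pE by (auto simp: ideal_adjoin_def)
    then show "ideal_adjoin R p x \<subseteq> f k" for k
      unfolding f_def using saturation_wrt_superset[OF P fi] by blast
    have "ideal_adjoin R (E (Suc k)) x \<subseteq> ideal_adjoin R (E k) x" for k using Eanti by (auto simp: ideal_adjoin_def)
    then show "f (Suc k) \<subseteq> f k" for k unfolding f_def saturation_wrt_def by blast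
  qed
  then obtain n where n: "f (Suc n) = f n" by (meson le_SucI order_refl)
  \<comment> \<open>Stationarity writes \<open>r\<close>, up to a factor outside \<open>P\<close>,
    as \<open>b + a x\<close> with \<open>b\<close> in \<open>E (n + 1)\<close>. Then
    \<open>a x\<close>, hence \<open>a\<close>, lies in \<open>E n\<close>, and \<open>a\<close> is
    expanded in the same way.\<close>
  have Epow: "\<forall>r\<in>E n. \<exists>s\<in>carrier R - P. s \<otimes> r \<in> ideal_adjoin R (E (Suc n)) (x [^] m)" for m :: nat
  proof (induction m)
    case 0
    show ?case
    proof
      fix r assume r: "r \<in> E n"
      have "\<one> \<otimes> r \<in> ideal_adjoin R (E (Suc n)) (x [^] (0::nat))"
        using ideal_adjoin_mult_mem(1)[OF Ei, of \<one> r] ER(3)[OF r] by simp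
      then show "\<exists>s\<in>carrier R - P. s \<otimes> r \<in> ideal_adjoin R (E (Suc n)) (x [^] (0::nat))" using oneP by blast
    qed
  next
    case (Suc m)
    show ?case
    proof
      fix r assume r: "r \<in> E n"
      then have rc: "r \<in> carrier R" using ER(3) by blast
      have "r \<in> f (Suc n)" unfolding n unfolding f_def
        using r saturation_wrt_superset[OF P fi] ideal_adjoin_superset(1)[OF Ei xc] by blast
      then obtain s where s: "s \<in> carrier R - P" "s \<otimes> r \<in> ideal_adjoin R (E (Suc n)) x"
        unfolding f_def by (rule saturation_wrtE)
      then obtain b a where ba: "b \<in> E (Suc n)" "a \<in> carrier R" "s \<otimes> r = b \<oplus> a \<otimes> x" by (auto simp: ideal_adjoin_def)
      have "b \<oplus> a \<otimes> x \<in> E n" unfolding ba(3)[symmetric] using ER(7) s r by blast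
      then have "a \<otimes> x \<in> E n" using ideal_add_cancel[OF Ei, of b n] ba Eanti xc by blast
      then have "a \<in> E n" using Exsat ba by blast
      then obtain t where t: "t \<in> carrier R - P" "t \<otimes> a \<in> ideal_adjoin R (E (Suc n)) (x [^] m)" using Suc by blast
      then obtain b' c where bc: "b' \<in> E (Suc n)" "c \<in> carrier R" "t \<otimes> a = b' \<oplus> c \<otimes> x [^] m" by (auto simp: ideal_adjoin_def)
      have bcar: "b \<in> carrier R" "b' \<in> carrier R" using ba bc ER(3) by blast+
      have "(t \<otimes> s) \<otimes> r = t \<otimes> (s \<otimes> r)" using t s rc by (simp add: m_assoc)
      also have "\<dots> = t \<otimes> b \<oplus> (t \<otimes> a) \<otimes> x" unfolding ba(3) using t ba xc bcar by (simp add: r_distr m_assoc)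
      also have "\<dots> = (t \<otimes> b \<oplus> b' \<otimes> x) \<oplus> c \<otimes> x [^] Suc m"
        unfolding bc(3) using t(1) bc(2) xc bcar by (simp add: l_distr m_assoc a_assoc)
      also have "\<dots> \<in> ideal_adjoin R (E (Suc n)) (x [^] Suc m)"
      proof -
        have "t \<otimes> b \<oplus> b' \<otimes> x \<in> E (Suc n)" using ER(4)[OF ER(7) ER(8)] t ba bc xc by blast
        then show ?thesis unfolding ideal_adjoin_def using bc(2) by blast
      qed
      finally show "\<exists>s\<in>carrier R - P. s \<otimes> r \<in> ideal_adjoin R (E (Suc n)) (x [^] Suc m)"
        using primeideal_compl_mult[OF P t(1) s(1)] by blast
    qed
  qed
  have "y [^] n \<in> E n"
    using EI[of "y [^] n" \<one> 0 n] oneP yc ideal_adjoin_superset(2)[OF pi, of "y [^] n"] by simp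
  then have "y [^] n \<in> E (Suc n)"
    using krull_intersection[OF P Esat x, of "y [^] n" "Suc n"] Epow yc by blast
  then obtain s j where s: "s \<in> carrier R - P" "s \<otimes> (x [^] (j::nat) \<otimes> y [^] n) \<in> ideal_adjoin R p (y [^] Suc n)"
    using EE by blast
  then obtain u t where ut: "u \<in> p" "t \<in> carrier R" "s \<otimes> (x [^] j \<otimes> y [^] n) = u \<oplus> t \<otimes> y [^] Suc n"
    by (auto simp: ideal_adjoin_def)
  have uc: "u \<in> carrier R" using pR ut by blast
  \<comment> \<open>Cancelling \<open>y^n\<close> modulo the prime \<open>p\<close> leaves
    \<open>s x^j - t y\<close> in \<open>p\<close>, so \<open>s x^j\<close> lies in
    \<open>p'\<close>, although neither \<open>s\<close> nor \<open>x\<close> does.\<close>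
  have "(s \<otimes> x [^] j \<ominus> t \<otimes> y) \<otimes> y [^] n = s \<otimes> (x [^] j \<otimes> y [^] n) \<ominus> t \<otimes> y [^] Suc n"
  proof -
    have "x [^] j \<in> carrier R" "y [^] n \<in> carrier R" "y [^] Suc n = y [^] n \<otimes> y" using xc yc by auto
    moreover have "s \<in> carrier R" using s(1) by simp
    ultimately show ?thesis using ut(2) yc by algebra
  qed
  also have "\<dots> = u" unfolding ut(3)
  proof -
    have "t \<otimes> y [^] Suc n \<in> carrier R" using ut yc by simp
    then show "u \<oplus> t \<otimes> y [^] Suc n \<ominus> t \<otimes> y [^] Suc n = u" using uc by algebra
  qed
  finally have "(s \<otimes> x [^] j \<ominus> t \<otimes> y) \<otimes> y [^] n \<in> p" using ut by simp
  then have "s \<otimes> x [^] j \<ominus> t \<otimes> y \<in> p"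
    using primeideal_rules(3)[OF p, of "s \<otimes> x [^] j \<ominus> t \<otimes> y" "y [^] n"] primeideal_pow[OF p yc] y s ut xc yc by auto
  then have "s \<otimes> x [^] j \<ominus> t \<otimes> y \<in> p'" using sub by blast
  then have "s \<otimes> x [^] j \<in> p'"
    using ideal_minus_cancel[OF pi', of "t \<otimes> y" "s \<otimes> x [^] j"] pR'(7) y ut s xc by auto
  then show False
    using primeideal_rules(3)[OF p', of s "x [^] j"] primeideal_pow[OF p' xc] xp' s xc sub by auto
qed

end

section \<open>Regular sequences\<close>

text \<open>The upper end is fixed at \<open>\<mm>\<close> and the chain grows downwards, because
  the arguments below replace its lowest members by larger primes.\<close>

inductive prime_chain :: "('a, 'k) ring_scheme \<Rightarrow> 'a set \<Rightarrow> 'a set \<Rightarrow> nat \<Rightarrow> bool" for R \<mm> where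
  base: "primeideal \<mm> R \<Longrightarrow> prime_chain R \<mm> \<mm> 0"
| step: "primeideal p R \<Longrightarrow> p \<subset> q \<Longrightarrow> prime_chain R \<mm> q n \<Longrightarrow> prime_chain R \<mm> p (Suc n)"

text \<open>Being a nonzerodivisor modulo the ideal reached so far is expressed in \<open>R\<close>
  itself, which avoids quotient rings. The list has to end exactly at \<open>\<mm>\<close>, so the
  last residue ring is a field.\<close>

fun regular_sequence :: "('a, 'k) ring_scheme \<Rightarrow> 'a set \<Rightarrow> 'a set \<Rightarrow> 'a list \<Rightarrow> bool" where
  "regular_sequence R \<mm> I [] \<longleftrightarrow> I = \<mm>"
| "regular_sequence R \<mm> I (x # xs) \<longleftrightarrow> x \<in> \<mm> \<and> (\<forall>r\<in>carrier R. x \<otimes>\<^bsub>R\<^esub> r \<in> I \<longrightarrow> r \<in> I) \<and>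
     regular_sequence R \<mm> (ideal_adjoin R I x) xs"

lemma prime_chain_0D: "prime_chain R \<mm> p 0 \<Longrightarrow> p = \<mm>"
  by (erule prime_chain.cases) simp_all

lemma prime_chain_SucE:
  assumes "prime_chain R \<mm> p (Suc n)"
  obtains q where "primeideal p R" "p \<subset> q" "prime_chain R \<mm> q n"
  using assms by (rule prime_chain.cases) auto

lemma prime_chain_prime:
  assumes "prime_chain R \<mm> p n"
  shows "primeideal p R" "p \<subseteq> \<mm>"
  using assms by (induction rule: prime_chain.induct) auto

context noetherian_cring
begin

text \<open>Requiring \<open>x\<close> costs at most one step of the chain. The induction hypothesis
  provides a prime containing \<open>x\<close> above the second member, and the principal ideal
  theorem moves \<open>x\<close> one place further down.\<close>

lemma prime_chain_mod:
  assumes "prime_chain R \<mm> p (Suc n)" "x \<in> \<mm>"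
  shows "\<exists>q. x \<in> q \<and> p \<subseteq> q \<and> prime_chain R \<mm> q n"
  using assms
proof (induction n arbitrary: p)
  case 0
  obtain q where "p \<subset> q" "prime_chain R \<mm> q 0" using 0(1) by (rule prime_chain_SucE)
  moreover from this have "q = \<mm>" by (simp add: prime_chain_0D)
  ultimately show ?case using 0 by blast
next
  case (Suc n)
  obtain p' where p: "primeideal p R" "p \<subset> p'" "prime_chain R \<mm> p' (Suc n)"
    using Suc.prems(1) by (rule prime_chain_SucE)
  obtain q where q: "x \<in> q" "p' \<subseteq> q" "prime_chain R \<mm> q n" using Suc.IH[OF p(3) Suc.prems(2)] by blast
  show ?case
  proof (cases "p' = q")
    case True
    then show ?thesis using p q by blast
  next
    case False
    then have "p' \<subset> q" using q(2) by blast
    then obtain q' where q': "primeideal q' R" "p \<subseteq> q'" "x \<in> q'" "q' \<subset> q"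
      using principal_ideal_theorem[OF p(1) prime_chain_prime(1)[OF p(3)] prime_chain_prime(1)[OF q(3)] p(2) _ q(1)]
      by metis
    show ?thesis using q'(2,3) prime_chain.step[OF q'(1,4) q(3)] by metis
  qed
qed

lemma adjoin_list_ideal:
  assumes "ideal I R" "set xs \<subseteq> carrier R"
  shows "ideal (foldl (ideal_adjoin R) I xs) R"
  using assms by (induction xs arbitrary: I) (auto intro: ideal_adjoin_ideal)

lemma adjoin_list_superset:
  assumes "ideal I R" "set xs \<subseteq> carrier R"
  shows "I \<subseteq> foldl (ideal_adjoin R) I xs" "set xs \<subseteq> foldl (ideal_adjoin R) I xs"
proof -
  have "I \<subseteq> foldl (ideal_adjoin R) I xs \<and> set xs \<subseteq> foldl (ideal_adjoin R) I xs"
    using assms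
  proof (induction xs arbitrary: I)
    case (Cons x xs)
    have "ideal (ideal_adjoin R I x) R" using Cons.prems by (auto intro: ideal_adjoin_ideal)
    then show ?case using Cons.IH[of "ideal_adjoin R I x"] Cons.prems ideal_adjoin_superset[OF Cons.prems(1), of x] by auto
  qed auto
  then show "I \<subseteq> foldl (ideal_adjoin R) I xs" "set xs \<subseteq> foldl (ideal_adjoin R) I xs" by auto
qed

lemma adjoin_list_minimal:
  assumes "ideal J R" "I \<subseteq> J" "set xs \<subseteq> J"
  shows "foldl (ideal_adjoin R) I xs \<subseteq> J"
  using assms
proof (induction xs arbitrary: I)
  case (Cons x xs)
  then show ?case using ideal_adjoin_minimal[OF Cons.prems(1,2), of x] by simp
qed auto

text \<open>The dimension is at most the number of generators: each generator pays for one step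
  through \<open>prime_chain_mod\<close>, and above \<open>\<mm>\<close> no step is left.\<close>

lemma prime_chain_length_le:
  assumes "ideal I R" "set xs \<subseteq> carrier R" "foldl (ideal_adjoin R) I xs = \<mm>" "prime_chain R \<mm> p n" "I \<subseteq> p"
  shows "n \<le> length xs"
  using assms
proof (induction xs arbitrary: I p n)
  case Nil
  show ?case
  proof (cases n)
    case (Suc k)
    obtain q where "p \<subset> q" "prime_chain R \<mm> q k" using Nil(4) unfolding Suc by (rule prime_chain_SucE)
    then show ?thesis using prime_chain_prime(2)[of R \<mm> q k] Nil by auto
  qed simp
next
  case (Cons x xs)
  show ?case
  proof (cases n)
    case (Suc k)
    have xm: "x \<in> \<mm>" using adjoin_list_superset(2)[OF Cons.prems(1,2)] Cons.prems(3) by auto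
    obtain q where q: "x \<in> q" "p \<subseteq> q" "prime_chain R \<mm> q k"
      using prime_chain_mod[OF Cons.prems(4)[unfolded Suc] xm] by blast
    have qi: "ideal q R" using primeideal_rules(1)[OF prime_chain_prime(1)[OF q(3)]] .
    have "k \<le> length xs"
    proof (rule Cons.IH)
      show "ideal (ideal_adjoin R I x) R" using Cons.prems by (auto intro: ideal_adjoin_ideal)
      show "ideal_adjoin R I x \<subseteq> q" using ideal_adjoin_minimal[OF qi _ q(1)] Cons.prems(5) q(2) by blast
    qed (use Cons.prems q in auto)
    then show ?thesis using Suc by simp
  qed simp
qed

end

section \<open>Generators of the maximal ideal of a local ring\<close>

locale noetherian_local_ring = noetherian_cring R for R (structure) +
  fixes \<mm> :: "'a set"
  assumes maximal: "maximalideal \<mm> R"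
    and proper_subset_maximal: "\<And>I. ideal I R \<Longrightarrow> I \<noteq> carrier R \<Longrightarrow> I \<subseteq> \<mm>"
begin

lemma prime_maximal: "primeideal \<mm> R"
  by (rule maximalideal_prime[OF maximal])

lemma ideal_maximal: "ideal \<mm> R"
  using primeideal_rules(1)[OF prime_maximal] .

text \<open>Elements outside \<open>\<mm>\<close> are units, so localising at \<open>\<mm>\<close>
  changes nothing.\<close>

lemma saturated_maximal:
  assumes "ideal J R"
  shows "saturated_wrt R \<mm> J"
  unfolding saturated_wrt_def
proof (intro conjI assms ballI impI)
  fix s r assume s: "s \<in> carrier R - \<mm>" and r: "r \<in> carrier R" "s \<otimes> r \<in> J"
  have "PIdl s = carrier R"
    using proper_subset_maximal[OF cgenideal_ideal] cgenideal_self s by blast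
  then obtain t where t: "t \<in> carrier R" "\<one> = t \<otimes> s" using one_closed unfolding cgenideal_def by blast
  have "r = (t \<otimes> s) \<otimes> r" unfolding t(2)[symmetric] using r by simp
  also have "\<dots> = t \<otimes> (s \<otimes> r)" using t(1) s r by (simp add: m_assoc)
  also have "\<dots> \<in> J" using ideal_rules(7)[OF assms t(1) r(2)] .
  finally show "r \<in> J" .
qed

lemma local_krull_intersection:
  assumes "ideal J R" "x \<in> \<mm>" "z \<in> carrier R" "\<And>n::nat. z \<in> ideal_adjoin R J (x [^] n)"
  shows "z \<in> J"
proof (rule krull_intersection[OF prime_maximal saturated_maximal[OF assms(1)] assms(2,3)])
  fix n :: nat
  show "\<exists>s\<in>carrier R - \<mm>. s \<otimes> z \<in> ideal_adjoin R J (x [^] n)"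
    using assms(3,4) primeideal_rules(2)[OF prime_maximal] by (intro bexI[of _ \<one>]) auto
qed

text \<open>Here the number of generators equals the length of the chain, so every quotient met in the
  induction is a domain: \<open>I + (x)\<close> is prime by induction, and \<open>p \<subseteq> I + x p\<close> forces \<open>p = I\<close>.\<close>

theorem regular_sequence_of_prime_chain:
  assumes "ideal I R" "set xs \<subseteq> carrier R" "foldl (ideal_adjoin R) I xs = \<mm>"
    and "prime_chain R \<mm> p (length xs)" "I \<subseteq> p"
  shows "primeideal I R \<and> regular_sequence R \<mm> I xs"
  using assms
proof (induction xs arbitrary: I p)
  case Nil
  then show ?case using prime_maximal by simp
next
  case (Cons x xs)
  have xm: "x \<in> \<mm>" using adjoin_list_superset(2)[OF Cons.prems(1,2)] Cons.prems(3) by auto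
  have xc: "x \<in> carrier R" "set xs \<subseteq> carrier R" using Cons.prems(2) by auto
  have pc: "prime_chain R \<mm> p (Suc (length xs))" using Cons.prems(4) by simp
  obtain q where q: "x \<in> q" "p \<subseteq> q" "prime_chain R \<mm> q (length xs)" using prime_chain_mod[OF pc xm] by blast
  have p: "primeideal p R" "p \<subseteq> \<mm>" using prime_chain_prime[OF Cons.prems(4)] by auto
  have pid: "ideal p R" using primeideal_rules(1)[OF p(1)] .
  have qi: "ideal q R" using primeideal_rules(1)[OF prime_chain_prime(1)[OF q(3)]] .
  note aI = ideal_adjoin_ideal[OF Cons.prems(1) xc(1)] and ap = ideal_adjoin_ideal[OF pid xc(1)]
  have apq: "ideal_adjoin R p x \<subseteq> q" using ideal_adjoin_minimal[OF qi q(2,1)] .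
  have aIp: "ideal_adjoin R I x \<subseteq> ideal_adjoin R p x" using Cons.prems(5) by (auto simp: ideal_adjoin_def)
  have fI: "foldl (ideal_adjoin R) (ideal_adjoin R I x) xs = \<mm>" using Cons.prems(3) by simp
  have xsm: "set xs \<subseteq> \<mm>" using adjoin_list_superset(2)[OF aI xc(2)] fI by simp
  have IH1: "primeideal (ideal_adjoin R I x) R" "regular_sequence R \<mm> (ideal_adjoin R I x) xs"
    using Cons.IH[OF aI xc(2) fI q(3)] apq aIp by auto
  have fp: "foldl (ideal_adjoin R) (ideal_adjoin R p x) xs = \<mm>"
  proof
    show "foldl (ideal_adjoin R) (ideal_adjoin R p x) xs \<subseteq> \<mm>"
      using adjoin_list_minimal[OF ideal_maximal _ xsm] ideal_adjoin_minimal[OF ideal_maximal p(2) xm] by blast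
    show "\<mm> \<subseteq> foldl (ideal_adjoin R) (ideal_adjoin R p x) xs"
      using adjoin_list_minimal[OF adjoin_list_ideal[OF ap xc(2)], of "ideal_adjoin R I x" xs]
        adjoin_list_superset[OF ap xc(2)] aIp fI by blast
  qed
  \<comment> \<open>If the two ideals differed, \<open>I + (x)\<close>, prime by induction, would
    lie strictly below \<open>q\<close> and start a chain longer than the number of remaining
    generators.\<close>
  have eq: "ideal_adjoin R I x = ideal_adjoin R p x"
  proof (rule ccontr)
    assume "ideal_adjoin R I x \<noteq> ideal_adjoin R p x"
    then have "ideal_adjoin R I x \<subset> q" using aIp apq by blast
    then have "prime_chain R \<mm> (ideal_adjoin R I x) (Suc (length xs))" using prime_chain.step[OF IH1(1) _ q(3)] by simp
    then show False using prime_chain_length_le[OF aI xc(2) fI _ subset_refl] by fastforce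
  qed
  \<comment> \<open>If \<open>x\<close> were in \<open>p\<close>, the whole chain would lie above
    \<open>p + (x)\<close>, over which the remaining generators are one too few for its
    length.\<close>
  have xp: "x \<notin> p"
  proof
    assume "x \<in> p"
    then have "ideal_adjoin R p x \<subseteq> p" using ideal_adjoin_minimal[OF pid] by blast
    then show False using prime_chain_length_le[OF ap xc(2) fp pc] by simp
  qed
  \<comment> \<open>In \<open>z = i + r x\<close> with \<open>z\<close> in \<open>p\<close> the
    factor \<open>r\<close> is again in \<open>p\<close>, since \<open>x\<close> is not. Repetition
    puts \<open>p\<close> into \<open>I + (x^n)\<close> for every \<open>n\<close>.\<close>
  have "z \<in> ideal_adjoin R I (x [^] n)" if "z \<in> p" for z and n :: nat
    using that
  proof (induction n arbitrary: z)
    case 0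
    then show ?case using ideal_adjoin_mult_mem(1)[OF Cons.prems(1) one_closed, of z] ideal_rules(3)[OF pid] by simp
  next
    case (Suc n)
    then have "z \<in> ideal_adjoin R I x" using eq ideal_adjoin_superset(1)[OF pid xc(1)] by blast
    then obtain i r where ir: "i \<in> I" "r \<in> carrier R" "z = i \<oplus> r \<otimes> x" by (auto simp: ideal_adjoin_def)
    have ic: "i \<in> carrier R" using ideal_rules(3)[OF Cons.prems(1)] ir by blast
    have "r \<otimes> x \<in> p" using ideal_add_cancel[OF pid, of i "r \<otimes> x"] ir Cons.prems(5) Suc.prems xc by auto
    then have "r \<in> p" using primeideal_rules(3)[OF p(1) ir(2) xc(1)] xp by blast
    then obtain j c where jc: "j \<in> I" "c \<in> carrier R" "r = j \<oplus> c \<otimes> x [^] n" using Suc.IH[of r] by (auto simp: ideal_adjoin_def)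
    have jcar: "j \<in> carrier R" using ideal_rules(3)[OF Cons.prems(1)] jc by blast
    have "z = (i \<oplus> j \<otimes> x) \<oplus> c \<otimes> x [^] Suc n"
      unfolding ir(3) jc(3) using ic jcar jc(2) xc by (simp add: l_distr m_assoc a_assoc)
    moreover have "i \<oplus> j \<otimes> x \<in> I" using ideal_rules(4,8)[OF Cons.prems(1)] ir jc xc by blast
    ultimately show ?case using jc(2) unfolding ideal_adjoin_def by blast
  qed
  then have "p \<subseteq> I" using local_krull_intersection[OF Cons.prems(1) xm] ideal_rules(3)[OF pid] by blast
  then have "I = p" using Cons.prems(5) by blast
  then show ?case using p(1) xm xp IH1(2) primeideal_rules(3)[OF p(1) xc(1)] by auto
qed

end

section \<open>Linear spans and semilinear maps\<close>

text \<open>Adding one multiple of a generator at a time gives an induction rule with a single step;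
  most of the later facts about linear combinations are proved by it.\<close>

inductive_set module_span :: "('a, 'k) ring_scheme \<Rightarrow> ('a, 'b, 'x) module_scheme \<Rightarrow> 'b set \<Rightarrow> 'b set"
  for R M X where
  zero: "\<zero>\<^bsub>M\<^esub> \<in> module_span R M X"
| step: "g \<in> module_span R M X \<Longrightarrow> a \<in> carrier R \<Longrightarrow> x \<in> X \<Longrightarrow> g \<oplus>\<^bsub>M\<^esub> a \<odot>\<^bsub>M\<^esub> x \<in> module_span R M X"

lemma module_span_mono: "X \<subseteq> Y \<Longrightarrow> module_span R M X \<subseteq> module_span R M Y"
proof
  fix g assume "X \<subseteq> Y" "g \<in> module_span R M X"
  then show "g \<in> module_span R M Y"
    by (induction rule: module_span.induct[OF \<open>g \<in> module_span R M X\<close>]) (auto intro: module_span.intros)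
qed

context module
begin

lemma submodule_rules:
  assumes "submodule H R M"
  shows "H \<subseteq> carrier M" "\<zero>\<^bsub>M\<^esub> \<in> H" "\<And>a. a \<in> H \<Longrightarrow> a \<in> carrier M"
    "\<And>a b. a \<in> H \<Longrightarrow> b \<in> H \<Longrightarrow> a \<oplus>\<^bsub>M\<^esub> b \<in> H" "\<And>a. a \<in> H \<Longrightarrow> \<ominus>\<^bsub>M\<^esub> a \<in> H"
    "\<And>a b. a \<in> H \<Longrightarrow> b \<in> H \<Longrightarrow> a \<ominus>\<^bsub>M\<^esub> b \<in> H"
    "\<And>r a. r \<in> carrier R \<Longrightarrow> a \<in> H \<Longrightarrow> r \<odot>\<^bsub>M\<^esub> a \<in> H"
  using submoduleE[OF assms] subgroup.one_closed[OF submodule.axioms(1)[OF assms]]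
  by (auto simp: M.minus_eq)

lemma submodule_criterion:
  assumes "H \<subseteq> carrier M" "\<zero>\<^bsub>M\<^esub> \<in> H"
    and "\<And>a b. a \<in> H \<Longrightarrow> b \<in> H \<Longrightarrow> a \<oplus>\<^bsub>M\<^esub> b \<in> H"
    and "\<And>r a. r \<in> carrier R \<Longrightarrow> a \<in> H \<Longrightarrow> r \<odot>\<^bsub>M\<^esub> a \<in> H"
  shows "submodule H R M"
proof (rule submoduleI[OF assms(1,2)])
  fix a assume a: "a \<in> H"
  then have "\<ominus>\<^bsub>M\<^esub> a = (\<ominus> \<one>) \<odot>\<^bsub>M\<^esub> a" using assms(1) by (auto simp: smult_l_minus)
  then show "\<ominus>\<^bsub>M\<^esub> a \<in> H" using assms(4)[of "\<ominus> \<one>" a] a by simp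
qed (use assms in auto)

lemma module_span_carrier:
  assumes "X \<subseteq> carrier M"
  shows "module_span R M X \<subseteq> carrier M"
proof
  fix g assume "g \<in> module_span R M X"
  then show "g \<in> carrier M" by induction (use assms in auto)
qed

lemma module_span_submodule:
  assumes X: "X \<subseteq> carrier M"
  shows "submodule (module_span R M X) R M"
proof (rule submodule_criterion)
  show c: "module_span R M X \<subseteq> carrier M" by (rule module_span_carrier[OF X])
  show "\<zero>\<^bsub>M\<^esub> \<in> module_span R M X" by (rule module_span.zero)
  show "a \<oplus>\<^bsub>M\<^esub> b \<in> module_span R M X" if "a \<in> module_span R M X" "b \<in> module_span R M X" for a b
    using that(2)
  proof induction
    case zero
    then show ?case using that(1) c by auto
  next
    case (step g r x)
    have "a \<oplus>\<^bsub>M\<^esub> (g \<oplus>\<^bsub>M\<^esub> r \<odot>\<^bsub>M\<^esub> x) = (a \<oplus>\<^bsub>M\<^esub> g) \<oplus>\<^bsub>M\<^esub> r \<odot>\<^bsub>M\<^esub> x"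
      using that(1) step c X by (intro M.a_assoc[symmetric]) auto
    then show ?case using module_span.step[OF step(4,2,3)] by simp
  qed
  show "r \<odot>\<^bsub>M\<^esub> a \<in> module_span R M X" if r: "r \<in> carrier R" and "a \<in> module_span R M X" for r a
    using that(2)
  proof induction
    case zero
    then show ?case using r by (simp add: module_span.zero)
  next
    case (step g s x)
    have "r \<odot>\<^bsub>M\<^esub> (g \<oplus>\<^bsub>M\<^esub> s \<odot>\<^bsub>M\<^esub> x) = r \<odot>\<^bsub>M\<^esub> g \<oplus>\<^bsub>M\<^esub> (r \<otimes> s) \<odot>\<^bsub>M\<^esub> x"
      using r step c X by (auto simp: smult_r_distr smult_assoc1 subset_eq)
    then show ?case using module_span.step[OF step(4) _ step(3), of "r \<otimes> s"] r step by simp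
  qed
qed

lemma module_span_superset:
  assumes X: "X \<subseteq> carrier M"
  shows "X \<subseteq> module_span R M X"
proof
  fix x assume x: "x \<in> X"
  have "\<zero>\<^bsub>M\<^esub> \<oplus>\<^bsub>M\<^esub> \<one> \<odot>\<^bsub>M\<^esub> x = x" using x X by auto
  then show "x \<in> module_span R M X" using module_span.step[OF module_span.zero one_closed x, of M] by simp
qed

lemma module_span_minimal:
  assumes "submodule H R M" "X \<subseteq> H"
  shows "module_span R M X \<subseteq> H"
proof
  fix g assume "g \<in> module_span R M X"
  then show "g \<in> H" by induction (use submodule_rules[OF assms(1)] assms(2) in auto)
qed

lemma module_span_insert:
  assumes "b \<in> carrier M" "X \<subseteq> carrier M" "g \<in> module_span R M (insert b X)"
  obtains k r where "k \<in> module_span R M X" "r \<in> carrier R" "g = k \<oplus>\<^bsub>M\<^esub> r \<odot>\<^bsub>M\<^esub> b"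
proof -
  note sp = submodule_rules[OF module_span_submodule[OF assms(2)]]
  have "\<exists>k r. k \<in> module_span R M X \<and> r \<in> carrier R \<and> g = k \<oplus>\<^bsub>M\<^esub> r \<odot>\<^bsub>M\<^esub> b"
    using assms(3)
  proof induction
    case zero
    have "\<zero>\<^bsub>M\<^esub> = \<zero>\<^bsub>M\<^esub> \<oplus>\<^bsub>M\<^esub> \<zero> \<odot>\<^bsub>M\<^esub> b" using assms(1) by simp
    then show ?case using sp(2) R.zero_closed by blast
  next
    case (step g a x)
    then obtain k r where k: "k \<in> module_span R M X" "r \<in> carrier R" "g = k \<oplus>\<^bsub>M\<^esub> r \<odot>\<^bsub>M\<^esub> b" by blast
    have kc: "k \<in> carrier M" using k sp by blast
    show ?case
    proof (cases "x = b")
      case True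
      have "g \<oplus>\<^bsub>M\<^esub> a \<odot>\<^bsub>M\<^esub> x = k \<oplus>\<^bsub>M\<^esub> (r \<oplus> a) \<odot>\<^bsub>M\<^esub> b"
        unfolding k(3) True using kc k(2) step(2) assms(1) by (simp add: smult_l_distr M.a_assoc)
      then show ?thesis using k step(2) by blast
    next
      case False
      then have x: "x \<in> X" "x \<in> carrier M" using step(3) assms(2) by auto
      have "g \<oplus>\<^bsub>M\<^esub> a \<odot>\<^bsub>M\<^esub> x = (k \<oplus>\<^bsub>M\<^esub> a \<odot>\<^bsub>M\<^esub> x) \<oplus>\<^bsub>M\<^esub> r \<odot>\<^bsub>M\<^esub> b"
        unfolding k(3) using kc k(2) step(2) assms(1) x by (simp add: M.a_ac)
      then show ?thesis using module_span.step[OF k(1) step(2) x(1)] k(2) by blast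
    qed
  qed
  then show ?thesis using that by blast
qed

end

lemma module_homD:
  assumes "h \<in> module_hom R M N"
  shows "\<And>x. x \<in> carrier M \<Longrightarrow> h x \<in> carrier N"
    "\<And>x y. x \<in> carrier M \<Longrightarrow> y \<in> carrier M \<Longrightarrow> h (x \<oplus>\<^bsub>M\<^esub> y) = h x \<oplus>\<^bsub>N\<^esub> h y"
    "\<And>a x. a \<in> carrier R \<Longrightarrow> x \<in> carrier M \<Longrightarrow> h (a \<odot>\<^bsub>M\<^esub> x) = a \<odot>\<^bsub>N\<^esub> h x"
  using assms by (auto simp: module_hom_def)

lemma module_homI:
  assumes "\<And>x. x \<in> carrier M \<Longrightarrow> h x \<in> carrier N"
    "\<And>x y. x \<in> carrier M \<Longrightarrow> y \<in> carrier M \<Longrightarrow> h (x \<oplus>\<^bsub>M\<^esub> y) = h x \<oplus>\<^bsub>N\<^esub> h y"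
    "\<And>a x. a \<in> carrier R \<Longrightarrow> x \<in> carrier M \<Longrightarrow> h (a \<odot>\<^bsub>M\<^esub> x) = a \<odot>\<^bsub>N\<^esub> h x"
  shows "h \<in> module_hom R M N"
  using assms by (auto simp: module_hom_def)

lemma module_hom_zero:
  assumes "module R M" "module R N" "h \<in> module_hom R M N"
  shows "h \<zero>\<^bsub>M\<^esub> = \<zero>\<^bsub>N\<^esub>"
proof -
  interpret M: module R M by fact
  interpret N: module R N by fact
  have "h (\<zero>\<^bsub>R\<^esub> \<odot>\<^bsub>M\<^esub> \<zero>\<^bsub>M\<^esub>) = \<zero>\<^bsub>R\<^esub> \<odot>\<^bsub>N\<^esub> h \<zero>\<^bsub>M\<^esub>"
    by (rule module_homD(3)[OF assms(3) M.R.zero_closed M.M.zero_closed])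
  then show ?thesis using module_homD(1)[OF assms(3) M.M.zero_closed] by simp
qed

lemma module_hom_minus:
  assumes "module R M" "module R N" "h \<in> module_hom R M N" "x \<in> carrier M" "y \<in> carrier M"
  shows "h (x \<ominus>\<^bsub>M\<^esub> y) = h x \<ominus>\<^bsub>N\<^esub> h y"
proof -
  interpret M: module R M by fact
  interpret N: module R N by fact
  note H = module_homD[OF assms(3)]
  have "x \<ominus>\<^bsub>M\<^esub> y = x \<oplus>\<^bsub>M\<^esub> (\<ominus>\<^bsub>R\<^esub> \<one>\<^bsub>R\<^esub>) \<odot>\<^bsub>M\<^esub> y" using assms by (simp add: M.smult_l_minus M.M.minus_eq)
  also have "h \<dots> = h x \<oplus>\<^bsub>N\<^esub> (\<ominus>\<^bsub>R\<^esub> \<one>\<^bsub>R\<^esub>) \<odot>\<^bsub>N\<^esub> h y" using assms H by simp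
  also have "\<dots> = h x \<ominus>\<^bsub>N\<^esub> h y" using assms H by (simp add: N.smult_l_minus N.M.minus_eq)
  finally show ?thesis .
qed

lemma module_hom_comp:
  assumes "g \<in> module_hom R M N" "h \<in> module_hom R N L"
  shows "(\<lambda>x. h (g x)) \<in> module_hom R M L"
  using assms by (auto simp: module_hom_def Pi_def)

lemma regular_module_simps [simp]:
  "carrier (regular_module R) = carrier R" "add (regular_module R) = add R"
  "zero (regular_module R) = zero R" "smult (regular_module R) = monoid.mult R"
  by (simp_all add: regular_module_def)

lemma regular_module_minus [simp]: "x \<ominus>\<^bsub>regular_module R\<^esub> y = x \<ominus>\<^bsub>R\<^esub> y"
  by (simp add: a_minus_def a_inv_def m_inv_def)

lemma (in cring) regular_module_module: "module R (regular_module R)"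
proof (rule moduleI)
  show "abelian_group (regular_module R)"
  proof (rule abelian_groupI)
    fix x assume "x \<in> carrier (regular_module R)"
    then show "\<exists>y\<in>carrier (regular_module R). y \<oplus>\<^bsub>regular_module R\<^esub> x = \<zero>\<^bsub>regular_module R\<^esub>"
      by (intro bexI[of _ "\<ominus> x"]) (auto simp: l_neg)
  qed (auto simp: a_ac)
qed (auto simp: is_cring l_distr r_distr m_assoc)

text \<open>Submodules of this direct sum serve as linear relations, in place of maps that are not
  known to be well defined.\<close>

definition prod_module ::
    "('a, 'b, 'x) module_scheme \<Rightarrow> ('a, 'c, 'y) module_scheme \<Rightarrow> ('a, 'b \<times> 'c) module" where
  "prod_module M N = \<lparr>carrier = carrier M \<times> carrier N, monoid.mult = undefined, one = undefined,
     zero = (\<zero>\<^bsub>M\<^esub>, \<zero>\<^bsub>N\<^esub>), add = (\<lambda>u v. (fst u \<oplus>\<^bsub>M\<^esub> fst v, snd u \<oplus>\<^bsub>N\<^esub> snd v)),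
     smult = (\<lambda>a u. (a \<odot>\<^bsub>M\<^esub> fst u, a \<odot>\<^bsub>N\<^esub> snd u))\<rparr>"

lemma prod_module_simps [simp]:
  "carrier (prod_module M N) = carrier M \<times> carrier N"
  "\<zero>\<^bsub>prod_module M N\<^esub> = (\<zero>\<^bsub>M\<^esub>, \<zero>\<^bsub>N\<^esub>)"
  "u \<oplus>\<^bsub>prod_module M N\<^esub> v = (fst u \<oplus>\<^bsub>M\<^esub> fst v, snd u \<oplus>\<^bsub>N\<^esub> snd v)"
  "a \<odot>\<^bsub>prod_module M N\<^esub> u = (a \<odot>\<^bsub>M\<^esub> fst u, a \<odot>\<^bsub>N\<^esub> snd u)"
  by (simp_all add: prod_module_def)

lemma prod_module_module:
  assumes "module R M" "module R N"
  shows "module R (prod_module M N)"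
proof -
  interpret M: module R M by fact
  interpret N: module R N by fact
  show ?thesis
  proof (rule moduleI)
    show "abelian_group (prod_module M N)"
    proof (rule abelian_groupI)
      fix u assume "u \<in> carrier (prod_module M N)"
      then show "\<exists>v\<in>carrier (prod_module M N). v \<oplus>\<^bsub>prod_module M N\<^esub> u = \<zero>\<^bsub>prod_module M N\<^esub>"
        by (intro bexI[of _ "(\<ominus>\<^bsub>M\<^esub> fst u, \<ominus>\<^bsub>N\<^esub> snd u)"]) (auto simp: M.M.l_neg N.M.l_neg)
    qed (auto simp: M.M.a_ac N.M.a_ac)
  qed (auto simp: M.is_cring M.smult_l_distr M.smult_r_distr M.smult_assoc1
      N.smult_l_distr N.smult_r_distr N.smult_assoc1)
qed

text \<open>For ideals \<open>I\<close> and \<open>V\<close> this is \<open>I^[2] + V\<close>, with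
  \<open>I^[2]\<close> the Frobenius power of \<open>I\<close>. The summand \<open>V\<close> is
  carried along so that the residue ring modulo \<open>V\<close> need not be formed.\<close>

inductive_set square_ideal :: "('a, 'k) ring_scheme \<Rightarrow> 'a set \<Rightarrow> 'a set \<Rightarrow> 'a set"
  for R I V where
  base: "v \<in> V \<Longrightarrow> v \<in> square_ideal R I V"
| step: "g \<in> square_ideal R I V \<Longrightarrow> a \<in> carrier R \<Longrightarrow> x \<in> I \<Longrightarrow>
    g \<oplus>\<^bsub>R\<^esub> a \<otimes>\<^bsub>R\<^esub> (x \<otimes>\<^bsub>R\<^esub> x) \<in> square_ideal R I V"

text \<open>Ideal-theoretic form of the flatness of \<open>R / V\<close> over \<open>R / I0\<close> along the Frobenius map:
  extending ideals from \<open>R / I0\<close> to \<open>R / V\<close> commutes with colon ideals.\<close>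

definition frobenius_flat :: "('a, 'k) ring_scheme \<Rightarrow> 'a set \<Rightarrow> 'a set \<Rightarrow> bool" where
  "frobenius_flat R I0 V \<longleftrightarrow> (\<forall>I a r. ideal I R \<longrightarrow> I0 \<subseteq> I \<longrightarrow> a \<in> carrier R \<longrightarrow> r \<in> carrier R \<longrightarrow>
     (a \<otimes>\<^bsub>R\<^esub> a) \<otimes>\<^bsub>R\<^esub> r \<in> square_ideal R I V \<longrightarrow> r \<in> square_ideal R (ideal_colon R I a) V)"

context cring
begin

lemma square_ideal_ideal:
  assumes I: "I \<subseteq> carrier R" and V: "ideal V R"
  shows "ideal (square_ideal R I V) R"
proof (rule ideal_criterion)
  note VR = ideal_rules[OF V]
  show c: "square_ideal R I V \<subseteq> carrier R"
  proof
    fix g assume "g \<in> square_ideal R I V"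
    then show "g \<in> carrier R" by induction (use I VR in auto)
  qed
  show "\<zero> \<in> square_ideal R I V" using VR by (simp add: square_ideal.base)
  show "a \<oplus> b \<in> square_ideal R I V" if "a \<in> square_ideal R I V" "b \<in> square_ideal R I V" for a b
    using that(2)
  proof induction
    case (base v)
    show ?case using that(1)
    proof induction
      case (base u)
      then show ?case using VR \<open>v \<in> V\<close> by (simp add: square_ideal.base)
    next
      case (step g r x)
      have "(g \<oplus> r \<otimes> (x \<otimes> x)) \<oplus> v = (g \<oplus> v) \<oplus> r \<otimes> (x \<otimes> x)"
        using step c I VR \<open>v \<in> V\<close> by (auto simp: a_ac subset_eq)
      then show ?case using square_ideal.step[OF step(4,2,3)] by simp
    qed
  next
    case (step g r x)
    have "a \<oplus> (g \<oplus> r \<otimes> (x \<otimes> x)) = (a \<oplus> g) \<oplus> r \<otimes> (x \<otimes> x)"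
      using that(1) step c I by (intro a_assoc[symmetric]) auto
    then show ?case using square_ideal.step[OF step(4,2,3)] by simp
  qed
  show "r \<otimes> a \<in> square_ideal R I V" if r: "r \<in> carrier R" and "a \<in> square_ideal R I V" for r a
    using that(2)
  proof induction
    case (base v)
    then show ?case using VR r by (simp add: square_ideal.base)
  next
    case (step g s x)
    have "r \<otimes> (g \<oplus> s \<otimes> (x \<otimes> x)) = r \<otimes> g \<oplus> (r \<otimes> s) \<otimes> (x \<otimes> x)"
      using r step c I by (auto simp: r_distr m_assoc subset_eq)
    then show ?case using square_ideal.step[OF step(4) _ step(3), of "r \<otimes> s"] r step by simp
  qed
qed

lemma square_ideal_superset:
  assumes "I \<subseteq> carrier R" "ideal V R"
  shows "V \<subseteq> square_ideal R I V" "x \<in> I \<Longrightarrow> x \<otimes> x \<in> square_ideal R I V"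
proof -
  show "V \<subseteq> square_ideal R I V" by (auto intro: square_ideal.base)
  assume "x \<in> I"
  then show "x \<otimes> x \<in> square_ideal R I V"
    using square_ideal.step[OF square_ideal.base[OF ideal_rules(2)[OF assms(2)]] one_closed, of x I] assms(1) by auto
qed

lemma square_ideal_minimal:
  assumes "ideal J R" "V \<subseteq> J" "\<And>x. x \<in> I \<Longrightarrow> x \<otimes> x \<in> J"
  shows "square_ideal R I V \<subseteq> J"
proof
  fix g assume "g \<in> square_ideal R I V"
  then show "g \<in> J" by induction (use ideal_rules[OF assms(1)] assms in auto)
qed

lemma frobenius_flatD:
  assumes "frobenius_flat R I0 V" "ideal I R" "I0 \<subseteq> I" "a \<in> carrier R" "r \<in> carrier R"
    "(a \<otimes> a) \<otimes> r \<in> square_ideal R I V"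
  shows "r \<in> square_ideal R (ideal_colon R I a) V"
  using assms unfolding frobenius_flat_def by blast

text \<open>Elementwise form of flatness: a linear relation between values of a Frobenius-semilinear map
  \<open>\<gamma>\<close> is a consequence of relations in the source.\<close>

lemma semilinear_kernel:
  fixes P :: "('a, 'c, 'x) module_scheme" and G :: "('a, 'd, 'y) module_scheme"
  assumes flat: "frobenius_flat R I0 V" and I0: "ideal I0 R" and V: "ideal V R"
    and I0V: "\<And>x. x \<in> I0 \<Longrightarrow> x \<otimes> x \<in> V"
    and P: "module R P" and G: "module R G" and K: "submodule K R P" and N: "submodule N R G"
    and lam: "\<phi> \<in> module_hom R P (regular_module R)" and Gam: "\<Gamma> \<in> module_hom R G (regular_module R)"
    and gc: "\<And>x. x \<in> K \<Longrightarrow> \<gamma> x \<in> carrier G"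
    and gadd: "\<And>x y. x \<in> K \<Longrightarrow> y \<in> K \<Longrightarrow> \<exists>n\<in>N. \<gamma> (x \<oplus>\<^bsub>P\<^esub> y) = (\<gamma> x \<oplus>\<^bsub>G\<^esub> \<gamma> y) \<oplus>\<^bsub>G\<^esub> n"
    and gsm: "\<And>a x. a \<in> carrier R \<Longrightarrow> x \<in> K \<Longrightarrow> \<gamma> (a \<odot>\<^bsub>P\<^esub> x) = (a \<otimes> a) \<odot>\<^bsub>G\<^esub> \<gamma> x"
    and Vg: "\<And>v x. v \<in> V \<Longrightarrow> x \<in> K \<Longrightarrow> v \<odot>\<^bsub>G\<^esub> \<gamma> x \<in> N"
    and Gg: "\<And>x. x \<in> K \<Longrightarrow> \<Gamma> (\<gamma> x) = \<phi> x \<otimes> \<phi> x" and GN: "\<And>n. n \<in> N \<Longrightarrow> \<Gamma> n \<in> V"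
    and g: "g \<in> module_span R G (\<gamma> ` K \<union> N)" and Gv: "\<Gamma> g \<in> V"
  shows "g \<in> module_span R G (\<gamma> ` {x \<in> K. \<phi> x \<in> I0} \<union> N)"
proof -
  interpret P: module R P by fact
  interpret G: module R G by fact
  note KR = P.submodule_rules[OF K] and NR = G.submodule_rules[OF N] and VR = ideal_rules[OF V] and IR = ideal_rules[OF I0]
  note lamH = module_homD[OF lam, simplified] and GamH = module_homD[OF Gam, simplified]
  define S where "S X = module_span R G (\<gamma> ` X \<union> N)" for X
  have Scar: "\<gamma> ` X \<union> N \<subseteq> carrier G" if "X \<subseteq> K" for X using that gc NR by auto
  have Ssub: "submodule (S X) R G" if "X \<subseteq> K" for X
    unfolding S_def using G.module_span_submodule[OF Scar[OF that]] .
  note SR = G.submodule_rules[OF Ssub]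
  have Sg: "\<gamma> x \<in> S X" if "X \<subseteq> K" "x \<in> X" for x X
    unfolding S_def using G.module_span_superset[OF Scar[OF that(1)]] that(2) by blast
  have SN: "n \<in> S X" if "X \<subseteq> K" "n \<in> N" for n X
    unfolding S_def using G.module_span_superset[OF Scar[OF that(1)]] that(2) by blast
  have Smono: "S X \<subseteq> S Y" if "X \<subseteq> Y" for X Y
    unfolding S_def using that by (intro module_span_mono) auto
  define K0 where "K0 = {x \<in> K. \<phi> x \<in> I0}"
  have K0K: "K0 \<subseteq> K" by (auto simp: K0_def)
  have GS0: "\<Gamma> h \<in> V" if "h \<in> S K0" for h
    using that[unfolded S_def]
  proof induction
    case zero
    then show ?case using module_hom_zero[OF G regular_module_module Gam] VR by simp
  next
    case (step h a x)
    have xc: "x \<in> carrier G" using step(3) Scar[OF K0K] by blast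
    have hc: "h \<in> carrier G" using step(1) SR(3)[OF K0K] by (simp add: S_def)
    have "\<Gamma> x \<in> V"
    proof (cases "x \<in> N")
      case False
      then obtain k where k: "k \<in> K" "\<phi> k \<in> I0" "x = \<gamma> k" using step(3) by (auto simp: K0_def)
      then show ?thesis using Gg I0V by simp
    qed (use GN in simp)
    then show ?case using step hc xc GamH VR by simp
  qed
  \<comment> \<open>A combination involves finitely many elements of \<open>K\<close> only, so
    \<open>K\<close> may be replaced by the span of a list, and \<open>main\<close> is an induction
    over that list.\<close>
  have fin: "\<exists>bs. set bs \<subseteq> K \<and> h \<in> S (module_span R P (set bs))" if "h \<in> S K" for h
    using that[unfolded S_def]
  proof induction
    case zero
    have "\<zero>\<^bsub>G\<^esub> \<in> S (module_span R P (set []))" by (simp add: S_def module_span.zero)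
    then show ?case by (intro exI[of _ "[]"]) simp
  next
    case (step h a x)
    then obtain bs where bs: "set bs \<subseteq> K" "h \<in> S (module_span R P (set bs))" by blast
    show ?case
    proof (cases "x \<in> N")
      case True
      have "h \<oplus>\<^bsub>G\<^esub> a \<odot>\<^bsub>G\<^esub> x \<in> S (module_span R P (set bs))"
        unfolding S_def using bs(2)[unfolded S_def] step(2) True by (intro module_span.step) auto
      then show ?thesis using bs(1) by blast
    next
      case False
      then obtain k where k: "k \<in> K" "x = \<gamma> k" using step(3) by auto
      have kbs: "set (k # bs) \<subseteq> K" "set (k # bs) \<subseteq> carrier P" using k bs KR by auto
      have "h \<in> S (module_span R P (set (k # bs)))"
        using bs(2) Smono[OF module_span_mono[of "set bs" "set (k # bs)" R P]] by auto
      moreover have "k \<in> module_span R P (set (k # bs))" using P.module_span_superset[OF kbs(2)] by auto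
      ultimately have "h \<oplus>\<^bsub>G\<^esub> a \<odot>\<^bsub>G\<^esub> x \<in> S (module_span R P (set (k # bs)))"
        unfolding S_def using step(2) k by (intro module_span.step) auto
      then show ?thesis using kbs(1) by blast
    qed
  qed
  have main: "h \<in> S K0" if "set bs \<subseteq> K" "h \<in> S (module_span R P (set bs))" "\<Gamma> h \<in> V" for bs h
    using that
  proof (induction bs arbitrary: h)
    case Nil
    have "module_span R P {} \<subseteq> {\<zero>\<^bsub>P\<^esub>}"
    proof
      fix x assume "x \<in> module_span R P {}"
      then show "x \<in> {\<zero>\<^bsub>P\<^esub>}" by induction auto
    qed
    moreover have "\<zero>\<^bsub>P\<^esub> \<in> K0" using KR IR module_hom_zero[OF P regular_module_module lam] by (simp add: K0_def)
    ultimately have "module_span R P {} \<subseteq> K0" by blast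
    then show ?case using Nil Smono by auto
  next
    case (Cons b bs)
    have bK: "b \<in> K" "b \<in> carrier P" and bsK: "set bs \<subseteq> K" "set bs \<subseteq> carrier P" using Cons.prems(1) KR by auto
    define B where "B = module_span R P (set bs)"
    have BK: "B \<subseteq> K" unfolding B_def by (rule P.module_span_minimal[OF K bsK(1)])
    have Bsub: "submodule B R P" unfolding B_def by (rule P.module_span_submodule[OF bsK(2)])
    note BR = P.submodule_rules[OF Bsub]
    have gb: "\<gamma> b \<in> carrier G" using gc bK by blast
    \<comment> \<open>Semilinearity collects all contributions of \<open>b\<close> in one
      coefficient \<open>c\<close>; the defects of additivity stay in \<open>N\<close>.\<close>
    have split: "\<exists>h' c. h' \<in> S B \<and> c \<in> carrier R \<and> h = h' \<oplus>\<^bsub>G\<^esub> c \<odot>\<^bsub>G\<^esub> \<gamma> b"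
      if "h \<in> S (module_span R P (set (b # bs)))" for h
      using that[unfolded S_def]
    proof induction
      case zero
      have "\<zero>\<^bsub>G\<^esub> = \<zero>\<^bsub>G\<^esub> \<oplus>\<^bsub>G\<^esub> \<zero> \<odot>\<^bsub>G\<^esub> \<gamma> b" using gb by simp
      then show ?case using SR(2)[OF BK] zero_closed by blast
    next
      case (step h a x)
      then obtain h' c where h': "h' \<in> S B" "c \<in> carrier R" "h = h' \<oplus>\<^bsub>G\<^esub> c \<odot>\<^bsub>G\<^esub> \<gamma> b" by blast
      have h'c: "h' \<in> carrier G" using h'(1) SR(3)[OF BK] by blast
      show ?case
      proof (cases "x \<in> N")
        case True
        have "h \<oplus>\<^bsub>G\<^esub> a \<odot>\<^bsub>G\<^esub> x = (h' \<oplus>\<^bsub>G\<^esub> a \<odot>\<^bsub>G\<^esub> x) \<oplus>\<^bsub>G\<^esub> c \<odot>\<^bsub>G\<^esub> \<gamma> b"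
          unfolding h'(3) using h'c h'(2) step(2) gb NR(3)[OF True] by (simp add: G.M.a_ac)
        moreover have "h' \<oplus>\<^bsub>G\<^esub> a \<odot>\<^bsub>G\<^esub> x \<in> S B" by (intro SR(4,7)[OF BK] SN[OF BK True] h'(1) step(2))
        ultimately show ?thesis using h'(2) by blast
      next
        case False
        then obtain y where y: "y \<in> module_span R P (insert b (set bs))" "x = \<gamma> y" using step(3) by auto
        then obtain k r where k: "k \<in> B" "r \<in> carrier R" "y = k \<oplus>\<^bsub>P\<^esub> r \<odot>\<^bsub>P\<^esub> b"
          using P.module_span_insert[OF bK(2) bsK(2)] unfolding B_def by blast
        obtain n where n: "n \<in> N" "\<gamma> y = (\<gamma> k \<oplus>\<^bsub>G\<^esub> \<gamma> (r \<odot>\<^bsub>P\<^esub> b)) \<oplus>\<^bsub>G\<^esub> n"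
          unfolding k(3) using gadd[OF subsetD[OF BK k(1)] KR(7)[OF k(2) bK(1)]] by blast
        have car: "\<gamma> k \<in> carrier G" "n \<in> carrier G" using gc k BK n NR by auto
        have "h \<oplus>\<^bsub>G\<^esub> a \<odot>\<^bsub>G\<^esub> x = (h' \<oplus>\<^bsub>G\<^esub> (a \<odot>\<^bsub>G\<^esub> \<gamma> k \<oplus>\<^bsub>G\<^esub> a \<odot>\<^bsub>G\<^esub> n)) \<oplus>\<^bsub>G\<^esub> (c \<oplus> a \<otimes> (r \<otimes> r)) \<odot>\<^bsub>G\<^esub> \<gamma> b"
          unfolding h'(3) y(2) n(2) gsm[OF k(2) bK(1)]
          using h'c h'(2) step(2) gb car k(2) by (simp add: G.smult_r_distr G.smult_l_distr G.smult_assoc1 G.M.a_ac)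
        moreover have "h' \<oplus>\<^bsub>G\<^esub> (a \<odot>\<^bsub>G\<^esub> \<gamma> k \<oplus>\<^bsub>G\<^esub> a \<odot>\<^bsub>G\<^esub> n) \<in> S B"
          by (intro SR(4,7)[OF BK] SN[OF BK n(1)] Sg[OF BK k(1)] h'(1) step(2))
        moreover have "c \<oplus> a \<otimes> (r \<otimes> r) \<in> carrier R" using h'(2) step(2) k(2) by simp
        ultimately show ?thesis by blast
      qed
    qed
    obtain h' c where h': "h' \<in> S B" "c \<in> carrier R" "h = h' \<oplus>\<^bsub>G\<^esub> c \<odot>\<^bsub>G\<^esub> \<gamma> b"
      using split[OF Cons.prems(2)] by blast
    have h'c: "h' \<in> carrier G" using h'(1) SR(3)[OF BK] by blast
    \<comment> \<open>\<open>I\<close> consists of the values of \<open>\<phi>\<close> on the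
      remaining generators, enlarged by \<open>I0\<close>; modulo its squares only the term with
      \<open>\<phi> b\<close> survives.\<close>
    define I where "I = {i \<oplus> \<phi> k | i k. i \<in> I0 \<and> k \<in> B}"
    have Ii: "ideal I R"
    proof (rule ideal_criterion)
      show "I \<subseteq> carrier R" using IR lamH BR by (auto simp: I_def)
      have "\<zero> = \<zero> \<oplus> \<phi> \<zero>\<^bsub>P\<^esub>" using module_hom_zero[OF P regular_module_module lam] by simp
      then show "\<zero> \<in> I" unfolding I_def using IR(2) BR(2) by blast
      show "a \<oplus> b \<in> I" if "a \<in> I" "b \<in> I" for a b
      proof -
        obtain i j k l where h: "i \<in> I0" "j \<in> I0" "k \<in> B" "l \<in> B" "a = i \<oplus> \<phi> k" "b = j \<oplus> \<phi> l"
          using \<open>a \<in> I\<close> \<open>b \<in> I\<close> unfolding I_def by blast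
        then have "a \<oplus> b = (i \<oplus> j) \<oplus> \<phi> (k \<oplus>\<^bsub>P\<^esub> l)" using IR(3) BR(3) lamH by (simp add: a_ac)
        moreover have "i \<oplus> j \<in> I0" "k \<oplus>\<^bsub>P\<^esub> l \<in> B" using IR(4) BR(4) h by auto
        ultimately show ?thesis unfolding I_def by blast
      qed
      show "r \<otimes> a \<in> I" if "r \<in> carrier R" "a \<in> I" for r a
      proof -
        obtain i k where h: "i \<in> I0" "k \<in> B" "a = i \<oplus> \<phi> k" using \<open>a \<in> I\<close> unfolding I_def by blast
        then have "r \<otimes> a = r \<otimes> i \<oplus> \<phi> (r \<odot>\<^bsub>P\<^esub> k)" using IR(3) BR(3) lamH that(1) by (simp add: r_distr)
        moreover have "r \<otimes> i \<in> I0" "r \<odot>\<^bsub>P\<^esub> k \<in> B" using IR(7) BR(7) h that(1) by auto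
        ultimately show ?thesis unfolding I_def by blast
      qed
    qed
    note IIR = ideal_rules[OF Ii]
    have I0I: "I0 \<subseteq> I"
    proof
      fix i assume "i \<in> I0"
      then have "i = i \<oplus> \<phi> \<zero>\<^bsub>P\<^esub>" using module_hom_zero[OF P regular_module_module lam] IR(3) by simp
      then show "i \<in> I" unfolding I_def using BR(2) \<open>i \<in> I0\<close> by blast
    qed
    have lamI: "\<phi> k \<in> I" if "k \<in> B" for k
    proof -
      have "\<phi> k = \<zero> \<oplus> \<phi> k" using lamH BR(3) that by simp
      then show ?thesis unfolding I_def using IR(2) that by blast
    qed
    note sqI = square_ideal_ideal[OF IIR(1) V] and sqsup = square_ideal_superset[OF IIR(1) V]
    note sqR = ideal_rules[OF sqI]
    have GSB: "\<Gamma> t \<in> square_ideal R I V" if "t \<in> S B" for t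
      using that[unfolded S_def]
    proof induction
      case zero
      then show ?case using module_hom_zero[OF G regular_module_module Gam] sqR by simp
    next
      case (step h a x)
      have xc: "x \<in> carrier G" using step(3) Scar[OF BK] by blast
      have hc: "h \<in> carrier G" using step(1) SR(3)[OF BK] by (simp add: S_def)
      have "\<Gamma> x \<in> square_ideal R I V"
      proof (cases "x \<in> N")
        case True
        then show ?thesis using GN sqsup(1) by blast
      next
        case False
        then obtain k where k: "k \<in> B" "x = \<gamma> k" using step(3) by auto
        have kK: "k \<in> K" using k(1) BK by blast
        show ?thesis unfolding k(2) Gg[OF kK] using sqsup(2) lamI[OF k(1)] .
      qed
      then show ?case using step hc xc GamH sqR by simp
    qed
    \<comment> \<open>Applying \<open>\<Gamma>\<close> leaves \<open>c\<close> times the square of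
      \<open>\<phi> b\<close> in \<open>I^[2] + V\<close>. Flatness then places \<open>c\<close> in
      the Frobenius power of \<open>I : \<phi> b\<close>, plus \<open>V\<close>.\<close>
    have "\<Gamma> h = \<Gamma> h' \<oplus> (\<phi> b \<otimes> \<phi> b) \<otimes> c"
      unfolding h'(3) using GamH h'c h'(2) gb Gg[OF bK(1)] lamH bK by (simp add: m_comm)
    then have "\<Gamma> h' \<oplus> (\<phi> b \<otimes> \<phi> b) \<otimes> c \<in> square_ideal R I V" using Cons.prems(3) sqsup(1) by auto
    then have "(\<phi> b \<otimes> \<phi> b) \<otimes> c \<in> square_ideal R I V"
      using ideal_add_cancel[OF sqI GSB[OF h'(1)], of "(\<phi> b \<otimes> \<phi> b) \<otimes> c"] h'(2) lamH bK by blast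
    then have cmem: "c \<in> square_ideal R (ideal_colon R I (\<phi> b)) V"
      using frobenius_flatD[OF flat Ii I0I lamH(1)[OF bK(2)] h'(2)] by simp
    \<comment> \<open>For \<open>s\<close> in the colon ideal, \<open>s b\<close> is an element
      \<open>u\<close> of \<open>K0\<close> plus an element of \<open>B\<close>: some
      \<open>k\<close> in \<open>B\<close> matches its value of \<open>\<phi>\<close> up to
      \<open>I0\<close>. Since \<open>s^2\<close> times \<open>\<gamma> b\<close> is
      \<open>\<gamma>\<close> of \<open>s b\<close>, the generator \<open>b\<close>
      disappears.\<close>
    have "\<exists>h1 h2. h1 \<in> S K0 \<and> h2 \<in> S B \<and> c \<odot>\<^bsub>G\<^esub> \<gamma> b = h1 \<oplus>\<^bsub>G\<^esub> h2" using cmem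
    proof induction
      case (base v)
      have "v \<odot>\<^bsub>G\<^esub> \<gamma> b \<in> N" using Vg base bK by blast
      moreover from this have "v \<odot>\<^bsub>G\<^esub> \<gamma> b = v \<odot>\<^bsub>G\<^esub> \<gamma> b \<oplus>\<^bsub>G\<^esub> \<zero>\<^bsub>G\<^esub>" using NR(3) by simp
      ultimately show ?case using SN[OF K0K] SR(2)[OF BK] by blast
    next
      case (step t a s)
      then obtain h1 h2 where hh: "h1 \<in> S K0" "h2 \<in> S B" "t \<odot>\<^bsub>G\<^esub> \<gamma> b = h1 \<oplus>\<^bsub>G\<^esub> h2" by blast
      have tc: "t \<in> carrier R"
        using ideal_rules(3)[OF square_ideal_ideal[OF _ V] step(1)] by (auto simp: ideal_colon_def)
      have s: "s \<in> carrier R" "\<phi> b \<otimes> s \<in> I" using step(3) by (auto simp: ideal_colon_def)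
      then obtain i k where ik: "i \<in> I0" "k \<in> B" "\<phi> b \<otimes> s = i \<oplus> \<phi> k" unfolding I_def by blast
      define u where "u = s \<odot>\<^bsub>P\<^esub> b \<ominus>\<^bsub>P\<^esub> k"
      have kK: "k \<in> K" "k \<in> carrier P" using ik BK KR by auto
      have uK: "u \<in> K" unfolding u_def by (intro KR(6,7) s bK(1) kK(1))
      have uc: "u \<in> carrier P" using uK KR by blast
      have "\<phi> u = s \<otimes> \<phi> b \<ominus> \<phi> k"
        unfolding u_def using module_hom_minus[OF P regular_module_module lam, of "s \<odot>\<^bsub>P\<^esub> b" k] lamH bK s kK
        by simp
      also have "\<dots> = i"
      proof -
        have "s \<otimes> \<phi> b = i \<oplus> \<phi> k" using ik(3) s lamH bK by (simp add: m_comm)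
        moreover have "i \<in> carrier R" "\<phi> k \<in> carrier R" using ik IR lamH kK by auto
        ultimately show ?thesis by algebra
      qed
      finally have uK0: "u \<in> K0" using uK ik(1) by (simp add: K0_def)
      have "s \<odot>\<^bsub>P\<^esub> b = u \<oplus>\<^bsub>P\<^esub> k" unfolding u_def using s bK kK by (simp add: P.M.minus_eq P.M.a_assoc P.M.l_neg)
      then obtain n where n: "n \<in> N" "\<gamma> (s \<odot>\<^bsub>P\<^esub> b) = (\<gamma> u \<oplus>\<^bsub>G\<^esub> \<gamma> k) \<oplus>\<^bsub>G\<^esub> n"
        using gadd[OF uK kK(1)] by metis
      have car: "\<gamma> u \<in> carrier G" "\<gamma> k \<in> carrier G" "n \<in> carrier G" "h1 \<in> carrier G" "h2 \<in> carrier G"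
        using gc uK kK n NR hh SR(3)[OF K0K] SR(3)[OF BK] by auto
      have "(t \<oplus> a \<otimes> (s \<otimes> s)) \<odot>\<^bsub>G\<^esub> \<gamma> b = t \<odot>\<^bsub>G\<^esub> \<gamma> b \<oplus>\<^bsub>G\<^esub> a \<odot>\<^bsub>G\<^esub> \<gamma> (s \<odot>\<^bsub>P\<^esub> b)"
        unfolding gsm[OF s(1) bK(1)] using tc step(2) s gb by (simp add: G.smult_l_distr G.smult_assoc1)
      also have "\<dots> = (h1 \<oplus>\<^bsub>G\<^esub> a \<odot>\<^bsub>G\<^esub> \<gamma> u) \<oplus>\<^bsub>G\<^esub> (h2 \<oplus>\<^bsub>G\<^esub> (a \<odot>\<^bsub>G\<^esub> \<gamma> k \<oplus>\<^bsub>G\<^esub> a \<odot>\<^bsub>G\<^esub> n))"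
        unfolding hh(3) n(2) using car step(2) by (simp add: G.smult_r_distr G.M.a_ac)
      finally have "(t \<oplus> a \<otimes> (s \<otimes> s)) \<odot>\<^bsub>G\<^esub> \<gamma> b
          = (h1 \<oplus>\<^bsub>G\<^esub> a \<odot>\<^bsub>G\<^esub> \<gamma> u) \<oplus>\<^bsub>G\<^esub> (h2 \<oplus>\<^bsub>G\<^esub> (a \<odot>\<^bsub>G\<^esub> \<gamma> k \<oplus>\<^bsub>G\<^esub> a \<odot>\<^bsub>G\<^esub> n))" .
      moreover have "h1 \<oplus>\<^bsub>G\<^esub> a \<odot>\<^bsub>G\<^esub> \<gamma> u \<in> S K0" by (intro SR(4,7)[OF K0K] hh(1) Sg[OF K0K uK0] step(2))
      moreover have "h2 \<oplus>\<^bsub>G\<^esub> (a \<odot>\<^bsub>G\<^esub> \<gamma> k \<oplus>\<^bsub>G\<^esub> a \<odot>\<^bsub>G\<^esub> n) \<in> S B"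
        by (intro SR(4,7)[OF BK] hh(2) Sg[OF BK ik(2)] SN[OF BK n(1)] step(2))
      ultimately show ?case by blast
    qed
    then obtain h1 h2 where hh: "h1 \<in> S K0" "h2 \<in> S B" "c \<odot>\<^bsub>G\<^esub> \<gamma> b = h1 \<oplus>\<^bsub>G\<^esub> h2" by blast
    have car: "h1 \<in> carrier G" "h2 \<in> carrier G" using hh SR(3)[OF K0K] SR(3)[OF BK] by auto
    have heq: "h = h1 \<oplus>\<^bsub>G\<^esub> (h' \<oplus>\<^bsub>G\<^esub> h2)" unfolding h'(3) hh(3) using car h'c by (simp add: G.M.a_ac)
    have "h' \<oplus>\<^bsub>G\<^esub> h2 \<in> S K0"
    proof (rule Cons.IH)
      show "set bs \<subseteq> K" by (rule bsK)
      show "h' \<oplus>\<^bsub>G\<^esub> h2 \<in> S (module_span R P (set bs))" using SR(4)[OF BK h'(1) hh(2)] by (simp add: B_def)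
      have "\<Gamma> h1 \<oplus> \<Gamma> (h' \<oplus>\<^bsub>G\<^esub> h2) \<in> V" using Cons.prems(3) unfolding heq using GamH car h'c by simp
      then show "\<Gamma> (h' \<oplus>\<^bsub>G\<^esub> h2) \<in> V" using ideal_add_cancel[OF V GS0[OF hh(1)]] GamH car h'c by blast
    qed
    then show ?case unfolding heq by (rule SR(4)[OF K0K hh(1)])
  qed
  have "g \<in> S K" using g by (simp add: S_def)
  then obtain bs where "set bs \<subseteq> K" "g \<in> S (module_span R P (set bs))" using fin by blast
  then have "g \<in> S K0" using main Gv by blast
  then show ?thesis by (simp add: S_def K0_def)
qed

end

section \<open>Flatness of the Frobenius map of a regular local ring\<close>

locale char_two_cring = cring R for R (structure) +
  assumes double_zero: "x \<in> carrier R \<Longrightarrow> x \<oplus> x = \<zero>"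
begin

lemma minus_self: "x \<in> carrier R \<Longrightarrow> \<ominus> x = x"
  using double_zero by (metis minus_equality)

lemma square_add:
  assumes "x \<in> carrier R" "y \<in> carrier R"
  shows "(x \<oplus> y) \<otimes> (x \<oplus> y) = x \<otimes> x \<oplus> y \<otimes> y"
proof -
  have "(x \<oplus> y) \<otimes> (x \<oplus> y) = (x \<otimes> x \<oplus> y \<otimes> y) \<oplus> (x \<otimes> y \<oplus> x \<otimes> y)" using assms by algebra
  then show ?thesis using assms double_zero[of "x \<otimes> y"] by simp
qed

lemma square_mult: "x \<in> carrier R \<Longrightarrow> y \<in> carrier R \<Longrightarrow> (x \<otimes> y) \<otimes> (x \<otimes> y) = (x \<otimes> x) \<otimes> (y \<otimes> y)"
  by algebra

lemma ideal_submodule: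
  assumes "ideal I R"
  shows "submodule I R (regular_module R)"
proof -
  interpret L: module R "regular_module R" by (rule regular_module_module)
  show ?thesis using ideal_rules[OF assms] by (intro L.submodule_criterion) auto
qed

lemma span_regular_subset:
  assumes "ideal J R" "X \<subseteq> J"
  shows "module_span R (regular_module R) X \<subseteq> J"
proof -
  interpret L: module R "regular_module R" by (rule regular_module_module)
  show ?thesis using L.module_span_minimal[OF ideal_submodule[OF assms(1)] assms(2)] .
qed

text \<open>The case of \<open>semilinear_kernel\<close> in which \<open>\<gamma>\<close> squares
  the elements of an ideal and \<open>\<phi>\<close> is the identity: the part of
  \<open>I^[2] + N\<close> inside \<open>V\<close> is generated by \<open>N\<close> and the squares
  from \<open>I\<close> that come from \<open>I0\<close>.\<close>

lemma square_kernel: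
  assumes flat: "frobenius_flat R I0 V" and I0: "ideal I0 R" and V: "ideal V R"
    and I0V: "\<And>x. x \<in> I0 \<Longrightarrow> x \<otimes> x \<in> V"
    and I: "ideal I R" and N: "ideal N R" "N \<subseteq> V"
    and VN: "\<And>v x. v \<in> V \<Longrightarrow> x \<in> I \<Longrightarrow> v \<otimes> (x \<otimes> x) \<in> N"
    and J: "ideal J R" "N \<subseteq> J" "\<And>x. x \<in> I \<Longrightarrow> x \<in> I0 \<Longrightarrow> x \<otimes> x \<in> J"
    and g: "g \<in> square_ideal R I N" "g \<in> V"
  shows "g \<in> J"
proof -
  interpret L: module R "regular_module R" by (rule regular_module_module)
  note IR = ideal_rules[OF I] and NR = ideal_rules[OF N(1)]
  let ?sq = "\<lambda>x. x \<otimes> x"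
  have id: "(\<lambda>x. x) \<in> module_hom R (regular_module R) (regular_module R)" by (rule module_homI) auto
  have "?sq ` I \<union> N \<subseteq> carrier (regular_module R)" using IR NR by auto
  note sub = L.submodule_rules[OF L.module_span_submodule[OF this], simplified]
    and sup = L.module_span_superset[OF this]
  have "g \<in> module_span R (regular_module R) (?sq ` I \<union> N)"
    using g(1)
  proof induction
    case (base v)
    then show ?case using sup by blast
  next
    case (step h a x)
    have "x \<otimes> x \<in> module_span R (regular_module R) (?sq ` I \<union> N)" using sup step(3) by blast
    then show ?case using sub(4)[OF step(4)] sub(7)[OF step(2)] by blast
  qed
  then have "g \<in> module_span R (regular_module R) (?sq ` {x \<in> I. x \<in> I0} \<union> N)"
  proof (rule semilinear_kernel[OF flat I0 V I0V regular_module_module regular_module_module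
        ideal_submodule[OF I] ideal_submodule[OF N(1)] id id, rotated -2])
    show "g \<in> V" by (rule g)
    show "\<exists>n\<in>N. (x \<oplus>\<^bsub>regular_module R\<^esub> y) \<otimes> (x \<oplus>\<^bsub>regular_module R\<^esub> y) =
        (x \<otimes> x \<oplus>\<^bsub>regular_module R\<^esub> y \<otimes> y) \<oplus>\<^bsub>regular_module R\<^esub> n" if "x \<in> I" "y \<in> I" for x y
      using that IR NR(2) by (intro bexI[of _ \<zero>]) (auto simp: square_add)
  qed (use IR VN N(2) in \<open>auto simp: square_mult\<close>)
  then show ?thesis using span_regular_subset[OF J(1), of "?sq ` {x \<in> I. x \<in> I0} \<union> N"] J by blast
qed

lemma square_ideal_mono:
  assumes "I \<subseteq> I'" "V \<subseteq> V'" "g \<in> square_ideal R I V"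
  shows "g \<in> square_ideal R I' V'"
  using assms(3) by induction (use assms in \<open>auto intro: square_ideal.intros\<close>)

lemma square_ideal_adjoin:
  assumes "I \<subseteq> carrier R" "ideal V R" "x \<in> carrier R" "g \<in> square_ideal R I (ideal_adjoin R V x)"
  obtains h r where "h \<in> square_ideal R I V" "r \<in> carrier R" "g = h \<oplus> r \<otimes> x"
proof -
  note sR = ideal_rules[OF square_ideal_ideal[OF assms(1,2)]]
  have "\<exists>h r. h \<in> square_ideal R I V \<and> r \<in> carrier R \<and> g = h \<oplus> r \<otimes> x"
    using assms(4)
  proof induction
    case (base v)
    then show ?case by (auto simp: ideal_adjoin_def intro: square_ideal.base)
  next
    case (step g a y)
    then obtain h r where h: "h \<in> square_ideal R I V" "r \<in> carrier R" "g = h \<oplus> r \<otimes> x" by blast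
    have "h \<in> carrier R" "y \<in> carrier R" using h sR step assms(1) by auto
    then have "g \<oplus> a \<otimes> (y \<otimes> y) = (h \<oplus> a \<otimes> (y \<otimes> y)) \<oplus> r \<otimes> x"
      unfolding h(3) using h(2) assms(3) step(2) by algebra
    then show ?case using square_ideal.step[OF h(1) step(2,3)] h(2) by blast
  qed
  then show ?thesis using that by blast
qed

end

text \<open>The inductive step of the local criterion for flatness: \<open>x\<close> is a nonzerodivisor modulo \<open>I0\<close>,
  and the Frobenius map is flat modulo \<open>I1 = I0 + (x)\<close>.\<close>

locale flat_step = noetherian_local_ring R \<mm> + char_two_cring R
  for R (structure) and \<mm> +
  fixes I0 :: "'a set" and x :: 'a
  assumes I0: "ideal I0 R" and xm: "x \<in> \<mm>"
    and nzd: "\<And>r. r \<in> carrier R \<Longrightarrow> x \<otimes> r \<in> I0 \<Longrightarrow> r \<in> I0"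
    and flat1: "frobenius_flat R (ideal_adjoin R I0 x) (ideal_adjoin R I0 x)"
begin

abbreviation "I1 \<equiv> ideal_adjoin R I0 x"
abbreviation "V2 \<equiv> ideal_adjoin R I0 (x \<otimes> x)"

lemma xc: "x \<in> carrier R"
  using ideal_rules(3)[OF ideal_maximal xm] .

lemma I1: "ideal I1 R" and V2: "ideal V2 R"
  using ideal_adjoin_ideal[OF I0] xc by auto

lemma sup1: "I0 \<subseteq> I1" "x \<in> I1" and sup2: "I0 \<subseteq> V2" "x \<otimes> x \<in> V2"
  using ideal_adjoin_superset[OF I0] xc by auto

lemmas I0R = ideal_rules[OF I0]

lemma nzd_eq:
  assumes "a \<in> carrier R" "b \<in> carrier R" "i \<in> I0" "x \<otimes> a = i \<oplus> x \<otimes> b"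
  shows "a \<ominus> b \<in> I0"
proof (rule nzd)
  show "a \<ominus> b \<in> carrier R" using assms by simp
  have "i \<in> carrier R" using assms I0R by blast
  have "x \<otimes> (a \<ominus> b) = x \<otimes> a \<ominus> x \<otimes> b" using assms xc by algebra
  also have "\<dots> = i" unfolding assms(4) using assms \<open>i \<in> carrier R\<close> xc by algebra
  finally show "x \<otimes> (a \<ominus> b) \<in> I0" using assms by simp
qed

lemma nzd2_eq:
  assumes "a \<in> carrier R" "b \<in> carrier R" "i \<in> I0" "(x \<otimes> x) \<otimes> a = i \<oplus> (x \<otimes> x) \<otimes> b"
  shows "a \<ominus> b \<in> I0"
proof (rule nzd, simp add: assms, rule nzd)
  show "x \<otimes> (a \<ominus> b) \<in> carrier R" using assms xc by simp
  have "i \<in> carrier R" using assms I0R by blast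
  have "x \<otimes> (x \<otimes> (a \<ominus> b)) = (x \<otimes> x) \<otimes> a \<ominus> (x \<otimes> x) \<otimes> b" using assms(1,2) xc by algebra
  also have "\<dots> = i" unfolding assms(4) using assms(1,2) \<open>i \<in> carrier R\<close> xc by algebra
  finally show "x \<otimes> (x \<otimes> (a \<ominus> b)) \<in> I0" using assms by simp
qed

lemma shifted_ideal:
  assumes "ideal J R" "y \<in> carrier R"
  shows "ideal {i \<oplus> y \<otimes> u | i u. i \<in> I0 \<and> u \<in> J} R" (is "ideal ?N R")
proof (rule ideal_criterion)
  note JR = ideal_rules[OF assms(1)]
  show "?N \<subseteq> carrier R" using JR(3) I0R(3) assms by auto
  have "\<zero> = \<zero> \<oplus> y \<otimes> \<zero>" using assms by simp
  then show "\<zero> \<in> ?N" using I0R(2) JR(2) by blast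
  fix a b assume "a \<in> ?N" "b \<in> ?N"
  then obtain i u j v where h: "i \<in> I0" "j \<in> I0" "u \<in> J" "v \<in> J" "a = i \<oplus> y \<otimes> u" "b = j \<oplus> y \<otimes> v" by blast
  have "i \<in> carrier R" "j \<in> carrier R" "u \<in> carrier R" "v \<in> carrier R" using h I0R(3) JR(3) by auto
  then have "a \<oplus> b = (i \<oplus> j) \<oplus> y \<otimes> (u \<oplus> v)" unfolding h(5,6) using assms(2) by algebra
  then show "a \<oplus> b \<in> ?N" using I0R(4)[OF h(1,2)] JR(4)[OF h(3,4)] by blast
next
  note JR = ideal_rules[OF assms(1)]
  fix r a assume r: "r \<in> carrier R" and "a \<in> ?N"
  then obtain i u where h: "i \<in> I0" "u \<in> J" "a = i \<oplus> y \<otimes> u" by blast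
  have "i \<in> carrier R" "u \<in> carrier R" using h I0R(3) JR(3) by auto
  then have "r \<otimes> a = r \<otimes> i \<oplus> y \<otimes> (r \<otimes> u)" unfolding h(3) using assms(2) r by algebra
  then show "r \<otimes> a \<in> ?N" using I0R(7)[OF r h(1)] JR(7)[OF r h(2)] by blast
qed

lemma shifted_ideal_superset:
  assumes "ideal J R" "y \<in> carrier R" "i \<in> I0"
  shows "i \<in> {i \<oplus> y \<otimes> u | i u. i \<in> I0 \<and> u \<in> J}"
proof -
  have "i = i \<oplus> y \<otimes> \<zero>" using assms I0R by simp
  then show ?thesis using assms(3) ideal_rules(2)[OF assms(1)] by blast
qed

text \<open>The product \<open>x w\<close> lies both in \<open>I^[2] + I0\<close> and in
  \<open>I1\<close>, so \<open>square_kernel\<close> expresses it through squares of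
  \<open>I1\<close>. Such a square \<open>(i + r x)^2\<close> is \<open>i^2 + x (r^2 x)\<close>,
  hence visibly \<open>x\<close> times an element of \<open>I1\<close> modulo \<open>I0\<close>, and
  \<open>x\<close> can be cancelled.\<close>

lemma square_ideal_divide:
  assumes I: "ideal I R" "I1 \<subseteq> I" and w: "w \<in> carrier R" "x \<otimes> w \<in> square_ideal R I I0"
  shows "w \<in> square_ideal R I I1"
proof -
  note IR = ideal_rules[OF I(1)]
  \<comment> \<open>\<open>N\<close> is just large enough to absorb the products of
    \<open>I1\<close> with squares of \<open>I\<close>. Membership of \<open>x w\<close> in
    \<open>J\<close> is the claim multiplied by \<open>x\<close>.\<close>
  define N where "N = {i \<oplus> x \<otimes> u | i u. i \<in> I0 \<and> u \<in> square_ideal R I I0}"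
  define J where "J = {i \<oplus> x \<otimes> u | i u. i \<in> I0 \<and> u \<in> square_ideal R I I1}"
  note s0 = square_ideal_ideal[OF IR(1) I0] and s1 = square_ideal_ideal[OF IR(1) I1]
  have N: "ideal N R" and J: "ideal J R" unfolding N_def J_def using shifted_ideal s0 s1 xc by auto
  have NI: "I0 \<subseteq> N" "I0 \<subseteq> J" unfolding N_def J_def using shifted_ideal_superset[OF s0 xc] shifted_ideal_superset[OF s1 xc] by auto
  have "x \<otimes> w \<in> J"
  proof (rule square_kernel[OF flat1 I1 I1 _ I(1) N _ _ J])
    show "N \<subseteq> J" unfolding N_def J_def using square_ideal_mono[OF subset_refl sup1(1)] by blast
    show "y \<otimes> y \<in> I1" if "y \<in> I1" for y using ideal_rules(3,7)[OF I1] that by blast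
    show "N \<subseteq> I1" unfolding N_def using ideal_rules(3)[OF s0] xc sup1(1) ideal_rules(4)[OF I1] ideal_rules(8)[OF I1 _ sup1(2)] by blast
    show "v \<otimes> (y \<otimes> y) \<in> N" if v: "v \<in> I1" and y: "y \<in> I" for v y
    proof -
      obtain i r where ir: "i \<in> I0" "r \<in> carrier R" "v = i \<oplus> r \<otimes> x" using v by (auto simp: ideal_adjoin_def)
      have "y \<in> carrier R" "i \<in> carrier R" using y ir IR I0R by auto
      then have "v \<otimes> (y \<otimes> y) = (y \<otimes> y) \<otimes> i \<oplus> x \<otimes> (r \<otimes> (y \<otimes> y))" unfolding ir(3) using ir(2) xc by algebra
      moreover have "(y \<otimes> y) \<otimes> i \<in> I0" using I0R(7)[OF _ ir(1)] \<open>y \<in> carrier R\<close> by simp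
      moreover have "r \<otimes> (y \<otimes> y) \<in> square_ideal R I I0"
        using square_ideal_superset(2)[OF IR(1) I0 y] ideal_rules(7)[OF s0 ir(2)] by blast
      ultimately show ?thesis unfolding N_def by blast
    qed
    show "y \<otimes> y \<in> J" if y: "y \<in> I1" for y
    proof -
      obtain i r where ir: "i \<in> I0" "r \<in> carrier R" "y = i \<oplus> r \<otimes> x" using y by (auto simp: ideal_adjoin_def)
      have ic: "i \<in> carrier R" using ir I0R by auto
      then have "y \<otimes> y = i \<otimes> i \<oplus> x \<otimes> ((r \<otimes> r) \<otimes> x)" unfolding ir(3) using square_add[of i "r \<otimes> x"] ir(2) xc by (simp add: m_ac)
      moreover have "i \<otimes> i \<in> I0" using I0R(7)[OF ic ir(1)] .
      moreover have "(r \<otimes> r) \<otimes> x \<in> square_ideal R I I1"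
        using ideal_rules(7)[OF I1 _ sup1(2), of "r \<otimes> r"] ir(2) by (auto intro: square_ideal.base)
      ultimately show ?thesis unfolding J_def by blast
    qed
    show "x \<otimes> w \<in> square_ideal R I N" using square_ideal_mono[OF subset_refl NI(1) w(2)] .
    show "x \<otimes> w \<in> I1" using ideal_rules(8)[OF I1 w(1) sup1(2)] .
  qed
  then obtain i u where iu: "i \<in> I0" "u \<in> square_ideal R I I1" "x \<otimes> w = i \<oplus> x \<otimes> u" unfolding J_def by blast
  have "w \<ominus> u \<in> I1" using nzd_eq[OF w(1) _ iu(1,3)] ideal_rules(3)[OF s1 iu(2)] sup1(1) by blast
  then have "w \<ominus> u \<in> square_ideal R I I1" by (rule square_ideal.base)
  then show ?thesis using ideal_minus_cancel[OF s1 iu(2) w(1)] by blast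
qed

text \<open>The elementary half of the equality of colon ideals: \<open>a^2\<close> times the square
  of \<open>y\<close> is the square of \<open>a y\<close>.\<close>

lemma square_colon:
  assumes "I \<subseteq> carrier R" "a \<in> carrier R" "ideal I R" "ideal V R" "k \<in> square_ideal R (ideal_colon R I a) V"
  shows "(a \<otimes> a) \<otimes> k \<in> square_ideal R I V"
  using assms(5)
proof induction
  case (base v)
  then show ?case using ideal_rules(7)[OF assms(4), of "a \<otimes> a" v] assms(2) by (auto intro: square_ideal.base)
next
  case (step g r y)
  have y: "y \<in> carrier R" "a \<otimes> y \<in> I" using step(3) by (auto simp: ideal_colon_def)
  have g: "g \<in> carrier R"
    using ideal_rules(3)[OF square_ideal_ideal[OF _ assms(4)] step(1)] by (auto simp: ideal_colon_def)
  have "(a \<otimes> a) \<otimes> (g \<oplus> r \<otimes> (y \<otimes> y)) = (a \<otimes> a) \<otimes> g \<oplus> r \<otimes> ((a \<otimes> y) \<otimes> (a \<otimes> y))"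
    using y(1) g step(2) assms(2) by algebra
  then show ?case using square_ideal.step[OF step(4,2) y(2)] by simp
qed

text \<open>Squares of elements of \<open>I1\<close> lie in \<open>V2\<close>, so the Frobenius map
  leads from \<open>R / I1\<close> to \<open>R / V2\<close>. Filter the target by powers of
  \<open>x\<close>: flatness modulo \<open>I1\<close> splits off the part of \<open>r\<close>
  without \<open>x\<close>, then \<open>square_ideal_divide\<close> cancels \<open>x\<close> and the
  argument is applied to the cofactor. What is left is a multiple of \<open>x^2\<close>, which the
  colon ideal absorbs because it contains \<open>x\<close>.\<close>

lemma flat_V2: "frobenius_flat R I1 V2"
  unfolding frobenius_flat_def
proof (intro allI impI)
  fix I a r
  assume I: "ideal I R" "I1 \<subseteq> I" and a: "a \<in> carrier R" and r: "r \<in> carrier R"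
    and mem: "(a \<otimes> a) \<otimes> r \<in> square_ideal R I V2"
  note IR = ideal_rules[OF I(1)]
  define K where "K = ideal_colon R I a"
  have K: "ideal K R" "I \<subseteq> K" unfolding K_def using ideal_colon_ideal ideal_colon_superset I a by auto
  note KR = ideal_rules[OF K(1)]
  have xI: "x \<in> I" "x \<in> K" using sup1(2) I K by auto
  note s0 = square_ideal_ideal[OF IR(1) I0] and s1 = square_ideal_ideal[OF IR(1) I1]
    and k0 = square_ideal_ideal[OF KR(1) I0] and kV = square_ideal_ideal[OF KR(1) V2]
  have V2s: "V2 \<subseteq> square_ideal R I I0"
    by (rule ideal_adjoin_minimal[OF s0]) (use square_ideal_superset[OF IR(1) I0] xI in auto)
  have "square_ideal R I V2 \<subseteq> square_ideal R I I0"
    by (rule square_ideal_minimal[OF s0 V2s]) (rule square_ideal_superset(2)[OF IR(1) I0])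
  then have mem0: "(a \<otimes> a) \<otimes> r \<in> square_ideal R I I0" using mem by blast
  have mem1: "(a \<otimes> a) \<otimes> r \<in> square_ideal R I I1" using square_ideal_mono[OF subset_refl sup1(1) mem0] .
  have "r \<in> square_ideal R K I1" using frobenius_flatD[OF flat1 I a r mem1] by (simp add: K_def)
  then obtain k s where ks: "k \<in> square_ideal R K I0" "s \<in> carrier R" "r = k \<oplus> s \<otimes> x"
    using square_ideal_adjoin[OF KR(1) I0 xc] by blast
  have kc: "k \<in> carrier R" using ideal_rules(3)[OF k0 ks(1)] .
  have ak: "(a \<otimes> a) \<otimes> k \<in> square_ideal R I I0" using square_colon[OF IR(1) a I(1) I0] ks(1) by (simp add: K_def)
  have "(a \<otimes> a) \<otimes> r = (a \<otimes> a) \<otimes> k \<oplus> x \<otimes> ((a \<otimes> a) \<otimes> s)" unfolding ks(3) using a kc ks(2) xc by algebra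
  then have "x \<otimes> ((a \<otimes> a) \<otimes> s) \<in> square_ideal R I I0"
    using ideal_add_cancel[OF s0 ak, of "x \<otimes> ((a \<otimes> a) \<otimes> s)"] mem0 a ks(2) xc by simp
  then have "(a \<otimes> a) \<otimes> s \<in> square_ideal R I I1" using a ks(2) by (intro square_ideal_divide[OF I]) simp_all
  then have "s \<in> square_ideal R K I1" using frobenius_flatD[OF flat1 I a ks(2)] by (simp add: K_def)
  then obtain k' s' where ks': "k' \<in> square_ideal R K I0" "s' \<in> carrier R" "s = k' \<oplus> s' \<otimes> x"
    using square_ideal_adjoin[OF KR(1) I0 xc] by blast
  have kc': "k' \<in> carrier R" using ideal_rules(3)[OF k0 ks'(1)] .
  have req: "r = (k \<oplus> x \<otimes> k') \<oplus> s' \<otimes> (x \<otimes> x)" unfolding ks(3) ks'(3) using kc kc' ks'(2) xc by algebra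
  have "k \<oplus> x \<otimes> k' \<in> square_ideal R K I0" using ideal_rules(4)[OF k0 ks(1)] ideal_rules(7)[OF k0 xc ks'(1)] by blast
  then have "k \<oplus> x \<otimes> k' \<in> square_ideal R K V2" using square_ideal_mono[OF subset_refl sup2(1)] by blast
  then have "r \<in> square_ideal R K V2" unfolding req by (rule square_ideal.step[OF _ ks'(2) xI(2)])
  then show "r \<in> square_ideal R (ideal_colon R I a) V2" by (simp add: K_def)
qed

text \<open>The flatness criterion for \<open>a = x\<close>, with \<open>I\<close> only required to
  contain \<open>I0\<close>. By \<open>flat_V2\<close> the element is expressed through squares of
  \<open>y = i + r x\<close> in \<open>I\<close>; then \<open>r x\<close> is in \<open>I\<close>, so
  \<open>r\<close> is in \<open>I : x\<close> and \<open>y^2 = i^2 + x^2 r^2\<close> displays the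
  factor \<open>x^2\<close> to be cancelled.\<close>

lemma square_ideal_divide_square:
  assumes I: "ideal I R" "I0 \<subseteq> I" and w: "w \<in> carrier R" "(x \<otimes> x) \<otimes> w \<in> square_ideal R I I0"
  shows "w \<in> square_ideal R (ideal_colon R I x) I0"
proof -
  note IR = ideal_rules[OF I(1)]
  define K where "K = ideal_colon R I x"
  have K: "ideal K R" "I \<subseteq> K" unfolding K_def using ideal_colon_ideal ideal_colon_superset I xc by auto
  note KR = ideal_rules[OF K(1)]
  have xxc: "x \<otimes> x \<in> carrier R" using xc by simp
  define N where "N = {i \<oplus> (x \<otimes> x) \<otimes> u | i u. i \<in> I0 \<and> u \<in> square_ideal R I I0}"
  define J where "J = {i \<oplus> (x \<otimes> x) \<otimes> u | i u. i \<in> I0 \<and> u \<in> square_ideal R K I0}"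
  note s0 = square_ideal_ideal[OF IR(1) I0] and s1 = square_ideal_ideal[OF KR(1) I0]
  have N: "ideal N R" and J: "ideal J R" unfolding N_def J_def using shifted_ideal s0 s1 xxc by auto
  have NI: "I0 \<subseteq> N" "I0 \<subseteq> J" unfolding N_def J_def
    using shifted_ideal_superset[OF s0 xxc] shifted_ideal_superset[OF s1 xxc] by auto
  have xxu: "(x \<otimes> x) \<otimes> u \<in> V2" if "u \<in> carrier R" for u using ideal_rules(8)[OF V2 that sup2(2)] .
  have "(x \<otimes> x) \<otimes> w \<in> J"
  proof (rule square_kernel[OF flat_V2 I1 V2 _ I(1) N _ _ J])
    show "N \<subseteq> J" unfolding N_def J_def using square_ideal_mono[OF K(2) subset_refl] by blast
    show "y \<otimes> y \<in> V2" if "y \<in> I1" for y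
    proof -
      obtain i r where ir: "i \<in> I0" "r \<in> carrier R" "y = i \<oplus> r \<otimes> x" using \<open>y \<in> I1\<close> by (auto simp: ideal_adjoin_def)
      have ic: "i \<in> carrier R" using ir I0R by auto
      then have "y \<otimes> y = i \<otimes> i \<oplus> (r \<otimes> r) \<otimes> (x \<otimes> x)" unfolding ir(3) using square_add[of i "r \<otimes> x"] ir(2) xc by (simp add: m_ac)
      moreover have "i \<otimes> i \<in> I0" using I0R(7)[OF ic ir(1)] .
      ultimately show ?thesis unfolding ideal_adjoin_def using ir(2) by blast
    qed
    show "N \<subseteq> V2" unfolding N_def using ideal_rules(3)[OF s0] sup2(1) ideal_rules(4)[OF V2] xxu by blast
    show "v \<otimes> (y \<otimes> y) \<in> N" if v: "v \<in> V2" and y: "y \<in> I" for v y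
    proof -
      obtain i r where ir: "i \<in> I0" "r \<in> carrier R" "v = i \<oplus> r \<otimes> (x \<otimes> x)" using v by (auto simp: ideal_adjoin_def)
      have "y \<in> carrier R" "i \<in> carrier R" using y ir IR I0R by auto
      then have "v \<otimes> (y \<otimes> y) = (y \<otimes> y) \<otimes> i \<oplus> (x \<otimes> x) \<otimes> (r \<otimes> (y \<otimes> y))" unfolding ir(3) using ir(2) xc by algebra
      moreover have "(y \<otimes> y) \<otimes> i \<in> I0" using I0R(7)[OF _ ir(1)] \<open>y \<in> carrier R\<close> by simp
      moreover have "r \<otimes> (y \<otimes> y) \<in> square_ideal R I I0"
        using square_ideal_superset(2)[OF IR(1) I0 y] ideal_rules(7)[OF s0 ir(2)] by blast
      ultimately show ?thesis unfolding N_def by blast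
    qed
    show "y \<otimes> y \<in> J" if yI: "y \<in> I" and y: "y \<in> I1" for y
    proof -
      obtain i r where ir: "i \<in> I0" "r \<in> carrier R" "y = i \<oplus> r \<otimes> x" using y by (auto simp: ideal_adjoin_def)
      have ic: "i \<in> carrier R" using ir I0R by auto
      have "r \<otimes> x \<in> I" using ideal_add_cancel[OF I(1), of i "r \<otimes> x"] ir I(2) yI xc by auto
      then have rK: "r \<in> K" using ir(2) xc by (simp add: K_def ideal_colon_def m_comm)
      have "y \<otimes> y = i \<otimes> i \<oplus> (x \<otimes> x) \<otimes> (r \<otimes> r)" unfolding ir(3) using square_add[of i "r \<otimes> x"] ir(2) ic xc by (simp add: m_ac)
      moreover have "i \<otimes> i \<in> I0" using I0R(7)[OF ic ir(1)] .
      moreover have "r \<otimes> r \<in> square_ideal R K I0" using square_ideal_superset(2)[OF KR(1) I0 rK] .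
      ultimately show ?thesis unfolding J_def by blast
    qed
    show "(x \<otimes> x) \<otimes> w \<in> square_ideal R I N" using square_ideal_mono[OF subset_refl NI(1) w(2)] .
    show "(x \<otimes> x) \<otimes> w \<in> V2" using xxu w(1) .
  qed
  then obtain i u where iu: "i \<in> I0" "u \<in> square_ideal R K I0" "(x \<otimes> x) \<otimes> w = i \<oplus> (x \<otimes> x) \<otimes> u" unfolding J_def by blast
  have "w \<ominus> u \<in> I0" using nzd2_eq[OF w(1) _ iu(1,3)] ideal_rules(3)[OF s1 iu(2)] by blast
  then have "w \<ominus> u \<in> square_ideal R K I0" by (rule square_ideal.base)
  then show ?thesis using ideal_minus_cancel[OF s1 iu(2) w(1)] by (simp add: K_def)
qed

end

context flat_step
begin

lemma square_ideal_carrier: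
  assumes "r \<in> carrier R" "ideal V R"
  shows "r \<in> square_ideal R (carrier R) V"
proof -
  have "\<zero> \<oplus> r \<otimes> (\<one> \<otimes> \<one>) \<in> square_ideal R (carrier R) V"
    using assms ideal_rules(2)[OF assms(2)] by (intro square_ideal.intros) auto
  then show ?thesis using assms(1) by simp
qed

text \<open>Here \<open>x\<close> lies in the colon ideal, so the additional generator
  \<open>x^2\<close> of \<open>V2\<close> is already one of the squares.\<close>

lemma flat_containing_x:
  assumes I: "ideal I R" "I1 \<subseteq> I" and a: "a \<in> carrier R" and r: "r \<in> carrier R"
    and mem: "(a \<otimes> a) \<otimes> r \<in> square_ideal R I I0"
  shows "r \<in> square_ideal R (ideal_colon R I a) I0"
proof -
  have K: "ideal (ideal_colon R I a) R" "I \<subseteq> ideal_colon R I a"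
    using ideal_colon_ideal ideal_colon_superset I a by auto
  note KR = ideal_rules[OF K(1)]
  note k0 = square_ideal_ideal[OF KR(1) I0]
  have "r \<in> square_ideal R (ideal_colon R I a) V2"
    using frobenius_flatD[OF flat_V2 I a r square_ideal_mono[OF subset_refl sup2(1) mem]] .
  moreover have "V2 \<subseteq> square_ideal R (ideal_colon R I a) I0"
    by (rule ideal_adjoin_minimal[OF k0]) (use square_ideal_superset[OF KR(1) I0] sup1(2) I(2) K(2) in auto)
  then have "square_ideal R (ideal_colon R I a) V2 \<subseteq> square_ideal R (ideal_colon R I a) I0"
    by (rule square_ideal_minimal[OF k0]) (rule square_ideal_superset(2)[OF KR(1) I0])
  ultimately show ?thesis by blast
qed

text \<open>Writing \<open>a h = i + x q\<close> with \<open>i \<in> I\<close> makes \<open>h \<mapsto> q\<close> a relation rather than a map; it is replaced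
  by the module of pairs \<open>(h, q)\<close>, to which \<open>semilinear_kernel\<close> is applied with \<open>\<phi> = snd\<close>.\<close>

lemma flat_containing_power:
  assumes "ideal I R" "I0 \<subseteq> I" "x [^] (n::nat) \<in> I" "a \<in> carrier R" "r \<in> carrier R"
    "(a \<otimes> a) \<otimes> r \<in> square_ideal R I I0"
  shows "r \<in> square_ideal R (ideal_colon R I a) I0"
  using assms
proof (induction n arbitrary: I a r)
  case 0
  have "I = carrier R" using ideal.one_imp_carrier[OF 0(1)] 0(3) by simp
  then have "ideal_colon R I a = carrier R" using 0(4) by (auto simp: ideal_colon_def)
  then show ?case using square_ideal_carrier[OF 0(5) I0] by simp
next
  case (Suc n)
  note I = Suc.prems(1,2) and a = Suc.prems(4) and r = Suc.prems(5) and mem = Suc.prems(6)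
  note IR = ideal_rules[OF I(1)]
  \<comment> \<open>These are the outer terms of the exact sequence from \<open>R / (I : x)\<close>
    by multiplication with \<open>x\<close> to \<open>R / I\<close> and on to
    \<open>R / (I + x)\<close>. The ideal \<open>I : x\<close> contains \<open>x^n\<close>, so the
    induction hypothesis covers it; \<open>I + (x)\<close> contains \<open>x\<close>.\<close>
  define I' where "I' = ideal_colon R I x"
  define I'' where "I'' = ideal_adjoin R I x"
  define K1 where "K1 = ideal_colon R I a"
  define V' where "V' = square_ideal R I' I0"
  have I': "ideal I' R" "I \<subseteq> I'" unfolding I'_def using ideal_colon_ideal ideal_colon_superset I xc by auto
  have I'': "ideal I'' R" "I \<subseteq> I''" "x \<in> I''" unfolding I''_def using ideal_adjoin_ideal ideal_adjoin_superset I xc by auto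
  have K1: "ideal K1 R" "I \<subseteq> K1" unfolding K1_def using ideal_colon_ideal ideal_colon_superset I a by auto
  note I'R = ideal_rules[OF I'(1)] and K1R = ideal_rules[OF K1(1)]
  have V': "ideal V' R" unfolding V'_def by (rule square_ideal_ideal[OF I'R(1) I0])
  have sK1: "ideal (square_ideal R K1 I0) R" by (rule square_ideal_ideal[OF K1R(1) I0])
  have sI: "ideal (square_ideal R I I0) R" by (rule square_ideal_ideal[OF IR(1) I0])
  note V'R = ideal_rules[OF V'] and sK1R = ideal_rules[OF sK1] and sIR = ideal_rules[OF sI]
  have xnI': "x [^] n \<in> I'" using Suc.prems(3) xc by (simp add: I'_def ideal_colon_def m_comm)
  \<comment> \<open>The induction hypothesis concerns all ideals above \<open>I'\<close>, so it is
    flatness of the Frobenius map from \<open>R / I'\<close> to \<open>R / V'\<close>.\<close>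
  have flat': "frobenius_flat R I' V'"
    unfolding frobenius_flat_def
  proof (intro allI impI)
    fix L b s assume L: "ideal L R" "I' \<subseteq> L" and b: "b \<in> carrier R" and s: "s \<in> carrier R"
      and m: "(b \<otimes> b) \<otimes> s \<in> square_ideal R L V'"
    note LR = ideal_rules[OF L(1)]
    have "V' \<subseteq> square_ideal R L I0" unfolding V'_def using square_ideal_mono[OF L(2) subset_refl] by blast
    then have "square_ideal R L V' \<subseteq> square_ideal R L I0"
      by (rule square_ideal_minimal[OF square_ideal_ideal[OF LR(1) I0]]) (rule square_ideal_superset(2)[OF LR(1) I0])
    then have "s \<in> square_ideal R (ideal_colon R L b) I0"
      using Suc.IH[OF L(1) _ _ b s] m L(2) I(2) I'(2) xnI' by blast
    moreover have "I0 \<subseteq> V'" unfolding V'_def by (rule square_ideal_superset(1)[OF I'R(1) I0])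
    ultimately show "s \<in> square_ideal R (ideal_colon R L b) V'" using square_ideal_mono[OF subset_refl] by blast
  qed
  let ?RR = "regular_module R"
  let ?P = "prod_module ?RR ?RR"
  have P: "module R ?P" by (rule prod_module_module[OF regular_module_module regular_module_module])
  interpret P: module R ?P by (rule P)
  define \<gamma> where "\<gamma> = (\<lambda>u::'a \<times> 'a. (fst u \<otimes> fst u, snd u \<otimes> snd u))"
  define K where "K = {u \<in> carrier R \<times> carrier R. a \<otimes> fst u \<ominus> x \<otimes> snd u \<in> I}"
  define N where "N = square_ideal R K1 I0 \<times> V'"
  have K: "submodule K R ?P"
  proof (rule P.submodule_criterion)
    show "\<zero>\<^bsub>?P\<^esub> \<in> K" using a xc IR(2) by (simp add: K_def minus_eq)
    show "u \<oplus>\<^bsub>?P\<^esub> v \<in> K" if "u \<in> K" "v \<in> K" for u v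
    proof -
      have c: "fst u \<in> carrier R" "snd u \<in> carrier R" "fst v \<in> carrier R" "snd v \<in> carrier R" using that by (auto simp: K_def)
      have "a \<otimes> (fst u \<oplus> fst v) \<ominus> x \<otimes> (snd u \<oplus> snd v) = (a \<otimes> fst u \<ominus> x \<otimes> snd u) \<oplus> (a \<otimes> fst v \<ominus> x \<otimes> snd v)"
        using c a xc by algebra
      then show ?thesis using c that IR(4) by (simp add: K_def)
    qed
    show "b \<odot>\<^bsub>?P\<^esub> u \<in> K" if "b \<in> carrier R" "u \<in> K" for b u
    proof -
      have c: "fst u \<in> carrier R" "snd u \<in> carrier R" using that by (auto simp: K_def)
      have "a \<otimes> (b \<otimes> fst u) \<ominus> x \<otimes> (b \<otimes> snd u) = b \<otimes> (a \<otimes> fst u \<ominus> x \<otimes> snd u)" using c a xc that(1) by algebra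
      then show ?thesis using c that IR(7) by (simp add: K_def)
    qed
  qed (auto simp: K_def)
  have N: "submodule N R ?P"
    by (rule P.submodule_criterion) (use V'R sK1R in \<open>auto simp: N_def\<close>)
  have snd: "snd \<in> module_hom R ?P ?RR" by (rule module_homI) auto
  have gc: "\<gamma> u \<in> carrier ?P" if "u \<in> K" for u using that by (auto simp: \<gamma>_def K_def)
  have Ncar: "\<gamma> ` K \<union> N \<subseteq> carrier ?P" using gc P.submodule_rules(1)[OF N] by blast
  note span = P.submodule_rules[OF P.module_span_submodule[OF Ncar]] and sup = P.module_span_superset[OF Ncar]
  have "r \<in> square_ideal R (ideal_colon R I'' a) I0"
  proof (rule flat_containing_x[OF I''(1) _ a r])
    show "I1 \<subseteq> I''" using ideal_adjoin_minimal[OF I''(1) _ I''(3)] I(2) I''(2) by blast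
    show "(a \<otimes> a) \<otimes> r \<in> square_ideal R I'' I0" using square_ideal_mono[OF I''(2) subset_refl mem] .
  qed
  \<comment> \<open>Each \<open>h\<close> is paired with a \<open>q\<close>, and \<open>s\<close>
    collects the \<open>q^2\<close> with the coefficients that build \<open>r\<close> from the
    \<open>h^2\<close>. In characteristic 2 the square of \<open>a h - x q\<close> is
    \<open>a^2 h^2 + x^2 q^2\<close>, so the stated sum lies in \<open>I^[2] + I0\<close>.\<close>
  then have "\<exists>s\<in>carrier R. (r, s) \<in> module_span R ?P (\<gamma> ` K \<union> N) \<and>
      (a \<otimes> a) \<otimes> r \<oplus> (x \<otimes> x) \<otimes> s \<in> square_ideal R I I0"
  proof induction
    case (base i)
    have ic: "i \<in> carrier R" using base I0R by blast
    have "(i, \<zero>) \<in> N" using base V'R(2) by (simp add: N_def square_ideal.base)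
    moreover have "(a \<otimes> a) \<otimes> i \<oplus> (x \<otimes> x) \<otimes> \<zero> \<in> square_ideal R I I0"
      using I0R(7)[of "a \<otimes> a" i] base a xc ic by (auto intro: square_ideal.base)
    ultimately show ?case using sup by blast
  next
    case (step g c h)
    then obtain s where s: "s \<in> carrier R" "(g, s) \<in> module_span R ?P (\<gamma> ` K \<union> N)"
      "(a \<otimes> a) \<otimes> g \<oplus> (x \<otimes> x) \<otimes> s \<in> square_ideal R I I0" by blast
    have gcar: "g \<in> carrier R" using span(3)[OF s(2)] by simp
    have h: "h \<in> carrier R" "a \<otimes> h \<in> I''" using step(3) by (auto simp: ideal_colon_def)
    then obtain i q where iq: "i \<in> I" "q \<in> carrier R" "a \<otimes> h = i \<oplus> q \<otimes> x" by (auto simp: I''_def ideal_adjoin_def)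
    have ic: "i \<in> carrier R" using iq IR by blast
    have "a \<otimes> h \<ominus> x \<otimes> q = i" unfolding iq(3) using ic iq(2) xc by algebra
    then have hqK: "(h, q) \<in> K" using h iq by (simp add: K_def)
    have "(g, s) \<oplus>\<^bsub>?P\<^esub> c \<odot>\<^bsub>?P\<^esub> \<gamma> (h, q) \<in> module_span R ?P (\<gamma> ` K \<union> N)"
      using s(2) step(2) hqK by (intro module_span.step) auto
    then have 1: "(g \<oplus> c \<otimes> (h \<otimes> h), s \<oplus> c \<otimes> (q \<otimes> q)) \<in> module_span R ?P (\<gamma> ` K \<union> N)" by (simp add: \<gamma>_def)
    have "(a \<otimes> a) \<otimes> (g \<oplus> c \<otimes> (h \<otimes> h)) \<oplus> (x \<otimes> x) \<otimes> (s \<oplus> c \<otimes> (q \<otimes> q))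
        = ((a \<otimes> a) \<otimes> g \<oplus> (x \<otimes> x) \<otimes> s) \<oplus> c \<otimes> ((a \<otimes> h) \<otimes> (a \<otimes> h) \<oplus> (q \<otimes> x) \<otimes> (q \<otimes> x))"
      using a xc h(1) iq(2) gcar s(1) step(2) by algebra
    also have "(a \<otimes> h) \<otimes> (a \<otimes> h) \<oplus> (q \<otimes> x) \<otimes> (q \<otimes> x) = i \<otimes> i"
      unfolding iq(3) using square_add[of i "q \<otimes> x"] ic iq(2) xc double_zero[of "(q \<otimes> x) \<otimes> (q \<otimes> x)"] by (simp add: a_assoc)
    also have "((a \<otimes> a) \<otimes> g \<oplus> (x \<otimes> x) \<otimes> s) \<oplus> c \<otimes> (i \<otimes> i) \<in> square_ideal R I I0"
      by (rule square_ideal.step[OF s(3) step(2) iq(1)])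
    finally show ?case using 1 s(1) iq(2) step(2) by (intro bexI[of _ "s \<oplus> c \<otimes> (q \<otimes> q)"]) auto
  qed
  then obtain s where s: "s \<in> carrier R" "(r, s) \<in> module_span R ?P (\<gamma> ` K \<union> N)"
    "(a \<otimes> a) \<otimes> r \<oplus> (x \<otimes> x) \<otimes> s \<in> square_ideal R I I0" by blast
  have "(x \<otimes> x) \<otimes> s \<in> square_ideal R I I0"
    using ideal_add_cancel[OF sI mem _ s(3)] xc s(1) by simp
  then have sV': "s \<in> V'" unfolding V'_def I'_def using square_ideal_divide_square[OF I s(1)] by blast
  have "(r, s) \<in> module_span R ?P (\<gamma> ` {u \<in> K. snd u \<in> I'} \<union> N)"
  proof (rule semilinear_kernel[OF flat' I'(1) V' _ P P K N snd snd gc _ _ _ _ _ s(2)])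
    show "y \<otimes> y \<in> V'" if "y \<in> I'" for y unfolding V'_def by (rule square_ideal_superset(2)[OF I'R(1) I0 that])
    show "\<exists>n\<in>N. \<gamma> (u \<oplus>\<^bsub>?P\<^esub> v) = (\<gamma> u \<oplus>\<^bsub>?P\<^esub> \<gamma> v) \<oplus>\<^bsub>?P\<^esub> n" if "u \<in> K" "v \<in> K" for u v
      using that V'R(2) sK1R(2) by (intro bexI[of _ "(\<zero>, \<zero>)"]) (auto simp: \<gamma>_def K_def N_def square_add)
    show "\<gamma> (b \<odot>\<^bsub>?P\<^esub> u) = (b \<otimes> b) \<odot>\<^bsub>?P\<^esub> \<gamma> u" if "b \<in> carrier R" "u \<in> K" for b u
      using that by (auto simp: \<gamma>_def K_def m_ac)
    show "snd (\<gamma> u) = snd u \<otimes> snd u" for u by (simp add: \<gamma>_def)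
    show "snd n \<in> V'" if "n \<in> N" for n using that by (auto simp: N_def)
    show "snd (r, s) \<in> V'" using sV' by simp
    \<comment> \<open>For \<open>x y\<close> in \<open>I\<close> and a pair \<open>(h, q)\<close>
      one has \<open>a y h = y (a h - x q) + q (x y)\<close>, so \<open>y h\<close> lies in
      \<open>I : a\<close>. This dictates the first component of \<open>N\<close>.\<close>
    show "v \<odot>\<^bsub>?P\<^esub> \<gamma> u \<in> N" if v: "v \<in> V'" and u: "u \<in> K" for v u
    proof -
      have uc: "fst u \<in> carrier R" "snd u \<in> carrier R" "a \<otimes> fst u \<ominus> x \<otimes> snd u \<in> I" using u by (auto simp: K_def)
      have "v \<otimes> (snd u \<otimes> snd u) \<in> V'" using V'R(8)[OF _ v] uc by simp
      moreover have "v \<otimes> (fst u \<otimes> fst u) \<in> square_ideal R K1 I0"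
        using v[unfolded V'_def]
      proof induction
        case (base i)
        then show ?case using I0R(8)[of "fst u \<otimes> fst u" i] uc by (auto intro: square_ideal.base)
      next
        case (step g c y)
        have y: "y \<in> carrier R" "x \<otimes> y \<in> I" using step(3) by (auto simp: I'_def ideal_colon_def)
        have gcar: "g \<in> carrier R" using V'R(3) step(1) by (simp add: V'_def)
        have "a \<otimes> (y \<otimes> fst u) = y \<otimes> (a \<otimes> fst u \<ominus> x \<otimes> snd u) \<oplus> snd u \<otimes> (x \<otimes> y)" using a y(1) uc(1,2) xc by algebra
        also have "\<dots> \<in> I" by (intro IR(4,7) y uc)
        finally have "y \<otimes> fst u \<in> K1" using y(1) uc(1) by (simp add: K1_def ideal_colon_def)
        moreover have "(g \<oplus> c \<otimes> (y \<otimes> y)) \<otimes> (fst u \<otimes> fst u) = g \<otimes> (fst u \<otimes> fst u) \<oplus> c \<otimes> ((y \<otimes> fst u) \<otimes> (y \<otimes> fst u))"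
          using gcar step(2) y(1) uc(1) by algebra
        ultimately show ?case using square_ideal.step[OF step(4,2)] by simp
      qed
      ultimately show ?thesis by (simp add: N_def \<gamma>_def)
    qed
  qed
  moreover have "module_span R ?P (\<gamma> ` {u \<in> K. snd u \<in> I'} \<union> N) \<subseteq> square_ideal R K1 I0 \<times> carrier R"
  proof (rule P.module_span_minimal)
    show "submodule (square_ideal R K1 I0 \<times> carrier R) R ?P"
      by (rule P.submodule_criterion) (use sK1R in auto)
    show "\<gamma> ` {u \<in> K. snd u \<in> I'} \<union> N \<subseteq> square_ideal R K1 I0 \<times> carrier R"
    proof (rule Un_least)
      show "N \<subseteq> square_ideal R K1 I0 \<times> carrier R" unfolding N_def using V'R(1) by blast
      \<comment> \<open>If \<open>q\<close> is in \<open>I : x\<close>, then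
        \<open>a h = (a h - x q) + x q\<close> is in \<open>I\<close>, so only squares from
        \<open>I : a\<close> remain in the first coordinate.\<close>
      show "\<gamma> ` {u \<in> K. snd u \<in> I'} \<subseteq> square_ideal R K1 I0 \<times> carrier R"
      proof
        fix w assume "w \<in> \<gamma> ` {u \<in> K. snd u \<in> I'}"
        then obtain u where u: "u \<in> K" "snd u \<in> I'" "w = \<gamma> u" by blast
        have uc: "fst u \<in> carrier R" "snd u \<in> carrier R" "a \<otimes> fst u \<ominus> x \<otimes> snd u \<in> I" using u by (auto simp: K_def)
        have "x \<otimes> snd u \<in> I" using u(2) by (simp add: I'_def ideal_colon_def)
        moreover have "a \<otimes> fst u = (a \<otimes> fst u \<ominus> x \<otimes> snd u) \<oplus> x \<otimes> snd u" using uc(1,2) a xc by algebra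
        ultimately have "a \<otimes> fst u \<in> I" using IR(4)[OF uc(3)] by metis
        then have "fst u \<in> K1" using uc by (simp add: K1_def ideal_colon_def)
        then show "w \<in> square_ideal R K1 I0 \<times> carrier R"
          unfolding u(3) \<gamma>_def using square_ideal_superset(2)[OF K1R(1) I0] uc by simp
      qed
    qed
  qed
  ultimately show ?case by (auto simp: K1_def)
qed

text \<open>\<open>I\<close> is approximated by \<open>I + (x^k)\<close>, which contains a power of
  \<open>x\<close>. For \<open>k\<close> large against \<open>n\<close>, every element of
  \<open>(I + (x^k)) : a\<close> is an element of \<open>I : a\<close> plus a multiple of
  \<open>x^n\<close>, so its square lies in \<open>J + (x^n)\<close>. Intersecting over
  \<open>n\<close> leaves \<open>J\<close>.\<close>

theorem flat_lift: "frobenius_flat R I0 I0"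
  unfolding frobenius_flat_def
proof (intro allI impI)
  fix I a r
  assume I: "ideal I R" "I0 \<subseteq> I" and a: "a \<in> carrier R" and r: "r \<in> carrier R"
    and mem: "(a \<otimes> a) \<otimes> r \<in> square_ideal R I I0"
  note IR = ideal_rules[OF I(1)]
  define K where "K = ideal_colon R I a"
  have K: "ideal K R" unfolding K_def by (rule ideal_colon_ideal[OF I(1) a])
  note KR = ideal_rules[OF K]
  define J where "J = square_ideal R K I0"
  have J: "ideal J R" unfolding J_def by (rule square_ideal_ideal[OF KR(1) I0])
  have "r \<in> J"
  proof (rule local_krull_intersection[OF J xm r])
    fix n :: nat
    have xn: "x [^] n \<in> carrier R" using xc by simp
    \<comment> \<open>The ideal is chosen so that membership of \<open>x^k w\<close> reads
      \<open>x^k w = j + t x^n a\<close>; the difference \<open>h - t x^n\<close> is then the part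
      of \<open>h\<close> inside \<open>I : a\<close>.\<close>
    let ?A = "ideal_adjoin R I (x [^] n \<otimes> a)"
    have A: "ideal ?A R" using ideal_adjoin_ideal[OF I(1)] xn a by simp
    note AR = ideal_rules[OF A] and IA = ideal_adjoin_superset[OF I(1), of "x [^] n \<otimes> a"]
    obtain k :: nat where k: "\<And>m w. m \<ge> k \<Longrightarrow> w \<in> carrier R \<Longrightarrow> x [^] m \<otimes> w \<in> ?A \<Longrightarrow> x [^] k \<otimes> w \<in> ?A"
      using colon_pow_stable[OF A xc] by blast
    have xk: "x [^] k \<in> carrier R" using xc by simp
    let ?Ik = "ideal_adjoin R I (x [^] k)"
    have Ik: "ideal ?Ik R" "I \<subseteq> ?Ik" "x [^] k \<in> ?Ik" using ideal_adjoin_ideal[OF I(1)] ideal_adjoin_superset[OF I(1)] xk by auto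
    have aJ: "ideal (ideal_adjoin R J (x [^] n)) R" by (rule ideal_adjoin_ideal[OF J xn])
    note JA = ideal_adjoin_superset[OF J xn]
    have "r \<in> square_ideal R (ideal_colon R ?Ik a) I0"
      using flat_containing_power[OF Ik(1) _ Ik(3) a r square_ideal_mono[OF Ik(2) subset_refl mem]] I(2) Ik(2) by blast
    moreover have "square_ideal R (ideal_colon R ?Ik a) I0 \<subseteq> ideal_adjoin R J (x [^] n)"
    proof (rule square_ideal_minimal[OF aJ])
      show "I0 \<subseteq> ideal_adjoin R J (x [^] n)" using JA(1) square_ideal_superset(1)[OF KR(1) I0] unfolding J_def by blast
      fix h assume "h \<in> ideal_colon R ?Ik a"
      then have h: "h \<in> carrier R" "a \<otimes> h \<in> ?Ik" by (auto simp: ideal_colon_def)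
      then obtain i w where iw: "i \<in> I" "w \<in> carrier R" "a \<otimes> h = i \<oplus> w \<otimes> x [^] k" by (auto simp: ideal_adjoin_def)
      have ic: "i \<in> carrier R" using iw IR by blast
      have "x [^] n \<otimes> i \<oplus> x [^] (n + k) \<otimes> w = x [^] n \<otimes> (i \<oplus> w \<otimes> x [^] k)"
        unfolding nat_pow_mult[OF xc, symmetric] using ic iw(2) xn xk by algebra
      also have "\<dots> = h \<otimes> (x [^] n \<otimes> a)" unfolding iw(3)[symmetric] using h(1) a xn by (simp add: m_ac)
      also have "\<dots> \<in> ?A" using AR(7)[OF h(1)] IA(2) xn a by simp
      finally have sum: "x [^] n \<otimes> i \<oplus> x [^] (n + k) \<otimes> w \<in> ?A" .
      have "x [^] n \<otimes> i \<in> ?A" using AR(7)[OF xn] IA(1) xn a iw(1) by auto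
      then have "x [^] (n + k) \<otimes> w \<in> ?A" by (rule ideal_add_cancel[OF A _ _ sum]) (use iw(2) xc in simp)
      then have "x [^] k \<otimes> w \<in> ?A" by (rule k[OF _ iw(2), rotated]) simp
      then obtain j t where jt: "j \<in> I" "t \<in> carrier R" "x [^] k \<otimes> w = j \<oplus> t \<otimes> (x [^] n \<otimes> a)" by (auto simp: ideal_adjoin_def)
      have jc: "j \<in> carrier R" using jt IR by blast
      define y where "y = h \<ominus> t \<otimes> x [^] n"
      have yc: "y \<in> carrier R" unfolding y_def using h jt xn by simp
      have "a \<otimes> y = a \<otimes> h \<ominus> t \<otimes> (x [^] n \<otimes> a)" unfolding y_def using a h(1) jt(2) xn by algebra
      also have "a \<otimes> h = i \<oplus> x [^] k \<otimes> w" unfolding iw(3) using iw(2) xk by (simp add: m_comm)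
      also have "i \<oplus> x [^] k \<otimes> w \<ominus> t \<otimes> (x [^] n \<otimes> a) = i \<oplus> j" unfolding jt(3) using ic jc jt(2) xn a by algebra
      finally have "y \<in> K" using yc IR(4)[OF iw(1) jt(1)] by (simp add: K_def ideal_colon_def)
      then have yJ: "y \<otimes> y \<in> J" unfolding J_def by (rule square_ideal_superset(2)[OF KR(1) I0])
      have "h = y \<oplus> t \<otimes> x [^] n" unfolding y_def using h(1) jt(2) xn by algebra
      then have "h \<otimes> h = y \<otimes> y \<oplus> (t \<otimes> t \<otimes> x [^] n) \<otimes> x [^] n"
        using square_add[of y "t \<otimes> x [^] n"] yc jt(2) xn by (simp add: m_ac)
      moreover have "t \<otimes> t \<otimes> x [^] n \<in> carrier R" using jt(2) xn by simp
      ultimately show "h \<otimes> h \<in> ideal_adjoin R J (x [^] n)" unfolding ideal_adjoin_def using yJ by blast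
    qed
    ultimately show "r \<in> ideal_adjoin R J (x [^] n)" by blast
  qed
  then show "r \<in> square_ideal R (ideal_colon R I a) I0" by (simp add: J_def K_def)
qed

end

section \<open>From regular sequences to regular local rings\<close>

lemma (in noetherian_local_ring) frobenius_flat_of_regular_sequence:
  assumes "char_two_cring R" "regular_sequence R \<mm> I xs" "ideal I R"
  shows "frobenius_flat R I I"
  using assms(2,3)
proof (induction xs arbitrary: I)
  case Nil
  interpret char_two_cring R by (rule assms)
  have "I = \<mm>" using Nil by simp
  note mR = ideal_rules[OF ideal_maximal]
  \<comment> \<open>Modulo \<open>\<mm>\<close> there are only two ideals. If \<open>a\<close> is in
    \<open>I\<close> the colon ideal is the whole ring; otherwise \<open>I\<close> is
    \<open>\<mm>\<close> and primality cancels \<open>a^2\<close>.\<close>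
  have "frobenius_flat R \<mm> \<mm>"
    unfolding frobenius_flat_def
  proof (intro allI impI)
    fix I a r
    assume I: "ideal I R" "\<mm> \<subseteq> I" and a: "a \<in> carrier R" and r: "r \<in> carrier R"
      and mem: "(a \<otimes> a) \<otimes> r \<in> square_ideal R I \<mm>"
    have top: "r \<in> square_ideal R (carrier R) \<mm>"
    proof -
      have "\<zero> \<oplus> r \<otimes> (\<one> \<otimes> \<one>) \<in> square_ideal R (carrier R) \<mm>" using r mR(2) by (intro square_ideal.intros) auto
      then show ?thesis using r by simp
    qed
    show "r \<in> square_ideal R (ideal_colon R I a) \<mm>"
    proof (cases "a \<in> I")
      case True
      then have "ideal_colon R I a = carrier R" using ideal_rules(8)[OF I(1)] by (auto simp: ideal_colon_def)
      then show ?thesis using top by simp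
    next
      case False
      then have "I = \<mm>" using proper_subset_maximal[OF I(1)] I(2) a by blast
      then have "(a \<otimes> a) \<otimes> r \<in> \<mm>"
        using square_ideal_minimal[OF ideal_maximal subset_refl, of \<mm>] mR(3,7) mem by blast
      then have "r \<in> \<mm>"
        using primeideal_rules(3)[OF prime_maximal] False \<open>I = \<mm>\<close> a r by (meson m_closed)
      then show ?thesis by (rule square_ideal.base)
    qed
  qed
  then show ?case using \<open>I = \<mm>\<close> by simp
next
  case (Cons x xs)
  interpret char_two_cring R by (rule assms)
  have x: "x \<in> \<mm>" "\<And>r. r \<in> carrier R \<Longrightarrow> x \<otimes> r \<in> I \<Longrightarrow> r \<in> I"
    "regular_sequence R \<mm> (ideal_adjoin R I x) xs"
    using Cons.prems(1) by simp_all
  have "x \<in> carrier R" using ideal_rules(3)[OF ideal_maximal x(1)] .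
  then have "frobenius_flat R (ideal_adjoin R I x) (ideal_adjoin R I x)"
    using Cons.IH[OF x(3) ideal_adjoin_ideal[OF Cons.prems(2)]] by simp
  from flat_step_axioms.intro[OF Cons.prems(2) x(1,2) this] have "flat_step_axioms R \<mm> I x" .
  then interpret flat_step R \<mm> I x
    by (rule flat_step.intro[OF noetherian_local_ring_axioms char_two_cring_axioms])
  show ?case by (rule flat_lift)
qed

lemma chain_prime_chain:
  assumes "maximalideal \<mm> R" "cring R" "\<And>q. primeideal q R \<Longrightarrow> q \<subseteq> \<mm>"
    and "\<And>i. i \<le> n \<Longrightarrow> primeideal (p i) R" "\<And>i. i < n \<Longrightarrow> p i \<subset> p (Suc i)"
  shows "\<exists>q. prime_chain R \<mm> q n"
proof -
  \<comment> \<open>A chain counted by the dimension may end below \<open>\<mm>\<close>; replacing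
    its top member by \<open>\<mm>\<close> keeps the length.\<close>
  have "prime_chain R \<mm> (if k = 0 then \<mm> else p (n - k)) k" if "k \<le> n" for k
    using that
  proof (induction k)
    case 0
    then show ?case using prime_chain.base[OF cring.maximalideal_prime[OF assms(2,1)]] by simp
  next
    case (Suc k)
    have eq: "Suc (n - Suc k) = n - k" using Suc.prems by simp
    have "p (n - Suc k) \<subset> p (n - k)" using assms(5)[of "n - Suc k"] Suc.prems eq by simp
    moreover have "p n \<subseteq> \<mm>" using assms(3,4) by simp
    ultimately have "p (n - Suc k) \<subset> (if k = 0 then \<mm> else p (n - k))" by (cases "k = 0") auto
    then show ?case using prime_chain.step[OF assms(4)] Suc by simp
  qed
  then show ?thesis by blast
qed

text \<open>An infinite set of extended naturals has supremum infinity, so a finite supremum of a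
  nonempty set is a maximum.\<close>

lemma enat_Sup_attained:
  assumes "A \<noteq> {}" "Sup A = enat d"
  shows "enat d \<in> A"
proof -
  have "finite A" using assms by (auto simp: Sup_enat_def split: if_splits)
  then have "Sup A = Max A" using assms by (simp add: Sup_enat_def)
  then show ?thesis using assms Max_in[OF \<open>finite A\<close> assms(1)] by simp
qed

lemma has_characteristic_two:
  fixes R (structure)
  assumes "cring R" "has_characteristic R 2"
  shows "char_two_cring R"
proof -
  interpret cring R by fact
  have "[(2::nat)] \<cdot> \<one> = \<zero>" using assms(2) by (simp add: has_characteristic_def)
  then have one: "\<one> \<oplus> \<one> = \<zero>" by (simp add: numeral_2_eq_2)
  show ?thesis
  proof
    fix x assume x: "x \<in> carrier R"
    then have "x \<oplus> x = (\<one> \<oplus> \<one>) \<otimes> x" by (simp add: l_distr)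
    then show "x \<oplus> x = \<zero>" using x one by simp
  qed
qed

text \<open>Regularity supplies a chain of primes whose length equals the number of generators of
  the maximal ideal. This is the extremal case treated by
  \<open>regular_sequence_of_prime_chain\<close>, so the generators form a regular sequence from
  zero to \<open>\<mm>\<close>.\<close>

theorem regular_local_ring_frobenius_flat:
  fixes R (structure)
  assumes "regular_local_ring R" "has_characteristic R 2"
  shows "frobenius_flat R {\<zero>} {\<zero>}"
proof -
  have cr: "cring R" and no: "noetherian_ring R" and ex1: "\<exists>!\<mm>. maximalideal \<mm> R"
    using assms(1) by (auto simp: regular_local_ring_def local_ring_def)
  interpret noetherian_cring R using cr no by (simp add: noetherian_cring_def)
  obtain S where S: "S \<subseteq> carrier R" "finite S" "enat (card S) = krull_dim R" "maximalideal (Idl S) R"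
    using assms(1) by (auto simp: regular_local_ring_def)
  define \<mm> where "\<mm> = Idl S"
  \<comment> \<open>Uniqueness of the maximal ideal yields the inclusion once some maximal ideal
    above \<open>I\<close> is found, here through the Noetherian property.\<close>
  have local: "I \<subseteq> \<mm>" if I: "ideal I R" "I \<noteq> carrier R" for I
  proof -
    let ?S = "{J. ideal J R \<and> I \<subseteq> J \<and> J \<noteq> carrier R}"
    have "?S \<noteq> {}" using I by blast
    then have "\<exists>M\<in>?S. \<forall>J\<in>?S. M \<subseteq> J \<longrightarrow> J = M" by (rule exists_maximal_ideal_in) simp
    then obtain M where MS: "M \<in> ?S" and Mmax: "\<forall>J\<in>?S. M \<subseteq> J \<longrightarrow> J = M" by (rule bexE)
    have M: "ideal M R" "I \<subseteq> M" "M \<noteq> carrier R" using MS by simp_all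
    have max: "J = M" if "ideal J R" "I \<subseteq> J" "J \<noteq> carrier R" "M \<subseteq> J" for J
      using Mmax[THEN bspec, of J] that by simp
    have "maximalideal M R"
    proof (rule maximalidealI[OF M(1)])
      show "carrier R \<noteq> M" using M(3) by simp
      fix J assume "ideal J R" "M \<subseteq> J" "J \<subseteq> carrier R"
      then show "J = M \<or> J = carrier R" using max[of J] M(2) by auto
    qed
    then have "M = \<mm>" using ex1 S(4) unfolding \<mm>_def by metis
    then show ?thesis using M by simp
  qed
  have "maximalideal \<mm> R" unfolding \<mm>_def by (rule S(4))
  from noetherian_local_ring_axioms.intro[OF this local]
  interpret noetherian_local_ring R \<mm>
    by (rule noetherian_local_ring.intro[OF noetherian_cring_axioms])
  have primes: "q \<subseteq> \<mm>" if "primeideal q R" for q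
  proof (rule local[OF primeideal_rules(1)[OF that]])
    show "q \<noteq> carrier R" using primeideal_rules(2)[OF that] one_closed by metis
  qed
  define A where "A = {enat n | n. \<exists>p :: nat \<Rightarrow> 'a set.
     (\<forall>i\<le>n. primeideal (p i) R) \<and> (\<forall>i<n. p i \<subset> p (Suc i))}"
  \<comment> \<open>The empty set also has a finite supremum in \<open>enat\<close>, so a chain has
    to be exhibited before the maximum can be taken.\<close>
  have "enat 0 \<in> A" unfolding A_def using prime_maximal by (intro CollectI exI[of _ 0] conjI exI[of _ "\<lambda>_. \<mm>"]) auto
  then have "enat (card S) \<in> A" using enat_Sup_attained[of A "card S"] S(3) by (auto simp: A_def krull_dim_def)
  then obtain p :: "nat \<Rightarrow> 'a set" where "\<forall>i\<le>card S. primeideal (p i) R" "\<forall>i<card S. p i \<subset> p (Suc i)"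
    by (auto simp: A_def)
  then obtain q where q: "prime_chain R \<mm> q (card S)"
    using chain_prime_chain[OF maximal is_cring primes, of "card S" p] by blast
  obtain xs where xs: "set xs = S" "length xs = card S"
    using finite_distinct_list[OF S(2)] distinct_card by metis
  have S\<mm>: "S \<subseteq> \<mm>" unfolding \<mm>_def by (rule genideal_self[OF S(1)])
  have xsc: "set xs \<subseteq> carrier R" using xs S(1) by simp
  note mR = ideal_rules[OF ideal_maximal]
  have "foldl (ideal_adjoin R) {\<zero>} xs = \<mm>"
  proof
    show "foldl (ideal_adjoin R) {\<zero>} xs \<subseteq> \<mm>"
      by (rule adjoin_list_minimal[OF ideal_maximal]) (use mR(2) S\<mm> xs in auto)
    show "\<mm> \<subseteq> foldl (ideal_adjoin R) {\<zero>} xs"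
      unfolding \<mm>_def using genideal_minimal[OF adjoin_list_ideal[OF zeroideal xsc]]
        adjoin_list_superset(2)[OF zeroideal xsc] xs by simp
  qed
  moreover have "{\<zero>} \<subseteq> q" using ideal_rules(2)[OF primeideal_rules(1)[OF prime_chain_prime(1)[OF q]]] by simp
  ultimately have "regular_sequence R \<mm> {\<zero>} xs"
    using regular_sequence_of_prime_chain[OF zeroideal xsc] q xs by simp
  then show ?thesis
    using frobenius_flat_of_regular_sequence[OF has_characteristic_two[OF cr assms(2)] _ zeroideal] by blast
qed

section \<open>The homology of the Tate construction\<close>

context module
begin

lemma span_Un_submodule:
  assumes X: "X \<subseteq> carrier M" and N: "submodule N R M" and g: "g \<in> module_span R M (X \<union> N)"
  obtains h n where "h \<in> module_span R M X" "n \<in> N" "g = h \<oplus>\<^bsub>M\<^esub> n"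
proof -
  note NR = submodule_rules[OF N] and XR = submodule_rules[OF module_span_submodule[OF X]]
  have "\<exists>h n. h \<in> module_span R M X \<and> n \<in> N \<and> g = h \<oplus>\<^bsub>M\<^esub> n"
    using g
  proof induction
    case zero
    then show ?case using XR(2) NR(2) M.r_zero[OF M.zero_closed] by metis
  next
    case (step g a x)
    then obtain h n where hn: "h \<in> module_span R M X" "n \<in> N" "g = h \<oplus>\<^bsub>M\<^esub> n" by blast
    have car: "h \<in> carrier M" "n \<in> carrier M" "x \<in> carrier M" using hn XR NR step(3) X by auto
    show ?case
    proof (cases "x \<in> N")
      case True
      have "g \<oplus>\<^bsub>M\<^esub> a \<odot>\<^bsub>M\<^esub> x = h \<oplus>\<^bsub>M\<^esub> (n \<oplus>\<^bsub>M\<^esub> a \<odot>\<^bsub>M\<^esub> x)"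
        unfolding hn(3) using car step(2) by (simp add: M.a_assoc)
      moreover have "n \<oplus>\<^bsub>M\<^esub> a \<odot>\<^bsub>M\<^esub> x \<in> N" by (intro NR(4,7) hn step(2) True)
      ultimately show ?thesis using hn(1) by blast
    next
      case False
      then have "x \<in> X" using step(3) by blast
      have "g \<oplus>\<^bsub>M\<^esub> a \<odot>\<^bsub>M\<^esub> x = (h \<oplus>\<^bsub>M\<^esub> a \<odot>\<^bsub>M\<^esub> x) \<oplus>\<^bsub>M\<^esub> n"
        unfolding hn(3) using car step(2) by (simp add: M.a_ac)
      then show ?thesis using module_span.step[OF hn(1) step(2) \<open>x \<in> X\<close>] hn(2) by blast
    qed
  qed
  then show ?thesis using that by blast
qed

lemma zero_submodule: "submodule {\<zero>\<^bsub>M\<^esub>} R M"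
  by (rule submodule_criterion) auto

lemma hom_image_submodule:
  assumes "module R N" "h \<in> module_hom R M N" "submodule H R M"
  shows "submodule (h ` H) R N"
proof -
  interpret N: module R N by fact
  note HR = submodule_rules[OF assms(3)] and hH = module_homD[OF assms(2)]
  show ?thesis
  proof (rule N.submodule_criterion)
    show "h ` H \<subseteq> carrier N" using HR hH by auto
    have "h \<zero>\<^bsub>M\<^esub> = \<zero>\<^bsub>N\<^esub>" by (rule module_hom_zero[OF module_axioms assms(1,2)])
    then show "\<zero>\<^bsub>N\<^esub> \<in> h ` H" using HR(2) by (metis imageI)
    show "a \<oplus>\<^bsub>N\<^esub> b \<in> h ` H" if a: "a \<in> h ` H" and b: "b \<in> h ` H" for a b
    proof -
      obtain x y where xy: "x \<in> H" "y \<in> H" "a = h x" "b = h y" using a b by blast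
      then have "a \<oplus>\<^bsub>N\<^esub> b = h (x \<oplus>\<^bsub>M\<^esub> y)" using hH(2) HR(3) by simp
      then show ?thesis using HR(4)[OF xy(1,2)] by blast
    qed
    show "r \<odot>\<^bsub>N\<^esub> a \<in> h ` H" if r: "r \<in> carrier R" and a: "a \<in> h ` H" for r a
    proof -
      obtain x where x: "x \<in> H" "a = h x" using a by blast
      then have "r \<odot>\<^bsub>N\<^esub> a = h (r \<odot>\<^bsub>M\<^esub> x)" using hH(3) HR(3) r by simp
      then show ?thesis using HR(7)[OF r x(1)] by blast
    qed
  qed
qed

lemma hom_kernel_submodule:
  assumes "module R N" "h \<in> module_hom R M N" "submodule H R M"
  shows "submodule {x \<in> H. h x = \<zero>\<^bsub>N\<^esub>} R M"
proof -
  interpret N: module R N by fact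
  note HR = submodule_rules[OF assms(3)] and hH = module_homD[OF assms(2)]
  show ?thesis
    by (rule submodule_criterion)
      (use HR hH module_hom_zero[OF module_axioms assms(1,2)] in \<open>auto simp: subset_eq\<close>)
qed

end

section \<open>Modules in characteristic two\<close>

locale char_two_module = char_two_cring R + module R M for R (structure) and M (structure)
begin

lemma double: "x \<in> carrier M \<Longrightarrow> x \<oplus>\<^bsub>M\<^esub> x = \<zero>\<^bsub>M\<^esub>"
proof -
  assume x: "x \<in> carrier M"
  then have "x \<oplus>\<^bsub>M\<^esub> x = (\<one> \<oplus> \<one>) \<odot>\<^bsub>M\<^esub> x" by (simp add: smult_l_distr)
  then show ?thesis using x double_zero[OF one_closed] by simp
qed

lemma double_left: "x \<in> carrier M \<Longrightarrow> y \<in> carrier M \<Longrightarrow> x \<oplus>\<^bsub>M\<^esub> (x \<oplus>\<^bsub>M\<^esub> y) = y"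
  by (simp add: M.a_assoc[symmetric] double)

lemmas char_two_ac = M.a_ac double double_left

lemma sum_zero_eq: "x \<in> carrier M \<Longrightarrow> y \<in> carrier M \<Longrightarrow> x \<oplus>\<^bsub>M\<^esub> y = \<zero>\<^bsub>M\<^esub> \<Longrightarrow> x = y"
  by (metis double double_left M.r_zero)

end

lemma (in char_two_cring) char_two_moduleI: "module R M \<Longrightarrow> char_two_module R M"
  by (simp add: char_two_module_def char_two_cring_axioms)

text \<open>Modules \<open>T\<close> and \<open>G\<close> with the universal properties of \<open>P \<otimes> P\<close> and \<open>R\<^sub>F \<otimes> P\<close> that are
  needed, where \<open>P\<close> has a triangular basis \<open>e\<close> with dual functionals \<open>\<phi>\<close>.\<close>

locale tate_setup = char_two_cring R + P: module R P + T: module R T + G: module R G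
  for R :: "('a, 'k) ring_scheme" (structure) and P :: "('a, 'b, 'x) module_scheme" and T :: "('a, 't, 'y) module_scheme"
    and G :: "('a, 'g, 'z) module_scheme" +
  fixes d :: "'b \<Rightarrow> 'b" and tens :: "'b \<Rightarrow> 'b \<Rightarrow> 't" and D :: "'t \<Rightarrow> 't" and \<gamma> :: "'b \<Rightarrow> 'g"
    and \<delta> :: "'g \<Rightarrow> 'g" and e :: "nat \<Rightarrow> 'b" and \<phi> :: "nat \<Rightarrow> 'b \<Rightarrow> 'a" and n :: nat
  assumes flat: "frobenius_flat R {\<zero>} {\<zero>}"
    and d: "d \<in> module_hom R P P" and dd: "x \<in> carrier P \<Longrightarrow> d (d x) = \<zero>\<^bsub>P\<^esub>"
    and tens_closed [simp]: "x \<in> carrier P \<Longrightarrow> y \<in> carrier P \<Longrightarrow> tens x y \<in> carrier T"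
    and tens_add_left: "x \<in> carrier P \<Longrightarrow> x' \<in> carrier P \<Longrightarrow> y \<in> carrier P \<Longrightarrow>
      tens (x \<oplus>\<^bsub>P\<^esub> x') y = tens x y \<oplus>\<^bsub>T\<^esub> tens x' y"
    and tens_add_right: "x \<in> carrier P \<Longrightarrow> y \<in> carrier P \<Longrightarrow> y' \<in> carrier P \<Longrightarrow>
      tens x (y \<oplus>\<^bsub>P\<^esub> y') = tens x y \<oplus>\<^bsub>T\<^esub> tens x y'"
    and tens_smult_left: "a \<in> carrier R \<Longrightarrow> x \<in> carrier P \<Longrightarrow> y \<in> carrier P \<Longrightarrow>
      tens (a \<odot>\<^bsub>P\<^esub> x) y = a \<odot>\<^bsub>T\<^esub> tens x y"
    and tens_smult_right: "a \<in> carrier R \<Longrightarrow> x \<in> carrier P \<Longrightarrow> y \<in> carrier P \<Longrightarrow>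
      tens x (a \<odot>\<^bsub>P\<^esub> y) = a \<odot>\<^bsub>T\<^esub> tens x y"
    and tens_span: "carrier T \<subseteq> module_span R T {tens x y | x y. x \<in> carrier P \<and> y \<in> carrier P}"
    and D: "D \<in> module_hom R T T"
    and D_tens: "x \<in> carrier P \<Longrightarrow> y \<in> carrier P \<Longrightarrow>
      D (tens x y) = (tens (d x) y \<oplus>\<^bsub>T\<^esub> tens x (d y)) \<oplus>\<^bsub>T\<^esub> (tens x y \<oplus>\<^bsub>T\<^esub> tens y x)"
    and contract_right: "f \<in> module_hom R P (regular_module R) \<Longrightarrow>
      \<exists>\<rho>\<in>module_hom R T P. \<forall>x\<in>carrier P. \<forall>y\<in>carrier P. \<rho> (tens x y) = f y \<odot>\<^bsub>P\<^esub> x"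
    and contract_left: "f \<in> module_hom R P (regular_module R) \<Longrightarrow>
      \<exists>\<rho>\<in>module_hom R T P. \<forall>x\<in>carrier P. \<forall>y\<in>carrier P. \<rho> (tens x y) = f x \<odot>\<^bsub>P\<^esub> y"
    and gamma_closed [simp]: "x \<in> carrier P \<Longrightarrow> \<gamma> x \<in> carrier G"
    and gamma_add: "x \<in> carrier P \<Longrightarrow> y \<in> carrier P \<Longrightarrow> \<gamma> (x \<oplus>\<^bsub>P\<^esub> y) = \<gamma> x \<oplus>\<^bsub>G\<^esub> \<gamma> y"
    and gamma_smult: "a \<in> carrier R \<Longrightarrow> x \<in> carrier P \<Longrightarrow> \<gamma> (a \<odot>\<^bsub>P\<^esub> x) = (a \<otimes> a) \<odot>\<^bsub>G\<^esub> \<gamma> x"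
    and gamma_span: "carrier G \<subseteq> module_span R G (\<gamma> ` carrier P)"
    and delta: "\<delta> \<in> module_hom R G G"
    and delta_gamma: "x \<in> carrier P \<Longrightarrow> \<delta> (\<gamma> x) = \<gamma> (d x)"
    and frobenius_functional: "f \<in> module_hom R P (regular_module R) \<Longrightarrow>
      \<exists>\<Lambda>\<in>module_hom R G (regular_module R). \<forall>x\<in>carrier P. \<Lambda> (\<gamma> x) = f x \<otimes> f x"
    and e: "i < n \<Longrightarrow> e i \<in> carrier P"
    and e_span: "carrier P \<subseteq> module_span R P (e ` {..<n})"
    and e_flag: "i < n \<Longrightarrow> d (e i) \<in> module_span R P (e ` {..<i})"
    and phi: "i < n \<Longrightarrow> \<phi> i \<in> module_hom R P (regular_module R)"
    and phi_e: "i < n \<Longrightarrow> \<phi> i (e i) = \<one>"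
    and phi_below: "i < n \<Longrightarrow> x \<in> module_span R P (e ` {..<i}) \<Longrightarrow> \<phi> i x = \<zero>"
begin

section \<open>Truncation along the basis and the relation between cycles\<close>

sublocale P2: char_two_module R P by (rule char_two_moduleI) unfold_locales
sublocale T2: char_two_module R T by (rule char_two_moduleI) unfold_locales
sublocale G2: char_two_module R G by (rule char_two_moduleI) unfold_locales

lemmas dH [simp] = module_homD[OF d] and DH [simp] = module_homD[OF D] and deltaH [simp] = module_homD[OF delta]

lemmas moduleP = P.module_axioms and moduleT = T.module_axioms and moduleG = G.module_axioms
  and moduleR = regular_module_module

lemma TG: "module R (prod_module T G)"
  by (rule prod_module_module[OF moduleT moduleG])

definition E where "E k = module_span R P (e ` {..<k})"
definition Z where "Z k = {x \<in> E k. d x = \<zero>\<^bsub>P\<^esub>}"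
definition TE where "TE k = module_span R T {tens x y | x y. x \<in> E k \<and> y \<in> E k}"
definition GE where "GE k = module_span R G (\<gamma> ` E k)"
definition sq where "sq z = (tens z z, \<gamma> z)"
text \<open>The graph of the wanted map from \<open>1 \<otimes> z\<close> to
  \<open>z \<otimes> z\<close>, spanned over \<open>R\<close>. Squaring is neither additive nor
  linear on cycles, so only the spanned relation makes sense before boundaries are divided
  out.\<close>

definition L where "L k = module_span R (prod_module T G) (sq ` Z k)"

lemma E_submodule: "k \<le> n \<Longrightarrow> submodule (E k) R P"
  unfolding E_def by (rule P.module_span_submodule) (use e in auto)

lemmas ER = P.submodule_rules[OF E_submodule]

lemma En: "E n = carrier P"
  using ER(1)[of n] e_span by (auto simp: E_def)

lemma E_mono: "j \<le> k \<Longrightarrow> E j \<subseteq> E k"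
  unfolding E_def by (rule module_span_mono) auto

lemma e_E: "k < n \<Longrightarrow> e k \<in> E (Suc k)"
  unfolding E_def using P.module_span_superset[of "e ` {..<Suc k}"] e by fastforce

lemma E_0: "E 0 = {\<zero>\<^bsub>P\<^esub>}"
  using P.module_span_minimal[OF P.zero_submodule, of "{}"] module_span.zero[of P R "{}"] by (auto simp: E_def)

lemma E_Suc:
  assumes "k < n" "x \<in> E (Suc k)"
  obtains y r where "y \<in> E k" "r \<in> carrier R" "x = y \<oplus>\<^bsub>P\<^esub> r \<odot>\<^bsub>P\<^esub> e k"
proof -
  have "x \<in> module_span R P (insert (e k) (e ` {..<k}))" using assms(2) by (simp add: E_def lessThan_Suc)
  then show ?thesis
  proof (rule P.module_span_insert[OF e[OF assms(1)], rotated])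
    show "e ` {..<k} \<subseteq> carrier P" using e assms(1) by auto
    show thesis if "y \<in> module_span R P (e ` {..<k})" "r \<in> carrier R" "x = y \<oplus>\<^bsub>P\<^esub> r \<odot>\<^bsub>P\<^esub> e k" for y r
      using that by (rule \<open>\<And>y r. \<lbrakk>y \<in> E k; r \<in> carrier R; x = y \<oplus>\<^bsub>P\<^esub> r \<odot>\<^bsub>P\<^esub> e k\<rbrakk> \<Longrightarrow> thesis\<close>[unfolded E_def])
  qed
qed

lemma phi_E: "k < n \<Longrightarrow> x \<in> E k \<Longrightarrow> \<phi> k x = \<zero>"
  by (simp add: phi_below E_def)

lemmas phiH = module_homD[OF phi, simplified]

lemma E_Suc_phi:
  assumes "k < n" "x \<in> E (Suc k)" "\<phi> k x = \<zero>"
  shows "x \<in> E k"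
proof -
  obtain y r where y: "y \<in> E k" "r \<in> carrier R" "x = y \<oplus>\<^bsub>P\<^esub> r \<odot>\<^bsub>P\<^esub> e k" using E_Suc[OF assms(1,2)] .
  have yc: "y \<in> carrier P" using ER(3)[OF _ y(1)] assms(1) by simp
  have "\<phi> k x = r" unfolding y(3) using phiH[OF assms(1)] yc y(2) e assms(1) phi_E[OF assms(1) y(1)] phi_e by simp
  then show ?thesis using y yc e assms by simp
qed

text \<open>Each functional is normalised on its own basis element and vanishes on the earlier ones,
  so coefficients are removed from the last index downwards.\<close>

lemma phi_separates:
  assumes "x \<in> carrier P" "\<And>i. i < n \<Longrightarrow> \<phi> i x = \<zero>"
  shows "x = \<zero>\<^bsub>P\<^esub>"
proof -
  have "x \<in> E (n - k)" for k
  proof (induction k)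
    case 0
    then show ?case using assms(1) En by simp
  next
    case (Suc k)
    show ?case
    proof (cases "k < n")
      case True
      then have "n - k = Suc (n - Suc k)" by simp
      then show ?thesis using E_Suc_phi[of "n - Suc k" x] Suc assms(2) True by simp
    next
      case False
      then show ?thesis using Suc by simp
    qed
  qed
  from this[of n] show ?thesis using E_0 by simp
qed

text \<open>At \<open>k = 0\<close> the truncated subtraction returns \<open>E 0\<close>, which is
  right because \<open>E 0\<close> is zero.\<close>

lemma d_E:
  assumes "k \<le> n" "x \<in> E k"
  shows "d x \<in> E (k - 1)"
  using assms(2)[unfolded E_def]
proof induction
  case zero
  have "k - 1 \<le> n" using assms(1) by simp
  then show ?case using module_hom_zero[OF moduleP moduleP d] ER(2) by simp
next
  case (step g a y)
  then obtain i where i: "i < k" "y = e i" by auto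
  have ec: "e i \<in> carrier P" using e i assms(1) by simp
  have gc: "g \<in> carrier P" using step(1) ER(3)[of k g] assms(1) by (simp add: E_def)
  have k1: "k - 1 \<le> n" using assms(1) by simp
  have "d (e i) \<in> E i" using e_flag i assms(1) by (simp add: E_def)
  moreover have "i \<le> k - 1" using i by simp
  ultimately have "d (e i) \<in> E (k - 1)" using E_mono by blast
  then have "d g \<oplus>\<^bsub>P\<^esub> a \<odot>\<^bsub>P\<^esub> d (e i) \<in> E (k - 1)" by (intro ER(4,7)[OF k1] step(2,4))
  then show ?case using gc ec step(2) i(2) by simp
qed

lemma d_E': "k \<le> n \<Longrightarrow> x \<in> E k \<Longrightarrow> d x \<in> E k"
  using d_E[of k x] E_mono[of "k - 1" k] by auto

lemma Z_submodule: "k \<le> n \<Longrightarrow> submodule (Z k) R P"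
  unfolding Z_def by (rule P.hom_kernel_submodule[OF moduleP d E_submodule])

lemma ZE: "z \<in> Z k \<Longrightarrow> z \<in> E k" "z \<in> Z k \<Longrightarrow> d z = \<zero>\<^bsub>P\<^esub>"
  by (auto simp: Z_def)

lemma ZP: "k \<le> n \<Longrightarrow> z \<in> Z k \<Longrightarrow> z \<in> carrier P"
  by (rule ER(3)[OF _ ZE(1)])

lemma tens_E_subset: "k \<le> n \<Longrightarrow> {tens x y | x y. x \<in> E k \<and> y \<in> E k} \<subseteq> carrier T"
  using ER(1)[of k] by (auto intro!: tens_closed)

lemma TE_submodule: "k \<le> n \<Longrightarrow> submodule (TE k) R T"
  unfolding TE_def by (rule T.module_span_submodule[OF tens_E_subset])

lemmas TER = T.submodule_rules[OF TE_submodule]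

lemma tens_TE: "k \<le> n \<Longrightarrow> x \<in> E k \<Longrightarrow> y \<in> E k \<Longrightarrow> tens x y \<in> TE k"
  unfolding TE_def using T.module_span_superset[OF tens_E_subset] by blast

lemma TE_mono: "j \<le> k \<Longrightarrow> TE j \<subseteq> TE k"
  unfolding TE_def using E_mono[of j k] by (intro module_span_mono) blast

lemma TEn: "TE n = carrier T"
  using TER(1)[of n] tens_span unfolding TE_def En by blast

lemma gamma_E_subset: "k \<le> n \<Longrightarrow> \<gamma> ` E k \<subseteq> carrier G"
  using ER(1)[of k] by auto

lemma GE_submodule: "k \<le> n \<Longrightarrow> submodule (GE k) R G"
  unfolding GE_def by (rule G.module_span_submodule[OF gamma_E_subset])

lemmas GER = G.submodule_rules[OF GE_submodule]

lemma gamma_GE: "k \<le> n \<Longrightarrow> x \<in> E k \<Longrightarrow> \<gamma> x \<in> GE k"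
  unfolding GE_def using G.module_span_superset[OF gamma_E_subset] by blast

lemma GE_mono: "j \<le> k \<Longrightarrow> GE j \<subseteq> GE k"
  unfolding GE_def using E_mono[of j k] by (intro module_span_mono) blast

lemma GEn: "GE n = carrier G"
  using GER(1)[of n] gamma_span unfolding GE_def En by blast

lemma tens_zero [simp]: "x \<in> carrier P \<Longrightarrow> tens x \<zero>\<^bsub>P\<^esub> = \<zero>\<^bsub>T\<^esub>" "x \<in> carrier P \<Longrightarrow> tens \<zero>\<^bsub>P\<^esub> x = \<zero>\<^bsub>T\<^esub>"
  using tens_smult_right[of \<zero> x "\<zero>\<^bsub>P\<^esub>"] tens_smult_left[of \<zero> "\<zero>\<^bsub>P\<^esub>" x] by simp_all

lemma gamma_zero [simp]: "\<gamma> \<zero>\<^bsub>P\<^esub> = \<zero>\<^bsub>G\<^esub>"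
  using gamma_smult[of \<zero> "\<zero>\<^bsub>P\<^esub>"] by simp

lemma D_zero [simp]: "D \<zero>\<^bsub>T\<^esub> = \<zero>\<^bsub>T\<^esub>"
  by (rule module_hom_zero[OF moduleT moduleT D])

lemma delta_zero [simp]: "\<delta> \<zero>\<^bsub>G\<^esub> = \<zero>\<^bsub>G\<^esub>"
  by (rule module_hom_zero[OF moduleG moduleG delta])

lemma DD_tens:
  assumes "x \<in> carrier P" "y \<in> carrier P"
  shows "D (D (tens x y)) = \<zero>\<^bsub>T\<^esub>"
  using assms by (simp add: D_tens dd T2.char_two_ac)

lemma DD:
  assumes "t \<in> carrier T"
  shows "D (D t) = \<zero>\<^bsub>T\<^esub>"
proof -
  have "t \<in> module_span R T {tens x y | x y. x \<in> carrier P \<and> y \<in> carrier P}" using tens_span assms by blast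
  then show ?thesis
  proof induction
    case (step g a x)
    have "g \<in> carrier T" by (rule subsetD[OF T.module_span_carrier step(1)]) auto
    then show ?case using step DD_tens by auto
  qed simp
qed

lemma delta_delta:
  assumes "g \<in> carrier G"
  shows "\<delta> (\<delta> g) = \<zero>\<^bsub>G\<^esub>"
proof -
  have "g \<in> module_span R G (\<gamma> ` carrier P)" using gamma_span assms by blast
  then show ?thesis
  proof induction
    case (step g a x)
    have "g \<in> carrier G" by (rule subsetD[OF G.module_span_carrier step(1)]) auto
    then show ?case using step by (auto simp: delta_gamma dd)
  qed simp
qed

lemma D_TE:
  assumes "k \<le> n" "t \<in> TE k"
  shows "D t \<in> TE k"
  using assms(2)[unfolded TE_def]
proof induction
  case zero
  then show ?case using TER(2)[OF assms(1)] by simp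
next
  case (step g a t)
  then obtain x y where xy: "x \<in> E k" "y \<in> E k" "t = tens x y" by blast
  have c: "x \<in> carrier P" "y \<in> carrier P" using ER(3)[OF assms(1)] xy by auto
  have gc: "g \<in> carrier T" using step(1) TER(3)[OF assms(1)] by (simp add: TE_def)
  have "D t \<in> TE k" unfolding xy(3) D_tens[OF c]
    by (intro TER(4)[OF assms(1)] tens_TE assms(1) xy d_E')
  then have "D g \<oplus>\<^bsub>T\<^esub> a \<odot>\<^bsub>T\<^esub> D t \<in> TE k" by (intro TER(4,7)[OF assms(1)] step(2,4))
  then show ?case using gc c step(2) xy(3) by simp
qed

text \<open>\<open>x \<otimes> x + x \<otimes> d x\<close> lifts \<open>x\<close> compatibly with the differentials; it is additive only up to
  boundaries.\<close>

lemma D_lift: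
  assumes "x \<in> carrier P"
  shows "D (tens x x \<oplus>\<^bsub>T\<^esub> tens x (d x)) = tens (d x) (d x)"
  using assms by (simp add: D_tens dd T2.char_two_ac)

lemma D_cycle_tens:
  assumes "x \<in> carrier P" "y \<in> carrier P" "d x = \<zero>\<^bsub>P\<^esub>" "d y = \<zero>\<^bsub>P\<^esub>"
  shows "D (tens x y) = tens x y \<oplus>\<^bsub>T\<^esub> tens y x"
  using assms by (simp add: D_tens)

text \<open>For cycles the cross terms are exactly the boundary of \<open>x \<otimes> y\<close>;
  this is the effect of the summand \<open>1 + \<tau>\<close> of the differential.\<close>

lemma tens_square_add:
  assumes "x \<in> carrier P" "y \<in> carrier P" "d x = \<zero>\<^bsub>P\<^esub>" "d y = \<zero>\<^bsub>P\<^esub>"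
  shows "tens (x \<oplus>\<^bsub>P\<^esub> y) (x \<oplus>\<^bsub>P\<^esub> y) = (tens x x \<oplus>\<^bsub>T\<^esub> tens y y) \<oplus>\<^bsub>T\<^esub> D (tens x y)"
  using assms by (simp add: D_cycle_tens tens_add_left tens_add_right T.M.a_ac)

lemma sq_Z_subset: "k \<le> n \<Longrightarrow> sq ` Z k \<subseteq> carrier (prod_module T G)"
  using ZP[of k] by (auto simp: sq_def)

lemma L_submodule: "k \<le> n \<Longrightarrow> submodule (L k) R (prod_module T G)"
  unfolding L_def by (rule module.module_span_submodule[OF TG sq_Z_subset])

lemmas LR = module.submodule_rules[OF TG L_submodule]

lemma sq_L: "k \<le> n \<Longrightarrow> z \<in> Z k \<Longrightarrow> sq z \<in> L k"
  unfolding L_def using module.module_span_superset[OF TG sq_Z_subset] by blast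

lemma Z_mono: "j \<le> k \<Longrightarrow> Z j \<subseteq> Z k"
  using E_mono[of j k] by (auto simp: Z_def)

lemma L_mono: "j \<le> k \<Longrightarrow> L j \<subseteq> L k"
  unfolding L_def using Z_mono[of j k] by (intro module_span_mono) blast

lemma L_car: "k \<le> n \<Longrightarrow> (t, g) \<in> L k \<Longrightarrow> t \<in> carrier T" "k \<le> n \<Longrightarrow> (t, g) \<in> L k \<Longrightarrow> g \<in> carrier G"
  using LR(3) by fastforce+

lemma L_add: "k \<le> n \<Longrightarrow> (t, g) \<in> L k \<Longrightarrow> (t', g') \<in> L k \<Longrightarrow> (t \<oplus>\<^bsub>T\<^esub> t', g \<oplus>\<^bsub>G\<^esub> g') \<in> L k"
  using LR(4)[of k "(t, g)" "(t', g')"] by simp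

lemma L_smult: "k \<le> n \<Longrightarrow> a \<in> carrier R \<Longrightarrow> (t, g) \<in> L k \<Longrightarrow> (a \<odot>\<^bsub>T\<^esub> t, a \<odot>\<^bsub>G\<^esub> g) \<in> L k"
  using LR(7)[of k a "(t, g)"] by simp

lemma L_induct [consumes 2, case_names zero step]:
  assumes "k \<le> n" "(t, g) \<in> L k" "Q \<zero>\<^bsub>T\<^esub> \<zero>\<^bsub>G\<^esub>"
    and "\<And>t g a z. (t, g) \<in> L k \<Longrightarrow> t \<in> carrier T \<Longrightarrow> g \<in> carrier G \<Longrightarrow> Q t g \<Longrightarrow> a \<in> carrier R \<Longrightarrow> z \<in> Z k \<Longrightarrow>
      z \<in> carrier P \<Longrightarrow> Q (t \<oplus>\<^bsub>T\<^esub> a \<odot>\<^bsub>T\<^esub> tens z z) (g \<oplus>\<^bsub>G\<^esub> a \<odot>\<^bsub>G\<^esub> \<gamma> z)"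
  shows "Q t g"
proof -
  have "Q (fst u) (snd u)" if "u \<in> L k" for u
    using that[unfolded L_def]
  proof induction
    case zero
    then show ?case using assms(3) by simp
  next
    case (step u a x)
    then obtain z where z: "z \<in> Z k" "x = sq z" by blast
    have u: "(fst u, snd u) \<in> L k" using step(1) by (simp add: L_def)
    show ?case
      using assms(4)[OF u L_car[OF assms(1) u] step(4,2) z(1) ZP[OF assms(1) z(1)]] by (simp add: z(2) sq_def)
  qed
  then show ?thesis using assms(2) by fastforce
qed

lemma L_cycle:
  assumes "k \<le> n" "(t, g) \<in> L k"
  shows "t \<in> TE k \<and> D t = \<zero>\<^bsub>T\<^esub>"
  using assms
proof (induction rule: L_induct)
  case zero
  then show ?case using TER(2)[OF assms(1)] by simp
next
  case (step t g a z)
  have "D (tens z z) = \<zero>\<^bsub>T\<^esub>" using step(6) ZE(2)[OF step(5)] by (simp add: D_cycle_tens T2.double)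
  moreover have "t \<oplus>\<^bsub>T\<^esub> a \<odot>\<^bsub>T\<^esub> tens z z \<in> TE k"
    by (intro TER(4,7)[OF assms(1)] conjunct1[OF step(7)] step(4) tens_TE assms(1) ZE(1)[OF step(5)])
  ultimately show ?case using step by simp
qed

lemma span_gamma_L:
  assumes "k \<le> n" "g \<in> module_span R G (\<gamma> ` Z k)"
  shows "\<exists>t. (t, g) \<in> L k"
  using assms(2)
proof induction
  case zero
  then show ?case using LR(2)[OF assms(1)] by auto
next
  case (step g a x)
  then obtain t z where h: "(t, g) \<in> L k" "z \<in> Z k" "x = \<gamma> z" by blast
  have "(a \<odot>\<^bsub>T\<^esub> tens z z, a \<odot>\<^bsub>G\<^esub> \<gamma> z) \<in> L k"
    using L_smult[OF assms(1) step(2)] sq_L[OF assms(1) h(2)] by (simp add: sq_def)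
  then show ?case using L_add[OF assms(1) h(1)] h(3) by blast
qed

text \<open>Flatness for finitely many functionals: \<open>semilinear_kernel\<close> with both
  ideals zero is applied to one functional after the other, each time on the kernel left by the
  previous ones.\<close>

lemma semilinear_kernel_iterated:
  fixes H :: "('a, 'h, 'w) module_scheme" and m :: nat
  assumes H: "module R H" and K: "submodule K R P" and N: "submodule N R H"
    and f: "\<And>i. i < m \<Longrightarrow> f i \<in> module_hom R P (regular_module R)"
    and F: "\<And>i. i < m \<Longrightarrow> F i \<in> module_hom R H (regular_module R)"
    and gc: "\<And>x. x \<in> K \<Longrightarrow> \<eta> x \<in> carrier H"
    and gadd: "\<And>x y. x \<in> K \<Longrightarrow> y \<in> K \<Longrightarrow> \<exists>n\<in>N. \<eta> (x \<oplus>\<^bsub>P\<^esub> y) = (\<eta> x \<oplus>\<^bsub>H\<^esub> \<eta> y) \<oplus>\<^bsub>H\<^esub> n"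
    and gsm: "\<And>a x. a \<in> carrier R \<Longrightarrow> x \<in> K \<Longrightarrow> \<eta> (a \<odot>\<^bsub>P\<^esub> x) = (a \<otimes> a) \<odot>\<^bsub>H\<^esub> \<eta> x"
    and Fg: "\<And>i x. i < m \<Longrightarrow> x \<in> K \<Longrightarrow> F i (\<eta> x) = f i x \<otimes> f i x"
    and FN: "\<And>i n. i < m \<Longrightarrow> n \<in> N \<Longrightarrow> F i n = \<zero>"
    and h: "h \<in> module_span R H (\<eta> ` K \<union> N)" and Fh: "\<And>i. i < m \<Longrightarrow> F i h = \<zero>"
  shows "h \<in> module_span R H (\<eta> ` {x \<in> K. \<forall>i<m. f i x = \<zero>} \<union> N)"
proof -
  have "h \<in> module_span R H (\<eta> ` {x \<in> K. \<forall>i<j. f i x = \<zero>} \<union> N) \<and> submodule {x \<in> K. \<forall>i<j. f i x = \<zero>} R P"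
    if "j \<le> m" for j
    using that
  proof (induction j)
    case 0
    then show ?case using h K by simp
  next
    case (Suc j)
    let ?K = "{x \<in> K. \<forall>i<j. f i x = \<zero>}"
    have jm: "j < m" using Suc.prems by simp
    have IH: "h \<in> module_span R H (\<eta> ` ?K \<union> N)" "submodule ?K R P" using Suc by simp_all
    have eq: "{x \<in> ?K. f j x = \<zero>} = {x \<in> K. \<forall>i<Suc j. f i x = \<zero>}" by (auto simp: less_Suc_eq)
    have "h \<in> module_span R H (\<eta> ` {x \<in> ?K. f j x \<in> {\<zero>}} \<union> N)"
    proof (rule semilinear_kernel[OF flat zeroideal zeroideal _ moduleP H IH(2) N f[OF jm] F[OF jm] _ _ _ _ _ _ IH(1)])
      show "v \<odot>\<^bsub>H\<^esub> \<eta> x \<in> N" if "v \<in> {\<zero>}" "x \<in> ?K" for v x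
      proof -
        have "v \<odot>\<^bsub>H\<^esub> \<eta> x = \<zero>\<^bsub>H\<^esub>" using that gc module.smult_l_null[OF H] by simp
        then show ?thesis using module.submodule_rules(2)[OF H N] by simp
      qed
    qed (use gc gadd gsm Fg FN Fh jm in auto)
    moreover have "submodule {x \<in> ?K. f j x = \<zero>\<^bsub>regular_module R\<^esub>} R P"
      by (rule P.hom_kernel_submodule[OF moduleR f[OF jm] IH(2)])
    ultimately show ?case using eq by simp
  qed
  then show ?thesis by blast
qed

text \<open>A flat pullback preserves kernels. The condition \<open>d x = 0\<close> is tested by the
  coordinates \<open>\<phi> i (d x)\<close>, and the functional that takes the squared value on
  \<open>\<gamma> x\<close> is \<open>\<Lambda> i\<close> after \<open>\<delta>\<close>, which
  vanishes on \<open>g\<close>.\<close>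

lemma GE_cycle:
  assumes "k \<le> n" "g \<in> GE k" "\<delta> g = \<zero>\<^bsub>G\<^esub>"
  shows "g \<in> module_span R G (\<gamma> ` Z k)"
proof -
  have "\<forall>i. \<exists>\<Lambda>. i < n \<longrightarrow> \<Lambda> \<in> module_hom R G (regular_module R) \<and> (\<forall>x\<in>carrier P. \<Lambda> (\<gamma> x) = \<phi> i x \<otimes> \<phi> i x)"
    using frobenius_functional[OF phi] by blast
  then obtain \<Lambda> where Lam: "\<And>i. i < n \<Longrightarrow> \<Lambda> i \<in> module_hom R G (regular_module R)"
    "\<And>i x. i < n \<Longrightarrow> x \<in> carrier P \<Longrightarrow> \<Lambda> i (\<gamma> x) = \<phi> i x \<otimes> \<phi> i x"
    by metis
  have L0: "\<Lambda> i \<zero>\<^bsub>G\<^esub> = \<zero>" if "i < n" for i using module_hom_zero[OF moduleG moduleR Lam(1)[OF that]] by simp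
  have "g \<in> module_span R G (\<gamma> ` {x \<in> E k. \<forall>i<n. \<phi> i (d x) = \<zero>} \<union> {\<zero>\<^bsub>G\<^esub>})"
  proof (rule semilinear_kernel_iterated[OF moduleG E_submodule[OF assms(1)] G.zero_submodule
        module_hom_comp[OF d phi] module_hom_comp[OF delta Lam(1)]])
    show "g \<in> module_span R G (\<gamma> ` E k \<union> {\<zero>\<^bsub>G\<^esub>})"
      using assms(2) module_span_mono[of "\<gamma> ` E k" "\<gamma> ` E k \<union> {\<zero>\<^bsub>G\<^esub>}" R G] by (auto simp: GE_def)
  qed (use ER(3)[OF assms(1)] assms(3) L0 Lam(2) in \<open>auto simp: gamma_add gamma_smult delta_gamma\<close>)
  moreover have "{x \<in> E k. \<forall>i<n. \<phi> i (d x) = \<zero>} = Z k"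
    using phi_separates ER(3)[OF assms(1)] phiH module_hom_zero[OF moduleP moduleR phi] by (auto simp: Z_def)
  ultimately have "g \<in> module_span R G (\<gamma> ` Z k \<union> {\<zero>\<^bsub>G\<^esub>})" by simp
  moreover have "\<gamma> ` Z k \<subseteq> carrier G" using ZP[OF assms(1)] by auto
  ultimately obtain h where "h \<in> module_span R G (\<gamma> ` Z k)" "g = h \<oplus>\<^bsub>G\<^esub> \<zero>\<^bsub>G\<^esub>"
    using G.span_Un_submodule[OF _ G.zero_submodule] by (metis singletonD)
  then show ?thesis using G.module_span_carrier[OF \<open>\<gamma> ` Z k \<subseteq> carrier G\<close>] by auto
qed

end

section \<open>Adding one basis element\<close>

context tate_setup
begin

text \<open>The decomposition \<open>TE (k + 1) = TE k \<oplus> (E k \<otimes> e k) \<oplus> (e k \<otimes> E k) \<oplus> R (e k \<otimes> e k)\<close>.\<close>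

definition quad :: "nat \<Rightarrow> 't \<Rightarrow> 'b \<Rightarrow> 'b \<Rightarrow> 'a \<Rightarrow> 't" where
  "quad k X p q r = ((X \<oplus>\<^bsub>T\<^esub> tens p (e k)) \<oplus>\<^bsub>T\<^esub> tens (e k) q) \<oplus>\<^bsub>T\<^esub> r \<odot>\<^bsub>T\<^esub> tens (e k) (e k)"

lemma quad_closed [simp]:
  assumes "k < n" "X \<in> carrier T" "p \<in> carrier P" "q \<in> carrier P" "r \<in> carrier R"
  shows "quad k X p q r \<in> carrier T"
  using assms e by (simp add: quad_def)

lemma quad_add:
  assumes "k < n" "X \<in> carrier T" "p \<in> carrier P" "q \<in> carrier P" "r \<in> carrier R"
    "X' \<in> carrier T" "p' \<in> carrier P" "q' \<in> carrier P" "r' \<in> carrier R"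
  shows "quad k X p q r \<oplus>\<^bsub>T\<^esub> quad k X' p' q' r'
    = quad k (X \<oplus>\<^bsub>T\<^esub> X') (p \<oplus>\<^bsub>P\<^esub> p') (q \<oplus>\<^bsub>P\<^esub> q') (r \<oplus> r')"
  using assms e by (simp add: quad_def tens_add_left tens_add_right T.smult_l_distr T.M.a_ac)

lemma quad_zero: "k < n \<Longrightarrow> X \<in> carrier T \<Longrightarrow> quad k X \<zero>\<^bsub>P\<^esub> \<zero>\<^bsub>P\<^esub> \<zero> = X"
  using e by (simp add: quad_def)

text \<open>No \<open>e \<otimes> e\<close> occurs in the image, since
  \<open>D (e \<otimes> e)\<close> is \<open>d e \<otimes> e + e \<otimes> d e\<close>; this is how
  \<open>r\<close> enters both mixed coordinates. The swap is responsible for \<open>q\<close> in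
  the first mixed coordinate and \<open>p\<close> in the second.\<close>

lemma D_quad:
  assumes "k < n" "X \<in> carrier T" "p \<in> carrier P" "q \<in> carrier P" "r \<in> carrier R"
  shows "D (quad k X p q r) = quad k (D X \<oplus>\<^bsub>T\<^esub> (tens p (d (e k)) \<oplus>\<^bsub>T\<^esub> tens (d (e k)) q))
    ((d p \<oplus>\<^bsub>P\<^esub> p) \<oplus>\<^bsub>P\<^esub> (q \<oplus>\<^bsub>P\<^esub> r \<odot>\<^bsub>P\<^esub> d (e k))) ((d q \<oplus>\<^bsub>P\<^esub> q) \<oplus>\<^bsub>P\<^esub> (p \<oplus>\<^bsub>P\<^esub> r \<odot>\<^bsub>P\<^esub> d (e k))) \<zero>"
proof -
  note ek = e[OF assms(1)]
  have "D (quad k X p q r) = ((D X \<oplus>\<^bsub>T\<^esub> D (tens p (e k))) \<oplus>\<^bsub>T\<^esub> D (tens (e k) q)) \<oplus>\<^bsub>T\<^esub> r \<odot>\<^bsub>T\<^esub> D (tens (e k) (e k))"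
    using assms ek by (simp add: quad_def)
  also have "D (tens (e k) (e k)) = tens (d (e k)) (e k) \<oplus>\<^bsub>T\<^esub> tens (e k) (d (e k))"
    using ek by (simp add: D_tens T2.double)
  also have "((D X \<oplus>\<^bsub>T\<^esub> D (tens p (e k))) \<oplus>\<^bsub>T\<^esub> D (tens (e k) q)) \<oplus>\<^bsub>T\<^esub> r \<odot>\<^bsub>T\<^esub> (tens (d (e k)) (e k) \<oplus>\<^bsub>T\<^esub> tens (e k) (d (e k)))
    = quad k (D X \<oplus>\<^bsub>T\<^esub> (tens p (d (e k)) \<oplus>\<^bsub>T\<^esub> tens (d (e k)) q))
    ((d p \<oplus>\<^bsub>P\<^esub> p) \<oplus>\<^bsub>P\<^esub> (q \<oplus>\<^bsub>P\<^esub> r \<odot>\<^bsub>P\<^esub> d (e k))) ((d q \<oplus>\<^bsub>P\<^esub> q) \<oplus>\<^bsub>P\<^esub> (p \<oplus>\<^bsub>P\<^esub> r \<odot>\<^bsub>P\<^esub> d (e k))) \<zero>"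
    using assms ek by (simp add: quad_def D_tens tens_add_left tens_add_right tens_smult_left tens_smult_right
        T.smult_r_distr T.M.a_ac)
  finally show ?thesis .
qed

lemma D_tens_e:
  assumes "k < n" "p \<in> carrier P"
  shows "D (tens (e k) p) = quad k (tens (d (e k)) p) p (d p \<oplus>\<^bsub>P\<^esub> p) \<zero>"
  using assms e by (simp add: quad_def D_tens tens_add_right T.M.a_ac)

lemma quad_exists:
  assumes k: "k < n" and t: "t \<in> TE (Suc k)"
  shows "\<exists>X p q r. X \<in> TE k \<and> p \<in> E k \<and> q \<in> E k \<and> r \<in> carrier R \<and> t = quad k X p q r"
  using t[unfolded TE_def]
proof induction
  case zero
  have kn: "k \<le> n" using k by simp
  have "\<zero>\<^bsub>T\<^esub> = quad k \<zero>\<^bsub>T\<^esub> \<zero>\<^bsub>P\<^esub> \<zero>\<^bsub>P\<^esub> \<zero>" using k by (simp add: quad_zero)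
  then show ?case using TER(2)[OF kn] ER(2)[OF kn] by blast
next
  case (step g a t)
  have kn: "k \<le> n" using k by simp
  note ek = e[OF k]
  obtain X p q r where IH: "X \<in> TE k" "p \<in> E k" "q \<in> E k" "r \<in> carrier R" "g = quad k X p q r" using step(4) by blast
  obtain x y where xy: "x \<in> E (Suc k)" "y \<in> E (Suc k)" "t = tens x y" using step(3) by blast
  obtain x' b where x': "x' \<in> E k" "b \<in> carrier R" "x = x' \<oplus>\<^bsub>P\<^esub> b \<odot>\<^bsub>P\<^esub> e k" using E_Suc[OF k xy(1)] .
  obtain y' c where y': "y' \<in> E k" "c \<in> carrier R" "y = y' \<oplus>\<^bsub>P\<^esub> c \<odot>\<^bsub>P\<^esub> e k" using E_Suc[OF k xy(2)] .
  have car: "X \<in> carrier T" "p \<in> carrier P" "q \<in> carrier P" "x' \<in> carrier P" "y' \<in> carrier P"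
    using TER(3)[OF kn IH(1)] ER(3)[OF kn IH(2)] ER(3)[OF kn IH(3)] ER(3)[OF kn x'(1)] ER(3)[OF kn y'(1)] .
  have "a \<odot>\<^bsub>T\<^esub> t = quad k (a \<odot>\<^bsub>T\<^esub> tens x' y') ((a \<otimes> c) \<odot>\<^bsub>P\<^esub> x') ((a \<otimes> b) \<odot>\<^bsub>P\<^esub> y') (a \<otimes> (c \<otimes> b))"
    unfolding xy(3) x'(3) y'(3) quad_def using car ek step(2) x'(2) y'(2)
    by (simp add: tens_add_left tens_add_right tens_smult_left tens_smult_right T.smult_r_distr T.smult_assoc1 T.M.a_ac)
  then have "g \<oplus>\<^bsub>T\<^esub> a \<odot>\<^bsub>T\<^esub> t = quad k (X \<oplus>\<^bsub>T\<^esub> a \<odot>\<^bsub>T\<^esub> tens x' y') (p \<oplus>\<^bsub>P\<^esub> (a \<otimes> c) \<odot>\<^bsub>P\<^esub> x')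
      (q \<oplus>\<^bsub>P\<^esub> (a \<otimes> b) \<odot>\<^bsub>P\<^esub> y') (r \<oplus> a \<otimes> (c \<otimes> b))"
    unfolding IH(5) using quad_add[OF k car(1-3) IH(4)] car step(2) x'(2) y'(2) by simp
  moreover have "X \<oplus>\<^bsub>T\<^esub> a \<odot>\<^bsub>T\<^esub> tens x' y' \<in> TE k" by (intro TER(4,7)[OF kn] IH step(2) tens_TE kn x' y')
  moreover have "p \<oplus>\<^bsub>P\<^esub> (a \<otimes> c) \<odot>\<^bsub>P\<^esub> x' \<in> E k" "q \<oplus>\<^bsub>P\<^esub> (a \<otimes> b) \<odot>\<^bsub>P\<^esub> y' \<in> E k"
    by (intro ER(4,7)[OF kn] IH step(2) x' y' m_closed)+
  moreover have "r \<oplus> a \<otimes> (c \<otimes> b) \<in> carrier R" using IH(4) step(2) x'(2) y'(2) by simp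
  ultimately show ?case by blast
qed

text \<open>Contraction of the second tensor factor with \<open>\<phi> k\<close>. Together with its
  mirror image it proves that the four coordinates of \<open>quad\<close> are unique.\<close>

definition right :: "nat \<Rightarrow> 't \<Rightarrow> 'b" where
  "right k = (SOME \<rho>. \<rho> \<in> module_hom R T P \<and> (\<forall>x\<in>carrier P. \<forall>y\<in>carrier P. \<rho> (tens x y) = \<phi> k y \<odot>\<^bsub>P\<^esub> x))"

definition left :: "nat \<Rightarrow> 't \<Rightarrow> 'b" where
  "left k = (SOME \<rho>. \<rho> \<in> module_hom R T P \<and> (\<forall>x\<in>carrier P. \<forall>y\<in>carrier P. \<rho> (tens x y) = \<phi> k x \<odot>\<^bsub>P\<^esub> y))"

lemma right:
  assumes "k < n"
  shows "right k \<in> module_hom R T P"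
    "x \<in> carrier P \<Longrightarrow> y \<in> carrier P \<Longrightarrow> right k (tens x y) = \<phi> k y \<odot>\<^bsub>P\<^esub> x"
proof -
  have "\<exists>\<rho>. \<rho> \<in> module_hom R T P \<and> (\<forall>x\<in>carrier P. \<forall>y\<in>carrier P. \<rho> (tens x y) = \<phi> k y \<odot>\<^bsub>P\<^esub> x)"
    using contract_right[OF phi[OF assms]] by blast
  note * = someI_ex[OF this, folded right_def]
  show "right k \<in> module_hom R T P" using * by (rule conjunct1)
  show "x \<in> carrier P \<Longrightarrow> y \<in> carrier P \<Longrightarrow> right k (tens x y) = \<phi> k y \<odot>\<^bsub>P\<^esub> x" using conjunct2[OF *] by simp
qed

lemma left:
  assumes "k < n"
  shows "left k \<in> module_hom R T P"
    "x \<in> carrier P \<Longrightarrow> y \<in> carrier P \<Longrightarrow> left k (tens x y) = \<phi> k x \<odot>\<^bsub>P\<^esub> y"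
proof -
  have "\<exists>\<rho>. \<rho> \<in> module_hom R T P \<and> (\<forall>x\<in>carrier P. \<forall>y\<in>carrier P. \<rho> (tens x y) = \<phi> k x \<odot>\<^bsub>P\<^esub> y)"
    using contract_left[OF phi[OF assms]] by blast
  note * = someI_ex[OF this, folded left_def]
  show "left k \<in> module_hom R T P" using * by (rule conjunct1)
  show "x \<in> carrier P \<Longrightarrow> y \<in> carrier P \<Longrightarrow> left k (tens x y) = \<phi> k x \<odot>\<^bsub>P\<^esub> y" using conjunct2[OF *] by simp
qed

lemma contract_TE:
  assumes k: "k < n" and t: "t \<in> TE k"
  shows "right k t = \<zero>\<^bsub>P\<^esub>" "left k t = \<zero>\<^bsub>P\<^esub>"
proof -
  have kn: "k \<le> n" using k by simp
  note rH = module_homD[OF right(1)[OF k]] and lH = module_homD[OF left(1)[OF k]]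
  have "right k t = \<zero>\<^bsub>P\<^esub> \<and> left k t = \<zero>\<^bsub>P\<^esub>"
    using t[unfolded TE_def]
  proof induction
    case zero
    show ?case using module_hom_zero[OF moduleT moduleP right(1)[OF k]] module_hom_zero[OF moduleT moduleP left(1)[OF k]] by simp
  next
    case (step g a t)
    then obtain x y where xy: "x \<in> E k" "y \<in> E k" "t = tens x y" by blast
    have c: "x \<in> carrier P" "y \<in> carrier P" using ER(3)[OF kn xy(1)] ER(3)[OF kn xy(2)] .
    have gc: "g \<in> carrier T" using step(1) TER(3)[OF kn] by (simp add: TE_def)
    show ?case using step gc c rH lH right(2)[OF k] left(2)[OF k] phi_E[OF k xy(1)] phi_E[OF k xy(2)] xy(3) by simp
  qed
  then show "right k t = \<zero>\<^bsub>P\<^esub>" "left k t = \<zero>\<^bsub>P\<^esub>" by auto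
qed

lemma right_quad:
  assumes k: "k < n" and X: "X \<in> TE k" and p: "p \<in> E k" and q: "q \<in> E k" and r: "r \<in> carrier R"
  shows "right k (quad k X p q r) = p \<oplus>\<^bsub>P\<^esub> r \<odot>\<^bsub>P\<^esub> e k" "left k (quad k X p q r) = q \<oplus>\<^bsub>P\<^esub> r \<odot>\<^bsub>P\<^esub> e k"
proof -
  have kn: "k \<le> n" using k by simp
  have car: "X \<in> carrier T" "p \<in> carrier P" "q \<in> carrier P" using TER(3)[OF kn X] ER(3)[OF kn p] ER(3)[OF kn q] .
  note ek = e[OF k]
  note rH = module_homD[OF right(1)[OF k]] and lH = module_homD[OF left(1)[OF k]]
  show "right k (quad k X p q r) = p \<oplus>\<^bsub>P\<^esub> r \<odot>\<^bsub>P\<^esub> e k"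
    unfolding quad_def using car ek r
    by (simp add: rH right(2)[OF k] contract_TE[OF k X] phi_E[OF k p] phi_E[OF k q] phi_e[OF k])
  show "left k (quad k X p q r) = q \<oplus>\<^bsub>P\<^esub> r \<odot>\<^bsub>P\<^esub> e k"
    unfolding quad_def using car ek r
    by (simp add: lH left(2)[OF k] contract_TE[OF k X] phi_E[OF k p] phi_E[OF k q] phi_e[OF k])
qed

text \<open>Contraction yields \<open>p + r e\<close> and \<open>q + r e\<close>. As
  \<open>\<phi> k\<close> vanishes on \<open>E k\<close>, it isolates \<open>r\<close>; then the
  mixed coordinates vanish and only \<open>X\<close> is left.\<close>

lemma quad_zero_iff:
  assumes k: "k < n" and X: "X \<in> TE k" and p: "p \<in> E k" and q: "q \<in> E k" and r: "r \<in> carrier R"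
    and z: "quad k X p q r = \<zero>\<^bsub>T\<^esub>"
  shows "X = \<zero>\<^bsub>T\<^esub>" "p = \<zero>\<^bsub>P\<^esub>" "q = \<zero>\<^bsub>P\<^esub>" "r = \<zero>"
proof -
  have kn: "k \<le> n" using k by simp
  have car: "X \<in> carrier T" "p \<in> carrier P" "q \<in> carrier P" using TER(3)[OF kn X] ER(3)[OF kn p] ER(3)[OF kn q] .
  note ek = e[OF k]
  have 1: "p \<oplus>\<^bsub>P\<^esub> r \<odot>\<^bsub>P\<^esub> e k = \<zero>\<^bsub>P\<^esub>" "q \<oplus>\<^bsub>P\<^esub> r \<odot>\<^bsub>P\<^esub> e k = \<zero>\<^bsub>P\<^esub>"
    using right_quad[OF k X p q r] z module_hom_zero[OF moduleT moduleP right(1)[OF k]]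
      module_hom_zero[OF moduleT moduleP left(1)[OF k]] by simp_all
  have "\<phi> k (p \<oplus>\<^bsub>P\<^esub> r \<odot>\<^bsub>P\<^esub> e k) = r" using phiH[OF k] car ek r phi_E[OF k p] phi_e[OF k] by simp
  then show r0: "r = \<zero>" using 1(1) module_hom_zero[OF moduleP moduleR phi[OF k]] by simp
  show p0: "p = \<zero>\<^bsub>P\<^esub>" and q0: "q = \<zero>\<^bsub>P\<^esub>" using 1 r0 car ek by simp_all
  show "X = \<zero>\<^bsub>T\<^esub>" using z quad_zero[OF k car(1)] by (simp add: r0 p0 q0)
qed

lemma quad_eq:
  assumes k: "k < n" and "X \<in> TE k" "p \<in> E k" "q \<in> E k" "r \<in> carrier R"
    and "X' \<in> TE k" "p' \<in> E k" "q' \<in> E k" "r' \<in> carrier R"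
    and eq: "quad k X p q r = quad k X' p' q' r'"
  shows "X = X'" "p = p'" "q = q'" "r = r'"
proof -
  have kn: "k \<le> n" using k by simp
  have car: "X \<in> carrier T" "p \<in> carrier P" "q \<in> carrier P" "X' \<in> carrier T" "p' \<in> carrier P" "q' \<in> carrier P"
    using TER(3)[OF kn] ER(3)[OF kn] assms by auto
  have "quad k (X \<oplus>\<^bsub>T\<^esub> X') (p \<oplus>\<^bsub>P\<^esub> p') (q \<oplus>\<^bsub>P\<^esub> q') (r \<oplus> r') = \<zero>\<^bsub>T\<^esub>"
    using quad_add[OF k car(1-3) assms(5) car(4-6) assms(9)] eq car assms(5,9) k by (simp add: T2.double)
  note z = quad_zero_iff[OF k _ _ _ _ this]
  have mem: "X \<oplus>\<^bsub>T\<^esub> X' \<in> TE k" "p \<oplus>\<^bsub>P\<^esub> p' \<in> E k" "q \<oplus>\<^bsub>P\<^esub> q' \<in> E k" "r \<oplus> r' \<in> carrier R"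
    using TER(4)[OF kn] ER(4)[OF kn] assms by auto
  show "X = X'" using z(1)[OF mem] T2.sum_zero_eq car by blast
  show "p = p'" using z(2)[OF mem] P2.sum_zero_eq car by blast
  show "q = q'" using z(3)[OF mem] P2.sum_zero_eq car by blast
  have "r \<oplus> r' = \<zero>" by (rule z(4)[OF mem])
  then have "r = \<ominus> r'" using assms(5,9) by (metis minus_equality a_comm minus_minus)
  then show "r = r'" using assms(9) by (simp add: minus_self)
qed

text \<open>The mixed part is acyclic: the boundary of \<open>e \<otimes> p\<close> has first mixed
  coordinate \<open>p\<close>, so adding it clears that coordinate at the price of changing
  \<open>X\<close> and \<open>q\<close>.\<close>

lemma quad_normalise:
  assumes k: "k < n" and t: "t \<in> TE (Suc k)"
  shows "\<exists>W X q r. W \<in> TE (Suc k) \<and> X \<in> TE k \<and> q \<in> E k \<and> r \<in> carrier R \<and> t = quad k X \<zero>\<^bsub>P\<^esub> q r \<oplus>\<^bsub>T\<^esub> D W"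
proof -
  have kn: "k \<le> n" and k1: "Suc k \<le> n" using k by simp_all
  note ek = e[OF k]
  obtain X p q r where h: "X \<in> TE k" "p \<in> E k" "q \<in> E k" "r \<in> carrier R" "t = quad k X p q r"
    using quad_exists[OF k t] by blast
  have car: "X \<in> carrier T" "p \<in> carrier P" "q \<in> carrier P"
    using TER(3)[OF kn h(1)] ER(3)[OF kn h(2)] ER(3)[OF kn h(3)] .
  have dek: "d (e k) \<in> E k" using e_flag[OF k] by (simp add: E_def)
  define X' where "X' = X \<oplus>\<^bsub>T\<^esub> tens (d (e k)) p"
  define q' where "q' = q \<oplus>\<^bsub>P\<^esub> (d p \<oplus>\<^bsub>P\<^esub> p)"
  have X': "X' \<in> TE k" unfolding X'_def by (intro TER(4)[OF kn] h(1) tens_TE[OF kn] dek h(2))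
  have q': "q' \<in> E k" unfolding q'_def by (intro ER(4)[OF kn] h(2,3) d_E'[OF kn])
  have W: "tens (e k) p \<in> TE (Suc k)" using tens_TE[OF k1 e_E[OF k]] h(2) E_mono[of k "Suc k"] by auto
  have "t = t \<oplus>\<^bsub>T\<^esub> (D (tens (e k) p) \<oplus>\<^bsub>T\<^esub> D (tens (e k) p))"
    using TER(3)[OF k1 t] ek car by (simp add: T2.double)
  also have "\<dots> = (t \<oplus>\<^bsub>T\<^esub> D (tens (e k) p)) \<oplus>\<^bsub>T\<^esub> D (tens (e k) p)"
    using TER(3)[OF k1 t] ek car by (simp add: T.M.a_assoc)
  also have "t \<oplus>\<^bsub>T\<^esub> D (tens (e k) p) = quad k X' \<zero>\<^bsub>P\<^esub> q' r"
    unfolding h(5) D_tens_e[OF k car(2)] X'_def q'_def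
    using quad_add[OF k car h(4), of "tens (d (e k)) p" p "d p \<oplus>\<^bsub>P\<^esub> p" \<zero>] car ek h(4) by (simp add: P2.double)
  finally show ?thesis using W X' q' h(4) by blast
qed

text \<open>With the first mixed coordinate zero, that of the boundary is \<open>q + r d e\<close>,
  whose vanishing determines \<open>q\<close>. The remaining coordinate is the connecting map:
  \<open>r (e \<otimes> e)\<close> contributes \<open>r (d e \<otimes> d e)\<close>.\<close>

lemma cycle_normal_form:
  assumes k: "k < n" and X: "X \<in> TE k" and q: "q \<in> E k" and r: "r \<in> carrier R"
    and Y: "Y \<in> TE k" and D: "D (quad k X \<zero>\<^bsub>P\<^esub> q r) = Y"
  shows "q = r \<odot>\<^bsub>P\<^esub> d (e k)" "Y = D X \<oplus>\<^bsub>T\<^esub> r \<odot>\<^bsub>T\<^esub> tens (d (e k)) (d (e k))"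
proof -
  have kn: "k \<le> n" and k1: "Suc k \<le> n" using k by simp_all
  note ek = e[OF k]
  have car: "X \<in> carrier T" "q \<in> carrier P" "Y \<in> carrier T" using TER(3)[OF kn X] ER(3)[OF kn q] TER(3)[OF kn Y] .
  have dek: "d (e k) \<in> E k" using e_flag[OF k] by (simp add: E_def)
  let ?u = "d (e k)"
  have z: "d \<zero>\<^bsub>P\<^esub> = \<zero>\<^bsub>P\<^esub>" by (rule module_hom_zero[OF moduleP moduleP d])
  have eq: "quad k (D X \<oplus>\<^bsub>T\<^esub> tens ?u q) (q \<oplus>\<^bsub>P\<^esub> r \<odot>\<^bsub>P\<^esub> ?u) ((d q \<oplus>\<^bsub>P\<^esub> q) \<oplus>\<^bsub>P\<^esub> r \<odot>\<^bsub>P\<^esub> ?u) \<zero>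
      = quad k Y \<zero>\<^bsub>P\<^esub> \<zero>\<^bsub>P\<^esub> \<zero>"
    using D D_quad[OF k car(1) P.M.zero_closed car(2) r] quad_zero[OF k car(3)] car ek r z by simp
  have m1: "D X \<oplus>\<^bsub>T\<^esub> tens ?u q \<in> TE k" by (intro TER(4)[OF kn] D_TE[OF kn] X tens_TE[OF kn] dek q)
  have m2: "q \<oplus>\<^bsub>P\<^esub> r \<odot>\<^bsub>P\<^esub> ?u \<in> E k" by (intro ER(4,7)[OF kn] q r dek)
  have m3: "(d q \<oplus>\<^bsub>P\<^esub> q) \<oplus>\<^bsub>P\<^esub> r \<odot>\<^bsub>P\<^esub> ?u \<in> E k" by (intro ER(4,7)[OF kn] q r dek d_E'[OF kn])
  note qe = quad_eq[OF k m1 m2 m3 zero_closed Y ER(2)[OF kn] ER(2)[OF kn] zero_closed eq]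
  show q': "q = r \<odot>\<^bsub>P\<^esub> ?u" using qe(2) P2.sum_zero_eq[of q "r \<odot>\<^bsub>P\<^esub> ?u"] car ek r by simp
  show "Y = D X \<oplus>\<^bsub>T\<^esub> r \<odot>\<^bsub>T\<^esub> tens ?u ?u" using qe(1) q' ek r tens_smult_right by simp
qed

text \<open>The coefficient of \<open>e k \<otimes> e k\<close>, obtained by contracting both
  factors with \<open>\<phi> k\<close>.\<close>

definition diag :: "nat \<Rightarrow> 't \<Rightarrow> 'a" where "diag k t = \<phi> k (right k t)"

lemma diag:
  assumes k: "k < n"
  shows "diag k \<in> module_hom R T (regular_module R)"
    "x \<in> carrier P \<Longrightarrow> y \<in> carrier P \<Longrightarrow> diag k (tens x y) = \<phi> k x \<otimes> \<phi> k y"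
    "X \<in> TE k \<Longrightarrow> p \<in> E k \<Longrightarrow> q \<in> E k \<Longrightarrow> r \<in> carrier R \<Longrightarrow> diag k (quad k X p q r) = r"
proof -
  have kn: "k \<le> n" using k by simp
  show "diag k \<in> module_hom R T (regular_module R)"
    unfolding diag_def by (rule module_hom_comp[OF right(1)[OF k] phi[OF k]])
  show "x \<in> carrier P \<Longrightarrow> y \<in> carrier P \<Longrightarrow> diag k (tens x y) = \<phi> k x \<otimes> \<phi> k y"
    using right(2)[OF k] phiH[OF k] by (simp add: diag_def m_comm)
  show "X \<in> TE k \<Longrightarrow> p \<in> E k \<Longrightarrow> q \<in> E k \<Longrightarrow> r \<in> carrier R \<Longrightarrow> diag k (quad k X p q r) = r"
    using right_quad(1)[OF k] phiH[OF k] ER(3)[OF kn] e[OF k] phi_E[OF k] phi_e[OF k] by (simp add: diag_def)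
qed

lemma diag_D:
  assumes k: "k < n" and W: "W \<in> TE (Suc k)"
  shows "diag k (D W) = \<zero>"
proof -
  have kn: "k \<le> n" using k by simp
  note ek = e[OF k]
  obtain X p q r where h: "X \<in> TE k" "p \<in> E k" "q \<in> E k" "r \<in> carrier R" "W = quad k X p q r"
    using quad_exists[OF k W] by blast
  have car: "X \<in> carrier T" "p \<in> carrier P" "q \<in> carrier P"
    using TER(3)[OF kn h(1)] ER(3)[OF kn h(2)] ER(3)[OF kn h(3)] .
  have dek: "d (e k) \<in> E k" using e_flag[OF k] by (simp add: E_def)
  show ?thesis unfolding h(5) D_quad[OF k car h(4)]
    by (rule diag(3)[OF k]; intro TER(4)[OF kn] ER(4,7)[OF kn] D_TE[OF kn] tens_TE[OF kn] d_E'[OF kn] h dek zero_closed)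
qed

text \<open>The coefficient of \<open>e \<otimes> e\<close> in \<open>z \<otimes> z\<close> is the
  square of \<open>\<phi> k z\<close>, so \<open>semilinear_kernel\<close> applies. Cycles of
  \<open>E (k + 1)\<close> on which \<open>\<phi> k\<close> vanishes are cycles of
  \<open>E k\<close>.\<close>

lemma L_diag_zero:
  assumes k: "k < n" and L: "(t, g) \<in> L (Suc k)" and z: "diag k t = \<zero>"
  shows "\<exists>t' W. (t', g) \<in> L k \<and> W \<in> TE (Suc k) \<and> t = t' \<oplus>\<^bsub>T\<^esub> D W"
proof -
  have kn: "k \<le> n" and k1: "Suc k \<le> n" using k by simp_all
  let ?TG = "prod_module T G"
  interpret TG: module R ?TG by (rule TG)
  \<comment> \<open>\<open>N\<close> holds the boundaries of \<open>x \<otimes> y\<close> by which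
    squaring of cycles fails to be additive; they have second component zero because
    \<open>\<gamma>\<close> is additive.\<close>
  define N where "N = D ` TE (Suc k) \<times> {\<zero>\<^bsub>G\<^esub>}"
  have DT: "submodule (D ` TE (Suc k)) R T" by (rule T.hom_image_submodule[OF moduleT D TE_submodule[OF k1]])
  note DTR = T.submodule_rules[OF DT]
  have N: "submodule N R ?TG"
    by (rule TG.submodule_criterion) (use DTR in \<open>auto simp: N_def\<close>)
  have f: "(\<lambda>u. diag k (fst u)) \<in> module_hom R ?TG (regular_module R)"
    using module_homD[OF diag(1)[OF k]] by (intro module_homI) auto
  have "(t, g) \<in> module_span R ?TG (sq ` {z \<in> Z (Suc k). \<phi> k z \<in> {\<zero>}} \<union> N)"
  proof (rule semilinear_kernel[OF flat zeroideal zeroideal _ moduleP TG Z_submodule[OF k1] N phi[OF k] f])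
    show "(t, g) \<in> module_span R ?TG (sq ` Z (Suc k) \<union> N)"
      using L module_span_mono[of "sq ` Z (Suc k)" "sq ` Z (Suc k) \<union> N" R ?TG] by (auto simp: L_def)
    show "sq z \<in> carrier ?TG" if "z \<in> Z (Suc k)" for z using sq_Z_subset[OF k1] that by blast
    show "\<exists>n\<in>N. sq (x \<oplus>\<^bsub>P\<^esub> y) = (sq x \<oplus>\<^bsub>?TG\<^esub> sq y) \<oplus>\<^bsub>?TG\<^esub> n" if "x \<in> Z (Suc k)" "y \<in> Z (Suc k)" for x y
    proof (rule bexI[of _ "(D (tens x y), \<zero>\<^bsub>G\<^esub>)"])
      have c: "x \<in> carrier P" "y \<in> carrier P" using ZP[OF k1] that by auto
      show "sq (x \<oplus>\<^bsub>P\<^esub> y) = (sq x \<oplus>\<^bsub>?TG\<^esub> sq y) \<oplus>\<^bsub>?TG\<^esub> (D (tens x y), \<zero>\<^bsub>G\<^esub>)"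
        using c ZE(2)[OF that(1)] ZE(2)[OF that(2)] by (simp add: sq_def tens_square_add gamma_add)
      show "(D (tens x y), \<zero>\<^bsub>G\<^esub>) \<in> N" unfolding N_def using tens_TE[OF k1 ZE(1)[OF that(1)] ZE(1)[OF that(2)]] by blast
    qed
    show "sq (a \<odot>\<^bsub>P\<^esub> x) = (a \<otimes> a) \<odot>\<^bsub>?TG\<^esub> sq x" if "a \<in> carrier R" "x \<in> Z (Suc k)" for a x
      using that ZP[OF k1 that(2)] by (simp add: sq_def tens_smult_left tens_smult_right T.smult_assoc1 gamma_smult)
    show "v \<odot>\<^bsub>?TG\<^esub> sq x \<in> N" if "v \<in> {\<zero>}" "x \<in> Z (Suc k)" for v x
      using that ZP[OF k1 that(2)] DTR(2) by (simp add: sq_def N_def)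
    show "diag k (fst (sq x)) = \<phi> k x \<otimes> \<phi> k x" if "x \<in> Z (Suc k)" for x
      using ZP[OF k1 that] diag(2)[OF k] by (simp add: sq_def)
    show "diag k (fst m) \<in> {\<zero>}" if "m \<in> N" for m using that diag_D[OF k] by (auto simp: N_def)
    show "diag k (fst (t, g)) \<in> {\<zero>}" using z by simp
  qed simp
  moreover have "{z \<in> Z (Suc k). \<phi> k z \<in> {\<zero>}} = Z k"
    using E_Suc_phi[OF k] phi_E[OF k] E_mono[of k "Suc k"] by (auto simp: Z_def)
  ultimately have "(t, g) \<in> module_span R ?TG (sq ` Z k \<union> N)" by simp
  then obtain h m where hm: "h \<in> L k" "m \<in> N" "(t, g) = h \<oplus>\<^bsub>?TG\<^esub> m"
    unfolding L_def by (rule TG.span_Un_submodule[OF sq_Z_subset[OF kn] N])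
  obtain W where W: "W \<in> TE (Suc k)" "m = (D W, \<zero>\<^bsub>G\<^esub>)" using hm(2) by (auto simp: N_def)
  obtain t' g' where h: "h = (t', g')" by (cases h)
  have g': "g' \<in> carrier G" using L_car(2)[OF kn] hm(1) h by blast
  then have "g = g'" "t = t' \<oplus>\<^bsub>T\<^esub> D W" using hm(3) W(2) h by simp_all
  then show ?thesis using hm(1) h W(1) by blast
qed

text \<open>Injectivity in homology. A boundary has no \<open>e \<otimes> e\<close> term, so the
  relation descends to \<open>L k\<close>. There the normal form shows that the element is a
  boundary of \<open>TE k\<close> up to a multiple of \<open>d e \<otimes> d e\<close>, and this
  multiple corresponds to a boundary on the other side as well.\<close>

theorem L_boundary:
  assumes "k \<le> n" "(t, g) \<in> L k" "W \<in> TE k" "t = D W"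
  shows "\<exists>v\<in>GE k. g = \<delta> v"
  using assms
proof (induction k arbitrary: t g W)
  case 0
  have "g = \<zero>\<^bsub>G\<^esub>" using 0(1,2)
  proof (induction rule: L_induct)
    case (step t g a z)
    then have "z = \<zero>\<^bsub>P\<^esub>" using E_0 ZE(1) by blast
    then show ?case using step by simp
  qed simp
  then show ?case using GER(2)[of 0] by (intro bexI[of _ "\<zero>\<^bsub>G\<^esub>"]) simp_all
next
  case (Suc k)
  have k: "k < n" and kn: "k \<le> n" and k1: "Suc k \<le> n" using Suc.prems(1) by simp_all
  note ek = e[OF k]
  let ?u = "d (e k)"
  have uE: "?u \<in> E k" using e_flag[OF k] by (simp add: E_def)
  have uZ: "?u \<in> Z k" using uE dd[OF ek] by (simp add: Z_def)
  have "diag k t = \<zero>" unfolding Suc.prems(4) by (rule diag_D[OF k Suc.prems(3)])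
  then obtain t' W1 where t': "(t', g) \<in> L k" "W1 \<in> TE (Suc k)" "t = t' \<oplus>\<^bsub>T\<^esub> D W1"
    using L_diag_zero[OF k Suc.prems(2)] by blast
  have t'E: "t' \<in> TE k" using L_cycle[OF kn t'(1)] by simp
  have tc: "t' \<in> carrier T" "W \<in> carrier T" "W1 \<in> carrier T" using TER(3)[OF kn t'E] TER(3)[OF k1] Suc.prems(3) t'(2) by auto
  have "W \<oplus>\<^bsub>T\<^esub> W1 \<in> TE (Suc k)" by (intro TER(4)[OF k1] Suc.prems t')
  then obtain W2 X q r where n: "W2 \<in> TE (Suc k)" "X \<in> TE k" "q \<in> E k" "r \<in> carrier R"
    "W \<oplus>\<^bsub>T\<^esub> W1 = quad k X \<zero>\<^bsub>P\<^esub> q r \<oplus>\<^bsub>T\<^esub> D W2" using quad_normalise[OF k] by blast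
  have nc: "W2 \<in> carrier T" "X \<in> carrier T" "q \<in> carrier P" using TER(3)[OF k1 n(1)] TER(3)[OF kn n(2)] ER(3)[OF kn n(3)] .
  have "t' = t \<oplus>\<^bsub>T\<^esub> D W1" unfolding t'(3) using tc by (simp add: T2.char_two_ac)
  also have "\<dots> = D (W \<oplus>\<^bsub>T\<^esub> W1)" unfolding Suc.prems(4) using tc by simp
  also have "\<dots> = D (quad k X \<zero>\<^bsub>P\<^esub> q r)" unfolding n(5) using nc n(4) k DD by simp
  finally have "D (quad k X \<zero>\<^bsub>P\<^esub> q r) = t'" by simp
  note nf = cycle_normal_form[OF k n(2-4) t'E this]
  \<comment> \<open>Adding the pair that belongs to the cycle \<open>d e\<close> turns the first
    component into \<open>D X\<close> with \<open>X\<close> in \<open>TE k\<close>, as the induction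
    hypothesis requires. Its second component is the boundary of \<open>r\<close> times
    \<open>\<gamma> (e k)\<close>.\<close>
  have "(r \<odot>\<^bsub>T\<^esub> tens ?u ?u, r \<odot>\<^bsub>G\<^esub> \<gamma> ?u) \<in> L k"
    using L_smult[OF kn n(4)] sq_L[OF kn uZ] by (simp add: sq_def)
  then have "(t' \<oplus>\<^bsub>T\<^esub> r \<odot>\<^bsub>T\<^esub> tens ?u ?u, g \<oplus>\<^bsub>G\<^esub> r \<odot>\<^bsub>G\<^esub> \<gamma> ?u) \<in> L k" by (rule L_add[OF kn t'(1)])
  moreover have "t' \<oplus>\<^bsub>T\<^esub> r \<odot>\<^bsub>T\<^esub> tens ?u ?u = D X" unfolding nf(2) using nc ek n(4) by (simp add: T2.char_two_ac)
  ultimately obtain v where v: "v \<in> GE k" "g \<oplus>\<^bsub>G\<^esub> r \<odot>\<^bsub>G\<^esub> \<gamma> ?u = \<delta> v" using Suc.IH[OF kn _ n(2)] by blast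
  have gc: "g \<in> carrier G" "v \<in> carrier G" using L_car(2)[OF kn t'(1)] GER(3)[OF kn v(1)] .
  have "g = \<delta> v \<oplus>\<^bsub>G\<^esub> r \<odot>\<^bsub>G\<^esub> \<gamma> ?u" unfolding v(2)[symmetric] using gc n(4) ek by (simp add: G2.char_two_ac)
  also have "\<dots> = \<delta> (v \<oplus>\<^bsub>G\<^esub> r \<odot>\<^bsub>G\<^esub> \<gamma> (e k))" using gc n(4) ek by (simp add: delta_gamma)
  finally have "g = \<delta> (v \<oplus>\<^bsub>G\<^esub> r \<odot>\<^bsub>G\<^esub> \<gamma> (e k))" .
  moreover have "v \<oplus>\<^bsub>G\<^esub> r \<odot>\<^bsub>G\<^esub> \<gamma> (e k) \<in> GE (Suc k)"
    using GE_mono[of k "Suc k"] v(1) by (intro GER(4,7)[OF k1] n(4) gamma_GE[OF k1] e_E[OF k]) auto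
  ultimately show ?case by blast
qed

text \<open>On the generators of the relation the coefficient of \<open>e \<otimes> e\<close> and
  the functional \<open>\<Lambda>\<close> both take the value \<open>\<phi> k z\<close> squared, so
  they agree on the whole relation; and \<open>\<Lambda>\<close> vanishes on
  \<open>GE k\<close>.\<close>

lemma frobenius_top_coefficient:
  assumes k: "k < n" and L: "(s, v \<oplus>\<^bsub>G\<^esub> r \<odot>\<^bsub>G\<^esub> \<gamma> (e k)) \<in> L (Suc k)" and v: "v \<in> GE k" and r: "r \<in> carrier R"
  shows "diag k s = r"
proof -
  have kn: "k \<le> n" and k1: "Suc k \<le> n" using k by simp_all
  obtain \<Lambda> where Lam: "\<Lambda> \<in> module_hom R G (regular_module R)"
    "\<And>x. x \<in> carrier P \<Longrightarrow> \<Lambda> (\<gamma> x) = \<phi> k x \<otimes> \<phi> k x"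
    using frobenius_functional[OF phi[OF k]] by blast
  note LH = module_homD[OF Lam(1), simplified] and dH = module_homD[OF diag(1)[OF k], simplified]
  have L0: "\<Lambda> \<zero>\<^bsub>G\<^esub> = \<zero>" "diag k \<zero>\<^bsub>T\<^esub> = \<zero>"
    using module_hom_zero[OF moduleG moduleR Lam(1)] module_hom_zero[OF moduleT moduleR diag(1)[OF k]] by simp_all
  have eq: "diag k t = \<Lambda> g" if "(t, g) \<in> L (Suc k)" for t g
    using k1 that
  proof (induction rule: L_induct)
    case (step t g a z)
    then show ?case using LH dH Lam(2) diag(2)[OF k] by simp
  qed (simp add: L0)
  have "\<Lambda> v = \<zero>"
    using v[unfolded GE_def]
  proof induction
    case (step g a y)
    then obtain x where x: "x \<in> E k" "y = \<gamma> x" by blast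
    have "g \<in> carrier G" using step(1) GER(3)[OF kn] by (simp add: GE_def)
    then show ?case using step x ER(3)[OF kn x(1)] LH Lam(2) phi_E[OF k x(1)] by simp
  qed (simp add: L0)
  moreover have "v \<in> carrier G" using GER(3)[OF kn v] .
  ultimately have "\<Lambda> (v \<oplus>\<^bsub>G\<^esub> r \<odot>\<^bsub>G\<^esub> \<gamma> (e k)) = r" using LH Lam(2) e[OF k] phi_e[OF k] r by simp
  then show ?thesis using eq[OF L] by simp
qed

text \<open>Surjectivity in homology. The leading coefficient \<open>r\<close> of a cycle makes
  \<open>r (d e \<otimes> d e)\<close> a boundary in \<open>TE k\<close>. By
  \<open>L_boundary\<close> the corresponding element of the pullback is a boundary too, so
  \<open>r\<close> is also the leading coefficient of a cycle there. Its partner in \<open>L\<close>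
  has the same leading coefficient, and the difference is handled by induction.\<close>

theorem TE_cycle:
  assumes "k \<le> n" "Y \<in> TE k" "D Y = \<zero>\<^bsub>T\<^esub>"
  shows "\<exists>s g W. (s, g) \<in> L k \<and> W \<in> TE k \<and> Y = s \<oplus>\<^bsub>T\<^esub> D W"
  using assms
proof (induction k arbitrary: Y)
  case 0
  have "Y = \<zero>\<^bsub>T\<^esub>"
    using 0(2)[unfolded TE_def]
  proof induction
    case (step g a x)
    then show ?case using E_0 by auto
  qed simp
  moreover have "(\<zero>\<^bsub>T\<^esub>, \<zero>\<^bsub>G\<^esub>) \<in> L 0" using LR(2)[of 0] by simp
  moreover have "\<zero>\<^bsub>T\<^esub> \<in> TE 0" using TER(2)[of 0] by simp
  ultimately show ?case by (intro exI[of _ "\<zero>\<^bsub>T\<^esub>"] exI[of _ "\<zero>\<^bsub>G\<^esub>"]) simp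
next
  case (Suc k)
  have k: "k < n" and kn: "k \<le> n" and k1: "Suc k \<le> n" using Suc.prems(1) by simp_all
  note ek = e[OF k]
  let ?u = "d (e k)"
  have uE: "?u \<in> E k" using e_flag[OF k] by (simp add: E_def)
  have uZ: "?u \<in> Z k" using uE dd[OF ek] by (simp add: Z_def)
  have zE: "\<zero>\<^bsub>T\<^esub> \<in> TE k" using TER(2)[OF kn] .
  have normal: "\<exists>W X r. W \<in> TE (Suc k) \<and> X \<in> TE k \<and> r \<in> carrier R \<and> Y = quad k X \<zero>\<^bsub>P\<^esub> (r \<odot>\<^bsub>P\<^esub> ?u) r \<oplus>\<^bsub>T\<^esub> D W
      \<and> D X = r \<odot>\<^bsub>T\<^esub> tens ?u ?u \<and> diag k Y = r" if Y: "Y \<in> TE (Suc k)" "D Y = \<zero>\<^bsub>T\<^esub>" for Y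
  proof -
    obtain W X q r where h: "W \<in> TE (Suc k)" "X \<in> TE k" "q \<in> E k" "r \<in> carrier R"
      "Y = quad k X \<zero>\<^bsub>P\<^esub> q r \<oplus>\<^bsub>T\<^esub> D W" using quad_normalise[OF k Y(1)] by blast
    have c: "W \<in> carrier T" "X \<in> carrier T" "q \<in> carrier P" using TER(3)[OF k1 h(1)] TER(3)[OF kn h(2)] ER(3)[OF kn h(3)] .
    have "D (quad k X \<zero>\<^bsub>P\<^esub> q r) = \<zero>\<^bsub>T\<^esub>" using Y(2) unfolding h(5) using c h(4) k DD by simp
    note nf = cycle_normal_form[OF k h(2-4) zE this]
    have "D X = r \<odot>\<^bsub>T\<^esub> tens ?u ?u" using T2.sum_zero_eq[OF _ _ nf(2)[symmetric]] c h(4) ek by simp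
    moreover have "diag k Y = r"
      unfolding h(5) using module_homD[OF diag(1)[OF k]] c h(4) k diag(3)[OF k h(2) ER(2)[OF kn] h(3,4)] diag_D[OF k h(1)] by simp
    ultimately show ?thesis using h nf(1) by blast
  qed
  obtain W X r where h: "W \<in> TE (Suc k)" "X \<in> TE k" "r \<in> carrier R" "Y = quad k X \<zero>\<^bsub>P\<^esub> (r \<odot>\<^bsub>P\<^esub> ?u) r \<oplus>\<^bsub>T\<^esub> D W"
    "D X = r \<odot>\<^bsub>T\<^esub> tens ?u ?u" using normal[OF Suc.prems(2,3)] by blast
  have "(r \<odot>\<^bsub>T\<^esub> tens ?u ?u, r \<odot>\<^bsub>G\<^esub> \<gamma> ?u) \<in> L k"
    using L_smult[OF kn h(3)] sq_L[OF kn uZ] by (simp add: sq_def)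
  then obtain v where v: "v \<in> GE k" "r \<odot>\<^bsub>G\<^esub> \<gamma> ?u = \<delta> v" using L_boundary[OF kn _ h(2) h(5)[symmetric]] by blast
  have vc: "v \<in> carrier G" using GER(3)[OF kn v(1)] .
  \<comment> \<open>\<open>v\<close> bounds \<open>r\<close> times \<open>\<gamma> (d e)\<close>, so
    adding it completes \<open>r\<close> times \<open>\<gamma> (e k)\<close> to a cycle of the
    pullback. \<open>GE_cycle\<close> then writes it as a combination of cycles
    \<open>\<gamma> z\<close>, which lifts to \<open>L\<close>.\<close>
  have "v \<oplus>\<^bsub>G\<^esub> r \<odot>\<^bsub>G\<^esub> \<gamma> (e k) \<in> GE (Suc k)"
    using GE_mono[of k "Suc k"] v(1) by (intro GER(4,7)[OF k1] h(3) gamma_GE[OF k1] e_E[OF k]) auto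
  moreover have "\<delta> (v \<oplus>\<^bsub>G\<^esub> r \<odot>\<^bsub>G\<^esub> \<gamma> (e k)) = \<zero>\<^bsub>G\<^esub>"
    using vc h(3) ek v(2)[symmetric] by (simp add: delta_gamma G2.double)
  ultimately have "v \<oplus>\<^bsub>G\<^esub> r \<odot>\<^bsub>G\<^esub> \<gamma> (e k) \<in> module_span R G (\<gamma> ` Z (Suc k))" by (rule GE_cycle[OF k1])
  then obtain s where s: "(s, v \<oplus>\<^bsub>G\<^esub> r \<odot>\<^bsub>G\<^esub> \<gamma> (e k)) \<in> L (Suc k)" using span_gamma_L[OF k1] by blast
  have sE: "s \<in> TE (Suc k)" "D s = \<zero>\<^bsub>T\<^esub>" using L_cycle[OF k1 s] by simp_all
  have ds: "diag k s = r" by (rule frobenius_top_coefficient[OF k s v(1) h(3)])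
  obtain W' X' r' where "W' \<in> TE (Suc k)" "X' \<in> TE k" "s = quad k X' \<zero>\<^bsub>P\<^esub> (r' \<odot>\<^bsub>P\<^esub> ?u) r' \<oplus>\<^bsub>T\<^esub> D W'"
    "D X' = r' \<odot>\<^bsub>T\<^esub> tens ?u ?u" "diag k s = r'" using normal[OF sE] by blast
  then have h': "W' \<in> TE (Suc k)" "X' \<in> TE k" "s = quad k X' \<zero>\<^bsub>P\<^esub> (r \<odot>\<^bsub>P\<^esub> ?u) r \<oplus>\<^bsub>T\<^esub> D W'"
    "D X' = r \<odot>\<^bsub>T\<^esub> tens ?u ?u" using ds by simp_all
  have c: "W \<in> carrier T" "X \<in> carrier T" "W' \<in> carrier T" "X' \<in> carrier T"
    using TER(3)[OF k1 h(1)] TER(3)[OF kn h(2)] TER(3)[OF k1 h'(1)] TER(3)[OF kn h'(2)] .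
  \<comment> \<open>Both normal forms have the same \<open>r\<close> and therefore the same mixed
    part, so modulo boundaries the sum of \<open>Y\<close> and \<open>s\<close> is
    \<open>X + X'\<close>, a cycle of \<open>TE k\<close>.\<close>
  have "X \<oplus>\<^bsub>T\<^esub> X' \<in> TE k" by (intro TER(4)[OF kn] h h')
  moreover have "D (X \<oplus>\<^bsub>T\<^esub> X') = \<zero>\<^bsub>T\<^esub>" using c h(5) h'(4) h(3) ek by (simp add: T2.double)
  ultimately obtain s2 g2 W2 where s2: "(s2, g2) \<in> L k" "W2 \<in> TE k" "X \<oplus>\<^bsub>T\<^esub> X' = s2 \<oplus>\<^bsub>T\<^esub> D W2"
    using Suc.IH[OF kn] by blast
  have c2: "s2 \<in> carrier T" "W2 \<in> carrier T" "s \<in> carrier T" "Y \<in> carrier T"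
    using L_car(1)[OF kn s2(1)] TER(3)[OF kn s2(2)] TER(3)[OF k1 sE(1)] TER(3)[OF k1 Suc.prems(2)] .
  have "quad k X \<zero>\<^bsub>P\<^esub> (r \<odot>\<^bsub>P\<^esub> ?u) r \<oplus>\<^bsub>T\<^esub> quad k X' \<zero>\<^bsub>P\<^esub> (r \<odot>\<^bsub>P\<^esub> ?u) r = X \<oplus>\<^bsub>T\<^esub> X'"
    using quad_add[OF k c(2) P.M.zero_closed _ h(3) c(4) P.M.zero_closed _ h(3)] c h(3) ek
    by (simp add: P2.double double_zero quad_zero[OF k])
  moreover have "Y \<oplus>\<^bsub>T\<^esub> s = (quad k X \<zero>\<^bsub>P\<^esub> (r \<odot>\<^bsub>P\<^esub> ?u) r \<oplus>\<^bsub>T\<^esub> quad k X' \<zero>\<^bsub>P\<^esub> (r \<odot>\<^bsub>P\<^esub> ?u) r) \<oplus>\<^bsub>T\<^esub> (D W \<oplus>\<^bsub>T\<^esub> D W')"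
    unfolding h(4) h'(3) using c h(3) ek k by (simp add: T.M.a_ac)
  ultimately have "Y \<oplus>\<^bsub>T\<^esub> s = (s2 \<oplus>\<^bsub>T\<^esub> D W2) \<oplus>\<^bsub>T\<^esub> (D W \<oplus>\<^bsub>T\<^esub> D W')" using s2(3) by simp
  then have "(Y \<oplus>\<^bsub>T\<^esub> s) \<oplus>\<^bsub>T\<^esub> s = ((s2 \<oplus>\<^bsub>T\<^esub> D W2) \<oplus>\<^bsub>T\<^esub> (D W \<oplus>\<^bsub>T\<^esub> D W')) \<oplus>\<^bsub>T\<^esub> s" by simp
  then have "Y = (s \<oplus>\<^bsub>T\<^esub> s2) \<oplus>\<^bsub>T\<^esub> D ((W2 \<oplus>\<^bsub>T\<^esub> W) \<oplus>\<^bsub>T\<^esub> W')" using c c2 by (simp add: T2.char_two_ac)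
  moreover have "(s \<oplus>\<^bsub>T\<^esub> s2, (v \<oplus>\<^bsub>G\<^esub> r \<odot>\<^bsub>G\<^esub> \<gamma> (e k)) \<oplus>\<^bsub>G\<^esub> g2) \<in> L (Suc k)"
    using L_mono[of k "Suc k"] s2(1) by (intro L_add[OF k1 s]) auto
  moreover have "(W2 \<oplus>\<^bsub>T\<^esub> W) \<oplus>\<^bsub>T\<^esub> W' \<in> TE (Suc k)"
    using TE_mono[of k "Suc k"] s2(2) by (intro TER(4)[OF k1] h(1) h'(1)) auto
  ultimately show ?case by blast
qed

end

section \<open>Quotient modules, homology and isomorphisms\<close>

context module
begin

lemma mem_coset_iff: "y \<in> L +>\<^bsub>M\<^esub> x \<longleftrightarrow> (\<exists>l\<in>L. y = l \<oplus>\<^bsub>M\<^esub> x)"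
  by (auto simp: a_r_coset_def')

lemma coset_self: "submodule L R M \<Longrightarrow> x \<in> carrier M \<Longrightarrow> x \<in> L +>\<^bsub>M\<^esub> x"
  unfolding mem_coset_iff by (rule bexI[of _ "\<zero>\<^bsub>M\<^esub>"]) (simp_all add: submodule_rules(2))

lemma minus_zero_right: "x \<in> carrier M \<Longrightarrow> x \<ominus>\<^bsub>M\<^esub> \<zero>\<^bsub>M\<^esub> = x"
  by (metis M.minus_eq M.l_neg M.r_zero M.zero_closed M.a_inv_closed)

lemma minus_eq_zero_iff:
  assumes "x \<in> carrier M" "y \<in> carrier M"
  shows "x \<ominus>\<^bsub>M\<^esub> y = \<zero>\<^bsub>M\<^esub> \<longleftrightarrow> x = y"
proof
  assume "x \<ominus>\<^bsub>M\<^esub> y = \<zero>\<^bsub>M\<^esub>"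
  moreover have "x = (x \<ominus>\<^bsub>M\<^esub> y) \<oplus>\<^bsub>M\<^esub> y" using assms by (simp add: M.minus_eq M.a_assoc M.l_neg)
  ultimately show "x = y" using assms by simp
qed (use assms in \<open>simp add: M.minus_eq M.r_neg\<close>)

lemma coset_eq_iff:
  assumes L: "submodule L R M" and x: "x \<in> carrier M" and y: "y \<in> carrier M"
  shows "L +>\<^bsub>M\<^esub> x = L +>\<^bsub>M\<^esub> y \<longleftrightarrow> x \<ominus>\<^bsub>M\<^esub> y \<in> L"
proof
  note LR = submodule_rules[OF L]
  assume "L +>\<^bsub>M\<^esub> x = L +>\<^bsub>M\<^esub> y"
  moreover have "x \<in> L +>\<^bsub>M\<^esub> x" by (rule coset_self[OF L x])
  ultimately obtain l where l: "l \<in> L" "x = l \<oplus>\<^bsub>M\<^esub> y" by (auto simp: mem_coset_iff)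
  then have "x \<ominus>\<^bsub>M\<^esub> y = l" using LR(3) y by (simp add: M.minus_eq M.a_assoc M.r_neg)
  then show "x \<ominus>\<^bsub>M\<^esub> y \<in> L" using l by simp
next
  note LR = submodule_rules[OF L]
  assume l: "x \<ominus>\<^bsub>M\<^esub> y \<in> L"
  have x': "x = (x \<ominus>\<^bsub>M\<^esub> y) \<oplus>\<^bsub>M\<^esub> y" using x y by (simp add: M.minus_eq M.a_assoc M.l_neg)
  have y': "y = (\<ominus>\<^bsub>M\<^esub> (x \<ominus>\<^bsub>M\<^esub> y)) \<oplus>\<^bsub>M\<^esub> x"   proof -
    have "\<ominus>\<^bsub>M\<^esub> (x \<ominus>\<^bsub>M\<^esub> y) = y \<oplus>\<^bsub>M\<^esub> (\<ominus>\<^bsub>M\<^esub> x)" using x y by (simp add: M.minus_eq M.minus_add M.a_comm)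
    then show ?thesis using x y by (simp add: M.a_assoc M.l_neg)
  qed
  show "L +>\<^bsub>M\<^esub> x = L +>\<^bsub>M\<^esub> y"
  proof (intro equalityI subsetI)
    fix z assume "z \<in> L +>\<^bsub>M\<^esub> x"
    then obtain k where k: "k \<in> L" "z = k \<oplus>\<^bsub>M\<^esub> x" by (auto simp: mem_coset_iff)
    have "z = (k \<oplus>\<^bsub>M\<^esub> (x \<ominus>\<^bsub>M\<^esub> y)) \<oplus>\<^bsub>M\<^esub> y"
      unfolding k(2) using LR(3) k(1) x y by (subst x') (simp add: M.a_assoc)
    then show "z \<in> L +>\<^bsub>M\<^esub> y" using LR(4)[OF k(1) l] by (auto simp: mem_coset_iff)
  next
    fix z assume "z \<in> L +>\<^bsub>M\<^esub> y"
    then obtain k where k: "k \<in> L" "z = k \<oplus>\<^bsub>M\<^esub> y" by (auto simp: mem_coset_iff)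
    have "z = (k \<oplus>\<^bsub>M\<^esub> (\<ominus>\<^bsub>M\<^esub> (x \<ominus>\<^bsub>M\<^esub> y))) \<oplus>\<^bsub>M\<^esub> x"
      unfolding k(2) using LR(3) k(1) x y by (subst y') (simp add: M.a_assoc)
    then show "z \<in> L +>\<^bsub>M\<^esub> x" using LR(4)[OF k(1) LR(5)[OF l]] by (auto simp: mem_coset_iff)
  qed
qed

lemma quotient_module_carrier: "carrier (quotient_module M L) = (\<lambda>x. L +>\<^bsub>M\<^esub> x) ` carrier M"
  by (auto simp: quotient_module_def A_RCOSETS_def')

lemma quotient_module_zero:
  assumes "submodule L R M"
  shows "\<zero>\<^bsub>quotient_module M L\<^esub> = L +>\<^bsub>M\<^esub> \<zero>\<^bsub>M\<^esub>"
  using submodule_rules[OF assms] by (auto simp: quotient_module_def mem_coset_iff)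

lemma quotient_module_add:
  assumes L: "submodule L R M" and x: "x \<in> carrier M" and y: "y \<in> carrier M"
  shows "(L +>\<^bsub>M\<^esub> x) \<oplus>\<^bsub>quotient_module M L\<^esub> (L +>\<^bsub>M\<^esub> y) = L +>\<^bsub>M\<^esub> (x \<oplus>\<^bsub>M\<^esub> y)"
proof -
  have "abelian_subgroup L M"
    by (rule abelian_subgroupI3[OF additive_subgroupI[OF submodule.axioms(1)[OF L]] M.abelian_group_axioms])
  then show ?thesis using abelian_subgroup.a_rcos_sum[OF _ x y] by (simp add: quotient_module_def)
qed

lemma quotient_module_smult:
  assumes L: "submodule L R M" and a: "a \<in> carrier R" and x: "x \<in> carrier M"
  shows "a \<odot>\<^bsub>quotient_module M L\<^esub> (L +>\<^bsub>M\<^esub> x) = L +>\<^bsub>M\<^esub> (a \<odot>\<^bsub>M\<^esub> x)"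
proof -
  note LR = submodule_rules[OF L]
  have eq: "L +>\<^bsub>M\<^esub> (a \<odot>\<^bsub>M\<^esub> y) = L +>\<^bsub>M\<^esub> (a \<odot>\<^bsub>M\<^esub> x)" if y: "y \<in> L +>\<^bsub>M\<^esub> x" for y
  proof -
    obtain l where l: "l \<in> L" "y = l \<oplus>\<^bsub>M\<^esub> x" using y unfolding mem_coset_iff by blast
    have lc: "l \<in> carrier M" using LR(3) l by blast
    have "a \<odot>\<^bsub>M\<^esub> y \<ominus>\<^bsub>M\<^esub> a \<odot>\<^bsub>M\<^esub> x = a \<odot>\<^bsub>M\<^esub> l"
      unfolding l(2) using lc x a by (simp add: smult_r_distr M.minus_eq M.a_assoc M.r_neg)
    then show ?thesis using coset_eq_iff[OF L, of "a \<odot>\<^bsub>M\<^esub> y" "a \<odot>\<^bsub>M\<^esub> x"] lc l x a LR(7) by simp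
  qed
  have "(\<Union>y\<in>L +>\<^bsub>M\<^esub> x. L +>\<^bsub>M\<^esub> (a \<odot>\<^bsub>M\<^esub> y)) = (\<Union>y\<in>L +>\<^bsub>M\<^esub> x. L +>\<^bsub>M\<^esub> (a \<odot>\<^bsub>M\<^esub> x))"
    by (rule SUP_cong[OF refl eq])
  also have "\<dots> = L +>\<^bsub>M\<^esub> (a \<odot>\<^bsub>M\<^esub> x)" using coset_self[OF L x] by blast
  finally show ?thesis by (simp add: quotient_module_def)
qed

lemma quotient_module_module:
  assumes L: "submodule L R M"
  shows "module R (quotient_module M L)"
proof (rule moduleI)
  note [simp] = quotient_module_carrier quotient_module_zero[OF L] quotient_module_add[OF L] quotient_module_smult[OF L]
  show "cring R" by (rule R.is_cring)
  show "abelian_group (quotient_module M L)"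
  proof (rule abelian_groupI)
    fix X assume "X \<in> carrier (quotient_module M L)"
    then obtain x where x: "x \<in> carrier M" "X = L +>\<^bsub>M\<^esub> x" by auto
    then show "\<exists>Y\<in>carrier (quotient_module M L). Y \<oplus>\<^bsub>quotient_module M L\<^esub> X = \<zero>\<^bsub>quotient_module M L\<^esub>"
      by (intro bexI[of _ "L +>\<^bsub>M\<^esub> (\<ominus>\<^bsub>M\<^esub> x)"]) (simp_all add: M.l_neg)
  qed (auto simp: M.a_ac)
qed (auto simp: smult_l_distr smult_r_distr smult_assoc1 quotient_module_carrier quotient_module_add[OF L]
    quotient_module_smult[OF L])

lemma quotient_module_hom:
  assumes L: "submodule L R M"
  shows "(\<lambda>x. L +>\<^bsub>M\<^esub> x) \<in> module_hom R M (quotient_module M L)"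
  by (rule module_homI) (auto simp: quotient_module_carrier quotient_module_add[OF L] quotient_module_smult[OF L])

lemma coset_eq_zero_iff:
  assumes L: "submodule L R M" and x: "x \<in> carrier M"
  shows "L +>\<^bsub>M\<^esub> x = \<zero>\<^bsub>quotient_module M L\<^esub> \<longleftrightarrow> x \<in> L"
  using coset_eq_iff[OF L x M.zero_closed] x by (simp add: quotient_module_zero[OF L] minus_zero_right)

end

lemma submodule_restrict:
  assumes "module R M" "submodule K R M" "submodule L R M" "L \<subseteq> K"
  shows "submodule L R (M\<lparr>carrier := K\<rparr>)"
proof -
  interpret module R M by fact
  interpret K: module R "M\<lparr>carrier := K\<rparr>" by (rule submodule.submodule_is_module[OF assms(2,1)])
  note LR = submodule_rules[OF assms(3)]
  show ?thesis by (rule K.submodule_criterion) (use LR assms(4) in auto)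
qed

section \<open>Homology of a differential module\<close>

context module
begin

lemma kernel_eq: "a_kernel M M h = {x \<in> carrier M. h x = \<zero>\<^bsub>M\<^esub>}"
  by (auto simp: a_kernel_def kernel_def)

lemma kernel_submodule:
  assumes "h \<in> module_hom R M M"
  shows "submodule (a_kernel M M h) R M"
  unfolding kernel_eq by (rule hom_kernel_submodule[OF module_axioms assms carrier_is_submodule])

text \<open>A coset of the boundaries is the same set whether formed in the kernel or in
  \<open>M\<close>; the rules are stated with cosets in \<open>M\<close> so that computations can
  stay there.\<close>

lemma homology_module:
  assumes h: "h \<in> module_hom R M M" and hh: "\<forall>x\<in>carrier M. h (h x) = \<zero>\<^bsub>M\<^esub>"
  shows "module R (homology M h)"
    "\<And>x. x \<in> a_kernel M M h \<Longrightarrow> h ` carrier M +>\<^bsub>M\<^esub> x \<in> carrier (homology M h)"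
    "\<And>X. X \<in> carrier (homology M h) \<Longrightarrow> \<exists>x\<in>a_kernel M M h. X = h ` carrier M +>\<^bsub>M\<^esub> x"
    "\<And>x y. x \<in> a_kernel M M h \<Longrightarrow> y \<in> a_kernel M M h \<Longrightarrow>
      h ` carrier M +>\<^bsub>M\<^esub> (x \<oplus>\<^bsub>M\<^esub> y) = (h ` carrier M +>\<^bsub>M\<^esub> x) \<oplus>\<^bsub>homology M h\<^esub> (h ` carrier M +>\<^bsub>M\<^esub> y)"
    "\<And>a x. a \<in> carrier R \<Longrightarrow> x \<in> a_kernel M M h \<Longrightarrow>
      h ` carrier M +>\<^bsub>M\<^esub> (a \<odot>\<^bsub>M\<^esub> x) = a \<odot>\<^bsub>homology M h\<^esub> (h ` carrier M +>\<^bsub>M\<^esub> x)"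
    "\<And>x. x \<in> a_kernel M M h \<Longrightarrow> h ` carrier M +>\<^bsub>M\<^esub> x = \<zero>\<^bsub>homology M h\<^esub> \<longleftrightarrow> x \<in> h ` carrier M"
    "\<And>x y. x \<in> a_kernel M M h \<Longrightarrow> y \<in> a_kernel M M h \<Longrightarrow>
      h ` carrier M +>\<^bsub>M\<^esub> x = h ` carrier M +>\<^bsub>M\<^esub> y \<longleftrightarrow> x \<ominus>\<^bsub>M\<^esub> y \<in> h ` carrier M"
proof -
  let ?K = "a_kernel M M h" and ?B = "h ` carrier M"
  let ?M = "M\<lparr>carrier := ?K\<rparr>"
  have K: "submodule ?K R M" by (rule kernel_submodule[OF h])
  have B: "submodule ?B R M" by (rule hom_image_submodule[OF module_axioms h carrier_is_submodule])
  have BK: "?B \<subseteq> ?K" using module_homD(1)[OF h] hh by (auto simp: kernel_eq)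
  interpret K: module R ?M by (rule submodule.submodule_is_module[OF K module_axioms])
  have B': "submodule ?B R ?M" by (rule submodule_restrict[OF module_axioms K B BK])
  have co: "?B +>\<^bsub>?M\<^esub> x = ?B +>\<^bsub>M\<^esub> x" for x by (simp add: a_r_coset_def')
  show "module R (homology M h)" unfolding homology_def by (rule K.quotient_module_module[OF B'])
  show "\<And>x. x \<in> ?K \<Longrightarrow> ?B +>\<^bsub>M\<^esub> x \<in> carrier (homology M h)"
    unfolding homology_def K.quotient_module_carrier co by simp
  show "\<And>X. X \<in> carrier (homology M h) \<Longrightarrow> \<exists>x\<in>?K. X = ?B +>\<^bsub>M\<^esub> x"
    unfolding homology_def K.quotient_module_carrier co by auto
  show "\<And>x y. x \<in> ?K \<Longrightarrow> y \<in> ?K \<Longrightarrow> ?B +>\<^bsub>M\<^esub> (x \<oplus>\<^bsub>M\<^esub> y) = (?B +>\<^bsub>M\<^esub> x) \<oplus>\<^bsub>homology M h\<^esub> (?B +>\<^bsub>M\<^esub> y)"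
    unfolding homology_def using K.quotient_module_add[OF B'] by (simp add: co)
  show "\<And>a x. a \<in> carrier R \<Longrightarrow> x \<in> ?K \<Longrightarrow> ?B +>\<^bsub>M\<^esub> (a \<odot>\<^bsub>M\<^esub> x) = a \<odot>\<^bsub>homology M h\<^esub> (?B +>\<^bsub>M\<^esub> x)"
    unfolding homology_def using K.quotient_module_smult[OF B'] by (simp add: co)
  show "\<And>x. x \<in> ?K \<Longrightarrow> ?B +>\<^bsub>M\<^esub> x = \<zero>\<^bsub>homology M h\<^esub> \<longleftrightarrow> x \<in> ?B"
    unfolding homology_def using K.coset_eq_zero_iff[OF B'] by (simp add: co)
  show "\<And>x y. x \<in> ?K \<Longrightarrow> y \<in> ?K \<Longrightarrow> ?B +>\<^bsub>M\<^esub> x = ?B +>\<^bsub>M\<^esub> y \<longleftrightarrow> x \<ominus>\<^bsub>M\<^esub> y \<in> ?B"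
    using coset_eq_iff[OF B] submodule_rules(3)[OF K] by blast
qed

end

text \<open>Both modules are the quotient of \<open>X\<close> by the same kernel. This form suits a
  relation \<open>X\<close> with two surjective projections, where no map between the targets is
  given.\<close>

lemma isomorphic_modules_cover:
  assumes X: "module R X" and M: "module R M" and N: "module R N"
    and f: "f \<in> module_hom R X M" and g: "g \<in> module_hom R X N"
    and fs: "carrier M \<subseteq> f ` carrier X" and gs: "carrier N \<subseteq> g ` carrier X"
    and ker: "\<And>x. x \<in> carrier X \<Longrightarrow> f x = \<zero>\<^bsub>M\<^esub> \<longleftrightarrow> g x = \<zero>\<^bsub>N\<^esub>"
  shows "isomorphic_modules R M N"
proof -
  interpret X: module R X by fact
  interpret M: module R M by fact
  interpret N: module R N by fact
  note fH = module_homD[OF f] and gH = module_homD[OF g]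
  have eq: "f x = f y \<longleftrightarrow> g x = g y" if "x \<in> carrier X" "y \<in> carrier X" for x y
  proof -
    have "f x = f y \<longleftrightarrow> f (x \<ominus>\<^bsub>X\<^esub> y) = \<zero>\<^bsub>M\<^esub>"
      using module_hom_minus[OF X M f that] fH(1) that by (simp add: M.minus_eq_zero_iff)
    also have "\<dots> \<longleftrightarrow> g (x \<ominus>\<^bsub>X\<^esub> y) = \<zero>\<^bsub>N\<^esub>" using ker that by simp
    also have "\<dots> \<longleftrightarrow> g x = g y"
      using module_hom_minus[OF X N g that] gH(1) that by (simp add: N.minus_eq_zero_iff)
    finally show ?thesis .
  qed
  define s where "s m = (SOME x. x \<in> carrier X \<and> f x = m)" for m
  have s: "s m \<in> carrier X" "f (s m) = m" if "m \<in> carrier M" for m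
  proof -
    have "\<exists>x. x \<in> carrier X \<and> f x = m" using fs that by blast
    from someI_ex[OF this] show "s m \<in> carrier X" "f (s m) = m" by (simp_all add: s_def)
  qed
  define h where "h m = g (s m)" for m
  have hf: "h (f x) = g x" if "x \<in> carrier X" for x
    using eq[OF s(1)[OF fH(1)[OF that]] that] s(2)[OF fH(1)[OF that]] by (simp add: h_def)
  have "h \<in> module_hom R M N"
  proof (rule module_homI)
    show "h m \<in> carrier N" if "m \<in> carrier M" for m using gH(1) s(1)[OF that] by (simp add: h_def)
    show "h (m \<oplus>\<^bsub>M\<^esub> m') = h m \<oplus>\<^bsub>N\<^esub> h m'" if "m \<in> carrier M" "m' \<in> carrier M" for m m'
      using hf[of "s m \<oplus>\<^bsub>X\<^esub> s m'"] s that fH gH by (simp add: h_def)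
    show "h (a \<odot>\<^bsub>M\<^esub> m) = a \<odot>\<^bsub>N\<^esub> h m" if "a \<in> carrier R" "m \<in> carrier M" for a m
      using hf[of "a \<odot>\<^bsub>X\<^esub> s m"] s that fH gH by (simp add: h_def)
  qed
  moreover have "bij_betw h (carrier M) (carrier N)"
    unfolding bij_betw_def
  proof
    show "inj_on h (carrier M)"
    proof (rule inj_onI)
      fix m m' assume m: "m \<in> carrier M" "m' \<in> carrier M" "h m = h m'"
      then have "f (s m) = f (s m')" using eq[OF s(1)[OF m(1)] s(1)[OF m(2)]] by (simp add: h_def)
      then show "m = m'" using s m by simp
    qed
    show "h ` carrier M = carrier N"
    proof
      show "h ` carrier M \<subseteq> carrier N" using gH(1) s(1) by (auto simp: h_def)
      show "carrier N \<subseteq> h ` carrier M"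
      proof
        fix y assume "y \<in> carrier N"
        then obtain x where "x \<in> carrier X" "y = g x" using gs by blast
        then show "y \<in> h ` carrier M" using hf fH(1) by (intro image_eqI[of _ _ "f x"]) auto
      qed
    qed
  qed
  ultimately show ?thesis unfolding isomorphic_modules_def by blast
qed

lemma isomorphic_modules_via:
  assumes M: "module R M" and N: "module R N" and H: "module R H"
    and "isomorphic_modules R M H" "isomorphic_modules R N H"
  shows "isomorphic_modules R M N"
proof -
  interpret M: module R M by fact
  obtain f g where f: "f \<in> module_hom R M H" "bij_betw f (carrier M) (carrier H)"
    and g: "g \<in> module_hom R N H" "bij_betw g (carrier N) (carrier H)"
    using assms(4,5) unfolding isomorphic_modules_def by blast
  define g' where "g' = inv_into (carrier N) g"
  have g': "g' y \<in> carrier N" "g (g' y) = y" if "y \<in> carrier H" for y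
    using g(2) that by (auto simp: g'_def bij_betw_def inv_into_into f_inv_into_f)
  note gH = module_homD[OF g(1)]
  have inj: "inj_on g (carrier N)" using g(2) by (simp add: bij_betw_def)
  interpret N: module R N by fact
  interpret H: module R H by fact
  have "g' \<in> module_hom R H N"
  proof (rule module_homI)
    show "g' (x \<oplus>\<^bsub>H\<^esub> y) = g' x \<oplus>\<^bsub>N\<^esub> g' y" if "x \<in> carrier H" "y \<in> carrier H" for x y
      by (rule inj_onD[OF inj]) (use that g' gH in simp_all)
    show "g' (a \<odot>\<^bsub>H\<^esub> x) = a \<odot>\<^bsub>N\<^esub> g' x" if "a \<in> carrier R" "x \<in> carrier H" for a x
      by (rule inj_onD[OF inj]) (use that g' gH in simp_all)
  qed (rule g')
  moreover have "bij_betw g' (carrier H) (carrier N)" unfolding g'_def by (rule bij_betw_inv_into[OF g(2)])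
  ultimately have "(\<lambda>x. g' (f x)) \<in> module_hom R M N" "bij_betw (\<lambda>x. g' (f x)) (carrier M) (carrier N)"
    using module_hom_comp[OF f(1)] bij_betw_trans[OF f(2)] by (auto simp: comp_def)
  then show ?thesis unfolding isomorphic_modules_def by blast
qed

section \<open>Comparison with the homology of the Frobenius pullback\<close>

context tate_setup
begin

lemma Z_kernel: "Z n = a_kernel P P d"
  by (auto simp: Z_def En P.kernel_eq)

lemma DD_all: "\<forall>t\<in>carrier T. D (D t) = \<zero>\<^bsub>T\<^esub>" and delta_delta_all: "\<forall>g\<in>carrier G. \<delta> (\<delta> g) = \<zero>\<^bsub>G\<^esub>"
  using DD delta_delta by simp_all

lemmas homology_T = T.homology_module[OF D DD_all] and homology_G = G.homology_module[OF delta delta_delta_all]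

text \<open>A recognition criterion, applied once to the Tate homology and once to the pullback of
  \<open>H(P)\<close>. The relation spanned by the pairs \<open>(\<eta> z, \<gamma> z)\<close>
  covers both modules, the second one by \<open>GE_cycle\<close>. Only one half of the comparison of
  kernels is assumed; flatness provides the other.\<close>

theorem isomorphic_homology:
  fixes M :: "('a, 'm, 'w) module_scheme"
  assumes M: "module R M" and ec: "\<And>z. z \<in> Z n \<Longrightarrow> \<eta> z \<in> carrier M"
    and eadd: "\<And>x y. x \<in> Z n \<Longrightarrow> y \<in> Z n \<Longrightarrow> \<eta> (x \<oplus>\<^bsub>P\<^esub> y) = \<eta> x \<oplus>\<^bsub>M\<^esub> \<eta> y"
    and esm: "\<And>a x. a \<in> carrier R \<Longrightarrow> x \<in> Z n \<Longrightarrow> \<eta> (a \<odot>\<^bsub>P\<^esub> x) = (a \<otimes> a) \<odot>\<^bsub>M\<^esub> \<eta> x"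
    and ed: "\<And>x. x \<in> carrier P \<Longrightarrow> \<eta> (d x) = \<zero>\<^bsub>M\<^esub>"
    and espan: "carrier M \<subseteq> module_span R M (\<eta> ` Z n)"
    and inj: "\<And>g. (\<zero>\<^bsub>M\<^esub>, g) \<in> module_span R (prod_module M G) ((\<lambda>z. (\<eta> z, \<gamma> z)) ` Z n) \<Longrightarrow> g \<in> \<delta> ` carrier G"
  shows "isomorphic_modules R M (homology G \<delta>)"
proof -
  interpret M: module R M by fact
  interpret M2: char_two_module R M by (rule char_two_moduleI[OF M])
  let ?MG = "prod_module M G"
  have MG: "module R ?MG" by (rule prod_module_module[OF M moduleG])
  interpret MG: module R ?MG by (rule MG)
  interpret MG2: char_two_module R ?MG by (rule char_two_moduleI[OF MG])
  define \<theta> where "\<theta> = (\<lambda>z. (\<eta> z, \<gamma> z))"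
  have Zc: "z \<in> carrier P" if "z \<in> Z n" for z using ZP[OF order_refl that] .
  have th: "\<theta> ` Z n \<subseteq> carrier ?MG" using ec Zc by (auto simp: \<theta>_def)
  define X where "X = module_span R ?MG (\<theta> ` Z n)"
  have Xs: "submodule X R ?MG" unfolding X_def by (rule MG.module_span_submodule[OF th])
  note XR = MG.submodule_rules[OF Xs]
  have thX: "\<theta> z \<in> X" if "z \<in> Z n" for z unfolding X_def using MG.module_span_superset[OF th] that by blast
  have dZ: "d x \<in> Z n" if "x \<in> carrier P" for x using that dd En by (simp add: Z_def)
  have ker: "snd u \<in> a_kernel G G \<delta>" if "u \<in> X" for u
    using that[unfolded X_def]
  proof induction
    case zero
    then show ?case by (simp add: G.kernel_eq)
  next
    case (step g a x)
    then obtain z where z: "z \<in> Z n" "x = \<theta> z" by blast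
    then show ?case using step Zc[OF z(1)] ZE(2)[OF z(1)] by (simp add: G.kernel_eq \<theta>_def delta_gamma)
  qed
  \<comment> \<open>For \<open>z = d x\<close> the generator of the relation is zero in the first
    component and the boundary of \<open>\<gamma> x\<close> in the second.\<close>
  have boundary: "(\<zero>\<^bsub>M\<^esub>, \<delta> v) \<in> X" if "v \<in> carrier G" for v
  proof -
    have "v \<in> module_span R G (\<gamma> ` carrier P)" using gamma_span that by blast
    then show ?thesis
    proof induction
      case zero
      then show ?case using XR(2) by simp
    next
      case (step g a y)
      then obtain x where x: "x \<in> carrier P" "y = \<gamma> x" by blast
      have gc: "g \<in> carrier G" by (rule subsetD[OF G.module_span_carrier step(1)]) auto
      have "\<theta> (d x) = (\<zero>\<^bsub>M\<^esub>, \<delta> y)" using x ed by (simp add: \<theta>_def delta_gamma)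
      then have "(\<zero>\<^bsub>M\<^esub>, \<delta> g) \<oplus>\<^bsub>?MG\<^esub> a \<odot>\<^bsub>?MG\<^esub> (\<zero>\<^bsub>M\<^esub>, \<delta> y) \<in> X"
        using XR(4)[OF step(4) XR(7)[OF step(2) thX[OF dZ[OF x(1)]]]] by simp
      then show ?case using step(2) x gc by simp
    qed
  qed
  \<comment> \<open>If the second component vanishes, so do all its coordinates, and by flatness
    only cycles \<open>z\<close> with all coordinates zero are involved. Then every such
    \<open>z\<close> is zero.\<close>
  have zero: "m = \<zero>\<^bsub>M\<^esub>" if m: "(m, \<zero>\<^bsub>G\<^esub>) \<in> X" for m
  proof -
    have "\<forall>i. \<exists>\<Lambda>. i < n \<longrightarrow> \<Lambda> \<in> module_hom R G (regular_module R) \<and> (\<forall>x\<in>carrier P. \<Lambda> (\<gamma> x) = \<phi> i x \<otimes> \<phi> i x)"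
      using frobenius_functional[OF phi] by blast
    then obtain \<Lambda> where Lam: "\<And>i. i < n \<Longrightarrow> \<Lambda> i \<in> module_hom R G (regular_module R)"
      "\<And>i x. i < n \<Longrightarrow> x \<in> carrier P \<Longrightarrow> \<Lambda> i (\<gamma> x) = \<phi> i x \<otimes> \<phi> i x"
      by metis
    have L0: "\<Lambda> i \<zero>\<^bsub>G\<^esub> = \<zero>" if "i < n" for i using module_hom_zero[OF moduleG moduleR Lam(1)[OF that]] by simp
    have snd: "(\<lambda>u. snd u) \<in> module_hom R ?MG G" by (rule module_homI) auto
    let ?K = "{x \<in> Z n. \<forall>i<n. \<phi> i x = \<zero>}"
    have "(m, \<zero>\<^bsub>G\<^esub>) \<in> module_span R ?MG (\<theta> ` ?K \<union> {\<zero>\<^bsub>?MG\<^esub>})"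
    proof (rule semilinear_kernel_iterated[OF MG Z_submodule[OF order_refl] MG.zero_submodule
          phi module_hom_comp[OF snd Lam(1)]])
      show "(m, \<zero>\<^bsub>G\<^esub>) \<in> module_span R ?MG (\<theta> ` Z n \<union> {\<zero>\<^bsub>?MG\<^esub>})"
        using m module_span_mono[of "\<theta> ` Z n" "\<theta> ` Z n \<union> {\<zero>\<^bsub>?MG\<^esub>}" R ?MG] by (auto simp: X_def)
      show "\<exists>k\<in>{\<zero>\<^bsub>?MG\<^esub>}. \<theta> (x \<oplus>\<^bsub>P\<^esub> y) = (\<theta> x \<oplus>\<^bsub>?MG\<^esub> \<theta> y) \<oplus>\<^bsub>?MG\<^esub> k" if "x \<in> Z n" "y \<in> Z n" for x y
        using that Zc ec eadd by (simp add: \<theta>_def gamma_add)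
      show "\<theta> (a \<odot>\<^bsub>P\<^esub> x) = (a \<otimes> a) \<odot>\<^bsub>?MG\<^esub> \<theta> x" if "a \<in> carrier R" "x \<in> Z n" for a x
        using that Zc esm by (simp add: \<theta>_def gamma_smult)
      show "\<theta> x \<in> carrier ?MG" if "x \<in> Z n" for x using th that by blast
    qed (use L0 Lam(2) Zc in \<open>auto simp: \<theta>_def\<close>)
    moreover have "module_span R ?MG (\<theta> ` ?K \<union> {\<zero>\<^bsub>?MG\<^esub>}) \<subseteq> {\<zero>\<^bsub>?MG\<^esub>}"
    proof (rule MG.module_span_minimal[OF MG.zero_submodule])
      have "\<eta> \<zero>\<^bsub>P\<^esub> = \<zero>\<^bsub>M\<^esub>" using ed[of "\<zero>\<^bsub>P\<^esub>"] module_hom_zero[OF moduleP moduleP d] by simp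
      then have "\<theta> \<zero>\<^bsub>P\<^esub> = \<zero>\<^bsub>?MG\<^esub>" by (simp add: \<theta>_def)
      moreover have "x = \<zero>\<^bsub>P\<^esub>" if "x \<in> ?K" for x using that Zc phi_separates by blast
      ultimately show "\<theta> ` ?K \<union> {\<zero>\<^bsub>?MG\<^esub>} \<subseteq> {\<zero>\<^bsub>?MG\<^esub>}" by auto
    qed
    ultimately show ?thesis by auto
  qed
  let ?X = "?MG\<lparr>carrier := X\<rparr>"
  let ?B = "\<delta> ` carrier G"
  show ?thesis
  proof (rule isomorphic_modules_cover[of R ?X M "homology G \<delta>" fst "\<lambda>u. ?B +>\<^bsub>G\<^esub> snd u"])
    show "module R ?X" by (rule submodule.submodule_is_module[OF Xs MG])
    show "module R (homology G \<delta>)" by (rule homology_G(1))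
    show "fst \<in> module_hom R ?X M" using XR(3) by (intro module_homI) auto
    show "(\<lambda>u. ?B +>\<^bsub>G\<^esub> snd u) \<in> module_hom R ?X (homology G \<delta>)"
      using ker homology_G(2,4,5) by (intro module_homI) auto
    show "carrier M \<subseteq> fst ` carrier ?X"
    proof
      fix m assume "m \<in> carrier M"
      then have "m \<in> module_span R M (\<eta> ` Z n)" using espan by blast
      then have "\<exists>g. (m, g) \<in> X"
      proof induction
        case zero
        then show ?case using XR(2) by auto
      next
        case (step h a y)
        then obtain g z where gz: "(h, g) \<in> X" "z \<in> Z n" "y = \<eta> z" by blast
        have "(h, g) \<oplus>\<^bsub>?MG\<^esub> a \<odot>\<^bsub>?MG\<^esub> \<theta> z \<in> X" by (intro XR(4,7) gz(1) step(2) thX gz(2))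
        then show ?case using gz(3) by (auto simp: \<theta>_def)
      qed
      then show "m \<in> fst ` carrier ?X" by force
    qed
    show "carrier (homology G \<delta>) \<subseteq> (\<lambda>u. ?B +>\<^bsub>G\<^esub> snd u) ` carrier ?X"
    proof
      fix Y assume "Y \<in> carrier (homology G \<delta>)"
      then obtain g where g: "g \<in> a_kernel G G \<delta>" "Y = ?B +>\<^bsub>G\<^esub> g" using homology_G(3) by blast
      have "g \<in> module_span R G (\<gamma> ` Z n)" using GE_cycle[OF order_refl, of g] g(1) GEn by (simp add: G.kernel_eq)
      then have "\<exists>m. (m, g) \<in> X"
      proof induction
        case zero
        then show ?case using XR(2) by auto
      next
        case (step h a y)
        then obtain m z where gz: "(m, h) \<in> X" "z \<in> Z n" "y = \<gamma> z" by blast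
        have "(m, h) \<oplus>\<^bsub>?MG\<^esub> a \<odot>\<^bsub>?MG\<^esub> \<theta> z \<in> X" by (intro XR(4,7) gz(1) step(2) thX gz(2))
        then show ?case using gz(3) by (auto simp: \<theta>_def)
      qed
      then show "Y \<in> (\<lambda>u. ?B +>\<^bsub>G\<^esub> snd u) ` carrier ?X" unfolding g(2) by force
    qed
    show "fst u = \<zero>\<^bsub>M\<^esub> \<longleftrightarrow> ?B +>\<^bsub>G\<^esub> snd u = \<zero>\<^bsub>homology G \<delta>\<^esub>" if uX: "u \<in> carrier ?X" for u
    proof -
      obtain m g where u: "u = (m, g)" by (cases u)
      have u: "u = (m, g)" "(m, g) \<in> X" using u uX by simp_all
      have c: "m \<in> carrier M" "g \<in> carrier G" using XR(3)[OF u(2)] by simp_all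
      have "m = \<zero>\<^bsub>M\<^esub> \<longleftrightarrow> g \<in> ?B"
      proof
        assume "m = \<zero>\<^bsub>M\<^esub>"
        then show "g \<in> ?B" using inj[of g] u(2) by (simp add: X_def \<theta>_def)
      next
        assume "g \<in> ?B"
        then obtain v where v: "v \<in> carrier G" "g = \<delta> v" by blast
        have "(m, g) \<oplus>\<^bsub>?MG\<^esub> (\<zero>\<^bsub>M\<^esub>, \<delta> v) \<in> X" by (rule XR(4)[OF u(2) boundary[OF v(1)]])
        then have "(m, \<zero>\<^bsub>G\<^esub>) \<in> X" using c v by (simp add: G2.double)
        then show "m = \<zero>\<^bsub>M\<^esub>" by (rule zero)
      qed
      then show ?thesis using homology_G(6) ker[OF u(2)] u(1) by simp
    qed
  qed (rule M)
qed

text \<open>The recognition criterion for the classes of \<open>z \<otimes> z\<close>: the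
  generation hypothesis is \<open>TE_cycle\<close> and the injectivity hypothesis is
  \<open>L_boundary\<close>, both for the full basis.\<close>

theorem isomorphic_tate_homology: "isomorphic_modules R (homology T D) (homology G \<delta>)"
proof (rule isomorphic_homology)
  let ?B = "D ` carrier T" and ?H = "homology T D"
  have Zc: "z \<in> carrier P" if "z \<in> Z n" for z using ZP[OF order_refl that] .
  have ker: "s \<in> a_kernel T T D" if "(s, g) \<in> L n" for s g
    using L_cycle[OF order_refl that] L_car(1)[OF order_refl that] by (simp add: T.kernel_eq)
  have kz: "tens z z \<in> a_kernel T T D" if "z \<in> Z n" for z
    using ker[of "tens z z" "\<gamma> z"] sq_L[OF order_refl that] by (simp add: sq_def)
  note kR = T.submodule_rules[OF T.kernel_submodule[OF D]]
  have kD: "D t \<in> a_kernel T T D" if "t \<in> carrier T" for t using that DD by (simp add: T.kernel_eq)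
  have class_D: "?B +>\<^bsub>T\<^esub> D t = \<zero>\<^bsub>?H\<^esub>" if "t \<in> carrier T" for t
    using homology_T(6)[OF kD[OF that]] that by blast
  interpret H: module R ?H by (rule homology_T(1))
  show "module R ?H" by (rule homology_T(1))
  show "?B +>\<^bsub>T\<^esub> tens z z \<in> carrier ?H" if "z \<in> Z n" for z by (rule homology_T(2)[OF kz[OF that]])
  show "?B +>\<^bsub>T\<^esub> tens (x \<oplus>\<^bsub>P\<^esub> y) (x \<oplus>\<^bsub>P\<^esub> y) = (?B +>\<^bsub>T\<^esub> tens x x) \<oplus>\<^bsub>?H\<^esub> (?B +>\<^bsub>T\<^esub> tens y y)"
    if xy: "x \<in> Z n" "y \<in> Z n" for x y
  proof -
    have Dt: "D (tens x y) \<in> a_kernel T T D" using Zc xy by (intro kD) simp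
    have "tens (x \<oplus>\<^bsub>P\<^esub> y) (x \<oplus>\<^bsub>P\<^esub> y) = (tens x x \<oplus>\<^bsub>T\<^esub> tens y y) \<oplus>\<^bsub>T\<^esub> D (tens x y)"
      using Zc ZE(2) xy by (intro tens_square_add) auto
    then show ?thesis
      using homology_T(4)[OF kR(4)[OF kz[OF xy(1)] kz[OF xy(2)]] Dt] homology_T(4)[OF kz[OF xy(1)] kz[OF xy(2)]]
        class_D[of "tens x y"] Zc xy H.M.r_zero[OF H.M.a_closed[OF homology_T(2)[OF kz[OF xy(1)]] homology_T(2)[OF kz[OF xy(2)]]]]
      by simp
  qed
  show "?B +>\<^bsub>T\<^esub> tens (a \<odot>\<^bsub>P\<^esub> x) (a \<odot>\<^bsub>P\<^esub> x) = (a \<otimes> a) \<odot>\<^bsub>?H\<^esub> (?B +>\<^bsub>T\<^esub> tens x x)"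
    if "a \<in> carrier R" "x \<in> Z n" for a x
    using that homology_T(5)[OF _ kz[OF that(2)], of "a \<otimes> a"] Zc[OF that(2)]
    by (simp add: tens_smult_left tens_smult_right T.smult_assoc1)
  \<comment> \<open>The square of a boundary is itself a boundary, namely of the corrected lift of
    \<open>x\<close>.\<close>
  show "?B +>\<^bsub>T\<^esub> tens (d x) (d x) = \<zero>\<^bsub>?H\<^esub>" if "x \<in> carrier P" for x
    unfolding D_lift[OF that, symmetric] using that by (intro class_D) simp
  have span: "?B +>\<^bsub>T\<^esub> s \<in> module_span R ?H ((\<lambda>z. ?B +>\<^bsub>T\<^esub> tens z z) ` Z n)" if "(s, g) \<in> L n" for s g
    using order_refl that
  proof (induction rule: L_induct)
    case zero
    have "?B +>\<^bsub>T\<^esub> \<zero>\<^bsub>T\<^esub> = \<zero>\<^bsub>?H\<^esub>" using class_D[of "\<zero>\<^bsub>T\<^esub>"] by simp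
    then show ?case by (simp add: module_span.zero)
  next
    case (step t g a z)
    have "?B +>\<^bsub>T\<^esub> (t \<oplus>\<^bsub>T\<^esub> a \<odot>\<^bsub>T\<^esub> tens z z) = (?B +>\<^bsub>T\<^esub> t) \<oplus>\<^bsub>?H\<^esub> a \<odot>\<^bsub>?H\<^esub> (?B +>\<^bsub>T\<^esub> tens z z)"
      using homology_T(4)[OF ker[OF step(1)] kR(7)[OF step(4) kz[OF step(5)]]] homology_T(5)[OF step(4) kz[OF step(5)]] by simp
    then show ?case using step by (auto intro: module_span.step)
  qed
  show "carrier ?H \<subseteq> module_span R ?H ((\<lambda>z. ?B +>\<^bsub>T\<^esub> tens z z) ` Z n)"
  proof
    fix Y assume "Y \<in> carrier ?H"
    then obtain y where y: "y \<in> a_kernel T T D" "Y = ?B +>\<^bsub>T\<^esub> y" using homology_T(3) by blast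
    then obtain s g W where s: "(s, g) \<in> L n" "W \<in> TE n" "y = s \<oplus>\<^bsub>T\<^esub> D W"
      using TE_cycle[OF order_refl, of y] TEn by (auto simp: T.kernel_eq)
    have W: "W \<in> carrier T" using s(2) TEn by simp
    have "Y = (?B +>\<^bsub>T\<^esub> s) \<oplus>\<^bsub>?H\<^esub> (?B +>\<^bsub>T\<^esub> D W)" unfolding y(2) s(3) by (rule homology_T(4)[OF ker[OF s(1)] kD[OF W]])
    also have "\<dots> = ?B +>\<^bsub>T\<^esub> s" unfolding class_D[OF W] by (rule H.M.r_zero[OF homology_T(2)[OF ker[OF s(1)]]])
    finally show "Y \<in> module_span R ?H ((\<lambda>z. ?B +>\<^bsub>T\<^esub> tens z z) ` Z n)" using span[OF s(1)] by simp
  qed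
  show "g \<in> \<delta> ` carrier G"
    if "(\<zero>\<^bsub>?H\<^esub>, g) \<in> module_span R (prod_module ?H G) ((\<lambda>z. (?B +>\<^bsub>T\<^esub> tens z z, \<gamma> z)) ` Z n)" for g
  proof -
    \<comment> \<open>A relation among homology classes is lifted to the relation \<open>L n\<close>
      among cycles, where \<open>L_boundary\<close> is available.\<close>
    have "\<exists>s. (s, snd u) \<in> L n \<and> fst u = ?B +>\<^bsub>T\<^esub> s"
      if "u \<in> module_span R (prod_module ?H G) ((\<lambda>z. (?B +>\<^bsub>T\<^esub> tens z z, \<gamma> z)) ` Z n)" for u
      using that
    proof induction
      case zero
      have "(\<zero>\<^bsub>T\<^esub>, \<zero>\<^bsub>G\<^esub>) \<in> L n" using LR(2)[of n] by simp
      moreover have "?B +>\<^bsub>T\<^esub> \<zero>\<^bsub>T\<^esub> = \<zero>\<^bsub>?H\<^esub>" using class_D[of "\<zero>\<^bsub>T\<^esub>"] by simp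
      ultimately show ?case by (intro exI[of _ "\<zero>\<^bsub>T\<^esub>"]) simp
    next
      case (step u a x)
      then obtain s z where s: "(s, snd u) \<in> L n" "fst u = ?B +>\<^bsub>T\<^esub> s" "z \<in> Z n" "x = (?B +>\<^bsub>T\<^esub> tens z z, \<gamma> z)" by blast
      have "(a \<odot>\<^bsub>T\<^esub> tens z z, a \<odot>\<^bsub>G\<^esub> \<gamma> z) \<in> L n"
        using L_smult[OF order_refl step(2)] sq_L[OF order_refl s(3)] by (simp add: sq_def)
      note L_add[OF order_refl s(1) this]
      moreover have "?B +>\<^bsub>T\<^esub> (s \<oplus>\<^bsub>T\<^esub> a \<odot>\<^bsub>T\<^esub> tens z z) = (?B +>\<^bsub>T\<^esub> s) \<oplus>\<^bsub>?H\<^esub> a \<odot>\<^bsub>?H\<^esub> (?B +>\<^bsub>T\<^esub> tens z z)"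
        using homology_T(4)[OF ker[OF s(1)] kR(7)[OF step(2) kz[OF s(3)]]] homology_T(5)[OF step(2) kz[OF s(3)]] by simp
      ultimately show ?case using s by (intro exI[of _ "s \<oplus>\<^bsub>T\<^esub> a \<odot>\<^bsub>T\<^esub> tens z z"]) simp
    qed
    from this[OF that] obtain s where s: "(s, g) \<in> L n" "?B +>\<^bsub>T\<^esub> s = \<zero>\<^bsub>?H\<^esub>" by (metis fst_conv snd_conv)
    then obtain W where "W \<in> carrier T" "s = D W" using homology_T(6)[OF ker[OF s(1)]] by blast
    then show ?thesis using L_boundary[OF order_refl s(1), of W] TEn GEn by blast
  qed
qed

end

section \<open>The universal property of the tensor product\<close>

lemma free_module_simps [simp]:
  "\<zero>\<^bsub>free_module R X\<^esub> = (\<lambda>i. \<zero>\<^bsub>R\<^esub>)" "f \<oplus>\<^bsub>free_module R X\<^esub> g = (\<lambda>i. f i \<oplus>\<^bsub>R\<^esub> g i)"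
  "a \<odot>\<^bsub>free_module R X\<^esub> f = (\<lambda>i. a \<otimes>\<^bsub>R\<^esub> f i)"
  by (simp_all add: free_module_def)

lemma free_module_carrier:
  "f \<in> carrier (free_module R X) \<longleftrightarrow> (\<forall>i. f i \<in> carrier R) \<and> finite {i. f i \<noteq> \<zero>\<^bsub>R\<^esub>} \<and> {i. f i \<noteq> \<zero>\<^bsub>R\<^esub>} \<subseteq> X"
  by (auto simp: free_module_def)

definition free_lift :: "('a, 'k) ring_scheme \<Rightarrow> ('a, 'd, 'z) module_scheme \<Rightarrow> ('i \<Rightarrow> 'd) \<Rightarrow> ('i \<Rightarrow> 'a) \<Rightarrow> 'd" where
  "free_lift R L b f = (\<Oplus>\<^bsub>L\<^esub>p\<in>{p. f p \<noteq> \<zero>\<^bsub>R\<^esub>}. f p \<odot>\<^bsub>L\<^esub> b p)"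

context cring
begin

lemma free_module_closed:
  assumes "f \<in> carrier (free_module R X)" "\<And>i. g i \<in> carrier R" "\<And>i. f i = \<zero> \<Longrightarrow> h i = \<zero> \<Longrightarrow> g i = \<zero>"
    "h \<in> carrier (free_module R X)"
  shows "g \<in> carrier (free_module R X)"
proof -
  have "{i. g i \<noteq> \<zero>} \<subseteq> {i. f i \<noteq> \<zero>} \<union> {i. h i \<noteq> \<zero>}" using assms(3) by blast
  then show ?thesis using assms(1,2,4) finite_subset[of "{i. g i \<noteq> \<zero>}"] unfolding free_module_carrier by blast
qed

lemma free_module_module: "module R (free_module R X)"
proof (rule moduleI)
  show "abelian_group (free_module R X)"
  proof (rule abelian_groupI)
    show "f \<oplus>\<^bsub>free_module R X\<^esub> g \<in> carrier (free_module R X)"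
      if "f \<in> carrier (free_module R X)" "g \<in> carrier (free_module R X)" for f g
      using that by (intro free_module_closed[OF that(1) _ _ that(2)]) (auto simp: free_module_carrier)
    show "\<zero>\<^bsub>free_module R X\<^esub> \<in> carrier (free_module R X)" by (simp add: free_module_carrier)
    fix f assume f: "f \<in> carrier (free_module R X)"
    have "(\<lambda>i. \<ominus> f i) \<in> carrier (free_module R X)"
      using f by (intro free_module_closed[OF f _ _ f]) (auto simp: free_module_carrier)
    then show "\<exists>g\<in>carrier (free_module R X). g \<oplus>\<^bsub>free_module R X\<^esub> f = \<zero>\<^bsub>free_module R X\<^esub>"
      using f by (intro bexI[of _ "\<lambda>i. \<ominus> f i"]) (auto simp: free_module_carrier l_neg)
  qed (auto simp: free_module_carrier a_ac)
  show "a \<odot>\<^bsub>free_module R X\<^esub> f \<in> carrier (free_module R X)"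
    if "a \<in> carrier R" "f \<in> carrier (free_module R X)" for a f
    using that by (intro free_module_closed[OF that(2) _ _ that(2)]) (auto simp: free_module_carrier)
qed (auto simp: is_cring free_module_carrier l_distr r_distr m_assoc)

lemma free_unit_closed: "i \<in> X \<Longrightarrow> free_unit R i \<in> carrier (free_module R X)"
proof -
  assume i: "i \<in> X"
  have "{j. free_unit R i j \<noteq> \<zero>} \<subseteq> {i}" by (auto simp: free_unit_def)
  then have "finite {j. free_unit R i j \<noteq> \<zero>} \<and> {j. free_unit R i j \<noteq> \<zero>} \<subseteq> X"
    using i finite_subset[of "{j. free_unit R i j \<noteq> \<zero>}" "{i}"] by auto
  then show ?thesis by (simp add: free_module_carrier free_unit_def)
qed

lemma free_module_span:
  assumes "f \<in> carrier (free_module R X)"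
  shows "f \<in> module_span R (free_module R X) (free_unit R ` X)"
proof -
  have "f \<in> module_span R (free_module R X) (free_unit R ` X)"
    if "finite S" "S \<subseteq> X" "\<And>i. f i \<in> carrier R" "\<And>i. i \<notin> S \<Longrightarrow> f i = \<zero>" for S f
    using that
  proof (induction S arbitrary: f rule: finite_induct)
    case empty
    then have "f = \<zero>\<^bsub>free_module R X\<^esub>" by auto
    then show ?case using module_span.zero[of "free_module R X"] by metis
  next
    case (insert i S)
    let ?g = "f(i := \<zero>)"
    have "?g \<in> module_span R (free_module R X) (free_unit R ` X)"
      using insert.prems insert.hyps by (intro insert.IH) auto
    moreover have "f = ?g \<oplus>\<^bsub>free_module R X\<^esub> f i \<odot>\<^bsub>free_module R X\<^esub> free_unit R i"
      using insert.prems(2) by (auto simp: free_unit_def)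
    moreover have "free_unit R i \<in> free_unit R ` X" using insert.prems(1) by blast
    ultimately show ?case using module_span.step insert.prems(2) by metis
  qed
  note gen = this[of "{i. f i \<noteq> \<zero>}" f]
  show ?thesis
    by (rule gen) (use assms in \<open>simp_all add: free_module_carrier\<close>)
qed

text \<open>Functions have different supports, so additivity of the lift requires summing over a
  common finite set.\<close>

lemma free_lift_superset:
  assumes "module R L" "f \<in> carrier (free_module R X)" "b \<in> X \<rightarrow> carrier L"
    and A: "finite A" "{p. f p \<noteq> \<zero>} \<subseteq> A" "A \<subseteq> X"
  shows "free_lift R L b f = (\<Oplus>\<^bsub>L\<^esub>p\<in>A. f p \<odot>\<^bsub>L\<^esub> b p)"
proof -
  interpret L: module R L by fact
  let ?S = "{p. f p \<noteq> \<zero>}"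
  have fc: "f p \<in> carrier R" for p using assms(2) by (simp add: free_module_carrier)
  have bc: "b p \<in> carrier L" if "p \<in> A" for p by (rule Pi_mem[OF assms(3) subsetD[OF A(3) that]])
  have "?S \<union> (A - ?S) = A" and S: "finite ?S" using A(2) finite_subset[OF A(2,1)] by blast+
  then have "(\<Oplus>\<^bsub>L\<^esub>p\<in>A. f p \<odot>\<^bsub>L\<^esub> b p) = (\<Oplus>\<^bsub>L\<^esub>p\<in>?S \<union> (A - ?S). f p \<odot>\<^bsub>L\<^esub> b p)" by (simp only:)
  also have "\<dots> = (\<Oplus>\<^bsub>L\<^esub>p\<in>?S. f p \<odot>\<^bsub>L\<^esub> b p) \<oplus>\<^bsub>L\<^esub> (\<Oplus>\<^bsub>L\<^esub>p\<in>A - ?S. f p \<odot>\<^bsub>L\<^esub> b p)"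
    using A fc bc S by (intro L.M.finsum_Un_disjoint) auto
  also have "(\<Oplus>\<^bsub>L\<^esub>p\<in>A - ?S. f p \<odot>\<^bsub>L\<^esub> b p) = (\<Oplus>\<^bsub>L\<^esub>p\<in>A - ?S. \<zero>\<^bsub>L\<^esub>)"
    using bc by (intro L.M.finsum_cong') auto
  also have "\<dots> = \<zero>\<^bsub>L\<^esub>" by (rule L.M.finsum_zero)
  also have "(\<Oplus>\<^bsub>L\<^esub>p\<in>?S. f p \<odot>\<^bsub>L\<^esub> b p) \<oplus>\<^bsub>L\<^esub> \<zero>\<^bsub>L\<^esub> = (\<Oplus>\<^bsub>L\<^esub>p\<in>?S. f p \<odot>\<^bsub>L\<^esub> b p)"
    using A fc bc by (intro L.M.r_zero L.M.finsum_closed) auto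
  finally show ?thesis unfolding free_lift_def by simp
qed

lemma free_lift_hom:
  assumes L: "module R L" and b: "b \<in> X \<rightarrow> carrier L"
  shows "free_lift R L b \<in> module_hom R (free_module R X) L"
proof -
  interpret L: module R L by fact
  interpret F: module R "free_module R X" by (rule free_module_module)
  note lift = free_lift_superset[OF L _ b]
  have fin: "finite {p. f p \<noteq> \<zero>}" "{p. f p \<noteq> \<zero>} \<subseteq> X" "\<And>p. f p \<in> carrier R" if "f \<in> carrier (free_module R X)" for f
    using that by (simp_all add: free_module_carrier)
  have bc: "b p \<in> carrier L" if "p \<in> X" for p by (rule Pi_mem[OF b that])
  show ?thesis
  proof (rule module_homI)
    fix f assume f: "f \<in> carrier (free_module R X)"
    show "free_lift R L b f \<in> carrier L"
      unfolding free_lift_def using fin[OF f] bc by (intro L.M.finsum_closed) auto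
    show "free_lift R L b (a \<odot>\<^bsub>free_module R X\<^esub> f) = a \<odot>\<^bsub>L\<^esub> free_lift R L b f" if a: "a \<in> carrier R" for a
    proof -
      let ?A = "{p. f p \<noteq> \<zero>}"
      have "{p. (a \<odot>\<^bsub>free_module R X\<^esub> f) p \<noteq> \<zero>} \<subseteq> ?A" using a by auto
      then have "free_lift R L b (a \<odot>\<^bsub>free_module R X\<^esub> f) = (\<Oplus>\<^bsub>L\<^esub>p\<in>?A. (a \<odot>\<^bsub>free_module R X\<^esub> f) p \<odot>\<^bsub>L\<^esub> b p)"
        using lift[OF F.smult_closed[OF a f] fin(1)[OF f] _ fin(2)[OF f]] by simp
      also have "\<dots> = (\<Oplus>\<^bsub>L\<^esub>p\<in>?A. a \<odot>\<^bsub>L\<^esub> (f p \<odot>\<^bsub>L\<^esub> b p))"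
        using fin[OF f] bc a by (intro L.M.finsum_cong') (auto simp: L.smult_assoc1 subset_eq)
      also have "\<dots> = a \<odot>\<^bsub>L\<^esub> free_lift R L b f"
        unfolding free_lift_def using fin[OF f] bc a by (intro L.finsum_smult_ldistr[symmetric]) auto
      finally show ?thesis .
    qed
    fix g assume g: "g \<in> carrier (free_module R X)"
    let ?A = "{p. f p \<noteq> \<zero>} \<union> {p. g p \<noteq> \<zero>}"
    have A: "finite ?A" "?A \<subseteq> X" using fin[OF f] fin[OF g] by auto
    have "{p. (f \<oplus>\<^bsub>free_module R X\<^esub> g) p \<noteq> \<zero>} \<subseteq> ?A" by auto
    then have "free_lift R L b (f \<oplus>\<^bsub>free_module R X\<^esub> g) = (\<Oplus>\<^bsub>L\<^esub>p\<in>?A. (f \<oplus>\<^bsub>free_module R X\<^esub> g) p \<odot>\<^bsub>L\<^esub> b p)"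
      using lift[OF F.M.a_closed[OF f g] A(1) _ A(2)] by simp
    also have "\<dots> = (\<Oplus>\<^bsub>L\<^esub>p\<in>?A. f p \<odot>\<^bsub>L\<^esub> b p \<oplus>\<^bsub>L\<^esub> g p \<odot>\<^bsub>L\<^esub> b p)"
      using fin(3)[OF f] fin(3)[OF g] bc A by (intro L.M.finsum_cong') (auto simp: L.smult_l_distr subset_eq)
    also have "\<dots> = (\<Oplus>\<^bsub>L\<^esub>p\<in>?A. f p \<odot>\<^bsub>L\<^esub> b p) \<oplus>\<^bsub>L\<^esub> (\<Oplus>\<^bsub>L\<^esub>p\<in>?A. g p \<odot>\<^bsub>L\<^esub> b p)"
      using fin(3)[OF f] fin(3)[OF g] bc A by (intro L.M.finsum_addf) (auto simp: subset_eq)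
    also have "\<dots> = free_lift R L b f \<oplus>\<^bsub>L\<^esub> free_lift R L b g"
      using lift[OF f A(1) _ A(2)] lift[OF g A(1) _ A(2)] by simp
    finally show "free_lift R L b (f \<oplus>\<^bsub>free_module R X\<^esub> g) = free_lift R L b f \<oplus>\<^bsub>L\<^esub> free_lift R L b g" .
  qed
qed

lemma free_lift_unit:
  assumes L: "module R L" and b: "b \<in> X \<rightarrow> carrier L" and i: "i \<in> X"
  shows "free_lift R L b (free_unit R i) = b i"
proof -
  interpret L: module R L by fact
  have bi: "b i \<in> carrier L" by (rule Pi_mem[OF b i])
  have "free_lift R L b (free_unit R i) = (\<Oplus>\<^bsub>L\<^esub>p\<in>{i}. free_unit R i p \<odot>\<^bsub>L\<^esub> b p)"
    by (rule free_lift_superset[OF L free_unit_closed[OF i] b]) (use i in \<open>auto simp: free_unit_def\<close>)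
  also have "\<dots> = b i" using bi by (simp add: free_unit_def L.M.finsum_insert)
  finally show ?thesis .
qed

end

text \<open>The intersection of all submodules containing \<open>A\<close> is exchanged for the
  inductive span, which admits induction.\<close>

lemma (in module) submodule_generated_eq:
  assumes "A \<subseteq> carrier M"
  shows "submodule_generated R M A = module_span R M A"
  unfolding submodule_generated_def
  using module_span_submodule[OF assms] module_span_superset[OF assms] module_span_minimal by blast

section \<open>Tensor products as quotients of free modules\<close>

locale tensor_product = M: module R M + N: module R N
  for R :: "('a, 'k) ring_scheme" (structure) and M :: "('a, 'b, 'x) module_scheme" and N :: "('a, 'c, 'y) module_scheme" +
  fixes \<rho> :: "'b \<Rightarrow> 'a \<Rightarrow> 'b"
  assumes rho_closed: "x \<in> carrier M \<Longrightarrow> a \<in> carrier R \<Longrightarrow> \<rho> x a \<in> carrier M"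
begin

abbreviation "FM \<equiv> free_module R (carrier M \<times> carrier N)"
abbreviation "TM \<equiv> tensor_module R M \<rho> N"
abbreviation "KM \<equiv> tensor_kernel R M \<rho> N"
abbreviation "pt \<equiv> pure_tensor R M \<rho> N"

sublocale F: module R FM by (rule M.free_module_module)

lemma unit_closed [simp]: "x \<in> carrier M \<Longrightarrow> y \<in> carrier N \<Longrightarrow> free_unit R (x, y) \<in> carrier FM"
  by (rule M.free_unit_closed) simp

lemma relations_closed: "tensor_relations R M \<rho> N \<subseteq> carrier FM"
  unfolding tensor_relations_def Let_def
  by (intro Un_least subsetI; elim CollectE exE conjE) (simp_all add: rho_closed del: free_module_simps)

lemma kernel_submodule: "submodule KM R FM"
  unfolding tensor_kernel_def F.submodule_generated_eq[OF relations_closed]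
  by (rule F.module_span_submodule[OF relations_closed])

lemma relations_kernel: "tensor_relations R M \<rho> N \<subseteq> KM"
  unfolding tensor_kernel_def F.submodule_generated_eq[OF relations_closed]
  by (rule F.module_span_superset[OF relations_closed])

lemma tensor_module_module: "module R TM"
  unfolding tensor_module_def by (rule F.quotient_module_module[OF kernel_submodule])

lemma pure_closed: "x \<in> carrier M \<Longrightarrow> y \<in> carrier N \<Longrightarrow> pt x y \<in> carrier TM"
  by (simp add: tensor_module_def F.quotient_module_carrier pure_tensor_def del: free_module_simps)

lemma pure_add_left:
  assumes "x \<in> carrier M" "x' \<in> carrier M" "y \<in> carrier N"
  shows "pt (x \<oplus>\<^bsub>M\<^esub> x') y = pt x y \<oplus>\<^bsub>TM\<^esub> pt x' y"
proof -
  have "free_unit R (x \<oplus>\<^bsub>M\<^esub> x', y) \<ominus>\<^bsub>FM\<^esub> (free_unit R (x, y) \<oplus>\<^bsub>FM\<^esub> free_unit R (x', y)) \<in> KM"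
    by (rule subsetD[OF relations_kernel]) (use assms in \<open>auto simp: tensor_relations_def Let_def simp del: free_module_simps\<close>)
  then show ?thesis
    unfolding pure_tensor_def tensor_module_def
    using assms F.coset_eq_iff[OF kernel_submodule] F.quotient_module_add[OF kernel_submodule]
    by (simp del: free_module_simps)
qed

lemma pure_add_right:
  assumes "x \<in> carrier M" "y \<in> carrier N" "y' \<in> carrier N"
  shows "pt x (y \<oplus>\<^bsub>N\<^esub> y') = pt x y \<oplus>\<^bsub>TM\<^esub> pt x y'"
proof -
  have "free_unit R (x, y \<oplus>\<^bsub>N\<^esub> y') \<ominus>\<^bsub>FM\<^esub> (free_unit R (x, y) \<oplus>\<^bsub>FM\<^esub> free_unit R (x, y')) \<in> KM"
    by (rule subsetD[OF relations_kernel]) (use assms in \<open>auto simp: tensor_relations_def Let_def simp del: free_module_simps\<close>)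
  then show ?thesis
    unfolding pure_tensor_def tensor_module_def
    using assms F.coset_eq_iff[OF kernel_submodule] F.quotient_module_add[OF kernel_submodule]
    by (simp del: free_module_simps)
qed

lemma pure_balanced:
  assumes "a \<in> carrier R" "x \<in> carrier M" "y \<in> carrier N"
  shows "pt (\<rho> x a) y = pt x (a \<odot>\<^bsub>N\<^esub> y)"
proof -
  have "free_unit R (\<rho> x a, y) \<ominus>\<^bsub>FM\<^esub> free_unit R (x, a \<odot>\<^bsub>N\<^esub> y) \<in> KM"
    by (rule subsetD[OF relations_kernel]) (use assms in \<open>auto simp: tensor_relations_def Let_def simp del: free_module_simps\<close>)
  then show ?thesis
    unfolding pure_tensor_def using assms F.coset_eq_iff[OF kernel_submodule] rho_closed
    by (simp del: free_module_simps)
qed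

lemma pure_smult:
  assumes "a \<in> carrier R" "x \<in> carrier M" "y \<in> carrier N"
  shows "pt (a \<odot>\<^bsub>M\<^esub> x) y = a \<odot>\<^bsub>TM\<^esub> pt x y"
proof -
  have "free_unit R (a \<odot>\<^bsub>M\<^esub> x, y) \<ominus>\<^bsub>FM\<^esub> (a \<odot>\<^bsub>FM\<^esub> free_unit R (x, y)) \<in> KM"
    by (rule subsetD[OF relations_kernel]) (use assms in \<open>auto simp: tensor_relations_def Let_def simp del: free_module_simps\<close>)
  then show ?thesis
    unfolding pure_tensor_def tensor_module_def
    using assms F.coset_eq_iff[OF kernel_submodule] F.quotient_module_smult[OF kernel_submodule]
    by (simp del: free_module_simps)
qed

lemma coset_hom: "(\<lambda>f. KM +>\<^bsub>FM\<^esub> f) \<in> module_hom R FM TM"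
  unfolding tensor_module_def by (rule F.quotient_module_hom[OF kernel_submodule])

lemma tensor_span: "carrier TM \<subseteq> module_span R TM {pt x y | x y. x \<in> carrier M \<and> y \<in> carrier N}"
proof
  fix t assume "t \<in> carrier TM"
  then obtain f where f: "f \<in> carrier FM" "t = KM +>\<^bsub>FM\<^esub> f"
    by (auto simp: tensor_module_def F.quotient_module_carrier simp del: free_module_simps)
  note H = module_homD[OF coset_hom]
  have "KM +>\<^bsub>FM\<^esub> f \<in> module_span R TM {pt x y | x y. x \<in> carrier M \<and> y \<in> carrier N}"
    using M.free_module_span[OF f(1)]
  proof induction
    case zero
    then show ?case using module_hom_zero[OF F.module_axioms tensor_module_module coset_hom] module_span.zero[of TM R]
      by (simp del: free_module_simps)
  next
    case (step g a u)
    then obtain x y where xy: "x \<in> carrier M" "y \<in> carrier N" "u = free_unit R (x, y)" by blast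
    have "g \<in> carrier FM"
      by (rule subsetD[OF F.module_span_carrier step(1)]) auto
    then have "KM +>\<^bsub>FM\<^esub> (g \<oplus>\<^bsub>FM\<^esub> a \<odot>\<^bsub>FM\<^esub> u) = (KM +>\<^bsub>FM\<^esub> g) \<oplus>\<^bsub>TM\<^esub> a \<odot>\<^bsub>TM\<^esub> pt x y"
      using xy step(2) H by (simp add: pure_tensor_def del: free_module_simps)
    then show ?case using module_span.step[OF step(4,2), of "pt x y"] xy by auto
  qed
  then show "t \<in> module_span R TM {pt x y | x y. x \<in> carrier M \<and> y \<in> carrier N}" using f(2) by simp
qed

lemma tensor_lift:
  fixes L :: "('a, 'd, 'z) module_scheme"
  assumes L: "module R L"
    and closed: "\<And>x y. x \<in> carrier M \<Longrightarrow> y \<in> carrier N \<Longrightarrow> \<beta> x y \<in> carrier L"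
    and add_left: "\<And>x x' y. x \<in> carrier M \<Longrightarrow> x' \<in> carrier M \<Longrightarrow> y \<in> carrier N \<Longrightarrow> \<beta> (x \<oplus>\<^bsub>M\<^esub> x') y = \<beta> x y \<oplus>\<^bsub>L\<^esub> \<beta> x' y"
    and add_right: "\<And>x y y'. x \<in> carrier M \<Longrightarrow> y \<in> carrier N \<Longrightarrow> y' \<in> carrier N \<Longrightarrow> \<beta> x (y \<oplus>\<^bsub>N\<^esub> y') = \<beta> x y \<oplus>\<^bsub>L\<^esub> \<beta> x y'"
    and balanced: "\<And>a x y. a \<in> carrier R \<Longrightarrow> x \<in> carrier M \<Longrightarrow> y \<in> carrier N \<Longrightarrow> \<beta> (\<rho> x a) y = \<beta> x (a \<odot>\<^bsub>N\<^esub> y)"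
    and linear: "\<And>a x y. a \<in> carrier R \<Longrightarrow> x \<in> carrier M \<Longrightarrow> y \<in> carrier N \<Longrightarrow> \<beta> (a \<odot>\<^bsub>M\<^esub> x) y = a \<odot>\<^bsub>L\<^esub> \<beta> x y"
  shows "tensor_lift R L \<beta> \<in> module_hom R TM L"
    "\<And>x y. x \<in> carrier M \<Longrightarrow> y \<in> carrier N \<Longrightarrow> tensor_lift R L \<beta> (pt x y) = \<beta> x y"
proof -
  interpret L: module R L by fact
  let ?b = "\<lambda>p. \<beta> (fst p) (snd p)"
  let ?\<Phi> = "free_lift R L ?b"
  have b: "?b \<in> carrier M \<times> carrier N \<rightarrow> carrier L" using closed by auto
  have hom: "?\<Phi> \<in> module_hom R FM L" by (rule M.free_lift_hom[OF L b])
  note H = module_homD[OF hom] and Hm = module_hom_minus[OF F.module_axioms L hom]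
  have u: "?\<Phi> (free_unit R (x, y)) = \<beta> x y" if "x \<in> carrier M" "y \<in> carrier N" for x y
    using M.free_lift_unit[OF L b, of "(x, y)"] that by simp
  have "tensor_relations R M \<rho> N \<subseteq> {f. ?\<Phi> f = \<zero>\<^bsub>L\<^esub>}"
    unfolding tensor_relations_def Let_def
    by (intro Un_least subsetI; elim CollectE exE conjE)
      (simp_all add: Hm H u add_left add_right balanced linear closed rho_closed L.minus_eq_zero_iff
          del: free_module_simps)
  then have "tensor_relations R M \<rho> N \<subseteq> {f \<in> carrier FM. ?\<Phi> f = \<zero>\<^bsub>L\<^esub>}" using relations_closed by blast
  then have "KM \<subseteq> {f \<in> carrier FM. ?\<Phi> f = \<zero>\<^bsub>L\<^esub>}"
    unfolding tensor_kernel_def F.submodule_generated_eq[OF relations_closed]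
    by (rule F.module_span_minimal[OF F.hom_kernel_submodule[OF L hom F.carrier_is_submodule]])
  then have kz: "?\<Phi> k = \<zero>\<^bsub>L\<^esub>" "k \<in> carrier FM" if "k \<in> KM" for k using that by auto
  \<comment> \<open>Any representative chosen by the lift differs from \<open>f\<close> by an
    element of the tensor kernel, where the linear extension of \<open>\<beta>\<close>
    vanishes.\<close>
  have val: "tensor_lift R L \<beta> (KM +>\<^bsub>FM\<^esub> f) = ?\<Phi> f" if f: "f \<in> carrier FM" for f
  proof -
    define g where "g = (SOME g. g \<in> KM +>\<^bsub>FM\<^esub> f)"
    have "g \<in> KM +>\<^bsub>FM\<^esub> f" unfolding g_def by (rule someI[of _ f]) (rule F.coset_self[OF kernel_submodule f])
    then obtain k where k: "k \<in> KM" "g = k \<oplus>\<^bsub>FM\<^esub> f" unfolding F.mem_coset_iff by blast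
    have "tensor_lift R L \<beta> (KM +>\<^bsub>FM\<^esub> f) = ?\<Phi> g" by (simp add: tensor_lift_def free_lift_def g_def Let_def)
    also have "\<dots> = ?\<Phi> k \<oplus>\<^bsub>L\<^esub> ?\<Phi> f" unfolding k(2) by (rule H(2)[OF kz(2)[OF k(1)] f])
    also have "\<dots> = ?\<Phi> f" using kz(1)[OF k(1)] H(1)[OF f] by simp
    finally show ?thesis .
  qed
  show "tensor_lift R L \<beta> \<in> module_hom R TM L"
  proof (rule module_homI)
    have ex: "\<exists>f\<in>carrier FM. t = KM +>\<^bsub>FM\<^esub> f" if "t \<in> carrier TM" for t
      using that by (auto simp: tensor_module_def F.quotient_module_carrier simp del: free_module_simps)
    show "tensor_lift R L \<beta> t \<in> carrier L" if "t \<in> carrier TM" for t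
      using ex[OF that] val H(1) by auto
    show "tensor_lift R L \<beta> (t \<oplus>\<^bsub>TM\<^esub> t') = tensor_lift R L \<beta> t \<oplus>\<^bsub>L\<^esub> tensor_lift R L \<beta> t'"
      if "t \<in> carrier TM" "t' \<in> carrier TM" for t t'
    proof -
      obtain f f' where f: "f \<in> carrier FM" "t = KM +>\<^bsub>FM\<^esub> f" "f' \<in> carrier FM" "t' = KM +>\<^bsub>FM\<^esub> f'"
        using ex \<open>t \<in> carrier TM\<close> \<open>t' \<in> carrier TM\<close> by metis
      have "t \<oplus>\<^bsub>TM\<^esub> t' = KM +>\<^bsub>FM\<^esub> (f \<oplus>\<^bsub>FM\<^esub> f')" unfolding f(2,4) using module_homD(2)[OF coset_hom f(1,3)] by simp
      then have "tensor_lift R L \<beta> (t \<oplus>\<^bsub>TM\<^esub> t') = ?\<Phi> (f \<oplus>\<^bsub>FM\<^esub> f')" by (simp only: val[OF F.M.a_closed[OF f(1,3)]])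
      also have "\<dots> = tensor_lift R L \<beta> t \<oplus>\<^bsub>L\<^esub> tensor_lift R L \<beta> t'"
        by (simp only: H(2)[OF f(1,3)] f(2,4) val[OF f(1)] val[OF f(3)])
      finally show ?thesis .
    qed
    show "tensor_lift R L \<beta> (a \<odot>\<^bsub>TM\<^esub> t) = a \<odot>\<^bsub>L\<^esub> tensor_lift R L \<beta> t"
      if a: "a \<in> carrier R" and t: "t \<in> carrier TM" for a t
    proof -
      obtain f where f: "f \<in> carrier FM" "t = KM +>\<^bsub>FM\<^esub> f" using ex[OF t] by blast
      have "a \<odot>\<^bsub>TM\<^esub> t = KM +>\<^bsub>FM\<^esub> (a \<odot>\<^bsub>FM\<^esub> f)" unfolding f(2) using module_homD(3)[OF coset_hom a f(1)] by simp
      then have "tensor_lift R L \<beta> (a \<odot>\<^bsub>TM\<^esub> t) = ?\<Phi> (a \<odot>\<^bsub>FM\<^esub> f)" by (simp only: val[OF F.smult_closed[OF a f(1)]])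
      also have "\<dots> = a \<odot>\<^bsub>L\<^esub> tensor_lift R L \<beta> t" by (simp only: H(3)[OF a f(1)] f(2) val[OF f(1)])
      finally show ?thesis .
    qed
  qed
  show "tensor_lift R L \<beta> (pt x y) = \<beta> x y" if "x \<in> carrier M" "y \<in> carrier N" for x y
    unfolding pure_tensor_def using val[OF unit_closed[OF that]] u[OF that] by simp
qed

end

section \<open>Triangular bases from free flags\<close>

text \<open>A flag refined to steps of rank one, recorded as a list. Independence says that each
  element has zero annihilator modulo the span of its predecessors, a condition that survives
  appending to the list.\<close>

definition triangular :: "('a, 'k) ring_scheme \<Rightarrow> ('a, 'b, 'x) module_scheme \<Rightarrow> ('b \<Rightarrow> 'b) \<Rightarrow> 'b list \<Rightarrow> bool" where
  "triangular R P d es \<longleftrightarrow> set es \<subseteq> carrier P \<and>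
     (\<forall>k<length es. d (es ! k) \<in> module_span R P (set (take k es)) \<and>
        (\<forall>c\<in>carrier R. c \<odot>\<^bsub>P\<^esub> es ! k \<in> module_span R P (set (take k es)) \<longrightarrow> c = \<zero>\<^bsub>R\<^esub>))"

context module
begin

text \<open>The zeros outside \<open>S\<close> are recorded because independence is later read off
  from a coefficient at an element not in \<open>S\<close>.\<close>

lemma finsum_coefficients:
  assumes B: "finite B" "B \<subseteq> carrier M" and S: "S \<subseteq> B" and x: "x \<in> module_span R M S"
  shows "\<exists>c\<in>B \<rightarrow>\<^sub>E carrier R. (\<forall>b\<in>B - S. c b = \<zero>) \<and> x = (\<Oplus>\<^bsub>M\<^esub>b\<in>B. c b \<odot>\<^bsub>M\<^esub> b)"
  using x
proof induction
  case zero
  have "(\<Oplus>\<^bsub>M\<^esub>b\<in>B. (\<lambda>b\<in>B. \<zero>) b \<odot>\<^bsub>M\<^esub> b) = (\<Oplus>\<^bsub>M\<^esub>b\<in>B. \<zero>\<^bsub>M\<^esub>)"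
    using B by (intro M.finsum_cong') (auto simp: subset_eq)
  then show ?case by (intro bexI[of _ "\<lambda>b\<in>B. \<zero>"]) (auto simp: M.finsum_zero)
next
  case (step g a y)
  then obtain c where c: "c \<in> B \<rightarrow>\<^sub>E carrier R" "\<forall>b\<in>B - S. c b = \<zero>" "g = (\<Oplus>\<^bsub>M\<^esub>b\<in>B. c b \<odot>\<^bsub>M\<^esub> b)" by blast
  have cc: "c b \<in> carrier R" if "b \<in> B" for b using c(1) that by auto
  have bc: "b \<in> carrier M" if "b \<in> B" for b using B(2) that by blast
  have y: "y \<in> B" using step(3) S by blast
  let ?c = "\<lambda>b\<in>B. if b = y then c b \<oplus> a else c b"
  have c1: "?c \<in> B \<rightarrow>\<^sub>E carrier R" using cc step(2) by auto
  have c2: "\<forall>b\<in>B - S. ?c b = \<zero>" using c(2) step(3) by auto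
  have c3: "(\<Oplus>\<^bsub>M\<^esub>b\<in>B. ?c b \<odot>\<^bsub>M\<^esub> b) = g \<oplus>\<^bsub>M\<^esub> a \<odot>\<^bsub>M\<^esub> y"
  proof -
    have "(\<Oplus>\<^bsub>M\<^esub>b\<in>B. ?c b \<odot>\<^bsub>M\<^esub> b) = (\<Oplus>\<^bsub>M\<^esub>b\<in>B. c b \<odot>\<^bsub>M\<^esub> b \<oplus>\<^bsub>M\<^esub> (if y = b then a \<odot>\<^bsub>M\<^esub> b else \<zero>\<^bsub>M\<^esub>))"
      using cc bc step(2) by (intro M.finsum_cong') (auto simp: smult_l_distr)
    also have "\<dots> = (\<Oplus>\<^bsub>M\<^esub>b\<in>B. c b \<odot>\<^bsub>M\<^esub> b) \<oplus>\<^bsub>M\<^esub> (\<Oplus>\<^bsub>M\<^esub>b\<in>B. if y = b then a \<odot>\<^bsub>M\<^esub> b else \<zero>\<^bsub>M\<^esub>)"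
      using cc bc step(2) by (intro M.finsum_addf) auto
    also have "(\<Oplus>\<^bsub>M\<^esub>b\<in>B. if y = b then a \<odot>\<^bsub>M\<^esub> b else \<zero>\<^bsub>M\<^esub>) = a \<odot>\<^bsub>M\<^esub> y"
      using bc step(2) by (intro M.finsum_singleton[OF y B(1)]) auto
    finally show ?thesis using c(3) by simp
  qed
  show ?case by (rule bexI[of _ ?c], rule conjI[OF c2 c3[symmetric]], rule c1)
qed

lemma finite_free_basis:
  assumes "finite_free R M"
  obtains B where "finite B" "B \<subseteq> carrier M" "carrier M \<subseteq> module_span R M B"
    "\<And>S b a. S \<subseteq> B \<Longrightarrow> b \<in> B - S \<Longrightarrow> a \<in> carrier R \<Longrightarrow> a \<odot>\<^bsub>M\<^esub> b \<in> module_span R M S \<Longrightarrow> a = \<zero>"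
proof -
  obtain B where basis: "B \<subseteq> carrier M \<and> finite B \<and>
      (\<forall>x\<in>carrier M. \<exists>!c. c \<in> B \<rightarrow>\<^sub>E carrier R \<and> x = (\<Oplus>\<^bsub>M\<^esub>b\<in>B. c b \<odot>\<^bsub>M\<^esub> b))"
    using assms unfolding finite_free_def by (rule exE)
  then have B: "B \<subseteq> carrier M" "finite B" by simp_all
  have ex1: "\<exists>!c. c \<in> B \<rightarrow>\<^sub>E carrier R \<and> x = (\<Oplus>\<^bsub>M\<^esub>b\<in>B. c b \<odot>\<^bsub>M\<^esub> b)" if "x \<in> carrier M" for x
    by (rule bspec[OF conjunct2[OF conjunct2[OF basis]] that])
  note spB = submodule_rules[OF module_span_submodule[OF B(1)]]
  have spans: "x \<in> module_span R M B" if x: "x \<in> carrier M" for x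
  proof -
    obtain c where c: "c \<in> B \<rightarrow>\<^sub>E carrier R" "x = (\<Oplus>\<^bsub>M\<^esub>b\<in>B. c b \<odot>\<^bsub>M\<^esub> b)" using ex1_implies_ex[OF ex1[OF x]] by (elim exE conjE)
    have cb: "c b \<odot>\<^bsub>M\<^esub> b \<in> module_span R M B" if "b \<in> B" for b
      using c(1) that by (intro spB(7) subsetD[OF module_span_superset[OF B(1)]]) auto
    have "(\<Oplus>\<^bsub>M\<^esub>b\<in>A. c b \<odot>\<^bsub>M\<^esub> b) \<in> module_span R M B" if "finite A" "A \<subseteq> B" for A
      using that
    proof (induction A rule: finite_induct)
      case empty
      then show ?case by (simp add: spB(2))
    next
      case (insert b A)
      have "(\<Oplus>\<^bsub>M\<^esub>b\<in>insert b A. c b \<odot>\<^bsub>M\<^esub> b) = c b \<odot>\<^bsub>M\<^esub> b \<oplus>\<^bsub>M\<^esub> (\<Oplus>\<^bsub>M\<^esub>b\<in>A. c b \<odot>\<^bsub>M\<^esub> b)"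
        using insert.hyps insert.prems spB(3)[OF cb] by (intro M.finsum_insert) auto
      also have "\<dots> \<in> module_span R M B" using insert.prems by (intro spB(4) cb insert.IH) auto
      finally show ?case .
    qed
    then show ?thesis using c(2) B(2) by simp
  qed
  have indep: "a = \<zero>" if h: "S \<subseteq> B" "b \<in> B - S" "a \<in> carrier R" "a \<odot>\<^bsub>M\<^esub> b \<in> module_span R M S" for S b a
  proof -
    have bB: "b \<in> B" "b \<in> carrier M" using h(2) B(1) by auto
    obtain c where c: "c \<in> B \<rightarrow>\<^sub>E carrier R" "\<forall>b\<in>B - S. c b = \<zero>" "a \<odot>\<^bsub>M\<^esub> b = (\<Oplus>\<^bsub>M\<^esub>b\<in>B. c b \<odot>\<^bsub>M\<^esub> b)"
      using finsum_coefficients[OF B(2,1) h(1,4)] by blast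
    \<comment> \<open>The obvious coordinates of \<open>a b\<close> sit at \<open>b\<close> alone,
      while membership in the span of \<open>S\<close> gives coordinates that vanish at
      \<open>b\<close>. Uniqueness identifies them and forces \<open>a\<close> to be zero.\<close>
    let ?c = "\<lambda>b'\<in>B. if b' = b then a else \<zero>"
    have "(\<Oplus>\<^bsub>M\<^esub>b'\<in>B. ?c b' \<odot>\<^bsub>M\<^esub> b') = (\<Oplus>\<^bsub>M\<^esub>b'\<in>B. if b = b' then a \<odot>\<^bsub>M\<^esub> b' else \<zero>\<^bsub>M\<^esub>)"
      using B(1) h(3) by (intro M.finsum_cong') (auto simp: subset_eq)
    also have "\<dots> = a \<odot>\<^bsub>M\<^esub> b" using B(1) h(3) by (intro M.finsum_singleton[OF bB(1) B(2)]) (auto simp: subset_eq)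
    finally have "a \<odot>\<^bsub>M\<^esub> b = (\<Oplus>\<^bsub>M\<^esub>b'\<in>B. ?c b' \<odot>\<^bsub>M\<^esub> b')" by simp
    moreover have "?c \<in> B \<rightarrow>\<^sub>E carrier R" using h(3) by auto
    ultimately have q: "?c \<in> B \<rightarrow>\<^sub>E carrier R \<and> a \<odot>\<^bsub>M\<^esub> b = (\<Oplus>\<^bsub>M\<^esub>b'\<in>B. ?c b' \<odot>\<^bsub>M\<^esub> b')" by (rule conjI[rotated])
    note u = ex1[OF smult_closed[OF h(3) bB(2)]]
    have "(THE c. c \<in> B \<rightarrow>\<^sub>E carrier R \<and> a \<odot>\<^bsub>M\<^esub> b = (\<Oplus>\<^bsub>M\<^esub>b\<in>B. c b \<odot>\<^bsub>M\<^esub> b)) = ?c"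
      by (rule the1_equality, rule u, rule q)
    moreover have "(THE c. c \<in> B \<rightarrow>\<^sub>E carrier R \<and> a \<odot>\<^bsub>M\<^esub> b = (\<Oplus>\<^bsub>M\<^esub>b\<in>B. c b \<odot>\<^bsub>M\<^esub> b)) = c"
      by (rule the1_equality, rule u, rule conjI[OF c(1,3)])
    ultimately have "?c = c" by (rule trans[OF sym])
    from fun_cong[OF this, of b] show ?thesis using bB c(2) h(2) by simp
  qed
  show ?thesis by (rule that[OF B(2,1) _ indep]) (use spans in auto)
qed

text \<open>Append lifts of a basis of the quotient of \<open>N'\<close> by \<open>N\<close>. Their
  differentials lie in \<open>N\<close>, the span of the old list, and a relation among the lifts is
  seen in the quotient, where the old list vanishes.\<close>

lemma triangular_extend:
  assumes N: "submodule N R M" and N': "submodule N' R M" and NN': "N \<subseteq> N'"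
    and free: "finite_free R (quotient_module (M\<lparr>carrier := N'\<rparr>) N)" and dN: "d ` N' \<subseteq> N"
    and es: "triangular R M d es" "module_span R M (set es) = N"
  shows "\<exists>es'. triangular R M d es' \<and> module_span R M (set es') = N'"
proof -
  let ?M' = "M\<lparr>carrier := N'\<rparr>"
  let ?Q = "quotient_module ?M' N"
  interpret M': module R ?M' by (rule submodule.submodule_is_module[OF N' module_axioms])
  have NM': "submodule N R ?M'" by (rule submodule_restrict[OF module_axioms N' N NN'])
  have co: "N +>\<^bsub>?M'\<^esub> x = N +>\<^bsub>M\<^esub> x" for x by (simp add: a_r_coset_def')
  interpret Q: module R ?Q by (rule M'.quotient_module_module[OF NM'])
  note NR = submodule_rules[OF N] and N'R = submodule_rules[OF N']
  note projH = module_homD[OF M'.quotient_module_hom[OF NM'], unfolded co]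
  have proj_zero: "N +>\<^bsub>M\<^esub> x = \<zero>\<^bsub>?Q\<^esub>" if "x \<in> N" for x
    using M'.coset_eq_zero_iff[OF NM', of x] that NN' by (auto simp: co)
  obtain B where B: "finite B" "B \<subseteq> carrier ?Q" "carrier ?Q \<subseteq> module_span R ?Q B"
    and ind: "\<And>S b a. S \<subseteq> B \<Longrightarrow> b \<in> B - S \<Longrightarrow> a \<in> carrier R \<Longrightarrow> a \<odot>\<^bsub>?Q\<^esub> b \<in> module_span R ?Q S \<Longrightarrow> a = \<zero>"
    using Q.finite_free_basis[OF free] by metis
  have "\<forall>b\<in>B. \<exists>x\<in>N'. b = N +>\<^bsub>M\<^esub> x"
    using B(2) unfolding M'.quotient_module_carrier co by auto
  then obtain f where f: "\<And>b. b \<in> B \<Longrightarrow> f b \<in> N'" "\<And>b. b \<in> B \<Longrightarrow> b = N +>\<^bsub>M\<^esub> f b" by metis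
  obtain bs where bs: "set bs = B" "distinct bs" using finite_distinct_list[OF B(1)] by blast
  define es' where "es' = es @ map f bs"
  have esc: "set es \<subseteq> carrier M" using es(1) by (simp add: triangular_def)
  have fc: "f ` B \<subseteq> carrier M" using f(1) N'R(1) by auto
  have esN: "set es \<subseteq> N" using module_span_superset[OF esc] es(2) by simp
  have proj_span: "N +>\<^bsub>M\<^esub> x \<in> module_span R ?Q S" if S: "S \<subseteq> B" and x: "x \<in> module_span R M (set es \<union> f ` S)" for S x
  proof -
    have sub: "set es \<union> f ` S \<subseteq> N'" using esN NN' f(1) S by auto
    have "x \<in> N' \<and> N +>\<^bsub>M\<^esub> x \<in> module_span R ?Q S"
      using x
    proof induction
      case zero
      then show ?case using N'R(2) proj_zero[OF NR(2)] module_span.zero[of ?Q R S] by simp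
    next
      case (step g a y)
      have y: "y \<in> N'" using step(3) sub by blast
      have eq: "N +>\<^bsub>M\<^esub> (g \<oplus>\<^bsub>M\<^esub> a \<odot>\<^bsub>M\<^esub> y) = (N +>\<^bsub>M\<^esub> g) \<oplus>\<^bsub>?Q\<^esub> a \<odot>\<^bsub>?Q\<^esub> (N +>\<^bsub>M\<^esub> y)"
        using projH(2)[of g "a \<odot>\<^bsub>M\<^esub> y"] projH(3)[OF step(2), of y] step(4) y N'R(7)[OF step(2) y] by simp
      have mem: "g \<oplus>\<^bsub>M\<^esub> a \<odot>\<^bsub>M\<^esub> y \<in> N'" using step(4) by (intro N'R(4,7) step(2) y) simp
      have gQ: "N +>\<^bsub>M\<^esub> g \<in> module_span R ?Q S" using step(4) by simp
      have Sc: "S \<subseteq> carrier ?Q" using S B(2) by blast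
      have "(N +>\<^bsub>M\<^esub> g) \<oplus>\<^bsub>?Q\<^esub> a \<odot>\<^bsub>?Q\<^esub> (N +>\<^bsub>M\<^esub> y) \<in> module_span R ?Q S"
      proof (cases "y \<in> set es")
        case True
        then have "N +>\<^bsub>M\<^esub> y = \<zero>\<^bsub>?Q\<^esub>" using proj_zero esN by blast
        then show ?thesis using gQ step(2) Q.module_span_carrier[OF Sc] by auto
      next
        case False
        then have "N +>\<^bsub>M\<^esub> y \<in> S" using step(3) f(2) S by auto
        then show ?thesis by (rule module_span.step[OF gQ step(2)])
      qed
      then show ?case using eq mem by simp
    qed
    then show ?thesis by simp
  qed
  have es'c: "set es' = set es \<union> f ` B" by (simp add: es'_def bs(1))
  have es'car: "set es' \<subseteq> carrier M" using esc fc es'c by simp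
  note spR = submodule_rules[OF module_span_submodule[OF es'car]]
  have Nsp: "N \<subseteq> module_span R M (set es')" using module_span_mono[of "set es" "set es'" R M] es(2) es'c by auto
  have span: "module_span R M (set es') = N'"
  proof
    show "module_span R M (set es') \<subseteq> N'"
      by (rule module_span_minimal[OF N']) (use es'c esN NN' f(1) in auto)
    show "N' \<subseteq> module_span R M (set es')"
    proof
      fix x assume x: "x \<in> N'"
      \<comment> \<open>Each class of the quotient is represented inside the new span; the
        difference from a given representative lies in \<open>N\<close>, which the old list already
        generates.\<close>
      have lift: "\<exists>y\<in>N' \<inter> module_span R M (set es'). X = N +>\<^bsub>M\<^esub> y" if "X \<in> module_span R ?Q B" for X
        using that
      proof induction
        case zero
        have "\<zero>\<^bsub>M\<^esub> \<in> N' \<inter> module_span R M (set es')" using N'R(2) spR(2) by simp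
        moreover have "\<zero>\<^bsub>?Q\<^esub> = N +>\<^bsub>M\<^esub> \<zero>\<^bsub>M\<^esub>" using proj_zero[OF NR(2)] by simp
        ultimately show ?case by blast
      next
        case (step X a b)
        then obtain y where y: "y \<in> N'" "y \<in> module_span R M (set es')" "X = N +>\<^bsub>M\<^esub> y" by blast
        have fb: "f b \<in> N'" "f b \<in> set es'" using f(1)[OF step(3)] es'c step(3) by auto
        have "y \<oplus>\<^bsub>M\<^esub> a \<odot>\<^bsub>M\<^esub> f b \<in> N'" by (intro N'R(4,7) y(1) step(2) fb(1))
        moreover have "y \<oplus>\<^bsub>M\<^esub> a \<odot>\<^bsub>M\<^esub> f b \<in> module_span R M (set es')" by (rule module_span.step[OF y(2) step(2) fb(2)])
        moreover have "X \<oplus>\<^bsub>?Q\<^esub> a \<odot>\<^bsub>?Q\<^esub> b = N +>\<^bsub>M\<^esub> (y \<oplus>\<^bsub>M\<^esub> a \<odot>\<^bsub>M\<^esub> f b)"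
          using projH(2)[of y "a \<odot>\<^bsub>M\<^esub> f b"] projH(3)[OF step(2), of "f b"] y fb(1) N'R(7)[OF step(2) fb(1)] f(2)[OF step(3)]
          by simp
        ultimately show ?case by blast
      qed
      have "N +>\<^bsub>M\<^esub> x \<in> carrier ?Q" using projH(1)[of x] x by simp
      then obtain y where y: "y \<in> N'" "y \<in> module_span R M (set es')" "N +>\<^bsub>M\<^esub> x = N +>\<^bsub>M\<^esub> y" using lift B(3) by blast
      have c: "x \<in> carrier M" "y \<in> carrier M" using N'R(3) x y by auto
      have "x \<ominus>\<^bsub>M\<^esub> y \<in> N" using coset_eq_iff[OF N c] y(3) by simp
      then have "(x \<ominus>\<^bsub>M\<^esub> y) \<oplus>\<^bsub>M\<^esub> y \<in> module_span R M (set es')" using Nsp y(2) spR(4) by blast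
      then show "x \<in> module_span R M (set es')" using c by (simp add: M.minus_eq M.a_assoc M.l_neg)
    qed
  qed
  have "triangular R M d es'"
    unfolding triangular_def
  proof (intro conjI allI impI ballI es'car)
    fix k assume k: "k < length es'"
    show "d (es' ! k) \<in> module_span R M (set (take k es'))"
    proof (cases "k < length es")
      case True
      then show ?thesis using es(1) by (simp add: triangular_def es'_def nth_append)
    next
      case False
      then have "es' ! k \<in> N'" using k f(1) bs(1) by (auto simp: es'_def nth_append)
      then have "d (es' ! k) \<in> module_span R M (set es)" using dN es(2) by blast
      moreover have "set es \<subseteq> set (take k es')" using False by (simp add: es'_def)
      ultimately show ?thesis using module_span_mono by blast
    qed
    fix c assume c: "c \<in> carrier R" "c \<odot>\<^bsub>M\<^esub> es' ! k \<in> module_span R M (set (take k es'))"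
    show "c = \<zero>"
    proof (cases "k < length es")
      case True
      then show ?thesis using es(1) c by (simp add: triangular_def es'_def nth_append)
    next
      case False
      define j where "j = k - length es"
      have j: "j < length bs" "es' ! k = f (bs ! j)" using False k by (auto simp: j_def es'_def nth_append)
      have tk: "set (take k es') = set es \<union> f ` set (take j bs)" using False by (simp add: j_def es'_def take_map)
      let ?S = "set (take j bs)"
      have S: "?S \<subseteq> B" using set_take_subset[of j bs] bs(1) by simp
      have bj: "bs ! j \<in> B" using j(1) bs(1) by auto
      have "bs ! j \<notin> ?S"
      proof
        assume "bs ! j \<in> ?S"
        then obtain i where "i < j" "bs ! i = bs ! j" using j(1) by (auto simp: in_set_conv_nth)
        then show False using bs(2) j(1) by (simp add: nth_eq_iff_index_eq)
      qed
      have "N +>\<^bsub>M\<^esub> (c \<odot>\<^bsub>M\<^esub> f (bs ! j)) \<in> module_span R ?Q ?S"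
        using proj_span[OF S] c(2) unfolding tk j(2) by blast
      moreover have "N +>\<^bsub>M\<^esub> (c \<odot>\<^bsub>M\<^esub> f (bs ! j)) = c \<odot>\<^bsub>?Q\<^esub> (bs ! j)"
        using projH(3)[OF c(1), of "f (bs ! j)"] f[OF bj] by simp
      ultimately show ?thesis using ind[OF S _ c(1)] bj \<open>bs ! j \<notin> ?S\<close> by simp
    qed
  qed
  then show ?thesis using span by blast
qed

lemma flag_triangular:
  assumes "admits_finite_free_flag R M d"
  shows "\<exists>es. triangular R M d es \<and> module_span R M (set es) = carrier M"
proof -
  obtain r :: nat and F where flag: "F 0 = {\<zero>\<^bsub>M\<^esub>}" "F r = carrier M" "\<forall>i\<le>r. direct_summand R M (F i)"
    "\<forall>i<r. F i \<subseteq> F (Suc i) \<and> finite_free R (quotient_module (M\<lparr>carrier := F (Suc i)\<rparr>) (F i)) \<and> d ` F (Suc i) \<subseteq> F i"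
    using assms unfolding admits_finite_free_flag_def by (elim exE conjE)
  note F0 = flag(1) and Fr = flag(2)
  have sub: "submodule (F i) R M" if "i \<le> r" for i using flag(3) that by (simp add: direct_summand_def)
  have step: "F i \<subseteq> F (Suc i)" "finite_free R (quotient_module (M\<lparr>carrier := F (Suc i)\<rparr>) (F i))"
    "d ` F (Suc i) \<subseteq> F i" if "i < r" for i using flag(4) that by simp_all
  have "\<exists>es. triangular R M d es \<and> module_span R M (set es) = F i" if "i \<le> r" for i
    using that
  proof (induction i)
    case 0
    have "module_span R M {} = {\<zero>\<^bsub>M\<^esub>}"
      using module_span_minimal[OF zero_submodule, of "{}"] module_span.zero[of M R "{}"] by auto
    then have "triangular R M d [] \<and> module_span R M (set []) = F 0" using F0 by (simp add: triangular_def)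
    then show ?case by blast
  next
    case (Suc i)
    then obtain es where es: "triangular R M d es" "module_span R M (set es) = F i" by auto
    have i: "i < r" "i \<le> r" "Suc i \<le> r" using Suc.prems by simp_all
    show ?case by (rule triangular_extend[OF sub[OF i(2)] sub[OF i(3)] step[OF i(1)] es])
  qed
  from this[of r] show ?thesis by (simp add: Fr)
qed

text \<open>The dual functional is well defined because any relation can be read off at its last index.\<close>

lemma triangular_independent:
  assumes es: "triangular R M d es" and k: "k < j" "j \<le> length es" and r: "r \<in> carrier R"
    and mem: "r \<odot>\<^bsub>M\<^esub> es ! k \<in> module_span R M ((!) es ` ({..<j} - {k}))"
  shows "r = \<zero>"
  using k mem
proof (induction j)
  case (Suc j)
  have esc: "es ! i \<in> carrier M" if "i < length es" for i using es that by (auto simp: triangular_def)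
  have tk: "set (take i es) = (!) es ` {..<i}" if "i \<le> length es" for i
    using nth_image[OF that] by (simp add: lessThan_atLeast0)
  have tri: "c = \<zero>" if "i < length es" "c \<in> carrier R" "c \<odot>\<^bsub>M\<^esub> es ! i \<in> module_span R M ((!) es ` {..<i})" for i c
    using es that tk[of i] by (simp add: triangular_def)
  show ?case
  proof (cases "k = j")
    case True
    then have "{..<Suc j} - {k} = {..<j}" by auto
    then show ?thesis using tri[of j r] Suc.prems r True by simp
  next
    case False
    then have kj: "k < j" using Suc.prems(1) by simp
    let ?S = "(!) es ` ({..<j} - {k})"
    have eq: "(!) es ` ({..<Suc j} - {k}) = insert (es ! j) ?S" using kj by (auto simp: lessThan_Suc)
    have Sc: "?S \<subseteq> carrier M" "(!) es ` {..<j} \<subseteq> carrier M" using esc Suc.prems(2) by auto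
    have ej: "es ! j \<in> carrier M" "es ! k \<in> carrier M" using esc Suc.prems(2) kj by auto
    obtain y c where y: "y \<in> module_span R M ?S" "c \<in> carrier R" "r \<odot>\<^bsub>M\<^esub> es ! k = y \<oplus>\<^bsub>M\<^esub> c \<odot>\<^bsub>M\<^esub> es ! j"
      using module_span_insert[OF ej(1) Sc(1) Suc.prems(3)[unfolded eq]] .
    note sp = submodule_rules[OF module_span_submodule[OF Sc(2)]]
    have yc: "y \<in> carrier M" using module_span_carrier[OF Sc(1)] y(1) by blast
    have "y \<in> module_span R M ((!) es ` {..<j})" using module_span_mono[of ?S "(!) es ` {..<j}" R M] y(1) by auto
    moreover have "r \<odot>\<^bsub>M\<^esub> es ! k \<in> module_span R M ((!) es ` {..<j})"
      using kj by (intro sp(7) r subsetD[OF module_span_superset[OF Sc(2)]]) auto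
    ultimately have "r \<odot>\<^bsub>M\<^esub> es ! k \<ominus>\<^bsub>M\<^esub> y \<in> module_span R M ((!) es ` {..<j})" by (intro sp(6))
    moreover have "r \<odot>\<^bsub>M\<^esub> es ! k \<ominus>\<^bsub>M\<^esub> y = c \<odot>\<^bsub>M\<^esub> es ! j"
      unfolding y(3) using yc y(2) ej by (simp add: M.minus_eq M.a_ac M.r_neg1 M.r_neg2 M.r_neg)
    ultimately have "c = \<zero>" using tri[of j c] y(2) Suc.prems(2) by simp
    then have "r \<odot>\<^bsub>M\<^esub> es ! k = y" using y(3) yc ej by simp
    then show ?thesis using Suc.IH[OF kj] y(1) Suc.prems(2) by simp
  qed
qed simp

text \<open>The coordinate function of a basis element: every \<open>x\<close> is
  \<open>y + r e\<close> with \<open>y\<close> in the span of all other basis elements, and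
  \<open>triangular_independent\<close> makes \<open>r\<close> unique. It vanishes on the other
  elements, in particular on the earlier ones.\<close>

lemma triangular_dual:
  assumes es: "triangular R M d es" "carrier M \<subseteq> module_span R M (set es)" and k: "k < length es"
  shows "\<exists>f\<in>module_hom R M (regular_module R). f (es ! k) = \<one> \<and> (\<forall>x\<in>module_span R M ((!) es ` {..<k}). f x = \<zero>)"
proof -
  let ?n = "length es"
  have esc: "es ! i \<in> carrier M" if "i < ?n" for i using es(1) that by (auto simp: triangular_def)
  let ?S = "(!) es ` ({..<?n} - {k})"
  let ?Q = "module_span R M ?S"
  have Sc: "?S \<subseteq> carrier M" using esc by auto
  note sp = submodule_rules[OF module_span_submodule[OF Sc]]
  have ek: "es ! k \<in> carrier M" using esc k by simp
  have "set es = (!) es ` insert k ({..<?n} - {k})"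
    using nth_image[of ?n es] k by (simp add: lessThan_atLeast0 insert_absorb)
  then have "set es = insert (es ! k) ?S" by (simp only: image_insert)
  then have ex: "\<exists>y r. y \<in> ?Q \<and> r \<in> carrier R \<and> x = y \<oplus>\<^bsub>M\<^esub> r \<odot>\<^bsub>M\<^esub> es ! k" if "x \<in> carrier M" for x
  proof -
    have "x \<in> module_span R M (insert (es ! k) ?S)"
      using subsetD[OF es(2) that] unfolding \<open>set es = insert (es ! k) ?S\<close> .
    then show ?thesis by (rule module_span_insert[OF ek Sc]) blast
  qed
  have uniq: "r = s" if h: "y \<in> ?Q" "y' \<in> ?Q" "r \<in> carrier R" "s \<in> carrier R"
    "y \<oplus>\<^bsub>M\<^esub> r \<odot>\<^bsub>M\<^esub> es ! k = y' \<oplus>\<^bsub>M\<^esub> s \<odot>\<^bsub>M\<^esub> es ! k" for y y' r s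
  proof -
    have c: "y \<in> carrier M" "y' \<in> carrier M" using sp(3) h by auto
    have "(r \<ominus> s) \<odot>\<^bsub>M\<^esub> es ! k = r \<odot>\<^bsub>M\<^esub> es ! k \<ominus>\<^bsub>M\<^esub> s \<odot>\<^bsub>M\<^esub> es ! k"
      using h(3,4) ek by (simp add: R.minus_eq M.minus_eq smult_l_distr smult_l_minus)
    also have "\<dots> = (y \<oplus>\<^bsub>M\<^esub> r \<odot>\<^bsub>M\<^esub> es ! k) \<ominus>\<^bsub>M\<^esub> (y \<oplus>\<^bsub>M\<^esub> s \<odot>\<^bsub>M\<^esub> es ! k)"
      using c h(3,4) ek by (simp add: M.minus_eq M.minus_add M.a_ac M.r_neg1 M.r_neg2 M.r_neg)
    also have "\<dots> = y' \<ominus>\<^bsub>M\<^esub> y"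
      unfolding h(5) using c h(3,4) ek by (simp add: M.minus_eq M.minus_add M.a_ac M.r_neg1 M.r_neg2 M.r_neg)
    also have "\<dots> \<in> ?Q" by (rule sp(6)[OF h(2,1)])
    finally have "r \<ominus> s = \<zero>" by (intro triangular_independent[OF es(1) k order_refl]) (use h in auto)
    then show ?thesis using h(3,4) by simp
  qed
  define f where "f x = (THE r. r \<in> carrier R \<and> (\<exists>y\<in>?Q. x = y \<oplus>\<^bsub>M\<^esub> r \<odot>\<^bsub>M\<^esub> es ! k))" for x
  have fI: "f (y \<oplus>\<^bsub>M\<^esub> r \<odot>\<^bsub>M\<^esub> es ! k) = r" if "y \<in> ?Q" "r \<in> carrier R" for y r
    unfolding f_def by (rule the_equality) (use that uniq in blast)+
  have fval: "\<exists>y\<in>?Q. f x \<in> carrier R \<and> x = y \<oplus>\<^bsub>M\<^esub> f x \<odot>\<^bsub>M\<^esub> es ! k" if xc: "x \<in> carrier M" for x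
  proof -
    obtain y r where y: "y \<in> ?Q" "r \<in> carrier R" "x = y \<oplus>\<^bsub>M\<^esub> r \<odot>\<^bsub>M\<^esub> es ! k" using ex[OF xc] by blast
    have "f x = r" unfolding y(3) by (rule fI[OF y(1,2)])
    then show ?thesis using y by (intro bexI[of _ y]) simp_all
  qed
  have "f \<in> module_hom R M (regular_module R)"
  proof (rule module_homI)
    show "f x \<in> carrier (regular_module R)" if "x \<in> carrier M" for x using fval[OF that] by auto
    show "f (x \<oplus>\<^bsub>M\<^esub> x') = f x \<oplus>\<^bsub>regular_module R\<^esub> f x'" if x: "x \<in> carrier M" "x' \<in> carrier M" for x x'
    proof -
      obtain y y' where y: "y \<in> ?Q" "f x \<in> carrier R" "x = y \<oplus>\<^bsub>M\<^esub> f x \<odot>\<^bsub>M\<^esub> es ! k"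
        "y' \<in> ?Q" "f x' \<in> carrier R" "x' = y' \<oplus>\<^bsub>M\<^esub> f x' \<odot>\<^bsub>M\<^esub> es ! k"
        using fval[OF x(1)] fval[OF x(2)] by blast
      have c: "y \<in> carrier M" "y' \<in> carrier M" using sp(3) y by auto
      have "(y \<oplus>\<^bsub>M\<^esub> f x \<odot>\<^bsub>M\<^esub> es ! k) \<oplus>\<^bsub>M\<^esub> (y' \<oplus>\<^bsub>M\<^esub> f x' \<odot>\<^bsub>M\<^esub> es ! k) = (y \<oplus>\<^bsub>M\<^esub> y') \<oplus>\<^bsub>M\<^esub> (f x \<oplus> f x') \<odot>\<^bsub>M\<^esub> es ! k"
        using c y(2,5) ek by (simp add: smult_l_distr M.a_ac)
      then have "x \<oplus>\<^bsub>M\<^esub> x' = (y \<oplus>\<^bsub>M\<^esub> y') \<oplus>\<^bsub>M\<^esub> (f x \<oplus> f x') \<odot>\<^bsub>M\<^esub> es ! k" using y(3,6) by metis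
      then show ?thesis using fI[OF sp(4)[OF y(1,4)], of "f x \<oplus> f x'"] y(2,5) by simp
    qed
    show "f (a \<odot>\<^bsub>M\<^esub> x) = a \<odot>\<^bsub>regular_module R\<^esub> f x" if a: "a \<in> carrier R" and x: "x \<in> carrier M" for a x
    proof -
      obtain y where y: "y \<in> ?Q" "f x \<in> carrier R" "x = y \<oplus>\<^bsub>M\<^esub> f x \<odot>\<^bsub>M\<^esub> es ! k"
        using fval[OF x] by blast
      have c: "y \<in> carrier M" using sp(3) y by auto
      have "a \<odot>\<^bsub>M\<^esub> (y \<oplus>\<^bsub>M\<^esub> f x \<odot>\<^bsub>M\<^esub> es ! k) = a \<odot>\<^bsub>M\<^esub> y \<oplus>\<^bsub>M\<^esub> (a \<otimes> f x) \<odot>\<^bsub>M\<^esub> es ! k"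
        using c y(2) ek a by (simp add: smult_r_distr smult_assoc1)
      then have "a \<odot>\<^bsub>M\<^esub> x = a \<odot>\<^bsub>M\<^esub> y \<oplus>\<^bsub>M\<^esub> (a \<otimes> f x) \<odot>\<^bsub>M\<^esub> es ! k" using y(3) by metis
      then show ?thesis using fI[OF sp(7)[OF a y(1)], of "a \<otimes> f x"] y(2) a by simp
    qed
  qed
  moreover have "f (es ! k) = \<one>" using fI[OF sp(2) R.one_closed] ek by simp
  moreover have "f x = \<zero>" if "x \<in> module_span R M ((!) es ` {..<k})" for x
  proof -
    have "(!) es ` {..<k} \<subseteq> ?S" using k by auto
    then have "x \<in> ?Q" using that module_span_mono by blast
    then show ?thesis using fI[of x \<zero>] sp(3) ek by simp
  qed
  ultimately show ?thesis by blast
qed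

end

section \<open>The Tate construction and the Frobenius pullback\<close>

locale frobenius_tensor = char_two_cring R + N: module R N
  for R :: "('a, 'k) ring_scheme" (structure) and N :: "('a, 'b, 'x) module_scheme"
begin

lemma frobenius_action_eq: "x \<in> carrier R \<Longrightarrow> a \<in> carrier R \<Longrightarrow> frobenius_action R x a = x \<otimes> (a \<otimes> a)"
  by (simp add: frobenius_action_def numeral_2_eq_2)

sublocale FP: tensor_product R "regular_module R" N "frobenius_action R"
proof -
  interpret RM: module R "regular_module R" by (rule regular_module_module)
  show "tensor_product R (regular_module R) N (frobenius_action R)"
    by unfold_locales (simp add: frobenius_action_eq)
qed

abbreviation "G \<equiv> frobenius_pullback R N"

definition fr :: "'b \<Rightarrow> ('a \<times> 'b \<Rightarrow> 'a) set" where
  "fr x = pure_tensor R (regular_module R) (frobenius_action R) N \<one> x"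

lemma G_eq: "G = FP.TM"
  by (simp add: frobenius_pullback_def)

lemma pure_fr: "r \<in> carrier R \<Longrightarrow> x \<in> carrier N \<Longrightarrow> FP.pt r x = r \<odot>\<^bsub>G\<^esub> fr x"
  using FP.pure_smult[of r \<one> x] by (simp add: fr_def G_eq)

lemma G_module: "module R G"
  unfolding G_eq by (rule FP.tensor_module_module)

lemma fr_closed: "x \<in> carrier N \<Longrightarrow> fr x \<in> carrier G"
  unfolding fr_def G_eq by (rule FP.pure_closed) simp_all

lemma fr_add: "x \<in> carrier N \<Longrightarrow> y \<in> carrier N \<Longrightarrow> fr (x \<oplus>\<^bsub>N\<^esub> y) = fr x \<oplus>\<^bsub>G\<^esub> fr y"
  unfolding fr_def G_eq by (rule FP.pure_add_right) simp_all

text \<open>Balancing moves the scalar \<open>a\<close> to the left factor, where the twisted right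
  action turns it into \<open>a^2\<close>.\<close>

lemma fr_smult:
  assumes "a \<in> carrier R" "x \<in> carrier N"
  shows "fr (a \<odot>\<^bsub>N\<^esub> x) = (a \<otimes> a) \<odot>\<^bsub>G\<^esub> fr x"
proof -
  have "fr (a \<odot>\<^bsub>N\<^esub> x) = FP.pt (frobenius_action R \<one> a) x"
    using FP.pure_balanced[of a \<one> x] assms by (simp add: fr_def)
  then show ?thesis using pure_fr[of "a \<otimes> a" x] assms by (simp add: frobenius_action_eq)
qed

lemma fr_span: "carrier G \<subseteq> module_span R G (fr ` carrier N)"
proof -
  interpret G: module R G by (rule G_module)
  have fc: "fr ` carrier N \<subseteq> carrier G" using fr_closed by auto
  note sp = G.module_span_submodule[OF fc]
  have "{FP.pt r x | r x. r \<in> carrier (regular_module R) \<and> x \<in> carrier N} \<subseteq> module_span R G (fr ` carrier N)"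
  proof
    fix t assume "t \<in> {FP.pt r x | r x. r \<in> carrier (regular_module R) \<and> x \<in> carrier N}"
    then obtain r x where rx: "r \<in> carrier R" "x \<in> carrier N" "t = FP.pt r x" by auto
    have "fr x \<in> module_span R G (fr ` carrier N)" using G.module_span_superset[OF fc] rx(2) by blast
    then show "t \<in> module_span R G (fr ` carrier N)"
      unfolding rx(3) pure_fr[OF rx(1,2)] by (rule G.submodule_rules(7)[OF sp rx(1)])
  qed
  then have "module_span R G {FP.pt r x | r x. r \<in> carrier (regular_module R) \<and> x \<in> carrier N}
      \<subseteq> module_span R G (fr ` carrier N)"
    by (rule G.module_span_minimal[OF sp])
  then show ?thesis using FP.tensor_span unfolding G_eq by (rule subset_trans[rotated])
qed

text \<open>The universal property of the Frobenius pullback: semilinear maps out of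
  \<open>N\<close> are linear maps out of \<open>R_F \<otimes> N\<close>.\<close>

lemma semilinear_lift:
  fixes L :: "('a, 'd, 'z) module_scheme"
  assumes L: "module R L" and c: "\<And>x. x \<in> carrier N \<Longrightarrow> s x \<in> carrier L"
    and add: "\<And>x y. x \<in> carrier N \<Longrightarrow> y \<in> carrier N \<Longrightarrow> s (x \<oplus>\<^bsub>N\<^esub> y) = s x \<oplus>\<^bsub>L\<^esub> s y"
    and sm: "\<And>a x. a \<in> carrier R \<Longrightarrow> x \<in> carrier N \<Longrightarrow> s (a \<odot>\<^bsub>N\<^esub> x) = (a \<otimes> a) \<odot>\<^bsub>L\<^esub> s x"
  shows "tensor_lift R L (\<lambda>r x. r \<odot>\<^bsub>L\<^esub> s x) \<in> module_hom R G L"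
    "\<And>x. x \<in> carrier N \<Longrightarrow> tensor_lift R L (\<lambda>r x. r \<odot>\<^bsub>L\<^esub> s x) (fr x) = s x"
proof -
  interpret L: module R L by fact
  let ?\<beta> = "\<lambda>r x. r \<odot>\<^bsub>L\<^esub> s x"
  have lift: "tensor_lift R L ?\<beta> \<in> module_hom R FP.TM L \<and>
    (\<forall>r\<in>carrier R. \<forall>x\<in>carrier N. tensor_lift R L ?\<beta> (FP.pt r x) = r \<odot>\<^bsub>L\<^esub> s x)"
  proof (intro conjI ballI)
    show "tensor_lift R L ?\<beta> \<in> module_hom R FP.TM L"
      by (rule FP.tensor_lift(1)[OF L])
        (simp_all add: c add sm L.smult_l_distr L.smult_r_distr L.smult_assoc1 frobenius_action_eq)
    show "tensor_lift R L ?\<beta> (FP.pt r x) = r \<odot>\<^bsub>L\<^esub> s x" if "r \<in> carrier R" "x \<in> carrier N" for r x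
      by (rule FP.tensor_lift(2)[OF L])
        (simp_all add: that c add sm L.smult_l_distr L.smult_r_distr L.smult_assoc1 frobenius_action_eq)
  qed
  then show "tensor_lift R L ?\<beta> \<in> module_hom R G L" by (simp add: G_eq)
  show "tensor_lift R L ?\<beta> (fr x) = s x" if "x \<in> carrier N" for x
    using lift that c by (simp add: fr_def)
qed

end

section \<open>The tensor square, its differential, and the pullback of homology\<close>

locale char_two_differential_module = char_two_cring R + P: module R P
  for R :: "('a, 'k) ring_scheme" (structure) and P :: "('a, 'b, 'x) module_scheme" +
  fixes d :: "'b \<Rightarrow> 'b"
  assumes d: "d \<in> module_hom R P P" and dd: "x \<in> carrier P \<Longrightarrow> d (d x) = \<zero>\<^bsub>P\<^esub>"
begin

lemmas dH = module_homD[OF d]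

sublocale FP: frobenius_tensor R P by unfold_locales

sublocale TP: tensor_product R P P "\<lambda>x a. a \<odot>\<^bsub>P\<^esub> x" by unfold_locales simp

abbreviation "T \<equiv> tensor_square R P"
abbreviation "tens \<equiv> pure_tensor R P (\<lambda>x a. a \<odot>\<^bsub>P\<^esub> x) P"
abbreviation "\<delta> \<equiv> frobenius_pullback_differential R P d"

lemma T_eq: "T = TP.TM"
  by (simp add: tensor_square_def)

lemma T_module: "module R T"
  unfolding T_eq by (rule TP.tensor_module_module)

lemmas tens_rules = TP.pure_closed[folded T_eq] TP.pure_add_left[folded T_eq] TP.pure_add_right[folded T_eq]
  TP.pure_smult[folded T_eq]

lemma tens_smult_right: "a \<in> carrier R \<Longrightarrow> x \<in> carrier P \<Longrightarrow> y \<in> carrier P \<Longrightarrow> tens x (a \<odot>\<^bsub>P\<^esub> y) = a \<odot>\<^bsub>T\<^esub> tens x y"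
  using TP.pure_balanced[of a x y] tens_rules(4)[of a x y] by simp

lemma bilinear_lift:
  fixes L :: "('a, 'd, 'z) module_scheme"
  assumes L: "module R L"
    and "\<And>x y. x \<in> carrier P \<Longrightarrow> y \<in> carrier P \<Longrightarrow> \<beta> x y \<in> carrier L"
    and "\<And>x x' y. x \<in> carrier P \<Longrightarrow> x' \<in> carrier P \<Longrightarrow> y \<in> carrier P \<Longrightarrow> \<beta> (x \<oplus>\<^bsub>P\<^esub> x') y = \<beta> x y \<oplus>\<^bsub>L\<^esub> \<beta> x' y"
    and "\<And>x y y'. x \<in> carrier P \<Longrightarrow> y \<in> carrier P \<Longrightarrow> y' \<in> carrier P \<Longrightarrow> \<beta> x (y \<oplus>\<^bsub>P\<^esub> y') = \<beta> x y \<oplus>\<^bsub>L\<^esub> \<beta> x y'"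
    and "\<And>a x y. a \<in> carrier R \<Longrightarrow> x \<in> carrier P \<Longrightarrow> y \<in> carrier P \<Longrightarrow> \<beta> (a \<odot>\<^bsub>P\<^esub> x) y = a \<odot>\<^bsub>L\<^esub> \<beta> x y"
    and "\<And>a x y. a \<in> carrier R \<Longrightarrow> x \<in> carrier P \<Longrightarrow> y \<in> carrier P \<Longrightarrow> \<beta> x (a \<odot>\<^bsub>P\<^esub> y) = a \<odot>\<^bsub>L\<^esub> \<beta> x y"
  shows "tensor_lift R L \<beta> \<in> module_hom R T L"
    "\<And>x y. x \<in> carrier P \<Longrightarrow> y \<in> carrier P \<Longrightarrow> tensor_lift R L \<beta> (tens x y) = \<beta> x y"
proof -
  show "tensor_lift R L \<beta> \<in> module_hom R T L"
    unfolding T_eq by (rule TP.tensor_lift(1)[OF L]) (simp_all add: assms)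
  show "tensor_lift R L \<beta> (tens x y) = \<beta> x y" if "x \<in> carrier P" "y \<in> carrier P" for x y
    by (rule TP.tensor_lift(2)[OF L]) (simp_all add: assms that)
qed

lemma tate_differential_hom:
  "tate_differential R P d \<in> module_hom R T T"
  "\<And>x y. x \<in> carrier P \<Longrightarrow> y \<in> carrier P \<Longrightarrow> tate_differential R P d (tens x y)
    = (tens (d x) y \<oplus>\<^bsub>T\<^esub> tens x (d y)) \<oplus>\<^bsub>T\<^esub> (tens x y \<oplus>\<^bsub>T\<^esub> tens y x)"
proof -
  interpret T: module R T by (rule T_module)
  let ?l = "tensor_map R P (\<lambda>x a. a \<odot>\<^bsub>P\<^esub> x) P d (\<lambda>y. y)"
  let ?r = "tensor_map R P (\<lambda>x a. a \<odot>\<^bsub>P\<^esub> x) P (\<lambda>x. x) d"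
  let ?s = "tensor_swap R P"
  have l: "?l \<in> module_hom R T T" "\<And>x y. x \<in> carrier P \<Longrightarrow> y \<in> carrier P \<Longrightarrow> ?l (tens x y) = tens (d x) y"
    unfolding tensor_map_def T_eq[symmetric]
    by (rule bilinear_lift[OF T_module], simp_all add: tens_rules tens_smult_right dH)+
  have r: "?r \<in> module_hom R T T" "\<And>x y. x \<in> carrier P \<Longrightarrow> y \<in> carrier P \<Longrightarrow> ?r (tens x y) = tens x (d y)"
    unfolding tensor_map_def T_eq[symmetric]
    by (rule bilinear_lift[OF T_module], simp_all add: tens_rules tens_smult_right dH)+
  have s: "?s \<in> module_hom R T T" "\<And>x y. x \<in> carrier P \<Longrightarrow> y \<in> carrier P \<Longrightarrow> ?s (tens x y) = tens y x"
    unfolding tensor_swap_def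
    by (rule bilinear_lift[OF T_module], simp_all add: tens_rules tens_smult_right dH)+
  note lH = module_homD[OF l(1)] and rH = module_homD[OF r(1)] and sH = module_homD[OF s(1)]
  show "tate_differential R P d \<in> module_hom R T T"
    by (rule module_homI) (simp_all add: tate_differential_def lH rH sH T.smult_r_distr T.M.a_ac)
  show "tate_differential R P d (tens x y) = (tens (d x) y \<oplus>\<^bsub>T\<^esub> tens x (d y)) \<oplus>\<^bsub>T\<^esub> (tens x y \<oplus>\<^bsub>T\<^esub> tens y x)"
    if "x \<in> carrier P" "y \<in> carrier P" for x y
    using that by (simp add: tate_differential_def l(2) r(2) s(2))
qed

lemma pullback_differential:
  "\<delta> \<in> module_hom R (FP.G) (FP.G)" "\<And>x. x \<in> carrier P \<Longrightarrow> \<delta> (FP.fr x) = FP.fr (d x)"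
proof -
  let ?\<beta> = "\<lambda>r x. FP.FP.pt r (d x)"
  have b: "?\<beta> \<one> x = FP.fr (d x)" for x by (simp add: FP.fr_def)
  note rules = FP.FP.pure_closed[folded FP.G_eq] FP.FP.pure_add_left[folded FP.G_eq]
    FP.FP.pure_add_right[folded FP.G_eq] FP.FP.pure_smult[folded FP.G_eq]
  show "\<delta> \<in> module_hom R (FP.G) (FP.G)"
    unfolding frobenius_pullback_differential_def tensor_map_def FP.G_eq
    by (rule FP.FP.tensor_lift(1)[OF FP.FP.tensor_module_module])
      (simp_all add: dH FP.FP.pure_closed FP.FP.pure_add_left[simplified] FP.FP.pure_add_right
        FP.FP.pure_balanced FP.FP.pure_smult[simplified])
  show "\<delta> (FP.fr x) = FP.fr (d x)" if "x \<in> carrier P" for x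
    unfolding frobenius_pullback_differential_def tensor_map_def FP.fr_def
    by (rule FP.FP.tensor_lift(2)[OF FP.FP.tensor_module_module])
      (simp_all add: that dH FP.FP.pure_closed FP.FP.pure_add_left[simplified] FP.FP.pure_add_right
        FP.FP.pure_balanced FP.FP.pure_smult[simplified])
qed

lemma tate_setup_exists:
  assumes flat: "frobenius_flat R {\<zero>} {\<zero>}" and flag: "admits_finite_free_flag R P d"
  shows "\<exists>e \<phi> n. tate_setup R P T FP.G d tens (tate_differential R P d) FP.fr \<delta> e \<phi> n"
proof -
  obtain es where es: "triangular R P d es" "module_span R P (set es) = carrier P"
    using P.flag_triangular[OF flag] by blast
  define e where "e = (!) es"
  define n where "n = length es"
  have tk: "set (take k es) = e ` {..<k}" if "k \<le> n" for k
    using nth_image[of k es] that by (simp add: lessThan_atLeast0 e_def n_def)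
  have all: "set es = e ` {..<n}" using tk[of n] by (simp add: n_def)
  have "\<forall>k. \<exists>f. k < n \<longrightarrow> f \<in> module_hom R P (regular_module R) \<and> f (e k) = \<one> \<and>
      (\<forall>x\<in>module_span R P (e ` {..<k}). f x = \<zero>)"
    using P.triangular_dual[OF es(1)] es(2) unfolding e_def n_def by blast
  then obtain \<phi> where phi: "\<And>k. k < n \<Longrightarrow> \<phi> k \<in> module_hom R P (regular_module R)"
    "\<And>k. k < n \<Longrightarrow> \<phi> k (e k) = \<one>" "\<And>k x. k < n \<Longrightarrow> x \<in> module_span R P (e ` {..<k}) \<Longrightarrow> \<phi> k x = \<zero>"
    by metis
  interpret T: module R T by (rule T_module)
  interpret G: module R FP.G by (rule FP.G_module)
  have "tate_setup R P T FP.G d tens (tate_differential R P d) FP.fr \<delta> e \<phi> n"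
  proof
    show "frobenius_flat R {\<zero>} {\<zero>}" by (rule flat)
    show "d \<in> module_hom R P P" by (rule d)
    show "tate_differential R P d \<in> module_hom R T T" by (rule tate_differential_hom)
    show "\<delta> \<in> module_hom R FP.G FP.G" by (rule pullback_differential)
    show "carrier T \<subseteq> module_span R T {tens x y | x y. x \<in> carrier P \<and> y \<in> carrier P}"
      unfolding T_eq by (rule TP.tensor_span)
    show "carrier FP.G \<subseteq> module_span R FP.G (FP.fr ` carrier P)" by (rule FP.fr_span)
    show "carrier P \<subseteq> module_span R P (e ` {..<n})" using es(2) all by simp
    show "\<exists>\<rho>\<in>module_hom R T P. \<forall>x\<in>carrier P. \<forall>y\<in>carrier P. \<rho> (tens x y) = f y \<odot>\<^bsub>P\<^esub> x"
      if f: "f \<in> module_hom R P (regular_module R)" for f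
    proof (intro bexI ballI)
      note fH = module_homD[OF f, simplified]
      show "tensor_lift R P (\<lambda>x y. f y \<odot>\<^bsub>P\<^esub> x) \<in> module_hom R T P"
        by (rule bilinear_lift(1)[OF P.module_axioms])
          (simp_all add: fH P.smult_l_distr P.smult_r_distr P.smult_assoc1[symmetric] m_comm)
      show "tensor_lift R P (\<lambda>x y. f y \<odot>\<^bsub>P\<^esub> x) (tens x y) = f y \<odot>\<^bsub>P\<^esub> x" if "x \<in> carrier P" "y \<in> carrier P" for x y
        by (rule bilinear_lift(2)[OF P.module_axioms])
          (simp_all add: that fH P.smult_l_distr P.smult_r_distr P.smult_assoc1[symmetric] m_comm)
    qed
    show "\<exists>\<rho>\<in>module_hom R T P. \<forall>x\<in>carrier P. \<forall>y\<in>carrier P. \<rho> (tens x y) = f x \<odot>\<^bsub>P\<^esub> y"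
      if f: "f \<in> module_hom R P (regular_module R)" for f
    proof (intro bexI ballI)
      note fH = module_homD[OF f, simplified]
      show "tensor_lift R P (\<lambda>x y. f x \<odot>\<^bsub>P\<^esub> y) \<in> module_hom R T P"
        by (rule bilinear_lift(1)[OF P.module_axioms])
          (simp_all add: fH P.smult_l_distr P.smult_r_distr P.smult_assoc1[symmetric] m_comm)
      show "tensor_lift R P (\<lambda>x y. f x \<odot>\<^bsub>P\<^esub> y) (tens x y) = f x \<odot>\<^bsub>P\<^esub> y" if "x \<in> carrier P" "y \<in> carrier P" for x y
        by (rule bilinear_lift(2)[OF P.module_axioms])
          (simp_all add: that fH P.smult_l_distr P.smult_r_distr P.smult_assoc1[symmetric] m_comm)
    qed
    show "\<exists>\<Lambda>\<in>module_hom R FP.G (regular_module R). \<forall>x\<in>carrier P. \<Lambda> (FP.fr x) = f x \<otimes> f x"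
      if f: "f \<in> module_hom R P (regular_module R)" for f
    proof (intro bexI ballI)
      note fH = module_homD[OF f, simplified]
      \<comment> \<open>In characteristic 2 the square of a linear functional is additive, hence
        semilinear, so it extends to the pullback.\<close>
      let ?\<Lambda> = "tensor_lift R (regular_module R) (\<lambda>r x. r \<odot>\<^bsub>regular_module R\<^esub> (f x \<otimes> f x))"
      show "?\<Lambda> \<in> module_hom R FP.G (regular_module R)"
        by (rule FP.semilinear_lift(1)[OF regular_module_module]) (simp_all add: fH square_add m_ac)
      show "?\<Lambda> (FP.fr x) = f x \<otimes> f x" if "x \<in> carrier P" for x
        by (rule FP.semilinear_lift(2)[OF regular_module_module]) (simp_all add: that fH square_add m_ac)
    qed
    show "d (e i) \<in> module_span R P (e ` {..<i})" "e i \<in> carrier P" if "i < n" for i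
      using es(1) that tk[of i] nth_mem[of i es] by (auto simp: triangular_def e_def n_def)
  qed (auto simp: dd tens_rules tens_smult_right tate_differential_hom(2) pullback_differential(2)
      FP.fr_closed FP.fr_add FP.fr_smult phi)
  then show ?thesis by blast
qed

text \<open>The recognition criterion again, now with \<open>1 \<otimes> [z]\<close> in the pullback
  of \<open>H(P)\<close>. Flatness is already contained in the criterion; what remains is a map
  \<open>?\<kappa>\<close> back into the pullback of \<open>P\<close> modulo boundaries, which shows
  that a pair \<open>(0, g)\<close> of the relation has a boundary as second component.\<close>

lemma homology_of_pullback:
  assumes instance_of: "tate_setup R P T FP.G d tens (tate_differential R P d) FP.fr \<delta> e \<phi> n"
  shows "isomorphic_modules R (frobenius_pullback R (homology P d)) (homology FP.G \<delta>)"
proof -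
  interpret S: tate_setup R P T FP.G d tens "tate_differential R P d" FP.fr \<delta> e \<phi> n by (rule instance_of)
  let ?H = "homology P d" and ?B = "d ` carrier P" and ?C = "\<delta> ` carrier FP.G"
  have "\<forall>x\<in>carrier P. d (d x) = \<zero>\<^bsub>P\<^esub>" using dd by blast
  note hom = P.homology_module[OF d this]
  interpret HF: frobenius_tensor R ?H
    using hom(1) char_two_cring_axioms by (simp add: frobenius_tensor_def)
  interpret HG: module R HF.G by (rule HF.G_module)
  note ker = S.Z_kernel
  have Zc: "z \<in> carrier P" "d z = \<zero>\<^bsub>P\<^esub>" if "z \<in> S.Z n" for z using that by (auto simp: ker P.kernel_eq)
  have C: "submodule ?C R FP.G" by (rule S.G.hom_image_submodule[OF S.moduleG S.delta S.G.carrier_is_submodule])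
  let ?Q = "quotient_module FP.G ?C"
  have Q: "module R ?Q" by (rule S.G.quotient_module_module[OF C])
  note proj = S.G.quotient_module_hom[OF C]
  note projH = module_homD[OF proj]
  \<comment> \<open>A cycle is chosen in each class so that \<open>\<sigma>\<close> is defined on
    homology; \<open>coset_fr_eq\<close> shows that the choice does not matter modulo
    boundaries.\<close>
  define rep where "rep c = (SOME z. z \<in> S.Z n \<and> c = ?B +>\<^bsub>P\<^esub> z)" for c
  have rep: "rep c \<in> S.Z n" "c = ?B +>\<^bsub>P\<^esub> rep c" if "c \<in> carrier ?H" for c
  proof -
    have "\<exists>z. z \<in> S.Z n \<and> c = ?B +>\<^bsub>P\<^esub> z" using hom(3)[OF that] by (auto simp: ker)
    from someI_ex[OF this] show "rep c \<in> S.Z n" "c = ?B +>\<^bsub>P\<^esub> rep c" by (simp_all add: rep_def)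
  qed
  define \<sigma> where "\<sigma> c = ?C +>\<^bsub>FP.G\<^esub> FP.fr (rep c)" for c
  have coset_fr_eq: "?C +>\<^bsub>FP.G\<^esub> FP.fr z = ?C +>\<^bsub>FP.G\<^esub> FP.fr z'"
    if z: "z \<in> S.Z n" "z' \<in> S.Z n" "?B +>\<^bsub>P\<^esub> z = ?B +>\<^bsub>P\<^esub> z'" for z z'
  proof -
    have "z \<ominus>\<^bsub>P\<^esub> z' \<in> ?B" using hom(7)[of z z'] z by (simp add: ker)
    then obtain x where x: "x \<in> carrier P" "z \<ominus>\<^bsub>P\<^esub> z' = d x" by blast
    have "z = (z \<ominus>\<^bsub>P\<^esub> z') \<oplus>\<^bsub>P\<^esub> z'"
      using Zc(1)[OF z(1)] Zc(1)[OF z(2)] by (simp add: P.M.minus_eq P.M.a_assoc P.M.l_neg)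
    then have "z = z' \<oplus>\<^bsub>P\<^esub> d x"
      unfolding x(2) using Zc(1)[OF z(2)] x(1) dH(1) by (simp add: P.M.a_comm)
    then have "FP.fr z = FP.fr z' \<oplus>\<^bsub>FP.G\<^esub> \<delta> (FP.fr x)"
      using Zc(1)[OF z(2)] x(1) dH by (simp add: FP.fr_add pullback_differential(2))
    moreover have "?C +>\<^bsub>FP.G\<^esub> \<delta> (FP.fr x) = \<zero>\<^bsub>?Q\<^esub>"
      using S.G.coset_eq_zero_iff[OF C, of "\<delta> (FP.fr x)"] FP.fr_closed[OF x(1)] S.deltaH(1) by simp
    ultimately show ?thesis
      using projH(2)[of "FP.fr z'" "\<delta> (FP.fr x)"] FP.fr_closed[OF x(1)] FP.fr_closed[OF Zc(1)[OF z(2)]]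
        S.deltaH(1) projH(1) module.axioms(2)[OF Q, THEN abelian_group.axioms(1), THEN abelian_monoid.r_zero] by simp
  qed
  have sigma: "\<sigma> (?B +>\<^bsub>P\<^esub> z) = ?C +>\<^bsub>FP.G\<^esub> FP.fr z" if z: "z \<in> S.Z n" for z
    unfolding \<sigma>_def
    using coset_fr_eq[OF rep(1) z] rep(2)[of "?B +>\<^bsub>P\<^esub> z"] hom(2)[of z] z by (simp add: ker)
  note ZR = P.submodule_rules[OF S.Z_submodule[OF order_refl]]
  let ?\<kappa> = "tensor_lift R ?Q (\<lambda>r c. r \<odot>\<^bsub>?Q\<^esub> \<sigma> c)"
  have s1: "\<sigma> c \<in> carrier ?Q" if "c \<in> carrier ?H" for c
    unfolding \<sigma>_def by (rule projH(1)[OF FP.fr_closed[OF Zc(1)[OF rep(1)[OF that]]]])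
  have s2: "\<sigma> (c \<oplus>\<^bsub>?H\<^esub> c') = \<sigma> c \<oplus>\<^bsub>?Q\<^esub> \<sigma> c'" if c: "c \<in> carrier ?H" "c' \<in> carrier ?H" for c c'
  proof -
    note z = rep[OF c(1)] and z' = rep[OF c(2)]
    have "c \<oplus>\<^bsub>?H\<^esub> c' = ?B +>\<^bsub>P\<^esub> (rep c \<oplus>\<^bsub>P\<^esub> rep c')"
      using hom(4)[of "rep c" "rep c'"] z z' by (simp add: ker)
    then have "\<sigma> (c \<oplus>\<^bsub>?H\<^esub> c') = ?C +>\<^bsub>FP.G\<^esub> FP.fr (rep c \<oplus>\<^bsub>P\<^esub> rep c')"
      using sigma[OF ZR(4)[OF z(1) z'(1)]] by simp
    then show ?thesis
      using projH(2) Zc(1)[OF z(1)] Zc(1)[OF z'(1)] by (simp add: FP.fr_add FP.fr_closed \<sigma>_def)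
  qed
  have s3: "\<sigma> (a \<odot>\<^bsub>?H\<^esub> c) = (a \<otimes> a) \<odot>\<^bsub>?Q\<^esub> \<sigma> c" if a: "a \<in> carrier R" and c: "c \<in> carrier ?H" for a c
  proof -
    note z = rep[OF c]
    have "a \<odot>\<^bsub>?H\<^esub> c = ?B +>\<^bsub>P\<^esub> (a \<odot>\<^bsub>P\<^esub> rep c)" using hom(5)[OF a, of "rep c"] z by (simp add: ker)
    then have "\<sigma> (a \<odot>\<^bsub>?H\<^esub> c) = ?C +>\<^bsub>FP.G\<^esub> FP.fr (a \<odot>\<^bsub>P\<^esub> rep c)" using sigma[OF ZR(7)[OF a z(1)]] by simp
    then show ?thesis using projH(3) Zc(1)[OF z(1)] a by (simp add: FP.fr_smult FP.fr_closed \<sigma>_def)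
  qed
  have kappa: "?\<kappa> \<in> module_hom R HF.G ?Q" "\<And>c. c \<in> carrier ?H \<Longrightarrow> ?\<kappa> (HF.fr c) = \<sigma> c"
    by (rule HF.semilinear_lift[OF Q s1 s2 s3]; assumption)+
  note kH = module_homD[OF kappa(1)]
  have cl: "?B +>\<^bsub>P\<^esub> z \<in> carrier ?H" if "z \<in> S.Z n" for z using hom(2)[of z] that by (simp add: ker)
  show ?thesis
  proof (rule S.isomorphic_homology[of HF.G "\<lambda>z. HF.fr (?B +>\<^bsub>P\<^esub> z)"])
    show "module R HF.G" by (rule HF.G_module)
    show "HF.fr (?B +>\<^bsub>P\<^esub> z) \<in> carrier HF.G" if "z \<in> S.Z n" for z by (rule HF.fr_closed[OF cl[OF that]])
    show "HF.fr (?B +>\<^bsub>P\<^esub> (x \<oplus>\<^bsub>P\<^esub> y)) = HF.fr (?B +>\<^bsub>P\<^esub> x) \<oplus>\<^bsub>HF.G\<^esub> HF.fr (?B +>\<^bsub>P\<^esub> y)"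
      if "x \<in> S.Z n" "y \<in> S.Z n" for x y
      using hom(4)[of x y] that HF.fr_add[OF cl cl] by (simp add: ker)
    show "HF.fr (?B +>\<^bsub>P\<^esub> (a \<odot>\<^bsub>P\<^esub> x)) = (a \<otimes> a) \<odot>\<^bsub>HF.G\<^esub> HF.fr (?B +>\<^bsub>P\<^esub> x)"
      if "a \<in> carrier R" "x \<in> S.Z n" for a x
      using hom(5)[of a x] that HF.fr_smult[OF _ cl] by (simp add: ker)
    show "HF.fr (?B +>\<^bsub>P\<^esub> d x) = \<zero>\<^bsub>HF.G\<^esub>" if "x \<in> carrier P" for x
    proof -
      have "?B +>\<^bsub>P\<^esub> d x = \<zero>\<^bsub>?H\<^esub>" using hom(6)[of "d x"] that dH dd by (simp add: P.kernel_eq)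
      moreover have "HF.fr \<zero>\<^bsub>?H\<^esub> = \<zero>\<^bsub>HF.G\<^esub>"
        using HF.fr_smult[OF zero_closed HF.N.M.zero_closed] HF.fr_closed[OF HF.N.M.zero_closed] by simp
      ultimately show ?thesis by simp
    qed
    have "HF.fr ` carrier ?H \<subseteq> (\<lambda>z. HF.fr (?B +>\<^bsub>P\<^esub> z)) ` S.Z n"
    proof
      fix t assume "t \<in> HF.fr ` carrier ?H"
      then obtain c where c: "c \<in> carrier ?H" "t = HF.fr c" by blast
      show "t \<in> (\<lambda>z. HF.fr (?B +>\<^bsub>P\<^esub> z)) ` S.Z n"
        by (rule image_eqI[of _ _ "rep c"]) (use rep[OF c(1)] c(2) in simp_all)
    qed
    then show "carrier HF.G \<subseteq> module_span R HF.G ((\<lambda>z. HF.fr (?B +>\<^bsub>P\<^esub> z)) ` S.Z n)"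
      by (rule subset_trans[OF HF.fr_span module_span_mono])
    show "g \<in> ?C" if g: "(\<zero>\<^bsub>HF.G\<^esub>, g) \<in> module_span R (prod_module HF.G FP.G)
        ((\<lambda>z. (HF.fr (?B +>\<^bsub>P\<^esub> z), FP.fr z)) ` S.Z n)" for g
    proof -
      \<comment> \<open>\<open>?\<kappa>\<close> sends the first component of each generator to the
        class of the second, and by linearity does so on the whole relation.\<close>
      have "fst u \<in> carrier HF.G \<and> snd u \<in> carrier FP.G \<and> ?\<kappa> (fst u) = ?C +>\<^bsub>FP.G\<^esub> snd u"
        if "u \<in> module_span R (prod_module HF.G FP.G) ((\<lambda>z. (HF.fr (?B +>\<^bsub>P\<^esub> z), FP.fr z)) ` S.Z n)" for u
        using that
      proof induction
        case zero
        then show ?case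
          using module_hom_zero[OF HF.G_module Q kappa(1)] module_hom_zero[OF S.moduleG Q proj] by simp
      next
        case (step u a y)
        then obtain z where z: "z \<in> S.Z n" "y = (HF.fr (?B +>\<^bsub>P\<^esub> z), FP.fr z)" by blast
        have c: "HF.fr (?B +>\<^bsub>P\<^esub> z) \<in> carrier HF.G" "FP.fr z \<in> carrier FP.G"
          using HF.fr_closed[OF cl[OF z(1)]] FP.fr_closed[OF Zc(1)[OF z(1)]] .
        have "?\<kappa> (fst u \<oplus>\<^bsub>HF.G\<^esub> a \<odot>\<^bsub>HF.G\<^esub> HF.fr (?B +>\<^bsub>P\<^esub> z)) = ?\<kappa> (fst u) \<oplus>\<^bsub>?Q\<^esub> a \<odot>\<^bsub>?Q\<^esub> \<sigma> (?B +>\<^bsub>P\<^esub> z)"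
          using step(2,4) c(1) kH(2,3) kappa(2)[OF cl[OF z(1)]] by simp
        also have "\<dots> = ?C +>\<^bsub>FP.G\<^esub> (snd u \<oplus>\<^bsub>FP.G\<^esub> a \<odot>\<^bsub>FP.G\<^esub> FP.fr z)"
          using step(2,4) c(2) projH(2,3) sigma[OF z(1)] by simp
        finally show ?case using step(2,4) c z(2) by simp
      qed
      from this[OF g] have "g \<in> carrier FP.G" "?C +>\<^bsub>FP.G\<^esub> g = \<zero>\<^bsub>?Q\<^esub>"
        using module_hom_zero[OF HF.G_module Q kappa(1)] by simp_all
      then show ?thesis using S.G.coset_eq_zero_iff[OF C] by simp
    qed
  qed
qed

end

theorem theorem5:
  fixes R :: "('a, 'k) ring_scheme"
    and P :: "('a, 'b, 'x) module_scheme"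
    and d :: "'b \<Rightarrow> 'b"
  assumes "regular_local_ring R"
    and "has_characteristic R 2"
    and "differential_module R P d"
    and "admits_finite_free_flag R P d"
  shows "isomorphic_modules R (homology (tensor_square R P) (tate_differential R P d))
           (frobenius_pullback R (homology P d)) \<and>
         isomorphic_modules R (homology (tensor_square R P) (tate_differential R P d))
           (homology (frobenius_pullback R P) (frobenius_pullback_differential R P d))"
proof -
  have diff: "module R P" "d \<in> module_hom R P P" "\<And>x. x \<in> carrier P \<Longrightarrow> d (d x) = \<zero>\<^bsub>P\<^esub>"
    using assms(3) by (simp_all add: differential_module_def)
  have "char_two_cring R"
    by (rule has_characteristic_two[OF module.axioms(1)[OF diff(1)] assms(2)])
  from char_two_differential_module.intro[OF this diff(1) char_two_differential_module_axioms.intro[OF diff(2,3)]]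
  interpret char_two_differential_module R P d .
  obtain e \<phi> n where instance_of: "tate_setup R P T FP.G d tens (tate_differential R P d) FP.fr \<delta> e \<phi> n"
    using tate_setup_exists[OF regular_local_ring_frobenius_flat[OF assms(1,2)] assms(4)] by (elim exE)
  interpret S: tate_setup R P T FP.G d tens "tate_differential R P d" FP.fr \<delta> e \<phi> n by (rule instance_of)
  have 1: "isomorphic_modules R (homology T (tate_differential R P d)) (homology FP.G \<delta>)"
    by (rule S.isomorphic_tate_homology)
  have hom: "\<forall>x\<in>carrier P. d (d x) = \<zero>\<^bsub>P\<^esub>" using diff(3) by blast
  have "frobenius_tensor R (homology P d)"
    using P.homology_module(1)[OF d hom] char_two_cring_axioms by (simp add: frobenius_tensor_def)
  then have "module R (frobenius_pullback R (homology P d))" by (rule frobenius_tensor.G_module)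
  then have "isomorphic_modules R (homology T (tate_differential R P d)) (frobenius_pullback R (homology P d))"
    \<comment> \<open>Both modules have been compared with the homology of the Frobenius pullback,
      so the two isomorphisms are joined there.\<close>
    by (rule isomorphic_modules_via[OF S.homology_T(1) _ S.homology_G(1) 1 homology_of_pullback[OF instance_of]])
  then show ?thesis using 1 by blast
qed

end
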